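(* Let $1\le d\le 3$, let $\Omega\subset\mathbb{R}^d$ be a simply-connected bounded domain with piecewise smooth boundary $\partial\Omega$ and convex corners, let $T>0$, and let $\alpha:[0,T]\to(0,1)$ be a function with bounded second-order derivative on $[0,T]$. Put $k(t):=\dfrac{t^{-\alpha(t)}}{\Gamma(1-\alpha(t))}$ for $t\in(0,T]$. Then there is a constant $Q>0$, independent of $u_0$ and $f$, such that for all $f\in H^1(0,T;L^2(\Omega))$ and $u_0\in\check H^2(\Omega)$, the problem $$\partial_t u(\boldsymbol{x},t)-\int_0^t k(t-s)\,\Delta u(\boldsymbol{x},s)\,ds=f(\boldsymbol{x},t),\quad (\boldsymbol{x},t)\in\Omega\times(0,T],$$ $$u(\boldsymbol{x},0)=u_0(\boldsymbol{x}),\ \boldsymbol{x}\in\Omega;\qquad u(\boldsymbol{x},t)=0,\ (\boldsymbol{x},t)\in\partial\Omega\times[0,T],$$ has a unique solution $u\in H^1(0,T;L^2(\Omega))$, and $$\|u\|_{H^1(0,T;L^2(\Omega))}\le Q\big(\|u_0\|_{\check H^2(\Omega)}+\|f\|_{H^1(0,T;L^2(\Omega))}\big).$$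
   Context: Let $\{(\lambda_i,\phi_i)\}_{i\ge1}$ be the eigenpairs of $-\Delta$ on $\Omega$ with homogeneous Dirichlet boundary conditions, with $\{\phi_i\}$ an orthonormal basis of $L^2(\Omega)$ and $0<\lambda_1\le\lambda_2\le\cdots$. For $s\ge0$, $$\check H^s(\Omega):=\Big\{q\in L^2(\Omega):\ \|q\|_{\check H^s(\Omega)}^2:=\sum_{i=1}^\infty\lambda_i^s\,(q,\phi_i)^2<\infty\Big\},$$ where $(\cdot,\cdot)$ is the $L^2(\Omega)$ inner product; in particular $\check H^0(\Omega)=L^2(\Omega)$ and $\check H^2(\Omega)=H^2(\Omega)\cap H_0^1(\Omega)$. For a Banach space $\mathcal X$, $H^1(0,T;\mathcal X)=W^{1,2}(0,T;\mathcal X)$ is the usual Bochner–Sobolev space. Solutions are understood through the spectral decomposition: $u\in H^1(0,T;L^2(\Omega))$ is a solution if its coefficients $u_i(t):=(u(\cdot,t),\phi_i)$ satisfy, for every $i\ge1$, $$u_i'(t)+\lambda_i\int_0^t k(t-s)u_i(s)\,ds=f_i(t)\ \text{ for (a.e.) } t\in(0,T],\qquad u_i(0)=(u_0,\phi_i),$$ where $f_i(t):=(f(\cdot,t),\phi_i)$. *)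

theory Defs
  imports "HOL-Analysis.Analysis"
begin

section \<open>The Hilbert space \<open>L\<^sup>2(\<real>\<^sup>d)\<close>\<close>

text \<open>Each class of Lebesgue measurable functions contains a Borel function, so Borel
  representatives suffice. Completeness and separability are established so that the Bochner
  integral of \<open>HOL-Analysis\<close> applies to functions with values in this space.\<close>

definition sq_integrable :: "('a::euclidean_space \<Rightarrow> real) \<Rightarrow> bool" where
  "sq_integrable f \<longleftrightarrow> f \<in> borel_measurable lborel \<and> integrable lborel (\<lambda>x. (f x)\<^sup>2)"

lemma sq_integrable_mult:
  assumes "sq_integrable f" "sq_integrable g"
  shows "integrable lborel (\<lambda>x. f x * g x)"
proof (rule Bochner_Integration.integrable_bound)
  show "integrable lborel (\<lambda>x. (f x)\<^sup>2 + (g x)\<^sup>2)"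
    using assms by (auto simp: sq_integrable_def)
  show "(\<lambda>x. f x * g x) \<in> borel_measurable lborel"
    using assms by (auto simp: sq_integrable_def)
  have "\<bar>a * b\<bar> \<le> a\<^sup>2 + b\<^sup>2" for a b :: real
    using sum_squares_bound[of a b] sum_squares_bound[of a "- b"] zero_le_power2[of a] zero_le_power2[of b]
    by (simp add: abs_le_iff)
  then show "AE x in lborel. norm (f x * g x) \<le> norm ((f x)\<^sup>2 + (g x)\<^sup>2)"
    by (auto simp: abs_of_nonneg)
qed

lemma sq_integrable_add:
  assumes "sq_integrable f" "sq_integrable g"
  shows "sq_integrable (\<lambda>x. f x + g x)"
  using assms sq_integrable_mult[OF assms]
  by (auto simp: sq_integrable_def power2_sum mult.assoc)

lemma sq_integrable_cmult: "sq_integrable f \<Longrightarrow> sq_integrable (\<lambda>x. c * f x)"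
  by (auto simp: sq_integrable_def power_mult_distrib)

lemma sq_integrable_uminus: "sq_integrable f \<Longrightarrow> sq_integrable (\<lambda>x. - f x)"
  by (auto simp: sq_integrable_def)

lemma sq_integrable_diff:
  assumes "sq_integrable f" "sq_integrable g"
  shows "sq_integrable (\<lambda>x. f x - g x)"
  using sq_integrable_add[OF assms(1) sq_integrable_uminus[OF assms(2)]] by simp

lemma sq_integrable_zero: "sq_integrable (\<lambda>x. 0)"
  by (simp add: sq_integrable_def)

lemma sq_integrable_indicator:
  "A \<in> sets borel \<Longrightarrow> emeasure lborel A < \<infinity> \<Longrightarrow> sq_integrable (indicator A :: 'a::euclidean_space \<Rightarrow> real)"
  by (simp add: sq_integrable_def power2_eq_square flip: indicator_inter_arith)

definition L2_rel :: "('a::euclidean_space \<Rightarrow> real) \<Rightarrow> ('a \<Rightarrow> real) \<Rightarrow> bool" where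
  "L2_rel f g \<longleftrightarrow> sq_integrable f \<and> sq_integrable g \<and> (AE x in lborel. f x = g x)"

quotient_type (overloaded) 'a L2 = "'a::euclidean_space \<Rightarrow> real" / partial: L2_rel
proof (rule part_equivpI)
  show "\<exists>f :: 'a \<Rightarrow> real. L2_rel f f"
    using sq_integrable_zero by (auto simp: L2_rel_def)
  show "symp L2_rel" by (auto simp: symp_def L2_rel_def)
  show "transp (L2_rel :: ('a \<Rightarrow> real) \<Rightarrow> _)"
    unfolding transp_def L2_rel_def by (auto elim: eventually_elim2)
qed

lemma L2_rel_refl: "L2_rel f f \<longleftrightarrow> sq_integrable f"
  by (simp add: L2_rel_def)

lemma sq_integrable_rep_L2: "sq_integrable (rep_L2 f)"
  using Quotient3_rep_reflp[OF Quotient3_L2] L2_rel_refl by blast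

lemma abs_rep_L2: "abs_L2 (rep_L2 f) = f"
  using Quotient3_abs_rep[OF Quotient3_L2] by blast

lemma abs_L2_eq_iff:
  "sq_integrable f \<Longrightarrow> sq_integrable g \<Longrightarrow> abs_L2 f = abs_L2 g \<longleftrightarrow> (AE x in lborel. f x = g x)"
  using Quotient3_rel[OF Quotient3_L2, of f g] by (auto simp: L2_rel_def)

lemma rep_abs_L2: "sq_integrable f \<Longrightarrow> AE x in lborel. rep_L2 (abs_L2 f) x = f x"
  using rep_abs_rsp[OF Quotient3_L2, of f f] abs_L2_eq_iff[OF sq_integrable_rep_L2, of f "abs_L2 f"]
  by (simp add: abs_rep_L2)

lemma L2_eqI: "AE x in lborel. rep_L2 f x = rep_L2 g x \<Longrightarrow> f = g"
  using abs_L2_eq_iff[OF sq_integrable_rep_L2 sq_integrable_rep_L2, of f g] by (simp add: abs_rep_L2)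

instantiation L2 :: (euclidean_space) real_inner
begin

lift_definition zero_L2 :: "'a L2" is "\<lambda>x. 0"
  by (simp add: L2_rel_def sq_integrable_zero)

lift_definition plus_L2 :: "'a L2 \<Rightarrow> 'a L2 \<Rightarrow> 'a L2" is "\<lambda>f g x. f x + g x"
  by (auto simp: L2_rel_def intro: sq_integrable_add)

lift_definition uminus_L2 :: "'a L2 \<Rightarrow> 'a L2" is "\<lambda>f x. - f x"
  by (auto simp: L2_rel_def intro: sq_integrable_uminus)

lift_definition minus_L2 :: "'a L2 \<Rightarrow> 'a L2 \<Rightarrow> 'a L2" is "\<lambda>f g x. f x - g x"
  by (auto simp: L2_rel_def intro: sq_integrable_diff)

lift_definition scaleR_L2 :: "real \<Rightarrow> 'a L2 \<Rightarrow> 'a L2" is "\<lambda>c f x. c * f x"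
  by (auto simp: L2_rel_def intro: sq_integrable_cmult)

lift_definition inner_L2 :: "'a L2 \<Rightarrow> 'a L2 \<Rightarrow> real" is "\<lambda>f g. LINT x|lborel. f x * g x"
  unfolding L2_rel_def sq_integrable_def by (intro integral_cong_AE) auto

definition norm_L2 :: "'a L2 \<Rightarrow> real" where "norm_L2 f = sqrt (inner f f)"
definition sgn_L2 :: "'a L2 \<Rightarrow> 'a L2" where "sgn_L2 f = inverse (norm f) *\<^sub>R f"
definition dist_L2 :: "'a L2 \<Rightarrow> 'a L2 \<Rightarrow> real" where "dist_L2 f g = norm (f - g)"
definition uniformity_L2 :: "('a L2 \<times> 'a L2) filter" where
  "uniformity_L2 = (INF e\<in>{0 <..}. principal {(f, g). dist f g < e})"
definition open_L2 :: "'a L2 set \<Rightarrow> bool" where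
  "open_L2 U \<longleftrightarrow> (\<forall>f\<in>U. eventually (\<lambda>(f', g). f' = f \<longrightarrow> g \<in> U) uniformity)"

instance
proof
  fix a b c :: "'a L2" and r s :: real
  show "a + b + c = a + (b + c)"
    by transfer (auto simp: L2_rel_def add.assoc intro!: sq_integrable_add)
  show "a + b = b + a"
    by transfer (auto simp: L2_rel_def add.commute intro!: sq_integrable_add)
  show "0 + a = a" by transfer (auto simp: L2_rel_def)
  show "- a + a = 0" by transfer (auto simp: L2_rel_def sq_integrable_zero)
  show "a - b = a + - b"
    by transfer (auto simp: L2_rel_def intro!: sq_integrable_diff)
  show "r *\<^sub>R (a + b) = r *\<^sub>R a + r *\<^sub>R b"
    by transfer (auto simp: L2_rel_def distrib_left intro!: sq_integrable_add sq_integrable_cmult)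
  show "(r + s) *\<^sub>R a = r *\<^sub>R a + s *\<^sub>R a"
    by transfer (auto simp: L2_rel_def distrib_right intro!: sq_integrable_add sq_integrable_cmult)
  show "r *\<^sub>R s *\<^sub>R a = (r * s) *\<^sub>R a"
    by transfer (auto simp: L2_rel_def mult.assoc intro!: sq_integrable_cmult)
  show "1 *\<^sub>R a = a" by transfer (auto simp: L2_rel_def)
  show "sgn a = inverse (norm a) *\<^sub>R a" by (simp add: sgn_L2_def)
  show "dist a b = norm (a - b)" by (simp add: dist_L2_def)
  show "(uniformity :: ('a L2 \<times> 'a L2) filter) = (INF e\<in>{0 <..}. principal {(f, g). dist f g < e})"
    by (simp add: uniformity_L2_def)
  show "open U \<longleftrightarrow> (\<forall>f\<in>U. \<forall>\<^sub>F (f', g) in uniformity. f' = f \<longrightarrow> g \<in> U)" for U :: "'a L2 set"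
    by (simp add: open_L2_def)
  show "inner a b = inner b a" by transfer (simp add: mult.commute)
  show "inner (a + b) c = inner a c + inner b c"
    by transfer (auto simp: L2_rel_def distrib_right sq_integrable_mult)
  show "inner (r *\<^sub>R a) b = r * inner a b"
    by transfer (auto simp: L2_rel_def mult.assoc)
  show "0 \<le> inner a a" by transfer simp
  show "inner a a = 0 \<longleftrightarrow> a = 0"
  proof transfer
    fix f :: "'a \<Rightarrow> real" assume "L2_rel f f"
    then have f: "f \<in> borel_measurable lborel" "integrable lborel (\<lambda>x. f x * f x)" "sq_integrable f"
      by (auto simp: L2_rel_def sq_integrable_def power2_eq_square)
    have "(LINT x|lborel. f x * f x) = 0 \<longleftrightarrow> (AE x in lborel. f x * f x = 0)"
      using f by (intro integral_nonneg_eq_0_iff_AE) auto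
    also have "\<dots> \<longleftrightarrow> L2_rel f (\<lambda>x. 0)" using f by (simp add: L2_rel_def sq_integrable_zero)
    finally show "(LINT x|lborel. f x * f x) = 0 \<longleftrightarrow> L2_rel f (\<lambda>x. 0)" .
  qed
  show "norm a = sqrt (inner a a)" by (simp add: norm_L2_def)
qed

end


lemma power2_norm_L2: "(norm f)\<^sup>2 = (LINT x|lborel. (rep_L2 f x)\<^sup>2)"
proof -
  have "inner f f = (LINT x|lborel. (rep_L2 f x)\<^sup>2)"
    using inner_L2.abs_eq[of "rep_L2 f" "rep_L2 f"] sq_integrable_rep_L2[of f]
    by (simp add: abs_rep_L2 L2_rel_refl power2_eq_square)
  then show ?thesis by (simp add: power2_norm_eq_inner)
qed

lemma power2_norm_abs_L2:
  "sq_integrable f \<Longrightarrow> (norm (abs_L2 f))\<^sup>2 = (LINT x|lborel. (f x)\<^sup>2)"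
  using inner_L2.abs_eq[of f f] by (simp add: L2_rel_refl power2_eq_square power2_norm_eq_inner[unfolded power2_eq_square])

lemma abs_L2_diff:
  "sq_integrable f \<Longrightarrow> sq_integrable g \<Longrightarrow> abs_L2 f - abs_L2 g = abs_L2 (\<lambda>x. f x - g x)"
  by (simp add: minus_L2.abs_eq L2_rel_refl)

lemma abs_L2_add:
  "sq_integrable f \<Longrightarrow> sq_integrable g \<Longrightarrow> abs_L2 f + abs_L2 g = abs_L2 (\<lambda>x. f x + g x)"
  by (simp add: plus_L2.abs_eq L2_rel_refl)

lemma abs_L2_scaleR: "sq_integrable f \<Longrightarrow> r *\<^sub>R abs_L2 f = abs_L2 (\<lambda>x. r * f x)"
  by (simp add: scaleR_L2.abs_eq L2_rel_refl)

lemma power2_dist_abs_L2: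
  assumes "sq_integrable f" "sq_integrable g"
  shows "(dist (abs_L2 f) (abs_L2 g))\<^sup>2 = (LINT x|lborel. (f x - g x)\<^sup>2)"
  using assms by (simp add: dist_norm abs_L2_diff power2_norm_abs_L2 sq_integrable_diff)

lemma nn_integral_dist_L2:
  "(\<integral>\<^sup>+x. ennreal ((rep_L2 f x - rep_L2 g x)\<^sup>2) \<partial>lborel) = ennreal ((dist f g)\<^sup>2)"
proof -
  have "sq_integrable (\<lambda>x. rep_L2 f x - rep_L2 g x)"
    by (intro sq_integrable_diff sq_integrable_rep_L2)
  then have "(\<integral>\<^sup>+x. ennreal ((rep_L2 f x - rep_L2 g x)\<^sup>2) \<partial>lborel)
      = ennreal (LINT x|lborel. (rep_L2 f x - rep_L2 g x)\<^sup>2)"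
    by (intro nn_integral_eq_integral) (auto simp: sq_integrable_def)
  also have "\<dots> = ennreal ((dist f g)\<^sup>2)"
    using power2_dist_abs_L2[OF sq_integrable_rep_L2 sq_integrable_rep_L2, of f g]
    by (simp add: abs_rep_L2)
  finally show ?thesis .
qed

lemma abs_L2_tendsto:
  fixes f :: "'a::euclidean_space \<Rightarrow> real"
  assumes s: "\<And>n. sq_integrable (s n)" and f: "sq_integrable f"
    and lim: "\<And>x. (\<lambda>n. s n x) \<longlonglongrightarrow> f x"
    and bnd: "\<And>n x. \<bar>s n x\<bar> \<le> 2 * \<bar>f x\<bar>"
  shows "(\<lambda>n. abs_L2 (s n)) \<longlonglongrightarrow> abs_L2 f"
proof -
  have "(\<lambda>n. LINT x|lborel. (s n x - f x)\<^sup>2) \<longlonglongrightarrow> (LINT x::'a|lborel. 0::real)"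
  proof (rule Bochner_Integration.integral_dominated_convergence[where w = "\<lambda>x. 9 * (f x)\<^sup>2"])
    show "AE x in lborel. (\<lambda>n. (s n x - f x)\<^sup>2) \<longlonglongrightarrow> 0"
    proof (rule AE_I2)
      fix x
      have "(\<lambda>n. (s n x - f x)\<^sup>2) \<longlonglongrightarrow> (f x - f x)\<^sup>2"
        by (intro tendsto_intros lim)
      then show "(\<lambda>n. (s n x - f x)\<^sup>2) \<longlonglongrightarrow> 0" by simp
    qed
    fix n
    show "AE x in lborel. norm ((s n x - f x)\<^sup>2) \<le> 9 * (f x)\<^sup>2"
    proof (rule AE_I2)
      fix x
      have "\<bar>s n x - f x\<bar> \<le> 3 * \<bar>f x\<bar>" using bnd[of n x] by linarith
      then have "\<bar>s n x - f x\<bar>\<^sup>2 \<le> (3 * \<bar>f x\<bar>)\<^sup>2" by (intro power_mono) auto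
      then show "norm ((s n x - f x)\<^sup>2) \<le> 9 * (f x)\<^sup>2" by (simp add: power_mult_distrib)
    qed
  qed (use f sq_integrable_diff[OF s f] in \<open>auto simp: sq_integrable_def intro!: borel_measurable_power\<close>)
  then have "(\<lambda>n. (dist (abs_L2 (s n)) (abs_L2 f))\<^sup>2) \<longlonglongrightarrow> 0"
    by (simp add: power2_dist_abs_L2 s f)
  then have "(\<lambda>n. sqrt ((dist (abs_L2 (s n)) (abs_L2 f))\<^sup>2)) \<longlonglongrightarrow> sqrt 0"
    by (intro tendsto_intros)
  then show ?thesis by (subst tendsto_dist_iff) simp
qed

instance L2 :: (euclidean_space) banach
proof
  fix X :: "nat \<Rightarrow> 'a L2"
  assume "Cauchy X"
  then have "\<forall>n. \<exists>N. \<forall>m\<ge>N. \<forall>k\<ge>N. dist (X m) (X k) < (1/2)^n"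
    by (auto simp: Cauchy_def)
  then obtain N where N: "\<And>n m k. m \<ge> N n \<Longrightarrow> k \<ge> N n \<Longrightarrow> dist (X m) (X k) < (1/2)^n"
    by metis
  define r where "r n = (\<Sum>i\<le>n. N i)" for n
  have r_ge: "r m \<ge> N n" if "m \<ge> n" for n m
    unfolding r_def using that by (intro member_le_sum) auto
  define Y where "Y n = X (r n)" for n
  have XY: "dist (X m) (Y n) < (1/2)^n" if "m \<ge> N n" for m n
    unfolding Y_def using that r_ge[of n n] by (intro N) auto
  have YY: "dist (Y m) (Y n) < (1/2)^n" if "m \<ge> n" for m n
    unfolding Y_def by (intro N r_ge that order_refl)
  define f where "f n = rep_L2 (Y n)" for n
  have sqf: "sq_integrable (f n)" for n unfolding f_def by (rule sq_integrable_rep_L2)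
  then have [measurable]: "f n \<in> borel_measurable borel" for n by (simp add: sq_integrable_def)
  have nn: "(\<integral>\<^sup>+x. ennreal ((f m x - f n x)\<^sup>2) \<partial>lborel) \<le> ennreal ((1/4)^n)" if "m \<ge> n" for m n
  proof -
    have "(dist (Y m) (Y n))\<^sup>2 \<le> ((1/2)^n)\<^sup>2"
      using YY[OF that] by (intro power_mono) auto
    also have "((1/2)^n)\<^sup>2 = (1/4::real)^n"
      by (simp add: power_divide power2_eq_square flip: power_mult_distrib)
    finally show ?thesis unfolding f_def nn_integral_dist_L2 by (rule ennreal_leI)
  qed
  have "(\<integral>\<^sup>+x. (\<Sum>n. ennreal (2^n * (f (Suc n) x - f n x)\<^sup>2)) \<partial>lborel)
      = (\<Sum>n. \<integral>\<^sup>+x. ennreal (2^n * (f (Suc n) x - f n x)\<^sup>2) \<partial>lborel)"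
    by (rule nn_integral_suminf) measurable
  also have "\<dots> \<le> (\<Sum>n. ennreal ((1/2)^n))"
  proof (intro suminf_le summableI)
    fix n
    have "(\<integral>\<^sup>+x. ennreal (2^n * (f (Suc n) x - f n x)\<^sup>2) \<partial>lborel)
        = ennreal (2^n) * (\<integral>\<^sup>+x. ennreal ((f (Suc n) x - f n x)\<^sup>2) \<partial>lborel)"
      by (subst nn_integral_cmult[symmetric]) (auto simp: ennreal_mult)
    also have "\<dots> \<le> ennreal (2^n) * ennreal ((1/4)^n)"
      by (intro mult_left_mono nn) auto
    also have "\<dots> = ennreal ((1/2)^n)"
      by (simp add: power_divide flip: ennreal_mult power_mult_distrib)
        (simp add: field_simps flip: power_mult_distrib)
    finally show "(\<integral>\<^sup>+x. ennreal (2^n * (f (Suc n) x - f n x)\<^sup>2) \<partial>lborel) \<le> ennreal ((1/2)^n)" .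
  qed
  also have "\<dots> < top"
    by (subst less_top[symmetric], intro ennreal_suminf_neq_top summable_geometric) auto
  finally have fin: "(\<integral>\<^sup>+x. (\<Sum>n. ennreal (2^n * (f (Suc n) x - f n x)\<^sup>2)) \<partial>lborel) \<noteq> \<infinity>"
    by (auto simp: top_unique)
  have conv: "AE x in lborel. convergent (\<lambda>n. f n x)"
    using nn_integral_PInf_AE[OF _ fin]
  proof (rule AE_mp)
    show "AE x in lborel. (\<Sum>n. ennreal (2^n * (f (Suc n) x - f n x)\<^sup>2)) \<noteq> \<infinity> \<longrightarrow> convergent (\<lambda>n. f n x)"
    proof (intro AE_I2 impI)
      fix x assume "(\<Sum>n. ennreal (2^n * (f (Suc n) x - f n x)\<^sup>2)) \<noteq> \<infinity>"
      then have "summable (\<lambda>n. 2^n * (f (Suc n) x - f n x)\<^sup>2)"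
        by (intro summable_suminf_not_top) auto
      then have "summable (\<lambda>n. 2^n * (f (Suc n) x - f n x)\<^sup>2 + (1/2)^n)"
        by (intro summable_add summable_geometric) auto
      then have "summable (\<lambda>n. f (Suc n) x - f n x)"
      proof (rule summable_comparison_test')
        fix n :: nat assume "n \<ge> 0"
        let ?d = "\<bar>f (Suc n) x - f n x\<bar>"
        have "?d \<le> 2^n * ?d\<^sup>2 + (1/2)^n"
        proof (cases "?d \<le> (1/2)^n")
          case True then show ?thesis by (simp add: add_increasing)
        next
          case False
          then have "1 \<le> 2^n * ?d" by (simp add: field_simps power_divide)
          then have "1 * ?d \<le> (2^n * ?d) * ?d" by (intro mult_right_mono) auto
          then have "?d \<le> 2^n * ?d\<^sup>2" by (simp only: power2_eq_square mult.assoc mult_1)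
          then show ?thesis by (simp add: add_increasing2)
        qed
        then show "norm (f (Suc n) x - f n x) \<le> 2^n * (f (Suc n) x - f n x)\<^sup>2 + (1/2)^n"
          by simp
      qed
      then have "convergent (\<lambda>n. \<Sum>i<n. f (Suc i) x - f i x)"
        by (simp add: summable_iff_convergent)
      then show "convergent (\<lambda>n. f n x)"
        using convergent_add_const_right_iff[of "\<lambda>n. f n x" "- f 0 x"]
        by (simp add: sum_lessThan_telescope[of "\<lambda>n. f n x"])
    qed
  qed measurable
  define F where "F x = lim (\<lambda>n. f n x)" for x
  have [measurable]: "F \<in> borel_measurable borel"
    unfolding F_def by measurable
  have FF: "(\<integral>\<^sup>+x. ennreal ((F x - f n x)\<^sup>2) \<partial>lborel) \<le> ennreal ((1/4)^n)" for n
  proof -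
    have "(\<integral>\<^sup>+x. ennreal ((F x - f n x)\<^sup>2) \<partial>lborel)
        = (\<integral>\<^sup>+x. liminf (\<lambda>m. ennreal ((f m x - f n x)\<^sup>2)) \<partial>lborel)"
    proof (rule nn_integral_cong_AE, use conv in eventually_elim)
      case (elim x)
      then have "(\<lambda>m. f m x) \<longlonglongrightarrow> F x" by (simp add: F_def convergent_LIMSEQ_iff)
      then have "(\<lambda>m. ennreal ((f m x - f n x)\<^sup>2)) \<longlonglongrightarrow> ennreal ((F x - f n x)\<^sup>2)"
        by (intro tendsto_intros)
      then show ?case by (intro lim_imp_Liminf[symmetric]) auto
    qed
    also have "\<dots> \<le> liminf (\<lambda>m. \<integral>\<^sup>+x. ennreal ((f m x - f n x)\<^sup>2) \<partial>lborel)"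
      by (intro nn_integral_liminf) measurable
    also have "\<dots> \<le> ennreal ((1/4)^n)"
      by (intro Liminf_le eventually_sequentiallyI[of n] nn) auto
    finally show ?thesis .
  qed
  have sqd: "sq_integrable (\<lambda>x. F x - f n x)" for n
    unfolding sq_integrable_def using FF[of n]
    by (auto intro!: integrableI_bounded simp: le_less_trans[OF _ ennreal_less_top])
  have sqF: "sq_integrable F"
    using sq_integrable_add[OF sqd[of 0] sqf[of 0]] by simp
  have FY: "dist (abs_L2 F) (Y n) \<le> (1/2)^n" for n
  proof -
    have "ennreal ((dist (abs_L2 F) (Y n))\<^sup>2) = ennreal (LINT x|lborel. (F x - f n x)\<^sup>2)"
      using power2_dist_abs_L2[OF sqF sqf[of n]] by (simp add: f_def abs_rep_L2)
    also have "\<dots> = (\<integral>\<^sup>+x. ennreal ((F x - f n x)\<^sup>2) \<partial>lborel)"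
      using sqd[of n] by (intro nn_integral_eq_integral[symmetric]) (auto simp: sq_integrable_def)
    also have "\<dots> \<le> ennreal ((1/4)^n)" by (rule FF)
    also have "(1/4::real)^n = ((1/2)^n)\<^sup>2"
      by (simp add: power_divide power2_eq_square flip: power_mult_distrib)
    finally have "(dist (abs_L2 F) (Y n))\<^sup>2 \<le> ((1/2)^n)\<^sup>2"
      by (simp add: ennreal_le_iff)
    then show ?thesis by (rule power2_le_imp_le) simp
  qed
  have "X \<longlonglongrightarrow> abs_L2 F"
  proof (rule metric_LIMSEQ_I)
    fix e :: real assume "e > 0"
    then obtain n where n: "(1/2::real)^n < e / 2"
      using real_arch_pow_inv[of "e / 2" "1/2"] by auto
    have "dist (X m) (abs_L2 F) < e" if "m \<ge> N n" for m
      using XY[OF that] FY[of n] n dist_triangle2[of "X m" "abs_L2 F" "Y n"] by linarith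
    then show "\<exists>no. \<forall>m\<ge>no. dist (X m) (abs_L2 F) < e" by blast
  qed
  then show "convergent X" by (rule convergentI)
qed

lemma L2_countable_dense: "\<exists>C :: 'a::euclidean_space L2 set. countable C \<and> closure C = UNIV"
proof -
  obtain B0 :: "'a set set" where B0: "countable B0" "topological_basis B0"
    using ex_countable_basis by blast
  define G where "G = Inter ` {F. finite F \<and> F \<subseteq> B0}"
  have cG: "countable G"
    unfolding G_def by (intro countable_image countable_Collect_finite_subset B0)
  have oG: "open A" if "A \<in> G" for A
    using that topological_basis_open[OF B0(2)] by (auto simp: G_def intro!: open_Inter)
  have "b \<in> G" if "b \<in> B0" for b
    unfolding G_def using that by (intro image_eqI[of _ _ "{b}"]) auto
  then have tG: "topological_basis G"
    using B0(2) oG unfolding topological_basis_def by (meson subset_iff)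
  have sG: "sets (borel :: 'a measure) = sigma_sets UNIV G"
    unfolding borel_eq_countable_basis[OF cG tG] by (rule sets_measure_of) simp
  have UG: "UNIV \<in> G" unfolding G_def by (intro image_eqI[of _ _ "{}"]) auto
  have iG: "Int_stable G"
  proof (rule Int_stableI)
    fix a b assume "a \<in> G" "b \<in> G"
    then obtain F F' where "finite F" "F \<subseteq> B0" "a = \<Inter>F" "finite F'" "F' \<subseteq> B0" "b = \<Inter>F'"
      by (auto simp: G_def)
    then show "a \<inter> b \<in> G"
      unfolding G_def by (intro image_eqI[of _ _ "F \<union> F'"]) auto
  qed
  define e :: "'a set \<times> nat \<Rightarrow> 'a L2" where "e p = abs_L2 (indicator (fst p \<inter> ball 0 (real (snd p))))" for p
  have fin: "emeasure lborel (A \<inter> ball 0 (real n)) < \<infinity>" if "A \<in> sets borel" for A :: "'a set" and n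
    using that by (intro emeasure_bounded_finite bounded_Int) auto
  have sqi: "sq_integrable (indicator (A \<inter> ball 0 (real n)) :: 'a \<Rightarrow> real)" if "A \<in> sets borel" for A n
    using that by (intro sq_integrable_indicator fin) auto
  define cmb where "cmb xs = (\<Sum>(q::rat, p)\<leftarrow>xs. real_of_rat q *\<^sub>R e p)" for xs
  define C where "C = cmb ` lists (UNIV \<times> (G \<times> UNIV))"
  have cC: "countable C"
    unfolding C_def by (intro countable_image countable_lists countable_SIGMA cG) auto
  define V where "V = closure C"
  have C_add: "x + y \<in> C" if xy: "x \<in> C" "y \<in> C" for x y
  proof -
    obtain xs ys where "xs \<in> lists (UNIV \<times> (G \<times> UNIV))" "x = cmb xs"
      "ys \<in> lists (UNIV \<times> (G \<times> UNIV))" "y = cmb ys"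
      using xy by (auto simp: C_def)
    then show ?thesis unfolding C_def by (intro image_eqI[of _ _ "xs @ ys"]) (auto simp: cmb_def)
  qed
  have C_scale: "real_of_rat q *\<^sub>R x \<in> C" if x: "x \<in> C" for x q
  proof -
    obtain xs where xs: "xs \<in> lists (UNIV \<times> (G \<times> UNIV))" "x = cmb xs"
      using x by (auto simp: C_def)
    have "real_of_rat q *\<^sub>R cmb xs = cmb (map (\<lambda>(q', p). (q * q', p)) xs)"
      unfolding cmb_def by (induction xs) (auto simp: scaleR_add_right of_rat_mult)
    moreover have "map (\<lambda>(q', p). (q * q', p)) xs \<in> lists (UNIV \<times> (G \<times> UNIV))"
      using xs(1) by auto
    ultimately show ?thesis unfolding C_def xs(2) by blast
  qed
  have e_V: "e (A, n) \<in> V" if "A \<in> G" for A n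
  proof -
    have "e (A, n) \<in> C" unfolding C_def
      using that by (intro image_eqI[of _ _ "[(1, (A, n))]"]) (auto simp: cmb_def)
    then show ?thesis unfolding V_def using closure_subset by blast
  qed
  have zero_V: "0 \<in> V"
    using closure_subset[of C] by (force simp: V_def C_def cmb_def intro!: image_eqI[of _ _ "[]"])
  have V_add: "x + y \<in> V" if xy: "x \<in> V" "y \<in> V" for x y
  proof -
    obtain f where f: "\<And>n. f n \<in> C" "f \<longlonglongrightarrow> x"
      using xy(1) unfolding V_def closure_sequential by auto
    obtain g where g: "\<And>n. g n \<in> C" "g \<longlonglongrightarrow> y"
      using xy(2) unfolding V_def closure_sequential by auto
    show ?thesis unfolding V_def closure_sequential
      using f g by (intro exI[of _ "\<lambda>n. f n + g n"] conjI allI C_add tendsto_add)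
  qed
  have V_scale: "r *\<^sub>R x \<in> V" if x: "x \<in> V" for r x
  proof -
    obtain f where f: "\<And>n. f n \<in> C" "f \<longlonglongrightarrow> x"
      using x unfolding V_def closure_sequential by auto
    have "\<exists>q. r < real_of_rat q \<and> real_of_rat q < r + inverse (real (Suc n))" for n
      using of_rat_dense[of r "r + inverse (real (Suc n))"] by simp
    then obtain q where q: "\<And>n. r < real_of_rat (q n) \<and> real_of_rat (q n) < r + inverse (real (Suc n))"
      by metis
    have "(\<lambda>n. real_of_rat (q n)) \<longlonglongrightarrow> r"
    proof (rule tendsto_sandwich[of "\<lambda>_. r" _ _ "\<lambda>n. r + inverse (real (Suc n))"])
      show "(\<lambda>n. r + inverse (real (Suc n))) \<longlonglongrightarrow> r" by (rule LIMSEQ_inverse_real_of_nat_add)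
    qed (use q in \<open>auto intro!: always_eventually less_imp_le\<close>)
    then have "(\<lambda>n. real_of_rat (q n) *\<^sub>R f n) \<longlonglongrightarrow> r *\<^sub>R x"
      by (intro tendsto_scaleR f)
    then show ?thesis unfolding V_def closure_sequential
      by (intro exI[of _ "\<lambda>n. real_of_rat (q n) *\<^sub>R f n"]) (auto intro: C_scale f(1))
  qed
  have V_diff: "x - y \<in> V" if "x \<in> V" "y \<in> V" for x y
    using V_add[OF that(1) V_scale[OF that(2), of "-1"]] by simp
  have V_lim: "l \<in> V" if "\<And>n. s n \<in> V" "s \<longlonglongrightarrow> l" for s l
    using closed_sequentially[of V s l] that by (simp add: V_def)
  have box: "\<forall>n. e (A, n) \<in> V" if "A \<in> sets borel" for A
    using iG subset_UNIV[of G, folded Pow_UNIV] that[unfolded sG]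
  proof (induction rule: sigma_sets_induct_disjoint)
    case (basic A) then show ?case using e_V by blast
  next
    case empty
    have "(indicator {} :: 'a \<Rightarrow> real) = (\<lambda>x. 0)" by auto
    then have "abs_L2 (indicator {} :: 'a \<Rightarrow> real) = 0" by (simp add: zero_L2_def map_fun_def)
    then show ?case using zero_V by (simp add: e_def)
  next
    case (compl A)
    then have A: "A \<in> sets borel" by (simp add: sG)
    have "e (UNIV - A, n) = e (UNIV, n) - e (A, n)" for n
      unfolding e_def using sqi[OF A] sqi[of UNIV]
      by (auto simp: abs_L2_diff indicator_def fun_eq_iff intro!: arg_cong[of _ _ abs_L2])
    then show ?case using compl V_diff e_V[OF UG] by auto
  next
    case (union A)
    then have A: "A i \<in> sets borel" for i by (auto simp: sG)
    show ?case
    proof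
      fix n
      let ?B = "\<lambda>A. indicator (A \<inter> ball 0 (real n)) :: 'a \<Rightarrow> real"
      have fs: "sq_integrable (\<lambda>x. \<Sum>i<m. ?B (A i) x) \<and> abs_L2 (\<lambda>x. \<Sum>i<m. ?B (A i) x) \<in> V" for m
      proof (induction m)
        case 0
        have "abs_L2 (\<lambda>x::'a. 0 :: real) = 0" by (simp add: zero_L2_def map_fun_def)
        then show ?case using zero_V sq_integrable_zero by simp
      next
        case (Suc m)
        have "abs_L2 (\<lambda>x. (\<Sum>i<m. ?B (A i) x) + ?B (A m) x) = abs_L2 (\<lambda>x. \<Sum>i<m. ?B (A i) x) + e (A m, n)"
          unfolding e_def using Suc sqi[OF A] by (subst abs_L2_add) auto
        then show ?case using Suc sqi[OF A] union.IH V_add by (auto intro!: sq_integrable_add)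
      qed
      have eq: "(\<Sum>i<m. ?B (A i) x) = ?B (\<Union>i<m. A i) x" for m x
      proof -
        have "(\<Sum>i<m. indicator (A i) x) = (indicator (\<Union>i<m. A i) x :: real)"
          using union.hyps(1) by (intro indicator_UN_disjoint[symmetric]) (auto intro: disjoint_family_on_mono)
        then show ?thesis by (simp add: indicator_inter_arith flip: sum_distrib_right)
      qed
      have "(\<lambda>m. abs_L2 (\<lambda>x. \<Sum>i<m. ?B (A i) x)) \<longlonglongrightarrow> abs_L2 (?B (\<Union>i. A i))"
      proof (rule abs_L2_tendsto)
        show "sq_integrable (?B (\<Union>i. A i))" using A by (intro sqi) auto
        show "\<bar>\<Sum>i<m. ?B (A i) x\<bar> \<le> 2 * \<bar>?B (\<Union>i. A i) x\<bar>" for m x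
          unfolding eq by (auto simp: indicator_def)
        show "(\<lambda>m. \<Sum>i<m. ?B (A i) x) \<longlonglongrightarrow> ?B (\<Union>i. A i) x" for x
        proof -
          have "(\<lambda>m. indicator (\<Union>i<m. A i) x :: real) \<longlonglongrightarrow> indicator (\<Union>i. A i) x"
            by (rule LIMSEQ_indicator_UN)
          then have "(\<lambda>m. indicator (\<Union>i<m. A i) x * indicator (ball 0 (real n)) x :: real)
              \<longlonglongrightarrow> indicator (\<Union>i. A i) x * indicator (ball 0 (real n)) x"
            by (intro tendsto_intros)
          then show ?thesis unfolding eq by (simp add: indicator_inter_arith)
        qed
      qed (use fs in blast)
      then have "abs_L2 (?B (\<Union>i. A i)) \<in> V" by (rule V_lim[rotated]) (use fs in blast)
      then show "e (\<Union>i. A i, n) \<in> V" by (simp add: e_def)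
    qed
  qed
  have ind: "abs_L2 (indicator A) \<in> V" if A: "A \<in> sets borel" "emeasure lborel A < \<infinity>" for A
  proof (rule V_lim)
    show "e (A, n) \<in> V" for n using box[OF A(1)] by blast
    show "(\<lambda>n. e (A, n)) \<longlonglongrightarrow> abs_L2 (indicator A)"
      unfolding e_def
    proof (rule abs_L2_tendsto)
      show "sq_integrable (indicator A :: 'a \<Rightarrow> real)" by (rule sq_integrable_indicator[OF A])
      show "sq_integrable (indicator (fst (A, n) \<inter> ball 0 (real (snd (A, n)))) :: 'a \<Rightarrow> real)" for n
        using sqi[OF A(1)] by simp
      fix x :: 'a
      obtain k :: nat where k: "norm x < real k" using reals_Archimedean2 by blast
      show "(\<lambda>n. indicator (fst (A, n) \<inter> ball 0 (real (snd (A, n)))) x :: real) \<longlonglongrightarrow> indicator A x"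
      proof (rule tendsto_eventually, rule eventually_sequentiallyI[of k])
        fix n assume "k \<le> n"
        then have "norm x < real n" using k by (meson less_le_trans of_nat_mono)
        then show "indicator (fst (A, n) \<inter> ball 0 (real (snd (A, n)))) x = (indicator A x :: real)"
          by (simp add: indicator_def)
      qed
    qed (auto simp: indicator_def)
  qed
  have "v \<in> V" for v
  proof -
    define f where "f = rep_L2 v"
    have sqf: "sq_integrable f" unfolding f_def by (rule sq_integrable_rep_L2)
    then have "f \<in> borel_measurable lborel" by (simp add: sq_integrable_def)
    from borel_measurable_implies_sequence_metric[OF this, of 0]
    obtain s where s': "\<forall>i. simple_function lborel (s i)"
      "\<forall>x\<in>space lborel. (\<lambda>i. s i x) \<longlonglongrightarrow> f x"
      "\<forall>i. \<forall>x\<in>space lborel. dist (s i x) 0 \<le> 2 * dist (f x) 0"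
      by (elim exE conjE) (rule that)
    have s: "simple_function lborel (s i)" "(\<lambda>i. s i x) \<longlonglongrightarrow> f x" "\<bar>s i x\<bar> \<le> 2 * \<bar>f x\<bar>" for i x
      using s' by simp_all
    have sm: "s i \<in> borel_measurable lborel" for i using s(1) by (rule borel_measurable_simple_function)
    have sqs: "sq_integrable (s i)" for i
      unfolding sq_integrable_def
    proof (rule conjI[OF sm], rule Bochner_Integration.integrable_bound[of lborel "\<lambda>x. 4 * (f x)\<^sup>2"])
      show "integrable lborel (\<lambda>x. 4 * (f x)\<^sup>2)" using sqf by (simp add: sq_integrable_def)
      show "(\<lambda>x. (s i x)\<^sup>2) \<in> borel_measurable lborel" by (intro borel_measurable_power sm)
      show "AE x in lborel. norm ((s i x)\<^sup>2) \<le> norm (4 * (f x)\<^sup>2)"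
      proof (rule AE_I2)
        fix x
        have "\<bar>s i x\<bar>\<^sup>2 \<le> (2 * \<bar>f x\<bar>)\<^sup>2" by (intro power_mono s) auto
        then show "norm ((s i x)\<^sup>2) \<le> norm (4 * (f x)\<^sup>2)" by (simp add: power_mult_distrib)
      qed
    qed
    have sV: "abs_L2 (s i) \<in> V" for i
    proof -
      define L where "L y = s i -` {y}" for y
      have Lm: "L y \<in> sets borel" for y
        using measurable_sets[OF sm[of i], of "{y}"] by (simp add: L_def)
      have Lf: "emeasure lborel (L y) < \<infinity>" if "y \<noteq> 0" for y
      proof -
        have "integrable lborel (\<lambda>x. inverse (y\<^sup>2) * (s i x)\<^sup>2)"
          using sqs[of i] by (auto simp: sq_integrable_def)
        then have "integrable lborel (indicator (L y) :: 'a \<Rightarrow> real)"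
          by (rule Bochner_Integration.integrable_bound)
            (use Lm that in \<open>auto simp: indicator_def L_def\<close>)
        then show ?thesis by (simp add: integrable_indicator_iff)
      qed
      have part: "sq_integrable (\<lambda>x. \<Sum>y\<in>Y. y * indicator (L y) x) \<and> abs_L2 (\<lambda>x. \<Sum>y\<in>Y. y * indicator (L y) x) \<in> V"
        if "finite Y" for Y
        using that
      proof induction
        case empty
        have "abs_L2 (\<lambda>x::'a. 0 :: real) = 0" by (simp add: zero_L2_def map_fun_def)
        then show ?case using zero_V sq_integrable_zero by simp
      next
        case (insert y Y)
        show ?case
        proof (cases "y = 0")
          case True
          then show ?thesis
            using insert.IH unfolding sum.insert[OF insert.hyps] by (simp only: mult_zero_left add_0)
        next
          case False
          have i: "sq_integrable (indicator (L y) :: 'a \<Rightarrow> real)"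
            by (intro sq_integrable_indicator Lm Lf False)
          have "abs_L2 (\<lambda>x. y * indicator (L y) x) \<in> V"
            using V_scale[OF ind[OF Lm Lf[OF False]], of y] i by (simp add: abs_L2_scaleR)
          moreover have "abs_L2 (\<lambda>x. y * indicator (L y) x + (\<Sum>y\<in>Y. y * indicator (L y) x)) =
              abs_L2 (\<lambda>x. y * indicator (L y) x) + abs_L2 (\<lambda>x. \<Sum>y\<in>Y. y * indicator (L y) x)"
            using insert.IH sq_integrable_cmult[OF i, of y] by (subst abs_L2_add) auto
          moreover have "sq_integrable (\<lambda>x. y * indicator (L y) x + (\<Sum>y\<in>Y. y * indicator (L y) x))"
            using insert.IH sq_integrable_cmult[OF i, of y] by (intro sq_integrable_add) auto
          ultimately show ?thesis
            using insert.IH V_add unfolding sum.insert[OF insert.hyps] by (simp only:)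
        qed
      qed
      have fr: "finite (range (s i))" using s(1)[of i] by (simp add: simple_function_def)
      have "s i = (\<lambda>x. \<Sum>y\<in>range (s i). y * indicator (L y) x)"
      proof
        fix x
        have "(\<Sum>y\<in>range (s i). y * indicator (L y) x) = (\<Sum>y\<in>range (s i). if y = s i x then y else 0)"
          by (intro sum.cong) (auto simp: L_def indicator_def)
        then show "s i x = (\<Sum>y\<in>range (s i). y * indicator (L y) x)" using fr by simp
      qed
      then show ?thesis using part[OF fr] by simp
    qed
    have "(\<lambda>i. abs_L2 (s i)) \<longlonglongrightarrow> abs_L2 f"
      by (intro abs_L2_tendsto sqs sqf s)
    then show ?thesis using V_lim[OF sV] by (simp add: f_def abs_rep_L2)
  qed
  then show ?thesis using cC by (auto simp: V_def)
qed

instance L2 :: (euclidean_space) second_countable_topology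
proof
  obtain C :: "'a L2 set" where C: "countable C" "closure C = UNIV"
    using L2_countable_dense by blast
  define B where "B = (\<lambda>(c, n). ball c (inverse (real (Suc n)))) ` (C \<times> UNIV)"
  have "countable B" unfolding B_def by (intro countable_image countable_SIGMA C) auto
  moreover have "topological_basis B"
  proof (rule topological_basisI)
    show "open b" if "b \<in> B" for b using that by (auto simp: B_def)
  next
    fix U :: "'a L2 set" and x assume "open U" "x \<in> U"
    then obtain r where r: "r > 0" "ball x r \<subseteq> U" by (meson openE)
    obtain n where n: "inverse (real (Suc n)) < r / 2"
      using reals_Archimedean[of "r / 2"] r by auto
    obtain c where c: "c \<in> C" "dist c x < inverse (real (Suc n))"
      using C(2) closure_approachable[of x C] by (metis UNIV_I inverse_positive_iff_positive of_nat_0_less_iff zero_less_Suc)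
    have "ball c (inverse (real (Suc n))) \<subseteq> U"
    proof
      fix y assume "y \<in> ball c (inverse (real (Suc n)))"
      then have "dist x y < r"
        using c n dist_triangle[of x y c] by (simp add: dist_commute)
      then show "y \<in> U" using r by auto
    qed
    then show "\<exists>b\<in>B. x \<in> b \<and> b \<subseteq> U"
      using c by (intro bexI[of _ "ball c (inverse (real (Suc n)))"]) (auto simp: B_def)
  qed
  ultimately show "\<exists>B :: 'a L2 set set. countable B \<and> open = generate_topology B"
    using topological_basis_imp_subbasis by blast
qed


section \<open>Dirichlet eigenpairs of the Laplacian\<close>

definition partial_deriv :: "'a::euclidean_space \<Rightarrow> ('a \<Rightarrow> real) \<Rightarrow> 'a \<Rightarrow> real" where
  "partial_deriv b f x = frechet_derivative f (at x) b"

text \<open>Meant for open \<open>S\<close>; derivatives are two-sided.\<close>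

fun Ck_on :: "nat \<Rightarrow> 'a::euclidean_space set \<Rightarrow> ('a \<Rightarrow> real) \<Rightarrow> bool" where
  "Ck_on 0 S f \<longleftrightarrow> continuous_on S f"
| "Ck_on (Suc k) S f \<longleftrightarrow>
     (\<forall>x\<in>S. f differentiable (at x)) \<and> (\<forall>b\<in>Basis. Ck_on k S (partial_deriv b f))"

definition smooth_on :: "'a::euclidean_space set \<Rightarrow> ('a \<Rightarrow> real) \<Rightarrow> bool" where
  "smooth_on S f \<longleftrightarrow> (\<forall>k. Ck_on k S f)"

definition test_fun :: "'a::euclidean_space set \<Rightarrow> ('a \<Rightarrow> real) \<Rightarrow> bool" where
  "test_fun S \<psi> \<longleftrightarrow> smooth_on UNIV \<psi> \<and> (\<exists>K. compact K \<and> K \<subseteq> S \<and> (\<forall>x. x \<notin> K \<longrightarrow> \<psi> x = 0))"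

text \<open>\<open>L\<^sup>2(\<Omega>)\<close> is identified with the closed subspace of \<open>L\<^sup>2(\<real>\<^sup>d)\<close> of functions vanishing off \<open>\<Omega>\<close>
  (extension by zero), so that \<open>inner\<close> and \<open>norm\<close> are the ones of \<open>L\<^sup>2(\<Omega>)\<close>.\<close>

definition L2_on :: "'a::euclidean_space set \<Rightarrow> 'a L2 set" where
  "L2_on \<Omega> = {g. AE x in lborel. x \<notin> \<Omega> \<longrightarrow> rep_L2 g x = 0}"

definition weak_partial :: "'a::euclidean_space set \<Rightarrow> 'a \<Rightarrow> 'a L2 \<Rightarrow> 'a L2 \<Rightarrow> bool" where
  "weak_partial \<Omega> b g h \<longleftrightarrow> g \<in> L2_on \<Omega> \<and> h \<in> L2_on \<Omega> \<and>
     (\<forall>\<psi>. test_fun \<Omega> \<psi> \<longrightarrow>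
       (LINT x|lborel. rep_L2 g x * partial_deriv b \<psi> x) = - (LINT x|lborel. rep_L2 h x * \<psi> x))"

text \<open>\<open>H\<^sub>0\<^sup>1(\<Omega>)\<close>: the closure of the test functions in the \<open>H\<^sup>1(\<Omega>)\<close> norm.\<close>

definition H10 :: "'a::euclidean_space set \<Rightarrow> 'a L2 set" where
  "H10 \<Omega> = {g \<in> L2_on \<Omega>. \<exists>\<psi> :: nat \<Rightarrow> 'a \<Rightarrow> real.
     (\<forall>n. test_fun \<Omega> (\<psi> n)) \<and> (\<lambda>n. abs_L2 (\<psi> n)) \<longlonglongrightarrow> g \<and>
     (\<forall>b\<in>Basis. \<exists>h. weak_partial \<Omega> b g h \<and> (\<lambda>n. abs_L2 (partial_deriv b (\<psi> n))) \<longlonglongrightarrow> h)}"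

text \<open>\<open>- \<Delta> g = \<mu> g\<close> with homogeneous Dirichlet boundary condition, in the weak form
  \<open>\<integral> \<nabla>g \<cdot> \<nabla>v = \<mu> \<integral> g v\<close> for all \<open>v\<close> in \<open>H\<^sub>0\<^sup>1(\<Omega>)\<close>.\<close>

definition dirichlet_eigenpair :: "'a::euclidean_space set \<Rightarrow> real \<Rightarrow> 'a L2 \<Rightarrow> bool" where
  "dirichlet_eigenpair \<Omega> \<mu> g \<longleftrightarrow> g \<in> H10 \<Omega> \<and> g \<noteq> 0 \<and>
     (\<forall>v\<in>H10 \<Omega>. \<forall>G V.
        (\<forall>b\<in>Basis. weak_partial \<Omega> b g (G b) \<and> weak_partial \<Omega> b v (V b)) \<longrightarrow>
        (\<Sum>b\<in>Basis. inner (G b) (V b)) = \<mu> * inner g v)"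

text \<open>The pairs are numbered from \<open>0\<close>.\<close>

definition dirichlet_eigensystem ::
  "'a::euclidean_space set \<Rightarrow> (nat \<Rightarrow> real) \<Rightarrow> (nat \<Rightarrow> 'a L2) \<Rightarrow> bool" where
  "dirichlet_eigensystem \<Omega> lam \<phi> \<longleftrightarrow>
     0 < lam 0 \<and> incseq lam \<and> (\<forall>i. dirichlet_eigenpair \<Omega> (lam i) (\<phi> i)) \<and>
     (\<forall>i j. inner (\<phi> i) (\<phi> j) = (if i = j then 1 else 0)) \<and>
     closure (span (range \<phi>)) = L2_on \<Omega>"

definition spectral_H ::
  "'a::euclidean_space set \<Rightarrow> (nat \<Rightarrow> real) \<Rightarrow> (nat \<Rightarrow> 'a L2) \<Rightarrow> real \<Rightarrow> 'a L2 set" where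
  "spectral_H \<Omega> lam \<phi> s = {q \<in> L2_on \<Omega>. summable (\<lambda>i. lam i powr s * (inner q (\<phi> i))\<^sup>2)}"

definition spectral_H_norm ::
  "(nat \<Rightarrow> real) \<Rightarrow> (nat \<Rightarrow> 'a::euclidean_space L2) \<Rightarrow> real \<Rightarrow> 'a L2 \<Rightarrow> real" where
  "spectral_H_norm lam \<phi> s q = sqrt (\<Sum>i. lam i powr s * (inner q (\<phi> i))\<^sup>2)"


section \<open>Piecewise smooth domains with convex corners\<close>

text \<open>Near each boundary point, after a choice of vertical direction \<open>v\<close>, the domain is the part
  strictly below the graph of a function \<open>\<eta>\<close> of the remaining variables (whence the invariance of
  \<open>\<eta>\<close> along \<open>v\<close>), where \<open>\<eta>\<close> is piecewise smooth in the sense of Scholtes: a continuous selection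
  of finitely many smooth functions. In dimension one this says that \<open>\<Omega>\<close> lies locally on one side
  of each boundary point.\<close>

definition piecewise_smooth_boundary :: "'a::euclidean_space set \<Rightarrow> bool" where
  "piecewise_smooth_boundary \<Omega> \<longleftrightarrow>
     (\<forall>p\<in>frontier \<Omega>. \<exists>r>0. \<exists>v \<eta> G. norm v = 1 \<and> (\<forall>x t. \<eta> (x + t *\<^sub>R v) = \<eta> x) \<and>
        continuous_on (ball p r) \<eta> \<and> finite G \<and> (\<forall>g\<in>G. smooth_on (ball p r) g) \<and>
        (\<forall>x\<in>ball p r. \<exists>g\<in>G. \<eta> x = g x) \<and>
        \<Omega> \<inter> ball p r = {x \<in> ball p r. inner x v < \<eta> x})"

text \<open>The Bouligand tangent cone.\<close>

definition tangent_cone :: "'a::euclidean_space set \<Rightarrow> 'a \<Rightarrow> 'a set" where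
  "tangent_cone \<Omega> p = {w. \<exists>x t. (\<forall>n::nat. x n \<in> \<Omega> \<and> 0 < t n) \<and> t \<longlonglongrightarrow> 0 \<and>
     (\<lambda>n. (1 / t n) *\<^sub>R (x n - p)) \<longlonglongrightarrow> w}"

definition convex_corners :: "'a::euclidean_space set \<Rightarrow> bool" where
  "convex_corners \<Omega> \<longleftrightarrow> (\<forall>p\<in>frontier \<Omega>. convex (tangent_cone \<Omega> p))"


section \<open>Bochner--Sobolev spaces on \<open>(0,T)\<close>\<close>

text \<open>The elements are functions, to be identified when they agree almost everywhere on \<open>(0,T)\<close>;
  \<open>X\<close> is a closed subspace of the ambient Banach space.\<close>

definition bochner_L2 ::
  "real \<Rightarrow> 'b set \<Rightarrow> (real \<Rightarrow> 'b::{banach, second_countable_topology}) set" where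
  "bochner_L2 T X = {u. u \<in> borel_measurable (lebesgue_on {0<..<T}) \<and>
     (AE t in lebesgue_on {0<..<T}. u t \<in> X) \<and>
     integrable (lebesgue_on {0<..<T}) (\<lambda>t. (norm (u t))\<^sup>2)}"

definition bochner_L2_norm ::
  "real \<Rightarrow> (real \<Rightarrow> 'b::{banach, second_countable_topology}) \<Rightarrow> real" where
  "bochner_L2_norm T u = sqrt (LINT t|lebesgue_on {0<..<T}. (norm (u t))\<^sup>2)"

definition bochner_weak_deriv ::
  "real \<Rightarrow> (real \<Rightarrow> 'b::{banach, second_countable_topology}) \<Rightarrow> (real \<Rightarrow> 'b) \<Rightarrow> bool" where
  "bochner_weak_deriv T u v \<longleftrightarrow>
     (\<forall>\<psi>. test_fun {0<..<T} \<psi> \<longrightarrow>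
       (LINT t|lebesgue_on {0<..<T}. deriv \<psi> t *\<^sub>R u t) = - (LINT t|lebesgue_on {0<..<T}. \<psi> t *\<^sub>R v t))"

definition bochner_H1 ::
  "real \<Rightarrow> 'b set \<Rightarrow> (real \<Rightarrow> 'b::{banach, second_countable_topology}) set" where
  "bochner_H1 T X = {u \<in> bochner_L2 T X. \<exists>v\<in>bochner_L2 T X. bochner_weak_deriv T u v}"

text \<open>The choice is immaterial: the weak derivative is unique up to null sets.\<close>

definition bochner_H1_norm ::
  "real \<Rightarrow> (real \<Rightarrow> 'b::{banach, second_countable_topology}) \<Rightarrow> real" where
  "bochner_H1_norm T u =
     sqrt ((bochner_L2_norm T u)\<^sup>2 +
       (bochner_L2_norm T (SOME v. v \<in> bochner_L2 T UNIV \<and> bochner_weak_deriv T u v))\<^sup>2)"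


section \<open>The variable-exponent problem\<close>

definition bounded_second_derivative :: "real \<Rightarrow> (real \<Rightarrow> real) \<Rightarrow> bool" where
  "bounded_second_derivative T \<alpha> \<longleftrightarrow>
     (\<exists>\<alpha>' \<alpha>'' C. \<forall>t\<in>{0..T}. (\<alpha> has_real_derivative \<alpha>' t) (at t within {0..T}) \<and>
        (\<alpha>' has_real_derivative \<alpha>'' t) (at t within {0..T}) \<and> \<bar>\<alpha>'' t\<bar> \<le> C)"

definition kernel :: "(real \<Rightarrow> real) \<Rightarrow> real \<Rightarrow> real" where
  "kernel \<alpha> t = t powr (- \<alpha> t) / Gamma (1 - \<alpha> t)"

text \<open>Pointwise values, in particular the initial value, are those of the continuous representative
  \<open>U\<close> of \<open>u\<close> in \<open>C([0,T]; L\<^sup>2(\<Omega>))\<close>.\<close>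

definition is_solution ::
  "'a::euclidean_space set \<Rightarrow> (nat \<Rightarrow> real) \<Rightarrow> (nat \<Rightarrow> 'a L2) \<Rightarrow> real \<Rightarrow> (real \<Rightarrow> real) \<Rightarrow>
   (real \<Rightarrow> 'a L2) \<Rightarrow> 'a L2 \<Rightarrow> (real \<Rightarrow> 'a L2) \<Rightarrow> bool" where
  "is_solution \<Omega> lam \<phi> T \<alpha> f u0 u \<longleftrightarrow> u \<in> bochner_H1 T (L2_on \<Omega>) \<and>
     (\<exists>U. continuous_on {0..T} U \<and> (AE t in lebesgue_on {0<..<T}. U t = u t) \<and>
       (\<forall>i. inner (U 0) (\<phi> i) = inner u0 (\<phi> i) \<and>
         (AE t in lebesgue_on {0<..<T}. \<exists>D.
            ((\<lambda>s. inner (U s) (\<phi> i)) has_real_derivative D) (at t) \<and>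
            D + lam i * (LINT s|lebesgue_on {0..t}. kernel \<alpha> (t - s) * inner (U s) (\<phi> i))
              = inner (f t) (\<phi> i))))"

end

theory Submission
  imports Defs
begin

text \<open>In the basis of eigenfunctions the problem decouples into scalar Volterra equations
  \<open>v + \<mu> (K * v) = g\<close> for \<open>v = u'\<close>, where \<open>\<mu>\<close> runs through the eigenvalues, \<open>K\<close> is the primitive of
  the kernel \<open>k\<close> and \<open>g = f - \<mu> u(0) K\<close>. All that matters is an \<open>L\<^sup>2(0,T)\<close> bound of \<open>v\<close> by \<open>g\<close>
  uniform in \<open>\<mu>\<close>; the bound is then summed over the modes.

  Freezing the exponent at \<open>t = 0\<close> gives \<open>k = k\<^sub>0 + 1 * \<kappa>\<close> with \<open>k\<^sub>0\<close> a multiple of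
  \<open>t powr (-\<alpha> 0)\<close> and \<open>\<kappa>\<close> integrable. With \<open>K\<^sub>0 = 1 * k\<^sub>0\<close> and \<open>A\<close> the multiple of \<open>t powr (\<alpha> 0 - 1)\<close> for which
  \<open>K\<^sub>0 * A = t\<close>, one has \<open>K * v = K\<^sub>0 * y\<close> for \<open>y = v + A * \<kappa> * v\<close>, so that \<open>y + \<mu> (K\<^sub>0 * y) = g + A * \<kappa> * v\<close> and the last
  term is absorbed by a Gronwall argument. For the frozen equation, \<open>K\<^sub>0 = j * j\<close> up to a constant, with
  \<open>j = t powr (\<gamma> - 1)\<close> and \<open>1/2 < \<gamma> < 1\<close>; over the complex numbers \<open>1 + \<mu> J\<^sup>2\<close>, where \<open>J\<close> is convolution
  with \<open>j\<close>, factors through \<open>1 + \<i> \<surd>\<mu> J\<close>, and the numerical range of \<open>J\<close> lies in a sector of half-angle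
  below \<open>\<pi>/2\<close>: up to a constant of modulus one, \<open>t powr (\<gamma> - 1)\<close> is on \<open>t > 0\<close> the mixture of the characters
  \<open>exp (\<i> \<omega> t)\<close>, \<open>\<omega> > 0\<close>, with the positive weight \<open>\<omega> powr (-\<gamma>)\<close>.\<close>

section \<open>Convolution on a bounded interval\<close>

text \<open>The numbers <J z, z> then lie in a fixed half-plane, and after multiplication by \<i>
  and any m \<ge> 0 they stay away from the negative reals, which bounds the inverse of 1 + \<i> m J
  independently of m. For the same reason \<mu> ((K - K0) * v) cannot simply be moved to the
  right-hand side, where its factor \<mu> would survive. Since t * \<kappa> = K0 * (A * \<kappa>),
  it can be put under \<open>K0\<close>, that is, into the unknown y; what remains on the right is
  free of \<mu>. The source \<mu> u(0) K explains the space of the initial value: two powers of the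
  eigenvalue fall on the square of its coefficient. Uniqueness takes a different tool, since a
  solution satisfies its equations only almost everywhere: an absolutely continuous function whose
  derivative is 0 almost everywhere is constant.\<close>

definition conv :: "(real \<Rightarrow> real) \<Rightarrow> (real \<Rightarrow> real) \<Rightarrow> real \<Rightarrow> real" where
  "conv a b t = (LINT s|lborel. indicator {0..t} s * (a (t - s) * b s))"

text \<open>Kernels are integrable and the functions they act on are bounded, so that a convolution
  converges at every point of [0,T] and identities hold pointwise. Measurability is asked for on the
  whole line, since the Fubini arguments run over \<open>lborel\<close>.\<close>

definition L1_upto :: "real \<Rightarrow> (real \<Rightarrow> real) \<Rightarrow> bool" where
  "L1_upto T a \<longleftrightarrow> a \<in> borel_measurable borel \<and> integrable lborel (\<lambda>s. indicator {0..T} s * a s)"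

definition bdd_upto :: "real \<Rightarrow> (real \<Rightarrow> real) \<Rightarrow> bool" where
  "bdd_upto T v \<longleftrightarrow> v \<in> borel_measurable borel \<and> (\<exists>M. \<forall>t\<in>{0..T}. \<bar>v t\<bar> \<le> M)"

definition mass :: "real \<Rightarrow> (real \<Rightarrow> real) \<Rightarrow> real" where
  "mass T a = (LINT s|lborel. indicator {0..T} s * \<bar>a s\<bar>)"

lemma L1_upto_measurable [measurable_dest]: "L1_upto T a \<Longrightarrow> a \<in> borel_measurable borel"
  by (simp add: L1_upto_def)

lemma bdd_upto_measurable [measurable_dest]: "bdd_upto T v \<Longrightarrow> v \<in> borel_measurable borel"
  by (simp add: bdd_upto_def)

lemma bdd_uptoE:
  assumes "bdd_upto T v"
  obtains M where "M \<ge> 0" "\<And>t. t \<in> {0..T} \<Longrightarrow> \<bar>v t\<bar> \<le> M"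
proof -
  obtain M where "\<forall>t\<in>{0..T}. \<bar>v t\<bar> \<le> M"
    using assms unfolding bdd_upto_def by blast
  then show thesis using that[of "max M 0"] by fastforce
qed

lemma L1_upto_abs: "L1_upto T a \<Longrightarrow> L1_upto T (\<lambda>x. \<bar>a x\<bar>)"
  using integrable_abs[of lborel "\<lambda>s. indicator {0..T} s * a s"]
  by (auto simp: L1_upto_def abs_mult)

lemma L1_upto_cmult: "L1_upto T a \<Longrightarrow> L1_upto T (\<lambda>x. c * a x)"
  by (auto simp: L1_upto_def mult.left_commute[of _ c])

lemma L1_upto_add: "L1_upto T a \<Longrightarrow> L1_upto T b \<Longrightarrow> L1_upto T (\<lambda>x. a x + b x)"
  by (auto simp: L1_upto_def distrib_left)

lemma L1_upto_mono:
  assumes "L1_upto T a" "S \<le> T" shows "L1_upto S a"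
proof -
  have "integrable lborel (\<lambda>s. indicator {0..S} s * (indicator {0..T} s * a s))"
    using integrable_mult_indicator[of "{0..S}" lborel "\<lambda>s. indicator {0..T} s * a s"] assms(1)
    by (auto simp: L1_upto_def)
  moreover have "(\<lambda>s. indicator {0..S} s * (indicator {0..T} s * a s)) = (\<lambda>s. indicator {0..S} s * a s)"
    using assms(2) by (auto simp: fun_eq_iff indicator_def)
  ultimately show ?thesis using assms(1) by (simp add: L1_upto_def)
qed

lemma integrable_indicator_Icc_mult:
  fixes v :: "real \<Rightarrow> real"
  assumes [measurable]: "v \<in> borel_measurable borel" and "\<And>t. t \<in> {a..b} \<Longrightarrow> \<bar>v t\<bar> \<le> M"
  shows "integrable lborel (\<lambda>s. indicator {a..b} s * v s)"
proof (rule Bochner_Integration.integrable_bound[of _ "\<lambda>s. indicator {a..b} s * M"])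
  show "integrable lborel (\<lambda>s. indicator {a..b} s * M)"
    by (simp add: integrable_indicator_iff emeasure_lborel_Icc_eq)
  show "AE x in lborel. norm (indicator {a..b} x * v x) \<le> norm (indicator {a..b} x * M)"
    using assms(2) by (intro AE_I2) (fastforce simp: indicator_def)
qed measurable

lemma bdd_upto_imp_L1: "bdd_upto T v \<Longrightarrow> L1_upto T v"
  using bdd_uptoE[of T v] bdd_upto_measurable[of T v] unfolding L1_upto_def
  by (metis integrable_indicator_Icc_mult)

lemma bdd_upto_mult:
  assumes "bdd_upto T v" "bdd_upto T w"
  shows "bdd_upto T (\<lambda>x. v x * w x)"
proof -
  note [measurable] = assms[THEN bdd_upto_measurable]
  obtain M where M: "M \<ge> 0" "\<And>t. t \<in> {0..T} \<Longrightarrow> \<bar>v t\<bar> \<le> M"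
    by (rule bdd_uptoE[OF assms(1)]) blast
  obtain N where N: "N \<ge> 0" "\<And>t. t \<in> {0..T} \<Longrightarrow> \<bar>w t\<bar> \<le> N"
    by (rule bdd_uptoE[OF assms(2)]) blast
  have "\<bar>v t * w t\<bar> \<le> M * N" if "t \<in> {0..T}" for t
    using M N that by (auto simp: abs_mult intro!: mult_mono)
  then show ?thesis unfolding bdd_upto_def by (intro conjI exI ballI) auto
qed

lemma bdd_upto_add:
  assumes "bdd_upto T v" "bdd_upto T w"
  shows "bdd_upto T (\<lambda>x. v x + w x)"
proof -
  note [measurable] = assms[THEN bdd_upto_measurable]
  obtain M where M: "M \<ge> 0" "\<And>t. t \<in> {0..T} \<Longrightarrow> \<bar>v t\<bar> \<le> M"
    by (rule bdd_uptoE[OF assms(1)]) blast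
  obtain N where N: "N \<ge> 0" "\<And>t. t \<in> {0..T} \<Longrightarrow> \<bar>w t\<bar> \<le> N"
    by (rule bdd_uptoE[OF assms(2)]) blast
  have "\<bar>v t + w t\<bar> \<le> M + N" if "t \<in> {0..T}" for t
    using M(2)[OF that] N(2)[OF that] by linarith
  then show ?thesis unfolding bdd_upto_def by (intro conjI exI ballI) auto
qed

lemma bdd_upto_const: "bdd_upto T (\<lambda>x. c)"
  by (auto simp: bdd_upto_def)

lemma bdd_upto_cmult: "bdd_upto T v \<Longrightarrow> bdd_upto T (\<lambda>x. c * v x)"
  by (intro bdd_upto_mult bdd_upto_const)

lemma bdd_upto_abs: "bdd_upto T v \<Longrightarrow> bdd_upto T (\<lambda>x. \<bar>v x\<bar>)"
  by (auto simp: bdd_upto_def)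

lemma bdd_upto_mono: "bdd_upto T v \<Longrightarrow> S \<le> T \<Longrightarrow> bdd_upto S v"
  unfolding bdd_upto_def by (metis atLeastAtMost_iff order_trans)

lemma bdd_upto_continuous:
  assumes "v \<in> borel_measurable borel" "continuous_on {0..T} v"
  shows "bdd_upto T v"
proof -
  have "bounded (v ` {0..T})"
    using assms(2) by (intro compact_imp_bounded compact_continuous_image) auto
  then show ?thesis using assms(1) by (auto simp: bdd_upto_def bounded_iff)
qed

lemma integrable_indicator_reflect:
  assumes "L1_upto T a" "t \<le> T"
  shows "integrable lborel (\<lambda>s. indicator {0..t} s * a (t - s))"
proof -
  have "integrable lborel (\<lambda>s. indicator {0..t} s * a s)"
    using L1_upto_mono[OF assms] by (simp add: L1_upto_def)
  from lborel_integrable_real_affine[OF this, of "-1" t]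
  have "integrable lborel (\<lambda>s. indicator {0..t} (t - s) * a (t - s))" by simp
  then show ?thesis
    by (rule Bochner_Integration.integrable_cong[THEN iffD1, rotated 2]) (auto simp: indicator_def)
qed

text \<open>The reflection s -> t - s. It preserves integrability too, so the equation also covers
  divergent integrals, to which \<open>LINT\<close> assigns 0.\<close>

lemma conv_commute: "conv a b t = conv b a t"
proof -
  have "conv a b t = (LINT s|lborel. indicator {0..t} (t - s) * (a (t - (t - s)) * b (t - s)))"
    unfolding conv_def by (subst lborel_integral_real_affine[of "-1" _ t]) auto
  also have "\<dots> = conv b a t"
    unfolding conv_def by (intro Bochner_Integration.integral_cong) (auto simp: indicator_def)
  finally show ?thesis .
qed

lemma conv_measurable [measurable]:
  assumes [measurable]: "a \<in> borel_measurable borel" "b \<in> borel_measurable borel"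
  shows "conv a b \<in> borel_measurable borel"
proof -
  have "(\<lambda>t. LINT s|lborel. (if 0 \<le> s \<and> s \<le> t then 1 else 0) * (a (t - s) * b s)) \<in> borel_measurable borel"
    by measurable
  then show ?thesis
    by (simp add: conv_def[abs_def] indicator_def)
qed

lemma conv_integrable:
  assumes "L1_upto T a" "bdd_upto T v" "t \<le> T"
  shows "integrable lborel (\<lambda>s. indicator {0..t} s * (a (t - s) * v s))"
proof -
  note [measurable] = L1_upto_measurable[OF assms(1)] bdd_upto_measurable[OF assms(2)]
  obtain M where M: "M \<ge> 0" "\<And>t. t \<in> {0..T} \<Longrightarrow> \<bar>v t\<bar> \<le> M"
    by (rule bdd_uptoE[OF assms(2)]) blast
  show ?thesis
  proof (rule Bochner_Integration.integrable_bound)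
    show "integrable lborel (\<lambda>s. (indicator {0..t} s * a (t - s)) * M)"
      using integrable_indicator_reflect[OF assms(1,3)] by simp
    show "AE s in lborel. norm (indicator {0..t} s * (a (t - s) * v s)) \<le> norm (indicator {0..t} s * a (t - s) * M)"
      using M assms(3) by (intro AE_I2) (auto simp: indicator_def abs_mult intro!: mult_left_mono)
  qed measurable
qed

lemma conv_cong:
  assumes "\<And>s. 0 \<le> s \<Longrightarrow> s \<le> t \<Longrightarrow> a s = a' s" "\<And>s. 0 \<le> s \<Longrightarrow> s \<le> t \<Longrightarrow> b s = b' s"
  shows "conv a b t = conv a' b' t"
  unfolding conv_def using assms by (intro Bochner_Integration.integral_cong) (auto simp: indicator_def)

lemma conv_mono:
  assumes "L1_upto T a" "bdd_upto T v" "bdd_upto T w" "t \<le> T"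
    and "\<And>s. 0 \<le> a s" "\<And>s. s \<in> {0..t} \<Longrightarrow> v s \<le> w s"
  shows "conv a v t \<le> conv a w t"
  unfolding conv_def using assms conv_integrable[of T a _ t]
  by (intro integral_mono) (auto simp: indicator_def intro!: mult_left_mono)

lemma conv_add_right:
  assumes "L1_upto T a" "bdd_upto T v" "bdd_upto T w" "t \<le> T"
  shows "conv a (\<lambda>s. v s + w s) t = conv a v t + conv a w t"
  unfolding conv_def using assms conv_integrable[of T a _ t]
  by (subst Bochner_Integration.integral_add[symmetric]) (auto simp: algebra_simps)

lemma conv_add_left:
  assumes "L1_upto T a" "L1_upto T b" "bdd_upto T v" "t \<le> T"
  shows "conv (\<lambda>s. a s + b s) v t = conv a v t + conv b v t"
  unfolding conv_def using assms conv_integrable[of T _ v t]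
  by (subst Bochner_Integration.integral_add[symmetric]) (auto simp: algebra_simps)

lemma conv_cmult_right: "conv a (\<lambda>s. c * v s) t = c * conv a v t"
  unfolding conv_def by (subst integral_mult_right_zero[symmetric]) (simp add: ac_simps)

lemma conv_cmult_left: "conv (\<lambda>s. c * a s) v t = c * conv a v t"
  unfolding conv_def by (subst integral_mult_right_zero[symmetric]) (simp add: ac_simps)

lemma mass_nonneg: "0 \<le> mass T a"
  unfolding mass_def by (intro Bochner_Integration.integral_nonneg) auto

lemma mass_mono:
  assumes "L1_upto T a" "S \<le> T"
  shows "mass S a \<le> mass T a"
  unfolding mass_def
  using L1_upto_abs[OF assms(1)] L1_upto_abs[OF L1_upto_mono[OF assms]] assms(2)
  by (intro integral_mono) (auto simp: L1_upto_def indicator_def)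

lemma conv_abs_le: 
  assumes "L1_upto T a" "bdd_upto T v" "t \<le> T"
  shows "\<bar>conv a v t\<bar> \<le> conv (\<lambda>x. \<bar>a x\<bar>) (\<lambda>x. \<bar>v x\<bar>) t"
proof -
  have "\<bar>conv a v t\<bar> \<le> (LINT s|lborel. \<bar>indicator {0..t} s * (a (t - s) * v s)\<bar>)"
    unfolding conv_def by (rule integral_abs_bound)
  also have "\<dots> = conv (\<lambda>x. \<bar>a x\<bar>) (\<lambda>x. \<bar>v x\<bar>) t"
    unfolding conv_def by (simp add: abs_mult)
  finally show ?thesis .
qed

lemma conv_one_eq_mass: "conv (\<lambda>x. \<bar>a x\<bar>) (\<lambda>_. 1) t = mass t a"
proof -
  have "conv (\<lambda>x. \<bar>a x\<bar>) (\<lambda>_. 1) t = conv (\<lambda>_. 1) (\<lambda>x. \<bar>a x\<bar>) t" by (rule conv_commute)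
  then show ?thesis by (simp add: conv_def mass_def)
qed

lemma conv_bound:
  assumes "L1_upto T a" "bdd_upto T v" "t \<le> T" "\<And>s. s \<in> {0..t} \<Longrightarrow> \<bar>v s\<bar> \<le> M"
  shows "\<bar>conv a v t\<bar> \<le> M * mass t a"
proof -
  have "\<bar>conv a v t\<bar> \<le> conv (\<lambda>x. \<bar>a x\<bar>) (\<lambda>x. \<bar>v x\<bar>) t"
    by (rule conv_abs_le[OF assms(1-3)])
  also have "\<dots> \<le> conv (\<lambda>x. \<bar>a x\<bar>) (\<lambda>x. M * 1) t"
    using assms by (intro conv_mono[of T]) (auto intro: L1_upto_abs bdd_upto_abs bdd_upto_const)
  also have "\<dots> = M * mass t a" by (simp add: conv_cmult_right conv_one_eq_mass del: mult_1_right)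
  finally show ?thesis .
qed

lemma bdd_upto_conv:
  assumes "L1_upto T a" "bdd_upto T v"
  shows "bdd_upto T (conv a v)"
proof -
  note [measurable] = L1_upto_measurable[OF assms(1)] bdd_upto_measurable[OF assms(2)]
  obtain M where M: "M \<ge> 0" "\<And>t. t \<in> {0..T} \<Longrightarrow> \<bar>v t\<bar> \<le> M"
    by (rule bdd_uptoE[OF assms(2)]) blast
  have "\<bar>conv a v t\<bar> \<le> M * mass T a" if "t \<in> {0..T}" for t
    using conv_bound[OF assms, of t M] M that mult_left_mono[OF mass_mono[OF assms(1), of t] M(1)] by fastforce
  then show ?thesis unfolding bdd_upto_def by (intro conjI exI ballI) auto
qed

text \<open>Fubini on the triangle 0 \<le> r \<le> s \<le> t. Since \<open>a\<close> and
  \<open>b\<close> are only integrable, \<open>conv a b\<close> may diverge at some points; the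
  value 0 that it has there is also that of the corresponding inner integral, so the last rewriting
  holds for every r.\<close>

lemma conv_assoc:
  assumes "L1_upto T a" "L1_upto T b" "bdd_upto T v" "t \<le> T"
  shows "conv a (conv b v) t = conv (conv a b) v t"
proof -
  note [measurable] = L1_upto_measurable[OF assms(1)] L1_upto_measurable[OF assms(2)] bdd_upto_measurable[OF assms(3)]
  obtain M where M: "M \<ge> 0" "\<And>t. t \<in> {0..T} \<Longrightarrow> \<bar>v t\<bar> \<le> M"
    by (rule bdd_uptoE[OF assms(3)]) blast
  define A where "A s = indicator {0..t} s * \<bar>a s\<bar>" for s
  define B where "B s = indicator {0..t} s * \<bar>b s\<bar>" for s
  have [measurable]: "A \<in> borel_measurable borel" "B \<in> borel_measurable borel"
    unfolding A_def B_def by measurable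
  have iA: "integrable lborel A" and iB: "integrable lborel B"
    using L1_upto_abs[OF L1_upto_mono[OF assms(1,4)]] L1_upto_abs[OF L1_upto_mono[OF assms(2,4)]]
    unfolding L1_upto_def A_def[abs_def] B_def[abs_def] by auto
  define F where "F = (\<lambda>(s, r). (if 0 \<le> r \<and> r \<le> s \<and> s \<le> t then a (t - s) * (b (s - r) * v r) else 0))"
  have [measurable]: "F \<in> borel_measurable (lborel \<Otimes>\<^sub>M lborel)"
    unfolding F_def by measurable
  \<comment> \<open>Up to a shear of the plane the majorant is a product of two integrable functions
    of one variable; \<open>M\<close> will take care of the bounded factor \<open>v\<close>.\<close>
  have AB: "integrable (lborel \<Otimes>\<^sub>M lborel) (\<lambda>(s, r). A (t - s) * B (s - r))"
  proof (rule lborel_pair.Fubini_integrable)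
    have "integrable lborel (\<lambda>s. A (t - s))"
      using lborel_integrable_real_affine[OF iA, of "-1" t] by simp
    moreover have "(LINT r|lborel. B (s - r)) = (LINT r|lborel. B r)" for s
      using lborel_integral_real_affine[of "-1" B s] by simp
    ultimately show "integrable lborel (\<lambda>s. LINT r|lborel. norm (case (s, r) of (s, r) \<Rightarrow> A (t - s) * B (s - r)))"
      by (simp add: abs_mult A_def B_def)
    have "integrable lborel (\<lambda>r. B (s - r))" for s
      using lborel_integrable_real_affine[OF iB, of "-1" s] by simp
    then show "AE s in lborel. integrable lborel (\<lambda>r. case (s, r) of (s, r) \<Rightarrow> A (t - s) * B (s - r))"
      by simp
  qed measurable
  have iF: "integrable (lborel \<Otimes>\<^sub>M lborel) F"
  proof (rule Bochner_Integration.integrable_bound)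
    show "integrable (lborel \<Otimes>\<^sub>M lborel) (\<lambda>x. (case x of (s, r) \<Rightarrow> A (t - s) * B (s - r)) * M)"
      using AB by simp
    have "\<bar>a (t - s)\<bar> * (\<bar>b (s - r)\<bar> * \<bar>v r\<bar>) \<le> A (t - s) * B (s - r) * M"
      if "0 \<le> r" "r \<le> s" "s \<le> t" for s r
    proof -
      have "A (t - s) = \<bar>a (t - s)\<bar>" "B (s - r) = \<bar>b (s - r)\<bar>" using that by (auto simp: A_def B_def)
      moreover have "\<bar>v r\<bar> \<le> M" using M(2)[of r] that assms(4) by auto
      ultimately show ?thesis by (simp add: mult_left_mono mult.assoc)
    qed
    then show "AE x in lborel \<Otimes>\<^sub>M lborel. norm (F x) \<le> norm ((case x of (s, r) \<Rightarrow> A (t - s) * B (s - r)) * M)"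
      using M(1) by (intro AE_I2) (auto simp: F_def abs_mult A_def B_def)
  qed measurable
  have "conv a (conv b v) t = (LINT s|lborel. LINT r|lborel. F (s, r))"
    unfolding conv_def[of a "conv b v"]
  proof (intro Bochner_Integration.integral_cong refl)
    fix s :: real
    have "indicator {0..t} s * (a (t - s) * conv b v s) =
       (LINT r|lborel. (indicator {0..t} s * a (t - s)) * (indicator {0..s} r * (b (s - r) * v r)))"
      unfolding conv_def by simp
    also have "\<dots> = (LINT r|lborel. F (s, r))"
      by (intro Bochner_Integration.integral_cong) (auto simp: F_def indicator_def)
    finally show "indicator {0..t} s * (a (t - s) * conv b v s) = (LINT r|lborel. F (s, r))" .
  qed
  also have "\<dots> = (LINT r|lborel. LINT s|lborel. F (s, r))"
    using lborel_pair.Fubini_integral[of "\<lambda>s r. F (s, r)"] iF by simp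
  also have "\<dots> = conv (conv a b) v t"
    unfolding conv_def[of "conv a b" v]
  proof (intro Bochner_Integration.integral_cong refl)
    fix r :: real
    have "(LINT s|lborel. F (s, r)) = (LINT x|lborel. F (r + x, r))"
      using lborel_integral_real_affine[of 1 "\<lambda>s. F (s, r)" r] by simp
    also have "\<dots> = (LINT x|lborel. (indicator {0..t} r * v r) * (indicator {0..t-r} x * (a (t - r - x) * b x)))"
      by (intro Bochner_Integration.integral_cong) (auto simp: F_def indicator_def algebra_simps)
    also have "\<dots> = indicator {0..t} r * (conv a b (t - r) * v r)"
      unfolding conv_def by simp
    finally show "(LINT s|lborel. F (s, r)) = indicator {0..t} r * (conv a b (t - r) * v r)" .
  qed
  finally show ?thesis .
qed

text \<open>\<open>a\<close> may be singular, so the moving argument is put on the continuous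
  factor: the integral is taken as \<open>conv v a\<close> and dominated by a multiple of
  |a|.\<close>

lemma conv_continuous_on:
  assumes a: "L1_upto T a" and v: "v \<in> borel_measurable borel" "continuous_on {0..T} v"
  shows "continuous_on {0..T} (conv a v)"
  unfolding continuous_on_sequentially o_def
proof (intro allI ballI impI, elim conjE)
  fix x t assume t: "t \<in> {0..T}" "\<forall>n. x n \<in> {0..T}" "x \<longlonglongrightarrow> t"
  note [measurable] = L1_upto_measurable[OF a] v(1)
  obtain M where M: "M \<ge> 0" "\<And>t. t \<in> {0..T} \<Longrightarrow> \<bar>v t\<bar> \<le> M"
    by (rule bdd_uptoE[OF bdd_upto_continuous[OF v]]) blast
  have "(\<lambda>n. conv v a (x n)) \<longlonglongrightarrow> conv v a t"
    unfolding conv_def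
  proof (rule integral_dominated_convergence[where w = "\<lambda>s. M * (indicator {0..T} s * \<bar>a s\<bar>)"])
    show "integrable lborel (\<lambda>s. M * (indicator {0..T} s * \<bar>a s\<bar>))"
      using L1_upto_abs[OF a] by (simp add: L1_upto_def)
    \<comment> \<open>At s = t the indicator of {0..x n} need not converge; this single point is
      discarded.\<close>
    have "AE s in lborel. s \<noteq> t" by (rule AE_lborel_singleton)
    then show "AE s in lborel. (\<lambda>n. indicator {0..x n} s * (v (x n - s) * a s)) \<longlonglongrightarrow> indicator {0..t} s * (v (t - s) * a s)"
    proof eventually_elim
      case (elim s)
      consider "s < 0 \<or> t < s" | "0 \<le> s" "s < t" using elim by linarith
      then show ?case
      proof cases
        case 1
        then have "\<forall>\<^sub>F n in sequentially. indicator {0..x n} s * (v (x n - s) * a s) = 0"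
        proof
          assume "t < s"
          from order_tendstoD(2)[OF t(3) this] show ?thesis by eventually_elim (auto simp: indicator_def)
        qed (auto simp: indicator_def)
        moreover have "indicator {0..t} s * (v (t - s) * a s) = 0" using 1 by auto
        ultimately show ?thesis by (simp only: tendsto_eventually)
      next
        case 2
        have ev: "\<forall>\<^sub>F n in sequentially. s < x n" using order_tendstoD(1)[OF t(3) 2(2)] .
        have "(\<lambda>n. v (x n - s)) \<longlonglongrightarrow> v (t - s)"
        proof (rule continuous_on_tendsto_compose[OF v(2)])
          show "(\<lambda>n. x n - s) \<longlonglongrightarrow> t - s" by (intro tendsto_intros t)
          show "t - s \<in> {0..T}" using 2 t by auto
          show "\<forall>\<^sub>F n in sequentially. x n - s \<in> {0..T}"
            using ev proof eventually_elim
              case (elim n)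
              then show ?case using t(2)[rule_format, of n] 2 by auto
            qed
        qed
        then have "(\<lambda>n. v (x n - s) * a s) \<longlonglongrightarrow> v (t - s) * a s" by (intro tendsto_intros)
        moreover have "\<forall>\<^sub>F n in sequentially. v (x n - s) * a s = indicator {0..x n} s * (v (x n - s) * a s)"
          using ev by eventually_elim (use 2 in \<open>auto simp: indicator_def\<close>)
        ultimately show ?thesis using 2 by (auto intro: Lim_transform_eventually)
      qed
    qed
    fix n
    have "\<bar>indicator {0..x n} s * (v (x n - s) * a s)\<bar> \<le> M * (indicator {0..T} s * \<bar>a s\<bar>)" for s
      using t(2)[rule_format, of n] M(1) M(2)[of "x n - s"] by (auto simp: indicator_def abs_mult intro!: mult_right_mono)
    then show "AE s in lborel. norm (indicator {0..x n} s * (v (x n - s) * a s)) \<le> M * (indicator {0..T} s * \<bar>a s\<bar>)"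
      by simp
  qed measurable
  then show "(\<lambda>n. conv a v (x n)) \<longlonglongrightarrow> conv a v t" by (simp add: conv_commute[of a v])
qed


section \<open>Fractional kernels\<close>

text \<open>For nonnegative functions gauge integrability is absolute; this makes the gauge
  integrals of powers available for \<open>lborel\<close>.\<close>

lemma integrable_lborel_of_nonneg:
  fixes f :: "real \<Rightarrow> real"
  assumes [measurable]: "f \<in> borel_measurable borel" "S \<in> sets borel"
    and "\<And>x. x \<in> S \<Longrightarrow> 0 \<le> f x" "f integrable_on S"
  shows "integrable lborel (\<lambda>x. indicator S x * f x)"
proof -
  have "f absolutely_integrable_on S"
    using assms by (intro nonnegative_absolutely_integrable_1) auto
  then show ?thesis
    unfolding set_integrable_def by (subst (asm) integrable_completion) auto
qed

lemma L1_upto_powr: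
  assumes "a > -1" shows "L1_upto T (\<lambda>x. x powr a)"
proof (cases "T \<ge> 0")
  case True
  then show ?thesis using assms
    by (auto simp: L1_upto_def intro!: integrable_lborel_of_nonneg integrable_on_powr_from_0)
qed (auto simp: L1_upto_def)

text \<open>The dilation s -> t s pulls out the power of t and leaves the Beta integral. Up to the
  constant this is the semigroup law of fractional integration.\<close>

lemma conv_powr:
  assumes "a > 0" "b > 0" "t \<ge> 0"
  shows "conv (\<lambda>x. x powr (a - 1)) (\<lambda>x. x powr (b - 1)) t = Beta a b * t powr (a + b - 1)"
proof (cases "t = 0")
  case True
  \<comment> \<open>Here \<open>0 powr x = 0\<close> for every x, so both sides vanish whatever the
    signs of the exponents.\<close>
  then show ?thesis
    by (auto simp: conv_def indicator_def intro!: integral_eq_zero_AE)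
next
  case False
  with assms have t: "t > 0" by simp
  have "conv (\<lambda>x. x powr (a - 1)) (\<lambda>x. x powr (b - 1)) t
     = t * (LINT s|lborel. indicator {0..t} (t * s) * ((t - t * s) powr (a - 1) * (t * s) powr (b - 1)))"
    unfolding conv_def using t by (subst lborel_integral_real_affine[of t _ 0]) auto
  also have "(LINT s|lborel. indicator {0..t} (t * s) * ((t - t * s) powr (a - 1) * (t * s) powr (b - 1)))
     = (LINT s|lborel. t powr (a + b - 2) * (indicator {0..1} s * (s powr (b - 1) * (1 - s) powr (a - 1))))"
  proof (intro Bochner_Integration.integral_cong refl)
    fix s :: real
    have "(t - t * s) powr (a - 1) * (t * s) powr (b - 1) = t powr (a + b - 2) * (s powr (b - 1) * (1 - s) powr (a - 1))"
      if "0 \<le> s" "s \<le> 1"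
    proof -
      have "(t - t * s) powr (a - 1) = t powr (a - 1) * (1 - s) powr (a - 1)"
        using t that by (subst powr_mult[symmetric]) (auto simp: algebra_simps)
      moreover have "(t * s) powr (b - 1) = t powr (b - 1) * s powr (b - 1)"
        using t that by (subst powr_mult) auto
      moreover have "t powr (a + b - 2) = t powr (a - 1) * t powr (b - 1)"
        by (simp flip: powr_add)
      ultimately show ?thesis by simp
    qed
    then show "indicator {0..t} (t * s) * ((t - t * s) powr (a - 1) * (t * s) powr (b - 1)) =
      t powr (a + b - 2) * (indicator {0..1} s * (s powr (b - 1) * (1 - s) powr (a - 1)))"
      using t by (auto simp: indicator_def zero_le_mult_iff)
  qed
  also have "\<dots> = t powr (a + b - 2) * Beta b a"
  proof -
    have "(LINT s|lborel. indicator {0..1} s *\<^sub>R (s powr (b - 1) * (1 - s) powr (a - 1))) = Beta b a"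
      using set_borel_integral_eq_integral(2)[OF integrable_Beta[OF assms(2,1)]]
        integral_unique[OF has_integral_Beta_real[OF assms(2,1)]]
      by (simp add: set_lebesgue_integral_def)
    then show ?thesis by simp
  qed
  also have "t * (t powr (a + b - 2) * Beta b a) = Beta a b * t powr (a + b - 1)"
    using t powr_add[of t 1 "a + b - 2"] by (simp add: Beta_commute)
  finally show ?thesis .
qed

text \<open>For \<phi> = cos and \<phi> = sin these are truncated generalized Fresnel integrals, the
  real and imaginary part of the integral of y powr (-\<gamma>) exp(\<i> y) over y > 0. The full
  integrals converge only conditionally, hence the explicit cut-off.\<close>

definition osc :: "real \<Rightarrow> (real \<Rightarrow> real) \<Rightarrow> real \<Rightarrow> real" where
  "osc \<gamma> \<phi> z = (LINT y|lborel. indicator {0..z} y * (y powr (-\<gamma>) * \<phi> y))"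

lemma L1_upto_mult_bounded:
  assumes "L1_upto T a" and [measurable]: "\<phi> \<in> borel_measurable borel" and "\<And>x. \<bar>\<phi> x\<bar> \<le> M"
  shows "L1_upto T (\<lambda>x. a x * \<phi> x)"
proof -
  note [measurable] = L1_upto_measurable[OF assms(1)]
  have "integrable lborel (\<lambda>s. indicator {0..T} s * (a s * \<phi> s))"
  proof (rule Bochner_Integration.integrable_bound)
    show "integrable lborel (\<lambda>s. M * (indicator {0..T} s * a s))"
      using assms(1) by (simp add: L1_upto_def)
    show "AE x in lborel. norm (indicator {0..T} x * (a x * \<phi> x)) \<le> norm (M * (indicator {0..T} x * a x))"
      using assms(3) by (intro AE_I2) (auto simp: indicator_def abs_mult mult.commute[of _ "\<bar>\<phi> _\<bar>"] intro!: mult_right_mono order_trans[OF assms(3) abs_ge_self])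
  qed measurable
  then show ?thesis by (simp add: L1_upto_def)
qed

lemma osc_split:
  assumes "\<gamma> < 1" and [measurable]: "\<phi> \<in> borel_measurable borel" and "\<And>x. \<bar>\<phi> x\<bar> \<le> 1" "0 \<le> c" "c \<le> z"
  shows "osc \<gamma> \<phi> z = osc \<gamma> \<phi> c + (LINT y:{c..z}|lborel. y powr (-\<gamma>) * \<phi> y)"
proof -
  have L: "L1_upto z (\<lambda>y. y powr (-\<gamma>) * \<phi> y)"
    using assms by (intro L1_upto_mult_bounded L1_upto_powr) auto
  have "set_integrable lborel {0..z} (\<lambda>y. y powr (-\<gamma>) * \<phi> y)"
    using L by (simp add: L1_upto_def set_integrable_def)
  then have *: "set_integrable lborel {0..c} (\<lambda>y. y powr (-\<gamma>) * \<phi> y)" "set_integrable lborel {c..z} (\<lambda>y. y powr (-\<gamma>) * \<phi> y)"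
    using assms by (auto elim!: set_integrable_subset)
  have "(LINT y:{0..c} \<union> {c..z}|lborel. y powr (-\<gamma>) * \<phi> y) = (LINT y:{0..c}|lborel. y powr (-\<gamma>) * \<phi> y) + (LINT y:{c..z}|lborel. y powr (-\<gamma>) * \<phi> y)"
    using * assms AE_lborel_singleton[of c]
    by (intro set_integral_Un_AE) (auto elim: eventually_mono)
  moreover have "{0..c} \<union> {c..z} = {0..z}" using assms by auto
  ultimately show ?thesis by (simp add: osc_def set_lebesgue_integral_def)
qed

text \<open>Integration by parts gains one power of y and so trades oscillation for absolute
  convergence at infinity. The interval [0,c] is kept apart, because y powr (-\<gamma>-1) \<Phi>(y)
  need not be integrable at 0.\<close>

lemma osc_by_parts:
  assumes \<gamma>: "0 < \<gamma>" "\<gamma> < 1" and \<Phi>: "\<And>x. (\<Phi> has_real_derivative \<phi> x) (at x)"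
    and \<phi>: "continuous_on UNIV \<phi>" "\<And>x. \<bar>\<phi> x\<bar> \<le> 1" and c: "0 < c" "c \<le> z"
  shows "osc \<gamma> \<phi> z = osc \<gamma> \<phi> c + (z powr (-\<gamma>) * \<Phi> z - c powr (-\<gamma>) * \<Phi> c) +
     \<gamma> * (LINT y:{c..z}|lborel. y powr (-\<gamma>-1) * \<Phi> y)"
proof -
  have \<Phi>c: "continuous_on S \<Phi>" for S
    using \<Phi> DERIV_continuous_on by (metis DERIV_isCont continuous_at_imp_continuous_on)
  have \<phi>c: "continuous_on S \<phi>" for S using \<phi>(1) continuous_on_subset by blast
  have [measurable]: "\<phi> \<in> borel_measurable borel" using \<phi>(1) by (rule borel_measurable_continuous_onI)
  have i1: "set_integrable lborel {c..z} (\<lambda>y. y powr (-\<gamma>) * \<phi> y)"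
    unfolding set_integrable_def using c
    by (intro borel_integrable_compact continuous_intros \<phi>c) auto
  have i2: "set_integrable lborel {c..z} (\<lambda>y. y powr (-\<gamma>-1) * \<Phi> y)"
    unfolding set_integrable_def using c
    by (intro borel_integrable_compact continuous_intros \<Phi>c) auto
  have i3: "set_integrable lborel {c..z} (\<lambda>y. \<gamma> * (y powr (-\<gamma>-1) * \<Phi> y))"
    using i2 by (rule set_integrable_mult_right)
  have "(LINT y:{c..z}|lborel. y powr (-\<gamma>) * \<phi> y - \<gamma> * (y powr (-\<gamma>-1) * \<Phi> y))
      = z powr (-\<gamma>) * \<Phi> z - c powr (-\<gamma>) * \<Phi> c"
    unfolding set_lebesgue_integral_def
  proof (rule integral_FTC_atLeastAtMost)
    show "((\<lambda>y. y powr (-\<gamma>) * \<Phi> y) has_vector_derivative y powr (-\<gamma>) * \<phi> y - \<gamma> * (y powr (-\<gamma>-1) * \<Phi> y)) (at y within {c..z})"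
      if "c \<le> y" for y
    proof -
      have "((\<lambda>y. y powr (-\<gamma>)) has_real_derivative -\<gamma> * y powr (-\<gamma>-1)) (at y within {c..z})"
        using c that by (intro DERIV_subset[OF has_real_derivative_powr]) auto
      from DERIV_mult[OF this DERIV_subset[OF \<Phi>]] show ?thesis
        unfolding has_real_derivative_iff_has_vector_derivative[symmetric] by (simp add: algebra_simps)
    qed
    show "continuous_on {c..z} (\<lambda>y. y powr (-\<gamma>) * \<phi> y - \<gamma> * (y powr (-\<gamma>-1) * \<Phi> y))"
      using c by (intro continuous_intros \<phi>c \<Phi>c) auto
  qed (use c in auto)
  moreover have "(LINT y:{c..z}|lborel. y powr (-\<gamma>) * \<phi> y - \<gamma> * (y powr (-\<gamma>-1) * \<Phi> y))
    = (LINT y:{c..z}|lborel. y powr (-\<gamma>) * \<phi> y) - \<gamma> * (LINT y:{c..z}|lborel. y powr (-\<gamma>-1) * \<Phi> y)"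
    using set_integral_diff(2)[OF i1 i3] by simp
  ultimately show ?thesis using osc_split[of \<gamma> \<phi> c z] \<gamma> \<phi>(2) c by simp
qed

lemma integrable_powr_tail:
  assumes "\<gamma> > 0"
  shows "integrable lborel (\<lambda>y::real. indicator {1..} y * y powr (-\<gamma>-1))"
  using has_integral_powr_to_inf[of "-\<gamma>-1" 1] assms
  by (intro integrable_lborel_of_nonneg) (auto simp: integrable_on_def)

text \<open>With c = 1 in \<open>osc_by_parts\<close> the boundary term at z tends to 0 and the
  remaining integrand is dominated by y powr (-\<gamma>-1). The bound uniform in z later provides
  the majorant when the frequency cut-off is removed.\<close>

lemma osc_converges:
  assumes \<gamma>: "0 < \<gamma>" "\<gamma> < 1" and \<Phi>: "\<And>x. (\<Phi> has_real_derivative \<phi> x) (at x)"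
    and \<phi>: "continuous_on UNIV \<phi>" "\<And>x. \<bar>\<phi> x\<bar> \<le> 1" and \<Phi>b: "\<And>x. \<bar>\<Phi> x\<bar> \<le> 1"
  shows "\<exists>L M. (osc \<gamma> \<phi> \<longlongrightarrow> L) at_top \<and> (\<forall>z. \<bar>osc \<gamma> \<phi> z\<bar> \<le> M)"
proof -
  have \<Phi>c: "continuous_on S \<Phi>" for S
    using \<Phi> DERIV_continuous_on by (metis DERIV_isCont continuous_at_imp_continuous_on)
  have [measurable]: "\<phi> \<in> borel_measurable borel" "\<Phi> \<in> borel_measurable borel"
    using \<phi>(1) \<Phi>c by (auto intro: borel_measurable_continuous_onI)
  define h where "h y = indicator {1..} y * (y powr (-\<gamma>-1) * \<Phi> y)" for y :: real
  have tail: "integrable lborel (\<lambda>y::real. indicator {1..} y * y powr (-\<gamma>-1))"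
    by (rule integrable_powr_tail[OF \<gamma>(1)])
  have ih: "integrable lborel h" unfolding h_def[abs_def]
    using \<Phi>b by (intro Bochner_Integration.integrable_bound[OF tail])
      (auto simp: indicator_def abs_mult intro!: mult_left_le)
  define H where "H z = (LINT y|lborel. indicator {..z} y *\<^sub>R h y)" for z
  have Hlim: "(H \<longlongrightarrow> integral\<^sup>L lborel h) at_top"
    unfolding H_def by (intro tendsto_integral_at_top ih) auto
  have eq: "osc \<gamma> \<phi> z = osc \<gamma> \<phi> 1 + (z powr (-\<gamma>) * \<Phi> z - \<Phi> 1) + \<gamma> * H z" if "z \<ge> 1" for z
  proof -
    have "(LINT y:{1..z}|lborel. y powr (-\<gamma>-1) * \<Phi> y) = H z"
      unfolding H_def set_lebesgue_integral_def
      by (intro Bochner_Integration.integral_cong) (auto simp: h_def indicator_def)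
    then show ?thesis using osc_by_parts[OF \<gamma> \<Phi> \<phi>, of 1 z] that by simp
  qed
  have z0: "((\<lambda>z. z powr (-\<gamma>)) \<longlongrightarrow> 0) at_top"
    by (rule tendsto_neg_powr) (use \<gamma> in \<open>auto intro: filterlim_ident\<close>)
  have "((\<lambda>z. z powr (-\<gamma>) * \<Phi> z) \<longlongrightarrow> 0) at_top"
  proof (rule tendsto_rabs_zero_cancel, rule real_tendsto_sandwich[OF _ _ tendsto_const z0])
    show "\<forall>\<^sub>F z in at_top. \<bar>z powr (-\<gamma>) * \<Phi> z\<bar> \<le> z powr (-\<gamma>)"
      using \<Phi>b by (auto simp: abs_mult intro!: always_eventually mult_left_le)
  qed auto
  then have "((\<lambda>z. osc \<gamma> \<phi> 1 + (z powr (-\<gamma>) * \<Phi> z - \<Phi> 1) + \<gamma> * H z) \<longlongrightarrow>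
      osc \<gamma> \<phi> 1 + (0 - \<Phi> 1) + \<gamma> * integral\<^sup>L lborel h) at_top"
    by (intro tendsto_intros Hlim)
  then have lim: "(osc \<gamma> \<phi> \<longlongrightarrow> osc \<gamma> \<phi> 1 + (0 - \<Phi> 1) + \<gamma> * integral\<^sup>L lborel h) at_top"
    by (rule Lim_transform_eventually) (intro eventually_mono[OF eventually_ge_at_top[of 1]] eq[symmetric])
  have Hb: "\<bar>H z\<bar> \<le> (LINT y|lborel. \<bar>h y\<bar>)" for z
  proof -
    have "\<bar>H z\<bar> \<le> (LINT y|lborel. \<bar>indicator {..z} y *\<^sub>R h y\<bar>)" unfolding H_def by (rule integral_abs_bound)
    also have "\<dots> \<le> (LINT y|lborel. \<bar>h y\<bar>)"
    proof (rule integral_mono)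
      show "integrable lborel (\<lambda>y. \<bar>indicator {..z} y *\<^sub>R h y\<bar>)"
        using ih by (intro integrable_abs integrable_mult_indicator) auto
    qed (use ih in \<open>auto simp: indicator_def\<close>)
    finally show ?thesis .
  qed
  define N where "N = mass 1 (\<lambda>y. y powr (-\<gamma>) * \<phi> y)"
  have small: "\<bar>osc \<gamma> \<phi> z\<bar> \<le> N" if "z \<le> 1" for z
  proof -
    have L: "L1_upto 1 (\<lambda>y. y powr (-\<gamma>) * \<phi> y)"
      using \<gamma> \<phi> by (intro L1_upto_mult_bounded L1_upto_powr) auto
    have "\<bar>osc \<gamma> \<phi> z\<bar> \<le> (LINT y|lborel. \<bar>indicator {0..z} y * (y powr (-\<gamma>) * \<phi> y)\<bar>)"
      unfolding osc_def by (rule integral_abs_bound)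
    also have "\<dots> = mass z (\<lambda>y. y powr (-\<gamma>) * \<phi> y)" by (simp add: mass_def abs_mult)
    also have "\<dots> \<le> N" unfolding N_def by (rule mass_mono[OF L that])
    finally show ?thesis .
  qed
  have "\<bar>osc \<gamma> \<phi> z\<bar> \<le> N + 2 + \<gamma> * (LINT y|lborel. \<bar>h y\<bar>)" for z
  proof (cases "z \<le> 1")
    case True
    have "0 \<le> \<gamma> * (LINT y|lborel. \<bar>h y\<bar>)" using \<gamma> by simp
    then show ?thesis using small[OF True] by linarith
  next
    case False
    then have z: "z \<ge> 1" by simp
    have "z powr (-\<gamma>) \<le> z powr 0" using z \<gamma> by (intro powr_mono) auto
    then have "\<bar>z powr (-\<gamma>) * \<Phi> z\<bar> \<le> 1" using \<Phi>b[of z] z by (simp add: abs_mult mult_le_one)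
    moreover have "\<bar>\<gamma> * H z\<bar> \<le> \<gamma> * (LINT y|lborel. \<bar>h y\<bar>)" using Hb[of z] \<gamma> by (simp add: abs_mult)
    ultimately show ?thesis using eq[OF z] small[of 1] \<Phi>b[of 1] by simp
  qed
  with lim show ?thesis by blast
qed

lemma one_minus_cos_le: "1 - cos x \<le> x\<^sup>2 / 2" for x :: real
proof -
  have "1 - cos x = 2 * (sin (x/2))\<^sup>2" using cos_double_sin[of "x/2"] by simp
  also have "(sin (x/2))\<^sup>2 \<le> (x/2)\<^sup>2" using abs_sin_x_le_abs_x[of "x/2"] by (simp only: abs_le_square_iff)
  finally show ?thesis by (simp add: power2_eq_square field_simps)
qed

text \<open>With the antiderivative 1 - cos, nonnegative and vanishing to second order at 0,
  integration by parts from e to z leaves nonnegative terms apart from one boundary term of size at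
  most e. Strict positivity of this limit is what keeps the half-angle of the sector strictly below
  \<pi>/2.\<close>

lemma osc_sin_limit_pos:
  assumes \<gamma>: "0 < \<gamma>" "\<gamma> < 1" and L: "(osc \<gamma> sin \<longlongrightarrow> L) at_top"
  shows "0 < L"
proof -
  define h where "h y = y powr (-\<gamma>-1) * (1 - cos y)" for y :: real
  have hnn: "h y \<ge> 0" for y by (simp add: h_def)
  have hc: "continuous_on {c..z} h" if "0 < c" for c z
    unfolding h_def using that by (intro continuous_intros) auto
  have hi: "set_integrable lborel {c..z} h" if "0 < c" for c z
    unfolding set_integrable_def by (intro borel_integrable_compact hc that) auto
  \<comment> \<open>A portion of the remaining integral that is positive and independent of e and z:
    on [1,2] the integrand is bounded below by a positive constant.\<close>
  define d where "d = (LINT y:{1..2}|lborel. h y)"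
  have dpos: "d > 0"
  proof -
    have h1: "h y \<ge> 2 powr (-\<gamma>-1) * (1 - cos 1)" if "y \<in> {1..2}" for y
      unfolding h_def
    proof (intro mult_mono)
      show "2 powr (-\<gamma>-1) \<le> y powr (-\<gamma>-1)" using that \<gamma> by (intro powr_mono2') auto
      show "1 - cos 1 \<le> 1 - cos y" using that pi_gt3 by (auto intro!: cos_monotone_0_pi_le)
    qed auto
    have "(LINT y:{1..2::real}|lborel. 2 powr (-\<gamma>-1) * (1 - cos 1)) \<le> d"
      unfolding d_def using h1 hi[of 1 2] by (intro set_integral_mono) (auto simp: set_integrable_def integrable_indicator_iff)
    moreover have "(LINT y:{1..2::real}|lborel. 2 powr (-\<gamma>-1) * (1 - cos 1)) = 2 powr (-\<gamma>-1) * (1 - cos 1)"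
      by (simp add: set_lebesgue_integral_def)
    moreover have "cos (1::real) < 1" using cos_monotone_0_pi[of 0 1] pi_gt3 by simp
    then have "0 < 2 powr (-\<gamma>-1) * (1 - cos (1::real))" by simp
    ultimately show ?thesis by linarith
  qed
  have key: "osc \<gamma> sin z \<ge> \<gamma> * d - e" if e: "0 < e" "e < 1" and z: "z \<ge> 2" for e z
  proof -
    have D: "((\<lambda>x. 1 - cos x) has_real_derivative sin x) (at x)" for x :: real
      by (auto intro!: derivative_eq_intros)
    have "osc \<gamma> sin z = osc \<gamma> sin e + (z powr (-\<gamma>) * (1 - cos z) - e powr (-\<gamma>) * (1 - cos e)) +
        \<gamma> * (LINT y:{e..z}|lborel. h y)"
      unfolding h_def using e z \<gamma> by (intro osc_by_parts[OF \<gamma> D]) (auto intro: continuous_intros)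
    moreover have "osc \<gamma> sin e \<ge> 0"
      unfolding osc_def using e pi_gt3
      by (intro Bochner_Integration.integral_nonneg) (auto simp: indicator_def intro!: mult_nonneg_nonneg sin_ge_zero)
    moreover have "0 \<le> z powr (-\<gamma>) * (1 - cos z)" by simp
    moreover have "e powr (-\<gamma>) * (1 - cos e) \<le> e"
    proof -
      have "1 - cos e \<le> e\<^sup>2" using one_minus_cos_le[of e] by (rule order_trans) simp
      then have "e powr (-\<gamma>) * (1 - cos e) \<le> e powr (-\<gamma>) * e powr 2" using e by (intro mult_left_mono) auto
      also have "\<dots> = e powr (2 - \<gamma>)" by (simp flip: powr_add)
      also have "\<dots> \<le> e powr 1" using e \<gamma> by (intro powr_mono') auto
      finally show ?thesis using e by simp
    qed
    moreover have "d \<le> (LINT y:{e..z}|lborel. h y)"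
      unfolding d_def set_lebesgue_integral_def
      using hi[of 1 2] hi[of e z] e z hnn unfolding set_integrable_def
      by (intro integral_mono) (auto simp: indicator_def)
    then have "\<gamma> * d \<le> \<gamma> * (LINT y:{e..z}|lborel. h y)" using \<gamma> by simp
    ultimately show ?thesis by linarith
  qed
  \<comment> \<open>Half of \<gamma> d absorbs the boundary term; the bound 1/2 secures the
    condition e < 1 of \<open>key\<close>.\<close>
  define e where "e = min (1/2) (\<gamma> * d / 2)"
  have e: "0 < e" "e < 1" "e \<le> \<gamma> * d / 2" using \<gamma> dpos by (auto simp: e_def min_def)
  have "\<gamma> * d - e \<le> L"
    by (rule tendsto_lowerbound[OF L]) (auto intro!: eventually_mono[OF eventually_ge_at_top[of 2]] key e)
  moreover have "0 < \<gamma> * d" using \<gamma> dpos by simp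
  ultimately show ?thesis using e by linarith
qed

text \<open>The substitution y = \<omega> x. As R grows it exhibits x powr (\<gamma> - 1), up to a
  constant, as a mixture of the oscillations \<phi>(\<omega> x) with weight \<omega> powr
  (-\<gamma>).\<close>

lemma osc_scale:
  assumes "\<gamma> < 1" "x > 0" "R \<ge> 0"
  shows "(LINT \<omega>|lborel. indicator {0..R} \<omega> * (\<omega> powr (-\<gamma>) * \<phi> (\<omega> * x))) = x powr (\<gamma> - 1) * osc \<gamma> \<phi> (R * x)"
proof -
  have "osc \<gamma> \<phi> (R * x) = x * (LINT \<omega>|lborel. indicator {0..R*x} (x * \<omega>) * ((x * \<omega>) powr (-\<gamma>) * \<phi> (x * \<omega>)))"
    unfolding osc_def using assms by (subst lborel_integral_real_affine[of x _ 0]) auto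
  also have "(LINT \<omega>|lborel. indicator {0..R*x} (x * \<omega>) * ((x * \<omega>) powr (-\<gamma>) * \<phi> (x * \<omega>)))
     = (LINT \<omega>|lborel. x powr (-\<gamma>) * (indicator {0..R} \<omega> * (\<omega> powr (-\<gamma>) * \<phi> (\<omega> * x))))"
    using assms by (intro Bochner_Integration.integral_cong) (auto simp: indicator_def powr_mult zero_le_mult_iff mult_ac)
  also have "x * \<dots> = x powr (1 - \<gamma>) * (LINT \<omega>|lborel. indicator {0..R} \<omega> * (\<omega> powr (-\<gamma>) * \<phi> (\<omega> * x)))"
    using assms powr_add[of x 1 "-\<gamma>"] by simp
  also have "x powr (\<gamma> - 1) * \<dots> = (LINT \<omega>|lborel. indicator {0..R} \<omega> * (\<omega> powr (-\<gamma>) * \<phi> (\<omega> * x)))"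
    using assms by (simp flip: mult.assoc powr_add)
  finally show ?thesis by simp
qed

lemma integrable_pair_mult:
  fixes f :: "'a \<Rightarrow> real" and g :: "'b \<Rightarrow> real"
  assumes "pair_sigma_finite M N" and f: "integrable M f" and g: "integrable N g"
  shows "integrable (M \<Otimes>\<^sub>M N) (\<lambda>(x, y). f x * g y)"
proof -
  interpret pair_sigma_finite M N by fact
  note [measurable] = borel_measurable_integrable[OF f] borel_measurable_integrable[OF g]
  show ?thesis
    by (rule Fubini_integrable) (use f g in \<open>auto simp: abs_mult\<close>)
qed

lemma AE_pair_neq: "AE z in lborel \<Otimes>\<^sub>M lborel. fst z \<noteq> (snd z :: real)"
proof (rule lborel_pair.AE_pair_measure)
  have "AE r in lborel. s \<noteq> r" for s :: real
    using AE_lborel_singleton[of s] by eventually_elim auto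
  then show "AE s in lborel. AE r in lborel. fst (s, r) \<noteq> (snd (s, r) :: real)"
    by simp
qed measurable

text \<open>The square of the modulus of \<open>\<integral> (p + \<i> q) exp (- \<i> \<omega> s) ds\<close> is integrated against
  \<open>\<omega> powr (-\<gamma>)\<close> over \<open>0 < \<omega> < R\<close>, and \<open>R\<close> tends to infinity. The double integral over
  \<open>(s, r)\<close> is symmetric; \<open>\<theta>\<close> selects the half \<open>r < s\<close>, on which it becomes a convolution.\<close>

lemma fractional_kernel_positive_type:
  assumes \<gamma>: "0 < \<gamma>" "\<gamma> < 1" and p: "bdd_upto t p" and q: "bdd_upto t q"
    and c1: "(osc \<gamma> cos \<longlongrightarrow> c1) at_top" and c2: "(osc \<gamma> sin \<longlongrightarrow> c2) at_top"
    and cb: "\<And>z. \<bar>osc \<gamma> cos z\<bar> \<le> K" and sb: "\<And>z. \<bar>osc \<gamma> sin z\<bar> \<le> K"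
  defines "j \<equiv> (\<lambda>x. x powr (\<gamma> - 1))"
  shows "0 \<le> c1 * (LINT s|lborel. indicator {0..t} s * (p s * conv j p s + q s * conv j q s)) +
             c2 * (LINT s|lborel. indicator {0..t} s * (q s * conv j p s - p s * conv j q s))"
proof -
  interpret lborel_triple: pair_sigma_finite "lborel :: real measure" "lborel \<Otimes>\<^sub>M lborel :: (real \<times> real) measure" ..
  note [measurable] = p[THEN bdd_upto_measurable] q[THEN bdd_upto_measurable]
  obtain M1 where M1: "M1 \<ge> 0" "\<And>s. s \<in> {0..t} \<Longrightarrow> \<bar>p s\<bar> \<le> M1"
    by (rule bdd_uptoE[OF p]) blast
  obtain M2 where M2: "M2 \<ge> 0" "\<And>s. s \<in> {0..t} \<Longrightarrow> \<bar>q s\<bar> \<le> M2"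
    by (rule bdd_uptoE[OF q]) blast
  define M where "M = max M1 M2"
  define P where "P s = indicator {0..t} s * p s" for s
  define Q where "Q s = indicator {0..t} s * q s" for s
  define I :: "real \<Rightarrow> real" where "I s = indicator {0..t} s" for s
  have [measurable]: "P \<in> borel_measurable borel" "Q \<in> borel_measurable borel" "I \<in> borel_measurable borel"
    unfolding P_def Q_def I_def by measurable
  have M: "M \<ge> 0" and PM: "\<bar>P s\<bar> \<le> M * I s" and QM: "\<bar>Q s\<bar> \<le> M * I s" for s
    using M1(1) M1(2)[of s] M2(1) M2(2)[of s] by (auto simp: P_def Q_def I_def M_def indicator_def)
  have I01: "0 \<le> I s" "I s \<le> 1" for s by (auto simp: I_def indicator_def)
  have iI: "integrable lborel I" by (simp add: I_def[abs_def] integrable_indicator_iff emeasure_lborel_Icc_eq)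
  \<comment> \<open>\<open>A\<close> and \<open>B\<close> are the real and imaginary part of the
    product of P + \<i> Q at s with its conjugate at r.\<close>
  define A where "A = (\<lambda>(s, r). P s * P r + Q s * Q r)"
  define B where "B = (\<lambda>(s, r). Q s * P r - P s * Q r)"
  have [measurable]: "A \<in> borel_measurable (lborel \<Otimes>\<^sub>M lborel)" "B \<in> borel_measurable (lborel \<Otimes>\<^sub>M lborel)"
    unfolding A_def B_def by measurable
  have bound2: "\<bar>u s * v r\<bar> \<le> M\<^sup>2 * (I s * I r)" if "\<And>s. \<bar>u s\<bar> \<le> M * I s" "\<And>s. \<bar>v s\<bar> \<le> M * I s" for u v :: "real \<Rightarrow> real" and s r
  proof -
    have "\<bar>u s\<bar> * \<bar>v r\<bar> \<le> (M * I s) * (M * I r)" using that M I01 by (intro mult_mono) auto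
    then show ?thesis by (simp add: abs_mult power2_eq_square mult_ac)
  qed
  have AM: "\<bar>A z\<bar> \<le> 2 * M\<^sup>2 * (I (fst z) * I (snd z))" for z
  proof (cases z)
    case (Pair s r)
    show ?thesis using bound2[OF PM PM, of s r] bound2[OF QM QM, of s r] unfolding A_def Pair by simp
  qed
  have BM: "\<bar>B z\<bar> \<le> 2 * M\<^sup>2 * (I (fst z) * I (snd z))" for z
  proof (cases z)
    case (Pair s r)
    show ?thesis using bound2[OF QM PM, of s r] bound2[OF PM QM, of s r] unfolding B_def Pair by simp
  qed
  \<comment> \<open>The real part of (A + \<i> B) exp(- \<i> \<omega> (s - r)).\<close>
  define H where "H \<omega> z = A z * cos (\<omega> * (fst z - snd z)) + B z * sin (\<omega> * (fst z - snd z))" for \<omega> z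
  have [measurable]: "(\<lambda>(\<omega>, z). H \<omega> z) \<in> borel_measurable (lborel \<Otimes>\<^sub>M (lborel \<Otimes>\<^sub>M lborel))"
    unfolding H_def by measurable
  have HM: "\<bar>H \<omega> z\<bar> \<le> 4 * M\<^sup>2 * (I (fst z) * I (snd z))" for \<omega> z
  proof -
    have "\<bar>A z * cos (\<omega> * (fst z - snd z))\<bar> \<le> \<bar>A z\<bar>" "\<bar>B z * sin (\<omega> * (fst z - snd z))\<bar> \<le> \<bar>B z\<bar>"
      by (auto simp: abs_mult intro!: mult_left_le)
    then show ?thesis using AM[of z] BM[of z] unfolding H_def by linarith
  qed
  have iII: "integrable (lborel \<Otimes>\<^sub>M lborel) (\<lambda>z. I (fst z) * I (snd z))"
    using integrable_pair_mult[OF lborel_pair.pair_sigma_finite_axioms iI iI] by (simp only: case_prod_unfold)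
  have iH: "integrable (lborel \<Otimes>\<^sub>M lborel) (H \<omega>)" for \<omega>
  proof (rule Bochner_Integration.integrable_bound[OF integrable_mult_right[OF iII, of "4 * M\<^sup>2"]])
    show "H \<omega> \<in> borel_measurable (lborel \<Otimes>\<^sub>M lborel)" unfolding H_def by measurable
  qed (use HM I01 in auto)
  define \<theta> :: "real \<times> real \<Rightarrow> real" where "\<theta> z = (if snd z < fst z then 1 else 0)" for z
  have [measurable]: "\<theta> \<in> borel_measurable (lborel \<Otimes>\<^sub>M lborel)"
    unfolding \<theta>_def by measurable
  have \<theta>01: "0 \<le> \<theta> z" "\<theta> z \<le> 1" for z by (auto simp: \<theta>_def)
  have i\<theta>H: "integrable (lborel \<Otimes>\<^sub>M lborel) (\<lambda>z. \<theta> z * H \<omega> z)" for \<omega>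
  proof (rule Bochner_Integration.integrable_bound[OF iH[of \<omega>]])
    show "(\<lambda>z. \<theta> z * H \<omega> z) \<in> borel_measurable (lborel \<Otimes>\<^sub>M lborel)" unfolding H_def by measurable
  qed (auto simp: \<theta>_def)
  have Hnn: "0 \<le> (LINT z|(lborel \<Otimes>\<^sub>M lborel). \<theta> z * H \<omega> z)" for \<omega>
  proof -
    have ib: "integrable lborel (\<lambda>s. u s * v s)" if "\<And>s. \<bar>u s\<bar> \<le> M * I s" "\<And>s. \<bar>v s\<bar> \<le> (1::real)"
      and [measurable]: "u \<in> borel_measurable borel" "v \<in> borel_measurable borel" for u v
    proof (rule Bochner_Integration.integrable_bound[OF integrable_mult_right[OF iI, of M]])
      have "\<bar>u s\<bar> * \<bar>v s\<bar> \<le> M * I s" for s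
        using mult_mono[OF that(1)[of s] that(2)[of s]] M I01 by simp
      then show "AE x in lborel. norm (u x * v x) \<le> norm (M * I x)" using M I01 by (simp add: abs_mult)
    qed measurable
    have "(LINT z|(lborel \<Otimes>\<^sub>M lborel). H \<omega> z) = (LINT s|lborel. LINT r|lborel. H \<omega> (s, r))"
      using lborel_pair.integral_fst'[OF iH] by simp
    \<comment> \<open>The factors are the real and imaginary part of (P + \<i> Q) exp(- \<i>
      \<omega> s), so the double integral becomes a sum of two squares.\<close>
    also have "\<dots> = (LINT s|lborel. (P s * cos (\<omega> * s) + Q s * sin (\<omega> * s)) * (LINT r|lborel. P r * cos (\<omega> * r) + Q r * sin (\<omega> * r))
       + (Q s * cos (\<omega> * s) - P s * sin (\<omega> * s)) * (LINT r|lborel. Q r * cos (\<omega> * r) - P r * sin (\<omega> * r)))"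
    proof (intro Bochner_Integration.integral_cong refl)
      fix s
      have "H \<omega> (s, r) = (P s * cos (\<omega> * s) + Q s * sin (\<omega> * s)) * (P r * cos (\<omega> * r) + Q r * sin (\<omega> * r))
       + (Q s * cos (\<omega> * s) - P s * sin (\<omega> * s)) * (Q r * cos (\<omega> * r) - P r * sin (\<omega> * r))" for r
        unfolding H_def A_def B_def by (simp add: cos_diff sin_diff right_diff_distrib) (simp add: algebra_simps)
      moreover have "integrable lborel (\<lambda>r. P r * cos (\<omega> * r) + Q r * sin (\<omega> * r))"
        "integrable lborel (\<lambda>r. Q r * cos (\<omega> * r) - P r * sin (\<omega> * r))"
        using PM QM by (auto intro!: Bochner_Integration.integrable_add Bochner_Integration.integrable_diff ib)
      ultimately show "(LINT r|lborel. H \<omega> (s, r)) =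
        (P s * cos (\<omega> * s) + Q s * sin (\<omega> * s)) * (LINT r|lborel. P r * cos (\<omega> * r) + Q r * sin (\<omega> * r))
       + (Q s * cos (\<omega> * s) - P s * sin (\<omega> * s)) * (LINT r|lborel. Q r * cos (\<omega> * r) - P r * sin (\<omega> * r))"
        by (simp del: Bochner_Integration.integral_add Bochner_Integration.integral_diff add: Bochner_Integration.integral_add[OF integrable_mult_right integrable_mult_right])
    qed
    also have "\<dots> = (LINT r|lborel. P r * cos (\<omega> * r) + Q r * sin (\<omega> * r))\<^sup>2 + (LINT r|lborel. Q r * cos (\<omega> * r) - P r * sin (\<omega> * r))\<^sup>2"
    proof -
      have "integrable lborel (\<lambda>r. P r * cos (\<omega> * r) + Q r * sin (\<omega> * r))"
        "integrable lborel (\<lambda>r. Q r * cos (\<omega> * r) - P r * sin (\<omega> * r))"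
        using PM QM by (auto intro!: Bochner_Integration.integrable_add Bochner_Integration.integrable_diff ib)
      then show ?thesis
        by (simp del: Bochner_Integration.integral_add Bochner_Integration.integral_diff
          add: power2_eq_square Bochner_Integration.integral_add[OF integrable_mult_left integrable_mult_left])
    qed
    finally have "0 \<le> (LINT z|(lborel \<Otimes>\<^sub>M lborel). H \<omega> z)" by simp
    \<comment> \<open>Off the null diagonal \<theta> selects exactly one of (s, r) and (r, s), and
      \<open>H\<close> has the same value at both; the full integral is therefore twice the one over
      the half.\<close>
    also have "\<dots> = (LINT z|(lborel \<Otimes>\<^sub>M lborel). \<theta> z * H \<omega> z + (case z of (x, y) \<Rightarrow> \<theta> (y, x) * H \<omega> (y, x)))"
    proof (rule integral_cong_AE)
      show "H \<omega> \<in> borel_measurable (lborel \<Otimes>\<^sub>M lborel)" using iH by blast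
      show "(\<lambda>z. \<theta> z * H \<omega> z + (case z of (x, y) \<Rightarrow> \<theta> (y, x) * H \<omega> (y, x))) \<in> borel_measurable (lborel \<Otimes>\<^sub>M lborel)"
        unfolding H_def by measurable
      show "AE z in lborel \<Otimes>\<^sub>M lborel. H \<omega> z = \<theta> z * H \<omega> z + (case z of (x, y) \<Rightarrow> \<theta> (y, x) * H \<omega> (y, x))"
        using AE_pair_neq
      proof eventually_elim
        case (elim z)
        obtain s r where z: "z = (s, r)" by (cases z)
        have "sin (\<omega> * (r - s)) = - sin (\<omega> * (s - r))" "cos (\<omega> * (r - s)) = cos (\<omega> * (s - r))"
          using sin_minus[of "\<omega> * (s - r)"] cos_minus[of "\<omega> * (s - r)"] by (simp_all add: algebra_simps)
        then have "H \<omega> (r, s) = H \<omega> (s, r)" by (simp add: H_def A_def B_def algebra_simps)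
        then show ?case using elim by (auto simp: z \<theta>_def)
      qed
    qed
    also have "\<dots> = (LINT z|(lborel \<Otimes>\<^sub>M lborel). \<theta> z * H \<omega> z) + (LINT z|(lborel \<Otimes>\<^sub>M lborel). (case z of (x, y) \<Rightarrow> \<theta> (y, x) * H \<omega> (y, x)))"
      using i\<theta>H lborel_pair.integrable_product_swap[OF i\<theta>H] by (intro Bochner_Integration.integral_add)
    also have "(LINT z|(lborel \<Otimes>\<^sub>M lborel). (case z of (x, y) \<Rightarrow> \<theta> (y, x) * H \<omega> (y, x))) = (LINT z|(lborel \<Otimes>\<^sub>M lborel). \<theta> z * H \<omega> z)"
      using lborel_pair.integral_product_swap[OF borel_measurable_integrable[OF i\<theta>H[of \<omega>]]] by simp
    finally show ?thesis by simp
  qed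
  \<comment> \<open>The integral of \<omega> powr (-\<gamma>) \<theta> H over 0 \<le> \<omega> \<le>
    R, evaluated by \<open>osc_scale\<close> at x = s - r > 0.\<close>
  define W where "W R z = \<theta> z * ((fst z - snd z) powr (\<gamma> - 1) * (A z * osc \<gamma> cos (R * (fst z - snd z)) + B z * osc \<gamma> sin (R * (fst z - snd z))))" for R z
  have Wnn: "0 \<le> (LINT z|(lborel \<Otimes>\<^sub>M lborel). W R z)" if R: "R \<ge> 0" for R
  proof -
    define \<mu> where "\<mu> \<omega> = indicator {0..R} \<omega> * \<omega> powr (-\<gamma>)" for \<omega>
    have i\<mu>: "integrable lborel \<mu>" using L1_upto_powr[of "-\<gamma>" R] \<gamma> by (simp add: L1_upto_def \<mu>_def[abs_def])
    have [measurable]: "\<mu> \<in> borel_measurable borel" unfolding \<mu>_def by measurable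
    have \<mu>nn: "0 \<le> \<mu> \<omega>" for \<omega> by (simp add: \<mu>_def)
    have iF: "integrable (lborel \<Otimes>\<^sub>M (lborel \<Otimes>\<^sub>M lborel)) (\<lambda>(\<omega>, z). \<mu> \<omega> * (\<theta> z * H \<omega> z))"
    proof (rule Bochner_Integration.integrable_bound)
      show "integrable (lborel \<Otimes>\<^sub>M (lborel \<Otimes>\<^sub>M lborel)) (\<lambda>(\<omega>, z). \<mu> \<omega> * (4 * M\<^sup>2 * (I (fst z) * I (snd z))))"
        using lborel_triple.pair_sigma_finite_axioms i\<mu> iII by (intro integrable_pair_mult) auto
      have "\<bar>\<mu> \<omega> * (\<theta> z * H \<omega> z)\<bar> \<le> \<mu> \<omega> * (4 * M\<^sup>2 * (I (fst z) * I (snd z)))" for \<omega> z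
      proof -
        have "\<bar>\<theta> z * H \<omega> z\<bar> \<le> \<bar>H \<omega> z\<bar>" by (simp add: \<theta>_def)
        then have "\<bar>\<theta> z * H \<omega> z\<bar> \<le> 4 * M\<^sup>2 * (I (fst z) * I (snd z))" using HM order_trans by blast
        then show ?thesis using \<mu>nn[of \<omega>] by (simp add: abs_mult[of "\<mu> \<omega>"] mult_left_mono)
      qed
      then show "AE x in lborel \<Otimes>\<^sub>M (lborel \<Otimes>\<^sub>M lborel). norm (case x of (\<omega>, z) \<Rightarrow> \<mu> \<omega> * (\<theta> z * H \<omega> z))
        \<le> norm (case x of (\<omega>, z) \<Rightarrow> \<mu> \<omega> * (4 * M\<^sup>2 * (I (fst z) * I (snd z))))"
        by (intro AE_I2) (auto split: prod.split intro: order_trans[OF _ abs_ge_self])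
    qed measurable
    have "0 \<le> (LINT \<omega>|lborel. \<mu> \<omega> * (LINT z|(lborel \<Otimes>\<^sub>M lborel). \<theta> z * H \<omega> z))"
      using Hnn \<mu>nn by (intro Bochner_Integration.integral_nonneg) auto
    also have "\<dots> = (LINT \<omega>|lborel. LINT z|(lborel \<Otimes>\<^sub>M lborel). \<mu> \<omega> * (\<theta> z * H \<omega> z))" by simp
    also have "\<dots> = (LINT z|(lborel \<Otimes>\<^sub>M lborel). LINT \<omega>|lborel. \<mu> \<omega> * (\<theta> z * H \<omega> z))"
      using lborel_triple.Fubini_integral[OF iF] by simp
    also have "\<dots> = (LINT z|(lborel \<Otimes>\<^sub>M lborel). W R z)"
    proof (intro Bochner_Integration.integral_cong refl)
      fix z :: "real \<times> real"
      define x where "x = fst z - snd z"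
      show "(LINT \<omega>|lborel. \<mu> \<omega> * (\<theta> z * H \<omega> z)) = W R z"
      proof (cases "snd z < fst z")
        case True
        then have x: "x > 0" by (simp add: x_def)
        have L: "integrable lborel (\<lambda>\<omega>. indicator {0..R} \<omega> * (\<omega> powr (-\<gamma>) * \<phi> (\<omega> * x)))"
          if "\<phi> = cos \<or> \<phi> = sin" for \<phi> :: "real \<Rightarrow> real"
        proof -
          have "L1_upto R (\<lambda>\<omega>. \<omega> powr (-\<gamma>) * \<phi> (\<omega> * x))"
            using that \<gamma> by (intro L1_upto_mult_bounded[of _ _ _ 1] L1_upto_powr) auto
          then show ?thesis by (simp add: L1_upto_def)
        qed
        have "(LINT \<omega>|lborel. \<mu> \<omega> * (\<theta> z * H \<omega> z)) = (LINT \<omega>|lborel.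
            A z * (indicator {0..R} \<omega> * (\<omega> powr (-\<gamma>) * cos (\<omega> * x))) + B z * (indicator {0..R} \<omega> * (\<omega> powr (-\<gamma>) * sin (\<omega> * x))))"
          using True by (intro Bochner_Integration.integral_cong) (auto simp: \<mu>_def \<theta>_def H_def x_def algebra_simps)
        also have "\<dots> = A z * (x powr (\<gamma> - 1) * osc \<gamma> cos (R * x)) + B z * (x powr (\<gamma> - 1) * osc \<gamma> sin (R * x))"
          using L by (subst Bochner_Integration.integral_add) (auto simp: osc_scale[OF \<gamma>(2) x R])
        finally show ?thesis using True by (simp add: W_def \<theta>_def x_def algebra_simps)
      qed (simp add: \<theta>_def W_def)
    qed
    finally show ?thesis .
  qed
  \<comment> \<open>The common majorant for all cut-offs: a weakly singular kernel on the triangle,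
    integrable because \<gamma> - 1 > -1.\<close>
  define N where "N z = \<theta> z * (I (fst z) * I (snd z)) * (fst z - snd z) powr (\<gamma> - 1)" for z
  have iN: "integrable (lborel \<Otimes>\<^sub>M lborel) N"
  proof -
    have L: "L1_upto t (\<lambda>x. x powr (\<gamma> - 1))" using \<gamma> by (intro L1_upto_powr) auto
    have "integrable lborel (\<lambda>x. indicator {0..t} x * x powr (\<gamma> - 1))" using L by (simp add: L1_upto_def)
    note ij = this
    have "integrable (lborel \<Otimes>\<^sub>M lborel) (\<lambda>(s, r). I s * (indicator {0..t} (s - r) * (s - r) powr (\<gamma> - 1)))"
    proof (rule lborel_pair.Fubini_integrable)
      have "(LINT r|lborel. indicator {0..t} (s - r) * (s - r) powr (\<gamma> - 1)) = (LINT r|lborel. indicator {0..t} r * r powr (\<gamma> - 1))" for s :: real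
        using lborel_integral_real_affine[of "-1" "\<lambda>r. indicator {0..t} r * r powr (\<gamma> - 1)" s] by simp
      then show "integrable lborel (\<lambda>s. LINT r|lborel. norm (case (s, r) of (s, r) \<Rightarrow> I s * (indicator {0..t} (s - r) * (s - r) powr (\<gamma> - 1))))"
        using iI I01 by (simp add: abs_mult)
      have "integrable lborel (\<lambda>r. indicator {0..t} (s - r) * (s - r) powr (\<gamma> - 1))" for s
        using lborel_integrable_real_affine[OF ij, of "-1" s] by simp
      then show "AE s in lborel. integrable lborel (\<lambda>r. case (s, r) of (s, r) \<Rightarrow> I s * (indicator {0..t} (s - r) * (s - r) powr (\<gamma> - 1)))"
        by simp
    qed measurable
    then show ?thesis
    proof (rule Bochner_Integration.integrable_bound)
      show "N \<in> borel_measurable (lborel \<Otimes>\<^sub>M lborel)" unfolding N_def by measurable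
      show "AE z in lborel \<Otimes>\<^sub>M lborel. norm (N z) \<le> norm (case z of (s, r) \<Rightarrow> I s * (indicator {0..t} (s - r) * (s - r) powr (\<gamma> - 1)))"
        by (intro AE_I2) (auto simp: N_def \<theta>_def I_def indicator_def split: prod.split)
    qed
  qed
  \<comment> \<open>The pointwise limit of \<open>W R\<close>. The frequency is gone, and
    integrating over r gives convolutions with \<open>j\<close>.\<close>
  define Z where "Z z = \<theta> z * ((fst z - snd z) powr (\<gamma> - 1) * (A z * c1 + B z * c2))" for z
  have ocm: "osc \<gamma> \<phi> \<in> borel_measurable borel" if [measurable]: "\<phi> \<in> borel_measurable borel" for \<phi>
  proof -
    have "(\<lambda>t. LINT s|lborel. (if 0 \<le> s \<and> s \<le> t then 1 else 0) * (s powr (-\<gamma>) * \<phi> s)) \<in> borel_measurable borel"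
      by measurable
    then show ?thesis by (simp add: osc_def[abs_def] indicator_def)
  qed
  have [measurable]: "osc \<gamma> cos \<in> borel_measurable borel" "osc \<gamma> sin \<in> borel_measurable borel"
    by (auto intro!: ocm)
  have K0: "K \<ge> 0" using cb[of 0] by linarith
  have "(\<lambda>n. LINT z|(lborel \<Otimes>\<^sub>M lborel). W (real n) z) \<longlonglongrightarrow> (LINT z|(lborel \<Otimes>\<^sub>M lborel). Z z)"
  proof (rule integral_dominated_convergence[where w = "\<lambda>z. 4 * M\<^sup>2 * K * N z"])
    show "integrable (lborel \<Otimes>\<^sub>M lborel) (\<lambda>z. 4 * M\<^sup>2 * K * N z)" using iN by simp
    show "AE z in lborel \<Otimes>\<^sub>M lborel. (\<lambda>n. W (real n) z) \<longlonglongrightarrow> Z z"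
    proof (intro AE_I2)
      fix z :: "real \<times> real"
      show "(\<lambda>n. W (real n) z) \<longlonglongrightarrow> Z z"
      proof (cases "snd z < fst z")
        case True
        then have "filterlim (\<lambda>n. real n * (fst z - snd z)) at_top sequentially"
          by (intro filterlim_at_top_mult_tendsto_pos[OF tendsto_const] filterlim_real_sequentially) auto
        from filterlim_compose[OF c1 this] filterlim_compose[OF c2 this]
        show ?thesis unfolding W_def Z_def by (intro tendsto_intros)
      qed (simp add: W_def Z_def \<theta>_def)
    qed
    show "AE z in lborel \<Otimes>\<^sub>M lborel. norm (W (real n) z) \<le> 4 * M\<^sup>2 * K * N z" for n
    proof (intro AE_I2)
      fix z :: "real \<times> real"
      let ?x = "fst z - snd z"
      have "\<bar>A z * osc \<gamma> cos (real n * ?x)\<bar> \<le> (2 * M\<^sup>2 * (I (fst z) * I (snd z))) * K"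
        unfolding abs_mult using AM[of z] cb[of "real n * ?x"] I01 by (intro mult_mono) auto
      moreover have "\<bar>B z * osc \<gamma> sin (real n * ?x)\<bar> \<le> (2 * M\<^sup>2 * (I (fst z) * I (snd z))) * K"
        unfolding abs_mult using BM[of z] sb[of "real n * ?x"] I01 by (intro mult_mono) auto
      ultimately have "\<bar>A z * osc \<gamma> cos (real n * ?x) + B z * osc \<gamma> sin (real n * ?x)\<bar> \<le> 4 * M\<^sup>2 * K * (I (fst z) * I (snd z))"
        by (simp add: algebra_simps)
      then have "\<theta> z * (?x powr (\<gamma> - 1) * \<bar>A z * osc \<gamma> cos (real n * ?x) + B z * osc \<gamma> sin (real n * ?x)\<bar>)
         \<le> \<theta> z * (?x powr (\<gamma> - 1) * (4 * M\<^sup>2 * K * (I (fst z) * I (snd z))))"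
        using \<theta>01 by (intro mult_left_mono) auto
      then show "norm (W (real n) z) \<le> 4 * M\<^sup>2 * K * N z"
        using \<theta>01[of z] by (simp add: W_def N_def abs_mult mult_ac)
    qed
  qed (unfold W_def Z_def, measurable)
  then have Znn: "0 \<le> (LINT z|(lborel \<Otimes>\<^sub>M lborel). Z z)"
    by (rule tendsto_lowerbound) (auto intro!: always_eventually Wnn)
  have iZ: "integrable (lborel \<Otimes>\<^sub>M lborel) Z"
  proof (rule Bochner_Integration.integrable_bound)
    show "integrable (lborel \<Otimes>\<^sub>M lborel) (\<lambda>z. 2 * M\<^sup>2 * (\<bar>c1\<bar> + \<bar>c2\<bar>) * N z)" using iN by simp
    show "Z \<in> borel_measurable (lborel \<Otimes>\<^sub>M lborel)" unfolding Z_def by measurable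
    show "AE z in lborel \<Otimes>\<^sub>M lborel. norm (Z z) \<le> norm (2 * M\<^sup>2 * (\<bar>c1\<bar> + \<bar>c2\<bar>) * N z)"
    proof (intro AE_I2)
      fix z :: "real \<times> real"
      let ?x = "fst z - snd z"
      have "\<bar>A z * c1\<bar> \<le> (2 * M\<^sup>2 * (I (fst z) * I (snd z))) * \<bar>c1\<bar>" "\<bar>B z * c2\<bar> \<le> (2 * M\<^sup>2 * (I (fst z) * I (snd z))) * \<bar>c2\<bar>"
        unfolding abs_mult using AM[of z] BM[of z] by (auto intro!: mult_right_mono)
      then have "\<bar>A z * c1 + B z * c2\<bar> \<le> 2 * M\<^sup>2 * (\<bar>c1\<bar> + \<bar>c2\<bar>) * (I (fst z) * I (snd z))"
        by (simp add: algebra_simps)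
      then have "\<theta> z * (?x powr (\<gamma> - 1) * \<bar>A z * c1 + B z * c2\<bar>)
         \<le> \<theta> z * (?x powr (\<gamma> - 1) * (2 * M\<^sup>2 * (\<bar>c1\<bar> + \<bar>c2\<bar>) * (I (fst z) * I (snd z))))"
        using \<theta>01 by (intro mult_left_mono) auto
      also have "\<dots> \<le> norm (2 * M\<^sup>2 * (\<bar>c1\<bar> + \<bar>c2\<bar>) * N z)"
        by (simp add: N_def mult_ac)
      finally show "norm (Z z) \<le> norm (2 * M\<^sup>2 * (\<bar>c1\<bar> + \<bar>c2\<bar>) * N z)"
        using \<theta>01[of z] by (simp add: Z_def abs_mult)
    qed
  qed
  have jL: "L1_upto t j" unfolding j_def using \<gamma> by (intro L1_upto_powr) auto
  note [measurable] = L1_upto_measurable[OF jL]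
  have inner: "(LINT r|lborel. Z (s, r)) = c1 * (indicator {0..t} s * (p s * conv j p s + q s * conv j q s)) +
             c2 * (indicator {0..t} s * (q s * conv j p s - p s * conv j q s))" for s
  proof (cases "s \<in> {0..t}")
    case True
    have i: "integrable lborel (\<lambda>r. indicator {0..s} r * (j (s - r) * p r))" "integrable lborel (\<lambda>r. indicator {0..s} r * (j (s - r) * q r))"
      using True by (auto intro!: conv_integrable[OF jL] p q)
    have "(LINT r|lborel. Z (s, r)) = (LINT r|lborel. (c1 * p s + c2 * q s) * (indicator {0..s} r * (j (s - r) * p r)) + (c1 * q s - c2 * p s) * (indicator {0..s} r * (j (s - r) * q r)))"
      using True by (intro Bochner_Integration.integral_cong refl)
        (auto simp: Z_def \<theta>_def A_def B_def P_def Q_def j_def indicator_def algebra_simps)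
    also have "\<dots> = (c1 * p s + c2 * q s) * conv j p s + (c1 * q s - c2 * p s) * conv j q s"
      unfolding conv_def using i by (subst Bochner_Integration.integral_add) auto
    finally show ?thesis using True by (simp add: algebra_simps)
  next
    case False
    then have "Z (s, r) = 0" for r by (simp add: Z_def A_def B_def P_def Q_def)
    then show ?thesis using False by simp
  qed
  have bc: "bdd_upto t (conv j p)" "bdd_upto t (conv j q)" by (auto intro!: bdd_upto_conv jL p q)
  have iX: "integrable lborel (\<lambda>s. indicator {0..t} s * (p s * conv j p s + q s * conv j q s))"
    using bdd_upto_imp_L1[OF bdd_upto_add[OF bdd_upto_mult[OF p bc(1)] bdd_upto_mult[OF q bc(2)]]]
    by (simp add: L1_upto_def)
  have iY: "integrable lborel (\<lambda>s. indicator {0..t} s * (q s * conv j p s - p s * conv j q s))"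
    using bdd_upto_imp_L1[OF bdd_upto_add[OF bdd_upto_mult[OF q bc(1)] bdd_upto_cmult[OF bdd_upto_mult[OF p bc(2)], of "-1"]]]
    by (simp add: L1_upto_def)
  have "(LINT z|(lborel \<Otimes>\<^sub>M lborel). Z z) = (LINT s|lborel. LINT r|lborel. Z (s, r))"
    using lborel_pair.integral_fst'[OF iZ] by simp
  also have "\<dots> = c1 * (LINT s|lborel. indicator {0..t} s * (p s * conv j p s + q s * conv j q s)) +
             c2 * (LINT s|lborel. indicator {0..t} s * (q s * conv j p s - p s * conv j q s))"
    unfolding inner using iX iY by (subst Bochner_Integration.integral_add) auto
  finally show ?thesis using Znn by simp
qed


section \<open>Uniform estimates for Volterra equations\<close>

text \<open>The upper end t stays variable, because the estimates are closed by a Gronwall argument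
  in t.\<close>

definition l2sq :: "real \<Rightarrow> (real \<Rightarrow> real) \<Rightarrow> real" where
  "l2sq t v = (LINT s|lborel. indicator {0..t} s * (v s)\<^sup>2)"

lemma bdd_upto_power2: "bdd_upto T v \<Longrightarrow> bdd_upto T (\<lambda>x. (v x)\<^sup>2)"
  using bdd_upto_mult[of T v v] by (simp add: power2_eq_square)

lemma bdd_upto_integrable: "bdd_upto T v \<Longrightarrow> integrable lborel (\<lambda>s. indicator {0..T} s * v s)"
  using bdd_upto_imp_L1 by (auto simp: L1_upto_def)

lemma l2sq_nonneg: "0 \<le> l2sq t v"
  unfolding l2sq_def by (intro Bochner_Integration.integral_nonneg) auto

lemma l2sq_eq_conv: "l2sq t v = conv (\<lambda>_. 1) (\<lambda>s. (v s)\<^sup>2) t"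
  by (simp add: l2sq_def conv_def)

lemma l2sq_cong: "(\<And>s. 0 \<le> s \<Longrightarrow> s \<le> t \<Longrightarrow> v s = w s) \<Longrightarrow> l2sq t v = l2sq t w"
  unfolding l2sq_eq_conv by (intro conv_cong) auto

lemma l2sq_mono_upto:
  assumes "bdd_upto T v" "s \<le> T" shows "l2sq s v \<le> l2sq T v"
  unfolding l2sq_def
  using bdd_upto_integrable[OF bdd_upto_power2[OF assms(1)]]
    bdd_upto_integrable[OF bdd_upto_power2[OF bdd_upto_mono[OF assms]]] assms(2)
  by (intro integral_mono) (auto simp: indicator_def)

lemma l2sq_add_le:
  assumes "bdd_upto T v" "bdd_upto T w"
  shows "l2sq T (\<lambda>x. v x + w x) \<le> 2 * l2sq T v + 2 * l2sq T w"
proof -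
  have "l2sq T (\<lambda>x. v x + w x) \<le> (LINT s|lborel. 2 * (indicator {0..T} s * (v s)\<^sup>2) + 2 * (indicator {0..T} s * (w s)\<^sup>2))"
    unfolding l2sq_def
  proof (rule integral_mono)
    show "integrable lborel (\<lambda>s. indicator {0..T} s * (v s + w s)\<^sup>2)"
      by (intro bdd_upto_integrable bdd_upto_power2 bdd_upto_add assms)
    show "integrable lborel (\<lambda>s. 2 * (indicator {0..T} s * (v s)\<^sup>2) + 2 * (indicator {0..T} s * (w s)\<^sup>2))"
      using assms by (intro Bochner_Integration.integrable_add integrable_mult_right bdd_upto_integrable bdd_upto_power2)
    fix s show "indicator {0..T} s * (v s + w s)\<^sup>2 \<le> 2 * (indicator {0..T} s * (v s)\<^sup>2) + 2 * (indicator {0..T} s * (w s)\<^sup>2)"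
      using sum_squares_bound[of "v s" "w s"] by (auto simp: indicator_def power2_sum)
  qed
  also have "\<dots> = 2 * l2sq T v + 2 * l2sq T w"
    unfolding l2sq_def using assms
    by (subst Bochner_Integration.integral_add) (auto intro!: bdd_upto_integrable bdd_upto_power2)
  finally show ?thesis .
qed

text \<open>Convolving |a| with (|v| - m)^2 gives a quadratic polynomial in m without negative
  values; its value at the minimum is the inequality.\<close>

lemma conv_abs_cauchy_schwarz:
  assumes a: "L1_upto T a" and v: "bdd_upto T v" and t: "t \<le> T"
  shows "(conv a v t)\<^sup>2 \<le> mass t a * conv (\<lambda>x. \<bar>a x\<bar>) (\<lambda>x. (v x)\<^sup>2) t"
proof -
  define b where "b = (\<lambda>x. \<bar>a x\<bar>)"
  define w where "w = (\<lambda>x. \<bar>v x\<bar>)"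
  have b: "L1_upto T b" and w: "bdd_upto T w" unfolding b_def w_def by (intro L1_upto_abs bdd_upto_abs a v)+
  have le: "\<bar>conv a v t\<bar> \<le> conv b w t" unfolding b_def w_def by (rule conv_abs_le[OF a v t])
  have quad: "0 \<le> conv b (\<lambda>x. (v x)\<^sup>2) t + (- 2 * m * conv b w t + m\<^sup>2 * mass t a)" for m
  proof -
    have "0 \<le> conv b (\<lambda>s. (w s - m)\<^sup>2) t"
      unfolding conv_def by (intro Bochner_Integration.integral_nonneg) (auto simp: b_def)
    also have "(\<lambda>s. (w s - m)\<^sup>2) = (\<lambda>s. (v s)\<^sup>2 + ((- 2 * m) * w s + m\<^sup>2 * 1))"
      by (auto simp: w_def power2_eq_square algebra_simps)
    also have "conv b \<dots> t = conv b (\<lambda>x. (v x)\<^sup>2) t + (- 2 * m * conv b w t + m\<^sup>2 * conv b (\<lambda>_. 1) t)"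
    proof -
      have w': "bdd_upto T (\<lambda>s. (- 2 * m) * w s)" and m': "bdd_upto T (\<lambda>s. m\<^sup>2 * 1)"
        by (intro bdd_upto_cmult bdd_upto_const w)+
      show ?thesis
        unfolding conv_add_right[OF b bdd_upto_power2[OF v] bdd_upto_add[OF w' m'] t]
          conv_add_right[OF b w' m' t] conv_cmult_right by (rule refl)
    qed
    finally show ?thesis unfolding b_def conv_one_eq_mass .
  qed
  have wnn: "0 \<le> conv b w t" using le by linarith
  have "(conv b w t)\<^sup>2 \<le> mass t a * conv b (\<lambda>x. (v x)\<^sup>2) t"
  proof (cases "mass t a = 0")
    case True
    obtain M where M: "M \<ge> 0" "\<And>t. t \<in> {0..T} \<Longrightarrow> \<bar>w t\<bar> \<le> M"
      by (rule bdd_uptoE[OF w]) blast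
    have "\<bar>conv b w t\<bar> \<le> M * mass t b" using M t by (intro conv_bound[OF b w t]) auto
    moreover have "mass t b = 0" using True by (simp add: mass_def b_def)
    ultimately show ?thesis using True by simp
  next
    case False
    then have pos: "mass t a > 0" using mass_nonneg[of t a] by linarith
    have "0 \<le> mass t a * (conv b (\<lambda>x. (v x)\<^sup>2) t + (- 2 * (conv b w t / mass t a) * conv b w t + (conv b w t / mass t a)\<^sup>2 * mass t a))"
      using quad[of "conv b w t / mass t a"] pos by simp
    also have "\<dots> = mass t a * conv b (\<lambda>x. (v x)\<^sup>2) t - (conv b w t)\<^sup>2"
      using pos by (simp add: field_simps power2_eq_square)
    finally show ?thesis by simp
  qed
  moreover have "(conv a v t)\<^sup>2 \<le> (conv b w t)\<^sup>2" using power_mono[OF le, of 2] by simp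
  ultimately show ?thesis by (simp add: b_def)
qed

text \<open>Cauchy-Schwarz at each time, then integration in time, which commutes with convolution:
  1 * (|a| * v^2) = |a| * (1 * v^2). Keeping one |a| inside the convolution, instead of its mass,
  leaves a right-hand side fit for Gronwall's lemma.\<close>

lemma l2sq_conv_le:
  assumes a: "L1_upto T a" and v: "bdd_upto T v" and t: "t \<le> T"
  shows "l2sq t (conv a v) \<le> mass T a * conv (\<lambda>x. \<bar>a x\<bar>) (\<lambda>s. l2sq s v) t"
proof -
  have one: "L1_upto T (\<lambda>_. 1)" by (intro bdd_upto_imp_L1 bdd_upto_const)
  have b: "L1_upto T (\<lambda>x. \<bar>a x\<bar>)" by (rule L1_upto_abs[OF a])
  have v2: "bdd_upto T (\<lambda>x. (v x)\<^sup>2)" by (rule bdd_upto_power2[OF v])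
  have "l2sq t (conv a v) \<le> conv (\<lambda>_. 1) (\<lambda>s. mass T a * conv (\<lambda>x. \<bar>a x\<bar>) (\<lambda>x. (v x)\<^sup>2) s) t"
    unfolding l2sq_eq_conv
  proof (rule conv_mono[OF one _ _ t])
    fix s assume s: "s \<in> {0..t}"
    have nn: "0 \<le> conv (\<lambda>x. \<bar>a x\<bar>) (\<lambda>x. (v x)\<^sup>2) s"
      unfolding conv_def by (intro Bochner_Integration.integral_nonneg) auto
    have "(conv a v s)\<^sup>2 \<le> mass s a * conv (\<lambda>x. \<bar>a x\<bar>) (\<lambda>x. (v x)\<^sup>2) s"
      using s t by (intro conv_abs_cauchy_schwarz[OF a v]) auto
    also have "\<dots> \<le> mass T a * conv (\<lambda>x. \<bar>a x\<bar>) (\<lambda>x. (v x)\<^sup>2) s"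
      using s t mass_mono[OF a, of s] nn by (intro mult_right_mono) auto
    finally show "(conv a v s)\<^sup>2 \<le> mass T a * conv (\<lambda>x. \<bar>a x\<bar>) (\<lambda>x. (v x)\<^sup>2) s" .
  qed (intro zero_le_one bdd_upto_power2 bdd_upto_cmult bdd_upto_conv a b v v2)+
  also have "\<dots> = mass T a * conv (\<lambda>_. 1) (conv (\<lambda>x. \<bar>a x\<bar>) (\<lambda>x. (v x)\<^sup>2)) t"
    by (rule conv_cmult_right)
  also have "conv (\<lambda>_. 1) (conv (\<lambda>x. \<bar>a x\<bar>) (\<lambda>x. (v x)\<^sup>2)) t = conv (conv (\<lambda>_. 1) (\<lambda>x. \<bar>a x\<bar>)) (\<lambda>x. (v x)\<^sup>2) t"
    by (rule conv_assoc[OF one b v2 t])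
  also have "conv (\<lambda>_. 1) (\<lambda>x. \<bar>a x\<bar>) = conv (\<lambda>x. \<bar>a x\<bar>) (\<lambda>_. 1)" by (rule ext) (rule conv_commute)
  also have "conv \<dots> (\<lambda>x. (v x)\<^sup>2) t = conv (\<lambda>x. \<bar>a x\<bar>) (conv (\<lambda>_. 1) (\<lambda>x. (v x)\<^sup>2)) t"
    by (rule conv_assoc[OF b one v2 t, symmetric])
  finally show ?thesis by (simp add: l2sq_eq_conv[abs_def])
qed

lemma bdd_upto_l2sq: "bdd_upto T v \<Longrightarrow> bdd_upto T (\<lambda>s. l2sq s v)"
  unfolding l2sq_eq_conv by (intro bdd_upto_conv bdd_upto_imp_L1 bdd_upto_const bdd_upto_power2)

text \<open>\<open>l2sq\<close> grows with its upper end, so the convolution in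
  \<open>l2sq_conv_le\<close> is at most its last value times the mass: Young's inequality.\<close>

lemma l2sq_conv_le_mass:
  assumes a: "L1_upto T a" and v: "bdd_upto T v" and t: "t \<le> T"
  shows "l2sq t (conv a v) \<le> (mass T a)\<^sup>2 * l2sq t v"
proof -
  have "l2sq t (conv a v) \<le> mass T a * conv (\<lambda>x. \<bar>a x\<bar>) (\<lambda>s. l2sq s v) t" by (rule l2sq_conv_le[OF a v t])
  also have "conv (\<lambda>x. \<bar>a x\<bar>) (\<lambda>s. l2sq s v) t \<le> l2sq t v * mass t (\<lambda>x. \<bar>a x\<bar>)"
  proof (rule order_trans[OF abs_ge_self], rule conv_bound[OF L1_upto_abs[OF a] bdd_upto_l2sq[OF v] t])
    show "\<bar>l2sq s v\<bar> \<le> l2sq t v" if "s \<in> {0..t}" for s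
      using l2sq_mono_upto[OF bdd_upto_mono[OF v t], of s] l2sq_nonneg[of s v] that by simp
  qed
  also have "mass t (\<lambda>x. \<bar>a x\<bar>) \<le> mass T a" using mass_mono[OF a t] by (simp add: mass_def)
  finally have "l2sq t (conv a v) \<le> mass T a * (l2sq t v * mass T a)"
    using l2sq_nonneg mass_nonneg by (simp add: mult_left_mono)
  then show ?thesis by (simp add: power2_eq_square mult_ac)
qed

text \<open>\<open>y\<close> and the auxiliary function \<open>q\<close> of the proof are the real and the imaginary part of
  \<open>y - \<i> m (j * y)\<close>, the image of \<open>y\<close> under one of the two factors of \<open>1 + m\<^sup>2 J\<^sup>2\<close>, where \<open>J\<close> is
  convolution with \<open>j\<close>.\<close>

lemma fractional_resolvent_bound:
  assumes \<gamma>: "0 < \<gamma>" "\<gamma> < 1"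
  shows "\<exists>C>0. \<forall>t \<mu> y G. 0 \<le> \<mu> \<longrightarrow> bdd_upto t y \<longrightarrow> bdd_upto t G \<longrightarrow>
     (\<forall>s\<in>{0..t}. y s + \<mu> * conv (\<lambda>x. x powr (2 * \<gamma> - 1)) y s = G s) \<longrightarrow> l2sq t y \<le> C * l2sq t G"
proof -
  have "\<exists>L M. (osc \<gamma> cos \<longlongrightarrow> L) at_top \<and> (\<forall>z. \<bar>osc \<gamma> cos z\<bar> \<le> M)"
    by (rule osc_converges[OF \<gamma>, of sin]) (auto intro!: derivative_eq_intros continuous_intros)
  then obtain c1 K1 where c1: "(osc \<gamma> cos \<longlongrightarrow> c1) at_top" and K1: "\<And>z. \<bar>osc \<gamma> cos z\<bar> \<le> K1"
    by blast
  have "\<exists>L M. (osc \<gamma> sin \<longlongrightarrow> L) at_top \<and> (\<forall>z. \<bar>osc \<gamma> sin z\<bar> \<le> M)"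
    by (rule osc_converges[OF \<gamma>, of "\<lambda>x. - cos x"]) (auto intro!: derivative_eq_intros continuous_intros)
  then obtain c2 K2 where c2: "(osc \<gamma> sin \<longlongrightarrow> c2) at_top" and K2: "\<And>z. \<bar>osc \<gamma> sin z\<bar> \<le> K2"
    by blast
  define K where "K = max K1 K2"
  have Kb: "\<bar>osc \<gamma> cos z\<bar> \<le> K" "\<bar>osc \<gamma> sin z\<bar> \<le> K" for z
    using K1[of z] K2[of z] by (auto simp: K_def)
  have c2pos: "c2 > 0" by (rule osc_sin_limit_pos[OF \<gamma> c2])
  define j :: "real \<Rightarrow> real" where "j = (\<lambda>x. x powr (\<gamma> - 1))"
  define C where "C = (c1\<^sup>2 + c2\<^sup>2) / c2\<^sup>2"
  have Cpos: "C > 0" using c2pos by (auto simp: C_def intro!: divide_pos_pos add_nonneg_pos)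
  show ?thesis
  proof (intro exI[of _ C] conjI Cpos allI impI)
    fix t \<mu> y G
    assume \<mu>: "0 \<le> \<mu>" and y: "bdd_upto t y" and G: "bdd_upto t G"
      and eq: "\<forall>s\<in>{0..t}. y s + \<mu> * conv (\<lambda>x. x powr (2 * \<gamma> - 1)) y s = G s"
    have jL: "L1_upto t j" unfolding j_def using \<gamma> by (intro L1_upto_powr) auto
    have Beta_pos: "Beta \<gamma> \<gamma> > 0" using \<gamma> by (simp add: Beta_def)
    \<comment> \<open>By \<open>conv_powr\<close>, convolving \<open>j\<close> with itself gives
      Beta \<gamma> \<gamma> times x powr (2 \<gamma> - 1); with this scaling \<mu> times that power
      is m^2 (j * j).\<close>
    define m where "m = sqrt (\<mu> / Beta \<gamma> \<gamma>)"
    have m0: "m \<ge> 0" using \<mu> Beta_pos by (simp add: m_def)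
    have m2: "m * m * Beta \<gamma> \<gamma> = \<mu>" using \<mu> Beta_pos by (simp add: m_def)
    define q where "q = (\<lambda>s. - m * conv j y s)"
    have q: "bdd_upto t q" unfolding q_def by (intro bdd_upto_cmult bdd_upto_conv jL y)
    \<comment> \<open>The real part of z + \<i> m J z = G for z = y + \<i> q; the imaginary part is
      the definition of \<open>q\<close>.\<close>
    have jq: "m * conv j q s = y s - G s" if s: "s \<in> {0..t}" for s
    proof -
      have "conv j q s = - m * conv j (conv j y) s" unfolding q_def by (rule conv_cmult_right)
      also have "conv j (conv j y) s = conv (conv j j) y s" using s by (intro conv_assoc[OF jL jL y]) auto
      also have "\<dots> = conv (\<lambda>x. Beta \<gamma> \<gamma> * x powr (2 * \<gamma> - 1)) y s"
        unfolding j_def using \<gamma> by (intro conv_cong) (auto simp: conv_powr)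
      also have "\<dots> = Beta \<gamma> \<gamma> * conv (\<lambda>x. x powr (2 * \<gamma> - 1)) y s" by (rule conv_cmult_left)
      finally have "m * conv j q s = - (m * m * Beta \<gamma> \<gamma>) * conv (\<lambda>x. x powr (2 * \<gamma> - 1)) y s" by simp
      also have "\<dots> = y s - G s" using eq s m2 by (auto simp: algebra_simps)
      finally show ?thesis .
    qed
    define X where "X = (\<lambda>s. y s * conv j y s + q s * conv j q s)"
    define Y where "Y = (\<lambda>s. q s * conv j y s - y s * conv j q s)"
    have bc: "bdd_upto t (conv j y)" "bdd_upto t (conv j q)" by (auto intro!: bdd_upto_conv jL y q)
    have iX: "integrable lborel (\<lambda>s. indicator {0..t} s * X s)"
      unfolding X_def by (intro bdd_upto_integrable bdd_upto_add bdd_upto_mult y q bc)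
    have iY: "integrable lborel (\<lambda>s. indicator {0..t} s * Y s)"
      using bdd_upto_integrable[OF bdd_upto_add[OF bdd_upto_mult[OF q bc(1)] bdd_upto_cmult[OF bdd_upto_mult[OF y bc(2)], of "-1"]]]
      by (simp add: Y_def)
    have iy: "integrable lborel (\<lambda>s. indicator {0..t} s * (y s)\<^sup>2)" and iG: "integrable lborel (\<lambda>s. indicator {0..t} s * (G s)\<^sup>2)"
      by (intro bdd_upto_integrable bdd_upto_power2 y G)+
    have "0 \<le> c1 * (LINT s|lborel. indicator {0..t} s * X s) + c2 * (LINT s|lborel. indicator {0..t} s * Y s)"
      unfolding X_def Y_def j_def by (rule fractional_kernel_positive_type[OF \<gamma> y q c1 c2 Kb])
    then have "0 \<le> m * (c1 * (LINT s|lborel. indicator {0..t} s * X s) + c2 * (LINT s|lborel. indicator {0..t} s * Y s))"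
      using m0 by simp
    also have "\<dots> = (LINT s|lborel. (m * c1) * (indicator {0..t} s * X s) + (m * c2) * (indicator {0..t} s * Y s))"
      using iX iY by (subst Bochner_Integration.integral_add) (auto simp: algebra_simps)
    also have "\<dots> \<le> (LINT s|lborel. (c1\<^sup>2 + c2\<^sup>2) / (2 * c2) * (indicator {0..t} s * (G s)\<^sup>2) + (- c2 / 2) * (indicator {0..t} s * (y s)\<^sup>2))"
    proof (rule integral_mono)
      show "integrable lborel (\<lambda>s. (m * c1) * (indicator {0..t} s * X s) + (m * c2) * (indicator {0..t} s * Y s))"
        using iX iY by simp
      show "integrable lborel (\<lambda>s. (c1\<^sup>2 + c2\<^sup>2) / (2 * c2) * (indicator {0..t} s * (G s)\<^sup>2) + (- c2 / 2) * (indicator {0..t} s * (y s)\<^sup>2))"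
        using iy iG by (intro Bochner_Integration.integrable_add integrable_mult_right)
      fix s
      show "(m * c1) * (indicator {0..t} s * X s) + (m * c2) * (indicator {0..t} s * Y s) \<le>
        (c1\<^sup>2 + c2\<^sup>2) / (2 * c2) * (indicator {0..t} s * (G s)\<^sup>2) + (- c2 / 2) * (indicator {0..t} s * (y s)\<^sup>2)"
      proof (cases "s \<in> {0..t}")
        case True
        have mjy: "m * conv j y s = - q s" by (simp add: q_def)
        have "m * X s = y s * (m * conv j y s) + q s * (m * conv j q s)" by (simp add: X_def algebra_simps)
        then have X': "m * X s = - (q s * G s)" unfolding mjy jq[OF True] by (simp add: algebra_simps)
        have "m * Y s = q s * (m * conv j y s) - y s * (m * conv j q s)" by (simp add: Y_def algebra_simps)
        then have Y': "m * Y s = - (q s)\<^sup>2 - (y s)\<^sup>2 + y s * G s"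
          unfolding mjy jq[OF True] by (simp add: algebra_simps power2_eq_square)
        \<comment> \<open>Tested with z = y + \<i> q, the half-plane condition bounds c2 |z|^2 by a
          term linear in G. The explicit sum of squares absorbs the unknowns and produces the ratio
          in \<open>C\<close>, the square of |c1 + \<i> c2| / c2.\<close>
        have "c1 * (- (q s * G s)) + c2 * (- (q s)\<^sup>2 - (y s)\<^sup>2 + y s * G s)
           \<le> (c1\<^sup>2 + c2\<^sup>2) / (2 * c2) * (G s)\<^sup>2 - c2 / 2 * (y s)\<^sup>2"
        proof -
          have "0 \<le> (c2 * q s + c1 * G s)\<^sup>2 + c2\<^sup>2 * (y s - G s)\<^sup>2 + c2\<^sup>2 * (q s)\<^sup>2" by simp
          also have "\<dots> = 2 * c2 * ((c1\<^sup>2 + c2\<^sup>2) / (2 * c2) * (G s)\<^sup>2 - c2 / 2 * (y s)\<^sup>2 -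
             (c1 * (- (q s * G s)) + c2 * (- (q s)\<^sup>2 - (y s)\<^sup>2 + y s * G s)))"
            using c2pos by (simp add: field_simps power2_eq_square)
          finally show ?thesis using c2pos by (simp add: zero_le_mult_iff)
        qed
        then show ?thesis using True unfolding X'[symmetric] Y'[symmetric] by (simp add: algebra_simps)
      qed simp
    qed
    also have "\<dots> = (c1\<^sup>2 + c2\<^sup>2) / (2 * c2) * l2sq t G + (- c2 / 2) * l2sq t y"
      unfolding l2sq_def using iy iG by (subst Bochner_Integration.integral_add) auto
    finally have "c2 / 2 * l2sq t y \<le> (c1\<^sup>2 + c2\<^sup>2) / (2 * c2) * l2sq t G" by simp
    then show "l2sq t y \<le> C * l2sq t G"
      using c2pos by (simp add: C_def field_simps power2_eq_square)
  qed
qed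

text \<open>Multiplication by the character exp(- n x) respects convolution, and for large n it
  makes the mass of an integrable kernel small. It replaces a subdivision of [0,T] into short
  intervals.\<close>

definition damp :: "nat \<Rightarrow> (real \<Rightarrow> real) \<Rightarrow> real \<Rightarrow> real" where
  "damp n a x = exp (- real n * x) * a x"

lemma damp_measurable [measurable]: "a \<in> borel_measurable borel \<Longrightarrow> damp n a \<in> borel_measurable borel"
  unfolding damp_def by measurable

lemma L1_upto_damp:
  assumes a: "L1_upto T a"
  shows "L1_upto T (damp n a)"
proof -
  note [measurable] = L1_upto_measurable[OF a]
  have ia: "integrable lborel (\<lambda>s. indicator {0..T} s * a s)" using a by (simp add: L1_upto_def)
  show ?thesis
    unfolding L1_upto_def
    by (auto intro!: Bochner_Integration.integrable_bound[OF ia] AE_I2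
       simp: indicator_def damp_def abs_mult intro!: mult_left_le_one_le)
qed

lemma conv_damp: "exp (- real n * s) * conv a v s = conv (damp n a) (damp n v) s"
proof -
  have "exp (- real n * s) * conv a v s = (LINT x|lborel. exp (- real n * s) * (indicator {0..s} x * (a (s - x) * v x)))"
    unfolding conv_def by simp
  also have "\<dots> = conv (damp n a) (damp n v) s"
    unfolding conv_def
  proof (intro Bochner_Integration.integral_cong refl)
    fix x
    have "exp (- real n * s) = exp (- real n * (s - x)) * exp (- real n * x)"
      by (simp add: algebra_simps flip: exp_add)
    then show "exp (- real n * s) * (indicator {0..s} x * (a (s - x) * v x)) = indicator {0..s} x * (damp n a (s - x) * damp n v x)"
      by (simp only: damp_def mult_ac)
  qed
  finally show ?thesis .
qed

text \<open>Dominated convergence: the weight tends to 0 at every s > 0.\<close>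

lemma mass_damp_small:
  assumes a: "L1_upto T a" and e: "e > 0"
  obtains n where "mass T (damp n a) < e"
proof -
  note [measurable] = L1_upto_measurable[OF a]
  have ia: "integrable lborel (\<lambda>s. indicator {0..T} s * \<bar>a s\<bar>)" using L1_upto_abs[OF a] by (simp add: L1_upto_def)
  have "(\<lambda>n. mass T (damp n a)) \<longlonglongrightarrow> (LINT s::real|lborel. (0::real))"
    unfolding mass_def
  proof (rule integral_dominated_convergence[where w = "\<lambda>s. indicator {0..T} s * \<bar>a s\<bar>"])
    show "AE s in lborel. (\<lambda>n. indicator {0..T} s * \<bar>damp n a s\<bar>) \<longlonglongrightarrow> 0"
      using AE_lborel_singleton[of 0]
    proof eventually_elim
      case (elim s)
      show ?case
      proof (cases "s \<in> {0..T}")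
        case True
        then have "s > 0" using elim by auto
        then have "(\<lambda>n. (exp (- s)) ^ n) \<longlonglongrightarrow> 0" by (intro LIMSEQ_realpow_zero) auto
        then have "(\<lambda>n. exp (- real n * s)) \<longlonglongrightarrow> 0" by (simp flip: exp_of_nat_mult)
        from tendsto_mult[OF this tendsto_const[of "\<bar>a s\<bar>"]] show ?thesis
          using True by (simp add: damp_def abs_mult)
      qed simp
    qed
    show "AE s in lborel. norm (indicator {0..T} s * \<bar>damp n a s\<bar>) \<le> indicator {0..T} s * \<bar>a s\<bar>" for n
      by (intro AE_I2) (auto simp: indicator_def damp_def abs_mult intro!: mult_left_le_one_le)
  qed (use ia in auto)
  then have "\<forall>\<^sub>F n in sequentially. mass T (damp n a) < e"
    using e by (intro order_tendstoD(2)) auto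
  then show thesis using that by (auto simp: eventually_sequentially)
qed

text \<open>The kernel may be singular, so a weighted supremum is used: after damping, B times the
  mass is at most 1/2 and the convolution term is absorbed. As the quantifiers record, the constant
  is chosen before A and V.\<close>

lemma gronwall_convolution:
  assumes a: "L1_upto T a" "\<And>x. 0 \<le> a x" and B: "0 \<le> B"
  shows "\<exists>Q\<ge>0. \<forall>A V. 0 \<le> A \<longrightarrow> bdd_upto T V \<longrightarrow> (\<forall>t\<in>{0..T}. 0 \<le> V t \<and> V t \<le> A + B * conv a V t) \<longrightarrow>
     (\<forall>t\<in>{0..T}. V t \<le> Q * A)"
proof -
  define b where "b n = damp n a" for n
  \<comment> \<open>B + 1 in place of B keeps the threshold meaningful for B = 0.\<close>
  have "0 < 1 / (2 * (B + 1))" using B by simp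
  then obtain n where n: "mass T (b n) < 1 / (2 * (B + 1))"
    unfolding b_def by (rule mass_damp_small[OF a(1)])
  have Bm: "B * mass T (b n) \<le> 1 / 2"
  proof -
    have "B * mass T (b n) \<le> (B + 1) * mass T (b n)" using mass_nonneg by (intro mult_right_mono) auto
    also have "\<dots> \<le> (B + 1) * (1 / (2 * (B + 1)))" using n B by (intro mult_left_mono) auto
    also have "\<dots> = 1 / 2"
    proof -
      have half: "x * (1 / (2 * x)) = 1 / 2" if "x > 0" for x :: real using that by simp
      show ?thesis by (rule half) (use B in simp)
    qed
    finally show ?thesis .
  qed
  have bL: "L1_upto T (b n)" unfolding b_def by (rule L1_upto_damp[OF a(1)])
  show ?thesis
  proof (intro exI[of _ "exp (real n * T) * 2"] conjI allI impI ballI)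
    fix A V t assume A: "0 \<le> A" and V: "bdd_upto T V"
      and le: "\<forall>t\<in>{0..T}. 0 \<le> V t \<and> V t \<le> A + B * conv a V t" and t: "t \<in> {0..T}"
    note [measurable] = V[THEN bdd_upto_measurable]
    define W where "W = damp n V"
    have W_eq: "W t = exp (- real n * t) * V t" for t by (simp add: W_def damp_def)
    have ebdd: "bdd_upto T (\<lambda>t. exp (- real n * t))"
      by (intro bdd_upto_continuous continuous_intros) measurable
    have "bdd_upto T (\<lambda>t. exp (- real n * t) * V t)" by (intro bdd_upto_mult ebdd V)
    then have W: "bdd_upto T W" by (simp only: W_def damp_def[abs_def])
    have Wnn: "0 \<le> W s" if "s \<in> {0..T}" for s using le that by (simp add: W_eq)
    \<comment> \<open>Finite because V is bounded, so that S \<le> A + S / 2 can be solved for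
      S.\<close>
    define S where "S = (SUP s\<in>{0..T}. W s)"
    have bdd: "bdd_above (W ` {0..T})"
      using W unfolding bdd_upto_def by (auto simp: bdd_above_def abs_le_iff)
    have WS: "W s \<le> S" if "s \<in> {0..T}" for s unfolding S_def by (rule cSUP_upper[OF that bdd])
    have S0: "S \<ge> 0" using WS[OF t] Wnn[OF t] by linarith
    have "W s \<le> A + S / 2" if s: "s \<in> {0..T}" for s
    proof -
      have cW: "exp (- real n * s) * conv a V s = conv (b n) W s"
        unfolding b_def W_def by (rule conv_damp)
      have "conv (b n) W s \<le> S * mass s (b n)"
        by (rule order_trans[OF abs_ge_self], rule conv_bound[OF bL W]) (use s WS Wnn in auto)
      also have "\<dots> \<le> S * mass T (b n)" using s S0 mass_mono[OF bL, of s] by (intro mult_left_mono) auto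
      finally have "B * conv (b n) W s \<le> S * (B * mass T (b n))"
        using B by (simp add: mult_left_mono mult.left_commute)
      also have "\<dots> \<le> S * (1 / 2)" using Bm S0 by (intro mult_left_mono)
      finally have *: "B * conv (b n) W s \<le> S / 2" by simp
      have "W s \<le> exp (- real n * s) * (A + B * conv a V s)" unfolding W_eq using le s by (intro mult_left_mono) auto
      also have "\<dots> = exp (- real n * s) * A + B * conv (b n) W s" unfolding cW[symmetric] by (simp add: algebra_simps)
      also have "\<dots> \<le> 1 * A + S / 2" using A s * by (intro add_mono mult_right_mono) auto
      finally show ?thesis by simp
    qed
    then have "S \<le> A + S / 2" unfolding S_def using t by (intro cSUP_least) auto
    then have "W t \<le> 2 * A" using WS[OF t] by linarith
    then have "exp (real n * t) * W t \<le> exp (real n * t) * (2 * A)" by (intro mult_left_mono) auto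
    moreover have "exp (real n * t) * W t = V t" by (simp add: W_eq exp_minus)
    moreover have "exp (real n * t) * (2 * A) \<le> exp (real n * T) * (2 * A)"
      using t A by (intro mult_right_mono) (auto intro: mult_left_mono)
    ultimately show "V t \<le> exp (real n * T) * 2 * A" by simp
  qed simp
qed

text \<open>\<open>Q\<close> is fixed before \<nu>, which stands for an eigenvalue: \<nu> enters
  only through \<open>fractional_resolvent_bound\<close>, whose constant is uniform, and the
  perturbation argument involves only \<open>A0\<close> and \<kappa>.\<close>

lemma volterra_uniform_bound:
  assumes a0: "0 < a0" "a0 < 1" and d: "d > 0" and \<kappa>: "L1_upto T \<kappa>"
    and K: "L1_upto T K" "\<And>t. t \<in> {0..T} \<Longrightarrow> K t = d * t powr (1 - a0) + conv (\<lambda>x. x) \<kappa> t"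
  shows "\<exists>Q\<ge>0. \<forall>\<nu> v g. 0 \<le> \<nu> \<longrightarrow> bdd_upto T v \<longrightarrow> bdd_upto T g \<longrightarrow>
     (\<forall>t\<in>{0..T}. v t + \<nu> * conv K v t = g t) \<longrightarrow> l2sq T v \<le> Q * l2sq T g"
proof (cases "T \<ge> 0")
  case False
  then show ?thesis by (auto simp: l2sq_def)
next
  case T: True
  \<comment> \<open>Chosen so that 2 \<gamma> - 1 = 1 - a0, the exponent in
    \<open>K0\<close>.\<close>
  define \<gamma> where "\<gamma> = 1 - a0 / 2"
  have \<gamma>: "0 < \<gamma>" "\<gamma> < 1" using a0 by (auto simp: \<gamma>_def)
  obtain C where C: "C > 0" and Cb: "\<And>t \<mu> y G. 0 \<le> \<mu> \<Longrightarrow> bdd_upto t y \<Longrightarrow> bdd_upto t G \<Longrightarrow>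
     (\<forall>s\<in>{0..t}. y s + \<mu> * conv (\<lambda>x. x powr (2 * \<gamma> - 1)) y s = G s) \<Longrightarrow> l2sq t y \<le> C * l2sq t G"
    using fractional_resolvent_bound[OF \<gamma>] by blast
  define K0 where "K0 = (\<lambda>x. d * x powr (1 - a0))"
  \<comment> \<open>The kernels have orders 2 - a0 and a0, which add up to 2, the order of the
    identity function; the constant cancels \<open>d\<close> and the Beta factor of
    \<open>conv_powr\<close>.\<close>
  define A0 where "A0 = (\<lambda>x. 1 / (d * Beta (2 - a0) a0) * x powr (a0 - 1))"
  have K0L: "L1_upto T K0" unfolding K0_def using a0 by (intro L1_upto_cmult L1_upto_powr) auto
  have A0L: "L1_upto T A0" unfolding A0_def using a0 by (intro L1_upto_cmult L1_upto_powr) auto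
  have Beta_pos: "Beta (2 - a0) a0 > 0" using a0 by (simp add: Beta_def)
  have idL: "L1_upto T (\<lambda>x. x)" by (intro bdd_upto_imp_L1 bdd_upto_continuous continuous_intros) auto
  have K0A0: "conv K0 A0 t = t" if "t \<ge> 0" for t
  proof -
    have "conv K0 A0 t = d * (1 / (d * Beta (2 - a0) a0) * conv (\<lambda>x. x powr ((2 - a0) - 1)) (\<lambda>x. x powr (a0 - 1)) t)"
      unfolding K0_def A0_def conv_cmult_left conv_cmult_right by simp
    also have "conv (\<lambda>x. x powr ((2 - a0) - 1)) (\<lambda>x. x powr (a0 - 1)) t = Beta (2 - a0) a0 * t"
      using a0 that by (subst conv_powr) auto
    finally show ?thesis using d Beta_pos by simp
  qed
  \<comment> \<open>Since v = y - z, the bound 2 |y|^2 + 2 |z|^2 with |y|^2 \<le> C (2 |g|^2 + 2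
    |z|^2) puts 4 C + 2 in front of |z|^2; the other factors come from passing from z to w and from
    w to v.\<close>
  define D where "D = (4 * C + 2) * ((mass T A0)\<^sup>2 * mass T \<kappa>)"
  have D0: "D \<ge> 0" using C mass_nonneg by (auto simp: D_def)
  obtain Q where Q0: "Q \<ge> 0" and Q: "\<And>A V. 0 \<le> A \<Longrightarrow> bdd_upto T V \<Longrightarrow>
      (\<forall>t\<in>{0..T}. 0 \<le> V t \<and> V t \<le> A + D * conv (\<lambda>x. \<bar>\<kappa> x\<bar>) V t) \<Longrightarrow> (\<forall>t\<in>{0..T}. V t \<le> Q * A)"
    using gronwall_convolution[OF L1_upto_abs[OF \<kappa>] _ D0] by auto
  show ?thesis
  proof (intro exI[of _ "Q * (4 * C)"] conjI allI impI)
    show "0 \<le> Q * (4 * C)" using Q0 C by simp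
    fix \<nu> v g assume \<nu>: "0 \<le> \<nu>" and v: "bdd_upto T v" and g: "bdd_upto T g"
      and eq: "\<forall>t\<in>{0..T}. v t + \<nu> * conv K v t = g t"
    define w where "w = conv \<kappa> v"
    define z where "z = conv A0 w"
    define y where "y = (\<lambda>t. v t + z t)"
    have w: "bdd_upto T w" unfolding w_def by (intro bdd_upto_conv \<kappa> v)
    have z: "bdd_upto T z" unfolding z_def by (intro bdd_upto_conv A0L w)
    have y: "bdd_upto T y" unfolding y_def by (intro bdd_upto_add v z)
    have K0y: "conv K0 y t = conv K v t" if t: "t \<in> {0..T}" for t
    proof -
      have tT: "t \<le> T" using t by simp
      have "conv K0 y t = conv K0 v t + conv K0 z t" unfolding y_def by (rule conv_add_right[OF K0L v z tT])
      also have "conv K0 z t = conv (conv K0 A0) w t" unfolding z_def by (rule conv_assoc[OF K0L A0L w tT])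
      also have "\<dots> = conv (\<lambda>x. x) w t" by (intro conv_cong K0A0) auto
      also have "\<dots> = conv (conv (\<lambda>x. x) \<kappa>) v t" unfolding w_def by (rule conv_assoc[OF idL \<kappa> v tT])
      also have "conv K0 v t + \<dots> = conv (\<lambda>s. K0 s + (K s - K0 s)) v t"
      proof -
        have "conv (conv (\<lambda>x. x) \<kappa>) v t = conv (\<lambda>s. K s - K0 s) v t"
          using t by (intro conv_cong) (auto simp: K K0_def)
        moreover have "L1_upto T (\<lambda>s. K s - K0 s)" using L1_upto_add[OF K(1) L1_upto_cmult[OF K0L, of "-1"]] by simp
        ultimately show ?thesis by (simp only: conv_add_left[OF K0L _ v tT])
      qed
      finally show ?thesis by simp
    qed
    have bound: "l2sq t v \<le> 4 * C * l2sq T g + D * conv (\<lambda>x. \<bar>\<kappa> x\<bar>) (\<lambda>s. l2sq s v) t" if t: "t \<in> {0..T}" for t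
    proof -
      have tT: "t \<le> T" using t by simp
      have mt: "bdd_upto t v" "bdd_upto t g" "bdd_upto t z" "bdd_upto t y"
        using v g z y tT bdd_upto_mono by blast+
      have "l2sq t y \<le> C * l2sq t (\<lambda>s. g s + z s)"
      proof (rule Cb)
        show "0 \<le> \<nu> * d" using \<nu> d by simp
        show "\<forall>s\<in>{0..t}. y s + \<nu> * d * conv (\<lambda>x. x powr (2 * \<gamma> - 1)) y s = g s + z s"
        proof
          fix s assume s: "s \<in> {0..t}"
          then have sT: "s \<in> {0..T}" using tT by auto
          have "d * conv (\<lambda>x. x powr (2 * \<gamma> - 1)) y s = conv K0 y s"
            unfolding K0_def conv_cmult_left by (simp add: \<gamma>_def)
          then have "y s + \<nu> * d * conv (\<lambda>x. x powr (2 * \<gamma> - 1)) y s = y s + \<nu> * conv K v s"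
            unfolding K0y[OF sT] mult.assoc by (rule arg_cong)
          then show "y s + \<nu> * d * conv (\<lambda>x. x powr (2 * \<gamma> - 1)) y s = g s + z s"
            using eq[rule_format, OF sT] by (simp only: y_def)
        qed
      qed (use mt in \<open>auto intro: bdd_upto_add\<close>)
      also have "\<dots> \<le> C * (2 * l2sq t g + 2 * l2sq t z)"
        using C mt by (intro mult_left_mono l2sq_add_le) auto
      finally have 1: "l2sq t y \<le> C * (2 * l2sq t g + 2 * l2sq t z)" .
      have "l2sq t v = l2sq t (\<lambda>s. y s + (-1) * z s)" by (simp add: y_def)
      also have "\<dots> \<le> 2 * l2sq t y + 2 * l2sq t (\<lambda>s. (-1) * z s)"
        using mt by (intro l2sq_add_le bdd_upto_cmult)
      also have "l2sq t (\<lambda>s. (-1) * z s) = l2sq t z" by (simp add: l2sq_def)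
      finally have "l2sq t v \<le> 4 * C * l2sq t g + (4 * C + 2) * l2sq t z"
        using 1 by (simp add: algebra_simps)
      also have "\<dots> \<le> 4 * C * l2sq T g + (4 * C + 2) * ((mass T A0)\<^sup>2 * (mass T \<kappa> * conv (\<lambda>x. \<bar>\<kappa> x\<bar>) (\<lambda>s. l2sq s v) t))"
      proof (intro add_mono mult_left_mono)
        show "l2sq t g \<le> l2sq T g" by (rule l2sq_mono_upto[OF g tT])
        have "l2sq t z \<le> (mass T A0)\<^sup>2 * l2sq t w" unfolding z_def by (rule l2sq_conv_le_mass[OF A0L w tT])
        also have "l2sq t w \<le> mass T \<kappa> * conv (\<lambda>x. \<bar>\<kappa> x\<bar>) (\<lambda>s. l2sq s v) t"
          unfolding w_def by (rule l2sq_conv_le[OF \<kappa> v tT])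
        finally show "l2sq t z \<le> (mass T A0)\<^sup>2 * (mass T \<kappa> * conv (\<lambda>x. \<bar>\<kappa> x\<bar>) (\<lambda>s. l2sq s v) t)"
          by (simp add: mult_left_mono)
      qed (use C in auto)
      finally show ?thesis by (simp add: D_def mult.assoc)
    qed
    have "\<forall>t\<in>{0..T}. l2sq t v \<le> Q * (4 * C * l2sq T g)"
      using C l2sq_nonneg bound bdd_upto_l2sq[OF v] by (intro Q) auto
    then show "l2sq T v \<le> Q * (4 * C) * l2sq T g" using T by (simp add: mult.assoc)
  qed
qed

text \<open>Banach's fixed point theorem for the damped equation: with mass below 1/2 the map is a
  contraction on all of [0,T] at once.\<close>

lemma volterra_continuous_solution:
  assumes T: "0 \<le> T" and a: "L1_upto T a" and F: "continuous_on {0..T} F"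
  shows "\<exists>u. u \<in> borel_measurable borel \<and> continuous_on {0..T} u \<and> (\<forall>t\<in>{0..T}. u t + conv a u t = F t)"
proof -
  have "0 < (1/2 :: real)" by simp
  then obtain n where n: "mass T (damp n a) < 1/2" by (rule mass_damp_small[OF a])
  define b where "b = damp n a"
  have b: "L1_upto T b" unfolding b_def by (rule L1_upto_damp[OF a])
  \<comment> \<open>The fixed point lives in the bounded continuous functions on the whole line;
    clamping the argument extends a function from [0,T].\<close>
  define cl where "cl t = max 0 (min T t)" for t
  have cl: "cl t \<in> {0..T}" for t using T by (simp add: cl_def)
  have cl_id: "cl t = t" if "t \<in> {0..T}" for t using that by (simp add: cl_def)
  have clc: "continuous_on UNIV cl" unfolding cl_def by (intro continuous_intros)
  have meas: "apply_bcontfun z \<in> borel_measurable borel" for z :: "real \<Rightarrow>\<^sub>C real"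
    by (intro borel_measurable_continuous_onI) auto
  have bddz: "bdd_upto T (apply_bcontfun z)" for z :: "real \<Rightarrow>\<^sub>C real"
    by (intro bdd_upto_continuous meas) auto
  define G where "G z t = exp (- real n * t) * F t - conv b (apply_bcontfun z) t" for z t
  have G: "continuous_on {0..T} (G z)" for z
    unfolding G_def by (intro continuous_intros F conv_continuous_on[OF b meas]) auto
  have Gcl: "(\<lambda>t. G z (cl t)) \<in> bcontfun" for z
  proof -
    have c: "continuous_on UNIV (\<lambda>t. G z (cl t))"
      by (rule continuous_on_compose2[OF G clc]) (use cl in auto)
    have "bounded (G z ` {0..T})" by (intro compact_imp_bounded compact_continuous_image G) auto
    then obtain B where "\<forall>x\<in>G z ` {0..T}. norm x \<le> B" unfolding bounded_iff by blast
    then show ?thesis using c cl by (intro bcontfun_normI) auto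
  qed
  define \<Phi> where "\<Phi> z = Bcontfun (\<lambda>t. G z (cl t))" for z
  have \<Phi>: "apply_bcontfun (\<Phi> z) t = G z (cl t)" for z t
    unfolding \<Phi>_def using Gcl by (simp add: Bcontfun_inverse)
  have "\<exists>!z. \<Phi> z = z"
  proof (rule banach_fix_type[of "1/2"])
    show "\<forall>z w. dist (\<Phi> z) (\<Phi> w) \<le> 1/2 * dist z w"
    proof (intro allI dist_bound)
      fix z w t
      define s where "s = cl t"
      have s: "s \<in> {0..T}" unfolding s_def by (rule cl)
      have "bdd_upto T (\<lambda>x. apply_bcontfun w x + (-1) * apply_bcontfun z x)" by (intro bdd_upto_add bdd_upto_cmult bddz)
      moreover have "conv b (\<lambda>x. apply_bcontfun w x + (-1) * apply_bcontfun z x) s = conv b (apply_bcontfun w) s + (-1) * conv b (apply_bcontfun z) s"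
        using s conv_add_right[OF b bddz bdd_upto_cmult[OF bddz], of s w "-1" z] by (simp only: conv_cmult_right) simp
      moreover have "\<bar>apply_bcontfun w x + (-1) * apply_bcontfun z x\<bar> \<le> dist z w" for x
        using dist_bounded[of z x w] by (simp add: dist_real_def abs_minus_commute)
      ultimately have "\<bar>conv b (apply_bcontfun w) s + (-1) * conv b (apply_bcontfun z) s\<bar> \<le> dist z w * mass s b"
        using conv_bound[OF b, of "\<lambda>x. apply_bcontfun w x + (-1) * apply_bcontfun z x" s "dist z w"] s by auto
      also have "\<dots> \<le> dist z w * (1/2)"
        using n mass_mono[OF b, of s] s by (intro mult_left_mono) (auto simp: b_def)
      finally show "dist (apply_bcontfun (\<Phi> z) t) (apply_bcontfun (\<Phi> w) t) \<le> 1/2 * dist z w"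
        unfolding \<Phi> G_def s_def[symmetric] by (simp add: dist_real_def)
    qed
  qed auto
  then obtain z where z: "\<Phi> z = z" by blast
  define u where "u t = exp (real n * t) * apply_bcontfun z t" for t
  note [measurable] = meas[of z]
  have zu: "damp n u = apply_bcontfun z" by (rule ext) (simp add: damp_def u_def exp_minus)
  have "u t + conv a u t = F t" if t: "t \<in> {0..T}" for t
  proof -
    have "apply_bcontfun z t = exp (- real n * t) * F t - conv b (apply_bcontfun z) t"
      using \<Phi>[of z t] t by (simp add: z cl_id G_def)
    also have "conv b (apply_bcontfun z) t = exp (- real n * t) * conv a u t"
      unfolding zu[symmetric] b_def by (rule conv_damp[symmetric])
    finally have "exp (real n * t) * apply_bcontfun z t = F t - conv a u t"
      by (simp add: exp_minus field_simps)
    then show ?thesis by (simp add: u_def)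
  qed
  moreover have "u \<in> borel_measurable borel" unfolding u_def by measurable
  moreover have "continuous_on {0..T} u" unfolding u_def by (intro continuous_intros) auto
  ultimately show ?thesis by blast
qed

text \<open>The once integrated equation u + l (K * u) = c + 1 * f is solved for u, where K = k * 1,
  and v is defined as f - l (k * u). Then u = c + 1 * v shows that v is the derivative, and
  inserting this into k * u gives the equation for v alone to which the uniform bound
  applies.\<close>

lemma volterra_mode_solution:
  assumes T: "0 \<le> T" and k: "L1_upto T k" and f: "f \<in> borel_measurable borel" "continuous_on {0..T} f"
  shows "\<exists>u v. u \<in> borel_measurable borel \<and> v \<in> borel_measurable borel \<and>
     continuous_on {0..T} u \<and> continuous_on {0..T} v \<and>
     (\<forall>t\<in>{0..T}. u t = c + conv (\<lambda>_. 1) v t \<and> v t + l * conv k u t = f t \<and>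
        v t + l * conv (conv k (\<lambda>_. 1)) v t = f t - l * c * conv k (\<lambda>_. 1) t)"
proof -
  have one: "L1_upto T (\<lambda>_. 1)" by (intro bdd_upto_imp_L1 bdd_upto_const)
  define K where "K = conv k (\<lambda>_. 1)"
  have K: "L1_upto T K" unfolding K_def by (intro bdd_upto_imp_L1 bdd_upto_conv k bdd_upto_const)
  have "continuous_on {0..T} (\<lambda>t. c + conv (\<lambda>_. 1) f t)"
    by (intro continuous_intros conv_continuous_on one f)
  then obtain u where u: "u \<in> borel_measurable borel" "continuous_on {0..T} u"
    and equ: "\<And>t. t \<in> {0..T} \<Longrightarrow> u t + conv (\<lambda>x. l * K x) u t = c + conv (\<lambda>_. 1) f t"
    using volterra_continuous_solution[OF T L1_upto_cmult[OF K, of l]] by blast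
  note bu = bdd_upto_continuous[OF u] and bf = bdd_upto_continuous[OF f]
  have bku: "bdd_upto T (conv k u)" by (intro bdd_upto_conv k bu)
  define v where "v = (\<lambda>t. f t + (- l) * conv k u t)"
  have v: "v \<in> borel_measurable borel" unfolding v_def using u f L1_upto_measurable[OF k] by measurable
  have vc: "continuous_on {0..T} v" unfolding v_def by (intro continuous_intros f conv_continuous_on k u)
  note bv = bdd_upto_continuous[OF v vc]
  have uv: "u t = c + conv (\<lambda>_. 1) v t" if t: "t \<in> {0..T}" for t
  proof -
    have tT: "t \<le> T" using t by simp
    have "conv (\<lambda>_. 1) v t = conv (\<lambda>_. 1) f t + (- l) * conv (\<lambda>_. 1) (conv k u) t"
      unfolding v_def conv_add_right[OF one bf bdd_upto_cmult[OF bku] tT] conv_cmult_right by (rule refl)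
    also have "conv (\<lambda>_. 1) (conv k u) t = conv (conv (\<lambda>_. 1) k) u t" by (rule conv_assoc[OF one k bu tT])
    also have "conv (\<lambda>_. 1) k = K" unfolding K_def by (rule ext) (rule conv_commute)
    finally show ?thesis using equ[OF t] by (simp add: conv_cmult_left)
  qed
  have "v t + l * conv K v t = f t - l * c * K t" if t: "t \<in> {0..T}" for t
  proof -
    have tT: "t \<le> T" using t by simp
    have b1: "bdd_upto T (conv (\<lambda>_. 1) v)" by (intro bdd_upto_conv one bv)
    have "conv k u t = conv k (\<lambda>t. c * 1 + conv (\<lambda>_. 1) v t) t" using uv t by (intro conv_cong) auto
    also have "\<dots> = c * K t + conv k (conv (\<lambda>_. 1) v) t"
      unfolding conv_add_right[OF k bdd_upto_cmult[OF bdd_upto_const] b1 tT] conv_cmult_right K_def by (rule refl)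
    also have "conv k (conv (\<lambda>_. 1) v) t = conv K v t" unfolding K_def by (rule conv_assoc[OF k one bv tT])
    finally show ?thesis by (simp add: v_def algebra_simps)
  qed
  then show ?thesis using u v vc uv unfolding K_def by (intro exI[of _ u] exI[of _ v]) (auto simp: v_def)
qed

text \<open>Gronwall's lemma for |u| with A = 0.\<close>

lemma volterra_integrated_unique:
  assumes k: "L1_upto T k" and u: "u \<in> borel_measurable borel" "continuous_on {0..T} u" 
    and eq: "\<And>t. t \<in> {0..T} \<Longrightarrow> u t + l * conv k u t = 0" and t: "t \<in> {0..T}"
  shows "u t = 0"
proof -
  note bu = bdd_upto_continuous[OF u]
  have "\<exists>Q\<ge>0. \<forall>A V. 0 \<le> A \<longrightarrow> bdd_upto T V \<longrightarrow>
      (\<forall>t\<in>{0..T}. 0 \<le> V t \<and> V t \<le> A + \<bar>l\<bar> * conv (\<lambda>x. \<bar>k x\<bar>) V t) \<longrightarrow> (\<forall>t\<in>{0..T}. V t \<le> Q * A)"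
    by (rule gronwall_convolution[OF L1_upto_abs[OF k]]) auto
  then obtain Q where Q: "\<And>A V. 0 \<le> A \<Longrightarrow> bdd_upto T V \<Longrightarrow> (\<forall>t\<in>{0..T}. 0 \<le> V t \<and> V t \<le> A + \<bar>l\<bar> * conv (\<lambda>x. \<bar>k x\<bar>) V t) \<Longrightarrow>
     (\<forall>t\<in>{0..T}. V t \<le> Q * A)" by blast
  have "\<bar>u s\<bar> \<le> 0 + \<bar>l\<bar> * conv (\<lambda>x. \<bar>k x\<bar>) (\<lambda>x. \<bar>u x\<bar>) s" if s: "s \<in> {0..T}" for s
  proof -
    have "u s = - l * conv k u s" using eq[OF s] by simp
    then have "\<bar>u s\<bar> = \<bar>l\<bar> * \<bar>conv k u s\<bar>" by (simp add: abs_mult)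
    also have "\<dots> \<le> \<bar>l\<bar> * conv (\<lambda>x. \<bar>k x\<bar>) (\<lambda>x. \<bar>u x\<bar>) s"
      using s by (intro mult_left_mono conv_abs_le[OF k bu]) auto
    finally show ?thesis by simp
  qed
  then have "\<forall>t\<in>{0..T}. \<bar>u t\<bar> \<le> Q * 0" by (intro Q bdd_upto_abs bu) auto
  then show ?thesis using t by auto
qed


section \<open>The variable-exponent kernel\<close>

text \<open>The value of the kernel at 0 enters the integral only at the single point s = t. This
  tolerates the conventional value of a singular kernel at 0.\<close>

lemma conv_AE_cong:
  assumes [measurable]: "a \<in> borel_measurable borel" "a' \<in> borel_measurable borel" "b \<in> borel_measurable borel"
    and "\<And>s. 0 < s \<Longrightarrow> s \<le> t \<Longrightarrow> a s = a' s"
  shows "conv a b t = conv a' b t"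
  unfolding conv_def
proof (rule integral_cong_AE)
  show "AE s in lborel. indicator {0..t} s * (a (t - s) * b s) = indicator {0..t} s * (a' (t - s) * b s)"
    using AE_lborel_singleton[of t] by eventually_elim (use assms(4) in \<open>auto simp: indicator_def\<close>)
qed measurable

text \<open>The logarithm, which comes from differentiating in the exponent, costs an arbitrarily
  small power; the gap between \<open>am\<close> and \<eta> pays for it, and \<eta> < 1 keeps the
  majorant integrable at 0.\<close>

lemma powr_log_bound:
  assumes T: "0 < T" and am: "am < \<eta>" "\<eta> < 1"
  obtains C :: real where "C \<ge> 0"
    "\<And>t a. 0 < t \<Longrightarrow> t \<le> T \<Longrightarrow> 0 \<le> a \<Longrightarrow> a \<le> am \<Longrightarrow> t powr (-a) * (1 + \<bar>ln t\<bar>) \<le> C * t powr (-\<eta>)"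
\<comment> \<open>The first summand serves t \<le> 1, where |ln t| \<le> t powr (-\<delta>) /
  \<delta>; the second serves t > 1, where the two factors are at most T and 1 + T.\<close>
proof (rule that[of "(1 + 1 / (\<eta> - am)) + T * (1 + T)"])
  define \<delta> where "\<delta> = \<eta> - am"
  have \<delta>: "0 < \<delta>" using am by (simp add: \<delta>_def)
  show "0 \<le> (1 + 1 / (\<eta> - am)) + T * (1 + T)" using T am by simp
  fix t a :: real assume t: "0 < t" "t \<le> T" and a: "0 \<le> a" "a \<le> am"
  have "t powr (\<eta> - a) * (1 + \<bar>ln t\<bar>) \<le> (1 + 1 / \<delta>) + T * (1 + T)"
  proof (cases "t \<le> 1")
    case True
    have "- ln t = ln (1 / t)" using t by (simp add: ln_div)
    also have "\<dots> \<le> (1 / t) powr \<delta> / \<delta>" using t True \<delta> by (intro ln_powr_bound) auto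
    finally have "\<bar>ln t\<bar> \<le> (1 / t) powr \<delta> / \<delta>" using t True by simp
    then have l: "t powr \<delta> * \<bar>ln t\<bar> \<le> t powr \<delta> * ((1 / t) powr \<delta> / \<delta>)" by (intro mult_left_mono) auto
    have "t powr \<delta> * ((1 / t) powr \<delta>) = 1" using t by (simp flip: powr_mult)
    then have eq: "t powr \<delta> * ((1 / t) powr \<delta> / \<delta>) = 1 / \<delta>" by simp
    have "t powr \<delta> * \<bar>ln t\<bar> \<le> 1 / \<delta>" using l unfolding eq .
    moreover have "t powr \<delta> \<le> 1" using t True \<delta> by (simp add: powr_le1)
    ultimately have "t powr \<delta> * (1 + \<bar>ln t\<bar>) \<le> 1 + 1 / \<delta>" by (simp add: distrib_left)
    moreover have "t powr (\<eta> - a) \<le> t powr \<delta>" using t True a by (intro powr_mono') (auto simp: \<delta>_def)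
    then have "t powr (\<eta> - a) * (1 + \<bar>ln t\<bar>) \<le> t powr \<delta> * (1 + \<bar>ln t\<bar>)" by (intro mult_right_mono) auto
    moreover have "0 \<le> T * (1 + T)" using T by simp
    ultimately show ?thesis by linarith
  next
    case False
    have "t powr (\<eta> - a) \<le> t powr 1" using False a am by (intro powr_mono) auto
    then have "t powr (\<eta> - a) \<le> T" using t by simp
    moreover have "\<bar>ln t\<bar> \<le> T" using ln_le_minus_one[of t] t False by simp
    ultimately have "t powr (\<eta> - a) * (1 + \<bar>ln t\<bar>) \<le> T * (1 + T)" using T by (intro mult_mono) auto
    moreover have "0 \<le> 1 / \<delta>" using \<delta> by simp
    ultimately show ?thesis by linarith
  qed
  then have "t powr (-\<eta>) * (t powr (\<eta> - a) * (1 + \<bar>ln t\<bar>)) \<le> t powr (-\<eta>) * ((1 + 1 / \<delta>) + T * (1 + T))"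
    by (intro mult_left_mono) auto
  moreover have "t powr (-\<eta>) * t powr (\<eta> - a) = t powr (-a)" by (simp flip: powr_add)
  ultimately show "t powr (-a) * (1 + \<bar>ln t\<bar>) \<le> ((1 + 1 / (\<eta> - am)) + T * (1 + T)) * t powr (-\<eta>)"
    unfolding \<delta>_def mult.assoc[symmetric] by (simp only: mult.commute)
qed

text \<open>The kernel minus its version with exponent frozen at 0 vanishes at 0, because |\<alpha>
  t - \<alpha> 0| \<le> L t lowers the singularity by one order; its derivative \<kappa> is bounded
  by a multiple of t powr (-\<eta>) and thus integrable. So k = k0 + 1 * \<kappa>, and one more
  integration turns 1 * 1 into the identity function and k0 into a pure power.\<close>

lemma variable_kernel_decomposition:
  assumes T: "0 < T" and \<alpha>: "\<And>t. t \<in> {0..T} \<Longrightarrow> 0 < \<alpha> t \<and> \<alpha> t < 1"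
    and \<alpha>': "\<And>t. t \<in> {0..T} \<Longrightarrow> (\<alpha> has_real_derivative \<alpha>' t) (at t within {0..T})"
    and \<alpha>'c: "continuous_on {0..T} \<alpha>'"
  defines "k \<equiv> (\<lambda>t. indicator {0<..T} t * kernel \<alpha> t)"
  shows "L1_upto T k \<and> (\<exists>\<kappa> d. 0 < d \<and> L1_upto T \<kappa> \<and>
    (\<forall>t\<in>{0..T}. conv k (\<lambda>_. 1) t = d * t powr (1 - \<alpha> 0) + conv (\<lambda>x. x) \<kappa> t))"
proof -
  have \<alpha>c: "continuous_on {0..T} \<alpha>" using \<alpha>' by (rule DERIV_continuous_on)
  obtain tm where tm: "tm \<in> {0..T}" "\<And>t. t \<in> {0..T} \<Longrightarrow> \<alpha> t \<le> \<alpha> tm"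
    using continuous_attains_sup[OF _ _ \<alpha>c] T by auto
  define am where "am = \<alpha> tm"
  have am: "0 < am" "am < 1" and \<alpha>am: "\<And>t. t \<in> {0..T} \<Longrightarrow> \<alpha> t \<in> {0..am}"
    using \<alpha> tm less_imp_le by (auto simp: am_def)
  \<comment> \<open>The midpoint between the maximum of \<alpha> and 1; the gap is positive because
    the maximum is attained.\<close>
  define \<eta> where "\<eta> = (am + 1) / 2"
  have \<eta>: "am < \<eta>" "\<eta> < 1" "0 < \<eta>" using am by (auto simp: \<eta>_def)
  obtain C1 where C1: "C1 \<ge> 0" "\<And>t a. 0 < t \<Longrightarrow> t \<le> T \<Longrightarrow> 0 \<le> a \<Longrightarrow> a \<le> am \<Longrightarrow> t powr (-a) * (1 + \<bar>ln t\<bar>) \<le> C1 * t powr (-\<eta>)"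
    using powr_log_bound[OF T \<eta>(1,2)] by blast
  define R where "R a = rGamma (1 - a)" for a :: real
  \<comment> \<open>The derivative of \<open>R\<close>: the sign from the inner function 1 - a
    cancels the sign in rGamma' = - rGamma Digamma.\<close>
  define R1 where "R1 a = rGamma (1 - a) * Digamma (1 - a)" for a :: real
  have notin: "1 - a \<notin> \<int>\<^sub>\<le>\<^sub>0" if "a < 1" for a :: real
    using that by (auto elim!: nonpos_Ints_cases)
  have R: "(R has_real_derivative R1 a) (at a within A)" if "a < 1" for a A
    unfolding R_def R1_def using notin[OF that] by (auto intro!: derivative_eq_intros)
  have Rc: "continuous_on S R" if "S \<subseteq> {..<1}" for S
    using that R by (intro DERIV_continuous_on[of S R R1]) auto
  have R1c: "continuous_on S R1" if "S \<subseteq> {..<1}" for S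
  proof -
    have "continuous_on ((\<lambda>a. 1 - a) ` S) (Digamma :: real \<Rightarrow> real)"
      using notin that by (intro continuous_on_Polygamma) auto
    then have "continuous_on S (\<lambda>a. Digamma (1 - a) :: real)"
      by (rule continuous_on_compose2) (auto intro!: continuous_intros)
    moreover have "continuous_on S (\<lambda>a. rGamma (1 - a) :: real)"
      by (rule continuous_on_compose2[OF continuous_on_rGamma[of UNIV]]) (auto intro!: continuous_intros)
    ultimately show ?thesis unfolding R1_def by (intro continuous_intros)
  qed
  have am1: "{0..am} \<subseteq> {..<1}" using am by auto
  have "bounded (R ` {0..am})" "bounded (R1 ` {0..am})"
    using am1 by (auto intro!: compact_imp_bounded compact_continuous_image Rc R1c)
  then obtain M1 M2 where M12: "\<forall>x\<in>R ` {0..am}. norm x \<le> M1" "\<forall>x\<in>R1 ` {0..am}. norm x \<le> M2"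
    unfolding bounded_iff by blast
  define M where "M = max M1 M2"
  have MR: "\<bar>R a\<bar> \<le> M" "\<bar>R1 a\<bar> \<le> M" if "a \<in> {0..am}" for a
    using M12 that by (auto simp: M_def le_max_iff_disj)
  have M0: "M \<ge> 0" using MR[of 0] am by auto
  \<comment> \<open>Time and exponent become independent variables, so that mean value estimates can
    run in the exponent at a fixed time.\<close>
  define P where "P t a = t powr (-a) * R a" for t a
  define Pa where "Pa t a = t powr (-a) * (R1 a - ln t * R a)" for t a
  have PD: "(P t has_real_derivative Pa t a) (at a within A)" if "0 < t" "a < 1" for t a A
  proof -
    have "((\<lambda>a. t powr (-a)) has_real_derivative - (t powr (-a) * ln t)) (at a within A)"
    proof -
      have "((\<lambda>a. exp (- a * ln t)) has_real_derivative - (exp (- a * ln t) * ln t)) (at a within A)"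
        by (auto intro!: derivative_eq_intros)
      then show ?thesis using that by (simp add: powr_def)
    qed
    from DERIV_mult[OF this R[OF that(2)]] show ?thesis
      unfolding P_def[abs_def] Pa_def by (simp add: algebra_simps)
  qed
  define C2 where "C2 = M * C1"
  have C20: "C2 \<ge> 0" using C1 M0 by (simp add: C2_def)
  have Pb: "\<bar>P t a\<bar> \<le> C2 * t powr (-\<eta>)" "\<bar>Pa t a\<bar> \<le> C2 * t powr (-\<eta>)"
    if t: "0 < t" "t \<le> T" and a: "a \<in> {0..am}" for t a
  proof -
    have *: "t powr (-a) * (M * (1 + \<bar>ln t\<bar>)) \<le> C2 * t powr (-\<eta>)"
      using mult_left_mono[OF C1(2)[of t a] M0] t a by (simp add: C2_def mult_ac)
    have "\<bar>R a\<bar> \<le> M * (1 + \<bar>ln t\<bar>)"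
      using MR(1)[OF a] mult_left_mono[of 1 "1 + \<bar>ln t\<bar>" M] M0 by simp
    then have "\<bar>P t a\<bar> \<le> t powr (-a) * (M * (1 + \<bar>ln t\<bar>))"
      unfolding P_def by (simp add: abs_mult mult_left_mono)
    with * show "\<bar>P t a\<bar> \<le> C2 * t powr (-\<eta>)" by linarith
    have "\<bar>ln t * R a\<bar> \<le> \<bar>ln t\<bar> * M" using MR(1)[OF a] by (simp add: abs_mult mult_left_mono)
    then have "\<bar>R1 a - ln t * R a\<bar> \<le> M * (1 + \<bar>ln t\<bar>)" using MR(2)[OF a] by (simp add: algebra_simps)
    then have "\<bar>Pa t a\<bar> \<le> t powr (-a) * (M * (1 + \<bar>ln t\<bar>))"
      unfolding Pa_def by (simp add: abs_mult mult_left_mono)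
    with * show "\<bar>Pa t a\<bar> \<le> C2 * t powr (-\<eta>)" by linarith
  qed
  have "bounded (\<alpha>' ` {0..T})" by (intro compact_imp_bounded compact_continuous_image \<alpha>'c) auto
  then obtain L where "\<forall>x\<in>\<alpha>' ` {0..T}. norm x \<le> L" unfolding bounded_iff by blast
  then have L: "\<bar>\<alpha>' t\<bar> \<le> L" if "t \<in> {0..T}" for t using that by auto
  have L0: "L \<ge> 0" using L[of 0] T by auto
  have \<alpha>L: "\<bar>\<alpha> t - \<alpha> 0\<bar> \<le> L * t" if "t \<in> {0..T}" for t
    using field_differentiable_bound[OF _ \<alpha>', of L t 0] L that T by auto
  define k0 where "k0 t = indicator {0<..T} t * P t (\<alpha> 0)" for t
  define k1 where "k1 t = P t (\<alpha> t) - P t (\<alpha> 0)" for t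
  \<comment> \<open>The derivative of \<open>k1\<close>. The two terms with an extra 1/t are grouped
    into one difference: the estimates in the exponent give this difference a factor t, which
    cancels the division.\<close>
  define q where "q t = - (\<alpha> t * P t (\<alpha> t) - \<alpha> 0 * P t (\<alpha> 0)) / t + \<alpha>' t * Pa t (\<alpha> t)" for t
  define \<kappa> where "\<kappa> t = indicator {0<..T} t * q t" for t
  have kP: "kernel \<alpha> t = P t (\<alpha> t)" for t
    by (simp add: kernel_def P_def R_def rGamma_inverse_Gamma field_simps)
  have Psub: "{0<..T} \<subseteq> {0..T}" by auto
  have \<alpha>c1: "continuous_on {0<..T} \<alpha>" using \<alpha>c Psub continuous_on_subset by blast
  have RA: "continuous_on {0<..T} (\<lambda>t. R (\<alpha> t))" "continuous_on {0<..T} (\<lambda>t. R1 (\<alpha> t))"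
    using \<alpha> by (auto intro!: continuous_on_compose2[OF Rc[OF order_refl] \<alpha>c1] continuous_on_compose2[OF R1c[OF order_refl] \<alpha>c1])
  have PAc: "continuous_on {0<..T} (\<lambda>t. P t (\<alpha> t))"
    unfolding P_def by (intro continuous_intros RA \<alpha>c1) auto
  have P0c: "continuous_on {0<..T} (\<lambda>t. P t (\<alpha> 0))"
    unfolding P_def by (intro continuous_intros) auto
  have qc: "continuous_on {0<..T} q"
    unfolding q_def Pa_def
    by (intro continuous_intros PAc P0c \<alpha>c1 RA continuous_on_subset[OF \<alpha>'c]) auto
  have meas[measurable]: "k \<in> borel_measurable borel" "k0 \<in> borel_measurable borel" "\<kappa> \<in> borel_measurable borel"
    using borel_measurable_continuous_on_indicator[OF _ PAc] borel_measurable_continuous_on_indicator[OF _ P0c]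
      borel_measurable_continuous_on_indicator[OF _ qc]
    by (simp_all add: k_def kP k0_def[abs_def] \<kappa>_def[abs_def])
  have ipow: "integrable lborel (\<lambda>s. indicator {0..T} s * (s powr (-\<eta>)))"
    using L1_upto_powr[of "-\<eta>" T] \<eta> by (simp add: L1_upto_def)
  have L1I: "L1_upto T h" if [measurable]: "h \<in> borel_measurable borel"
    and hb: "\<And>t. 0 < t \<Longrightarrow> t \<le> T \<Longrightarrow> \<bar>h t\<bar> \<le> C * t powr (-\<eta>)" and h0: "h 0 = 0" for h and C :: real
    unfolding L1_upto_def
  proof (intro conjI Bochner_Integration.integrable_bound[OF integrable_mult_right[OF ipow, of C]])
    have "\<bar>indicator {0..T} t * h t\<bar> \<le> \<bar>C * (indicator {0..T} t * t powr (-\<eta>))\<bar>" for t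
      using hb[of t] h0 by (cases "t = 0") (auto simp: indicator_def intro: order_trans[OF _ abs_ge_self])
    then show "AE t in lborel. norm (indicator {0..T} t * h t) \<le> norm (C * (indicator {0..T} t * t powr (-\<eta>)))"
      by simp
  qed measurable
  have \<alpha>0: "\<alpha> 0 \<in> {0..am}" using \<alpha>am[of 0] T by auto
  have kL: "L1_upto T k" by (rule L1I[OF meas(1), of C2]) (use Pb \<alpha>am in \<open>auto simp: k_def kP\<close>)
  have k0L: "L1_upto T k0" by (rule L1I[OF meas(2), of C2]) (use Pb \<alpha>0 in \<open>auto simp: k0_def\<close>)
  have inam: "a < 1" if "a \<in> {0..am}" for a using that am by auto
  have mvt1: "\<bar>P t (\<alpha> t) - P t (\<alpha> 0)\<bar> \<le> C2 * t powr (-\<eta>) * (L * t)" if t: "0 < t" "t \<le> T" for t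
  proof -
    have "\<bar>P t (\<alpha> t) - P t (\<alpha> 0)\<bar> \<le> C2 * t powr (-\<eta>) * \<bar>\<alpha> t - \<alpha> 0\<bar>"
      using field_differentiable_bound[of "{0..am}" "P t" "Pa t" "C2 * t powr (-\<eta>)" "\<alpha> t" "\<alpha> 0"]
        PD[OF t(1)] inam Pb(2)[OF t] \<alpha>am[of t] \<alpha>0 t by auto
    also have "\<dots> \<le> C2 * t powr (-\<eta>) * (L * t)" using \<alpha>L[of t] C20 t by (intro mult_left_mono) auto
    finally show ?thesis .
  qed
  have mvt2: "\<bar>\<alpha> t * P t (\<alpha> t) - \<alpha> 0 * P t (\<alpha> 0)\<bar> \<le> 2 * C2 * t powr (-\<eta>) * (L * t)" if t: "0 < t" "t \<le> T" for t
  proof -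
    have D: "((\<lambda>a. a * P t a) has_real_derivative P t a + a * Pa t a) (at a within {0..am})" if "a \<in> {0..am}" for a
      using DERIV_mult[OF DERIV_ident PD[OF t(1) inam[OF that]]] by (simp add: algebra_simps)
    have B: "\<bar>P t a + a * Pa t a\<bar> \<le> 2 * C2 * t powr (-\<eta>)" if "a \<in> {0..am}" for a
    proof -
      have "\<bar>a * Pa t a\<bar> \<le> 1 * \<bar>Pa t a\<bar>" unfolding abs_mult using inam[OF that] that by (intro mult_right_mono) auto
      then show ?thesis using Pb[OF t that] by linarith
    qed
    have "\<bar>\<alpha> t * P t (\<alpha> t) - \<alpha> 0 * P t (\<alpha> 0)\<bar> \<le> 2 * C2 * t powr (-\<eta>) * \<bar>\<alpha> t - \<alpha> 0\<bar>"
      using field_differentiable_bound[of "{0..am}" "\<lambda>a. a * P t a" "\<lambda>a. P t a + a * Pa t a" "2 * C2 * t powr (-\<eta>)" "\<alpha> t" "\<alpha> 0"]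
        D B \<alpha>am[of t] \<alpha>0 t by auto
    also have "\<dots> \<le> 2 * C2 * t powr (-\<eta>) * (L * t)" using \<alpha>L[of t] C20 t by (intro mult_left_mono) auto
    finally show ?thesis .
  qed
  have qb: "\<bar>q t\<bar> \<le> 3 * L * C2 * t powr (-\<eta>)" if t: "0 < t" "t \<le> T" for t
  proof -
    have "\<bar>- (\<alpha> t * P t (\<alpha> t) - \<alpha> 0 * P t (\<alpha> 0)) / t\<bar> \<le> 2 * C2 * t powr (-\<eta>) * (L * t) / t"
      using divide_right_mono[OF mvt2[OF t], of t] t by (simp only: abs_divide abs_minus_cancel abs_of_pos less_imp_le)
    also have "\<dots> = 2 * L * C2 * t powr (-\<eta>)" using t by simp
    finally have 1: "\<bar>- (\<alpha> t * P t (\<alpha> t) - \<alpha> 0 * P t (\<alpha> 0)) / t\<bar> \<le> 2 * L * C2 * t powr (-\<eta>)" .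
    have "\<bar>\<alpha>' t * Pa t (\<alpha> t)\<bar> \<le> L * (C2 * t powr (-\<eta>))"
      unfolding abs_mult using L[of t] Pb(2)[OF t \<alpha>am[of t]] t L0 by (intro mult_mono) auto
    moreover have "\<bar>q t\<bar> \<le> \<bar>- (\<alpha> t * P t (\<alpha> t) - \<alpha> 0 * P t (\<alpha> 0)) / t\<bar> + \<bar>\<alpha>' t * Pa t (\<alpha> t)\<bar>"
      unfolding q_def by (rule abs_triangle_ineq)
    moreover have "3 * L * C2 * t powr (-\<eta>) = 2 * L * C2 * t powr (-\<eta>) + L * (C2 * t powr (-\<eta>))"
      by (simp add: algebra_simps)
    ultimately show ?thesis using 1 by linarith
  qed
  have \<kappa>L: "L1_upto T \<kappa>" by (rule L1I[OF meas(3), of "3 * L * C2"]) (use qb in \<open>auto simp: \<kappa>_def\<close>)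
  have k1D: "(k1 has_real_derivative q t) (at t)" if t: "0 < t" "t < T" for t
  proof -
    have "(\<alpha> has_real_derivative \<alpha>' t) (at t within {0<..<T})" using t by (intro DERIV_subset[OF \<alpha>']) auto
    then have \<alpha>D: "(\<alpha> has_real_derivative \<alpha>' t) (at t)" using t by (simp add: at_within_open[of t "{0<..<T}"])
    have \<alpha>1: "\<alpha> t < 1" using \<alpha>[of t] t by auto
    have pw: "((\<lambda>t. t powr (- \<alpha> t)) has_real_derivative t powr (- \<alpha> t) * (- \<alpha>' t * ln t + 1 * (- \<alpha> t) / t)) (at t)"
      using t by (intro DERIV_powr DERIV_ident DERIV_minus \<alpha>D)
    have "((\<lambda>t. R (\<alpha> t)) has_real_derivative R1 (\<alpha> t) * \<alpha>' t) (at t)"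
      by (rule DERIV_chain2[OF R[OF \<alpha>1] \<alpha>D])
    from DERIV_mult[OF pw this]
    have 1: "((\<lambda>t. P t (\<alpha> t)) has_real_derivative - \<alpha> t * P t (\<alpha> t) / t + \<alpha>' t * Pa t (\<alpha> t)) (at t)"
      unfolding P_def Pa_def by (rule DERIV_cong) (use t in \<open>simp add: field_simps\<close>)
    have "((\<lambda>t. t powr (- \<alpha> 0)) has_real_derivative - \<alpha> 0 * t powr (- \<alpha> 0 - 1)) (at t)"
      using t by (intro has_real_derivative_powr) auto
    from DERIV_cmult_right[OF this, of "R (\<alpha> 0)"]
    have 2: "((\<lambda>t. P t (\<alpha> 0)) has_real_derivative - \<alpha> 0 * P t (\<alpha> 0) / t) (at t)"
      unfolding P_def by (rule DERIV_cong) (use t in \<open>simp add: powr_diff\<close>)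
    show ?thesis
      unfolding k1_def[abs_def] q_def by (rule DERIV_cong[OF DERIV_diff[OF 1 2]]) (simp add: diff_divide_distrib)
  qed
  have k10: "k1 0 = 0" by (simp add: k1_def P_def)
  have k1c: "continuous_on {0..T} k1"
  proof -
    have "continuous (at t within {0..T}) k1" if t: "t \<in> {0..T}" for t
    proof (cases "t = 0")
      case True
      have "((\<lambda>t. C2 * L * t powr (1 - \<eta>)) \<longlongrightarrow> C2 * L * 0) (at 0 within {0..T})"
        by (intro tendsto_intros tendsto_zero_powrI[of _ _ _ "1 - \<eta>"])
          (use \<eta> in \<open>auto intro!: tendsto_eq_intros simp: eventually_at_filter\<close>)
      then have lim: "((\<lambda>t. C2 * L * t powr (1 - \<eta>)) \<longlongrightarrow> 0) (at 0 within {0..T})" by simp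
      have "(k1 \<longlongrightarrow> 0) (at 0 within {0..T})"
      proof (rule Lim_null_comparison[OF _ lim])
        show "\<forall>\<^sub>F t in at 0 within {0..T}. norm (k1 t) \<le> C2 * L * t powr (1 - \<eta>)"
        proof (unfold eventually_at_filter, intro always_eventually allI impI)
          fix t :: real assume "t \<noteq> 0" "t \<in> {0..T}"
          then have t: "0 < t" "t \<le> T" by auto
          have "t powr (1 - \<eta>) = t * t powr (-\<eta>)" using t powr_add[of t 1 "-\<eta>"] by simp
          then show "norm (k1 t) \<le> C2 * L * t powr (1 - \<eta>)"
            using mvt1[OF t] by (simp add: k1_def mult_ac)
        qed
      qed
      then show ?thesis using True k10 by (simp add: continuous_within)
    next
      case False
      have "continuous_on {0<..T} k1" unfolding k1_def[abs_def] by (intro continuous_intros PAc P0c)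
      then have "continuous (at t within {0<..T}) k1" using False t by (auto simp: continuous_on_eq_continuous_within)
      moreover have "at t within {0..T} = at t within {0<..T}"
        using False t by (intro at_within_nhd[of t "{0<..}"]) auto
      ultimately show ?thesis by simp
    qed
    then show ?thesis by (simp add: continuous_on_eq_continuous_within)
  qed
  have one: "L1_upto T (\<lambda>_. 1)" by (intro bdd_upto_imp_L1 bdd_upto_const)
  have k1int: "k1 t = conv (\<lambda>_. 1) \<kappa> t" if t: "t \<in> {0..T}" for t
  proof -
    \<comment> \<open>The derivative is available only at interior points; with continuity up to the
      endpoints the fundamental theorem still applies.\<close>
    have "(\<kappa> has_integral k1 t - k1 0) {0..t}"
    proof (rule fundamental_theorem_of_calculus_interior)
      show "continuous_on {0..t} k1" using t by (intro continuous_on_subset[OF k1c]) auto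
      show "(k1 has_vector_derivative \<kappa> x) (at x)" if "x \<in> {0<..<t}" for x
        using k1D[of x] that t by (simp add: \<kappa>_def has_real_derivative_iff_has_vector_derivative)
    qed (use t in auto)
    moreover have "set_integrable lborel {0..t} \<kappa>"
      using L1_upto_mono[OF \<kappa>L] t by (simp add: L1_upto_def set_integrable_def)
    ultimately have "(LINT x:{0..t}|lborel. \<kappa> x) = k1 t"
      using set_borel_integral_eq_integral(2)[of "{0..t}" \<kappa>] k10 by (simp add: integral_unique)
    then show ?thesis by (simp add: conv_def set_lebesgue_integral_def)
  qed
  define d where "d = R (\<alpha> 0) * Beta (1 - \<alpha> 0) 1"
  have "\<alpha> 0 < 1" using \<alpha>[of 0] T by auto
  then have "Gamma (1 - \<alpha> 0) > 0" "Beta (1 - \<alpha> 0) 1 > 0"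
    by (auto simp: Beta_def intro!: divide_pos_pos mult_pos_pos Gamma_real_pos)
  then have dpos: "d > 0" by (simp add: d_def R_def rGamma_inverse_Gamma)
  have "conv k (\<lambda>_. 1) t = d * t powr (1 - \<alpha> 0) + conv (\<lambda>x. x) \<kappa> t" if t: "t \<in> {0..T}" for t
  proof -
    have tT: "t \<le> T" using t by simp
    have k1': "bdd_upto T (conv (\<lambda>_. 1) \<kappa>)"
    proof -
      have "conv (\<lambda>_. 1) \<kappa> = conv \<kappa> (\<lambda>_. 1)" by (rule ext) (rule conv_commute)
      then show ?thesis using bdd_upto_conv[OF \<kappa>L bdd_upto_const[of T 1]] by (simp only:)
    qed
    have "conv k (\<lambda>_. 1) t = conv (\<lambda>s. k0 s + conv (\<lambda>_. 1) \<kappa> s) (\<lambda>_. 1) t"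
    proof (rule conv_AE_cong)
      fix s assume s: "0 < s" "s \<le> t"
      then show "k s = k0 s + conv (\<lambda>_. 1) \<kappa> s"
        using k1int[of s] t by (simp add: k_def kP k0_def k1_def)
    qed measurable
    also have "\<dots> = conv k0 (\<lambda>_. 1) t + conv (conv (\<lambda>_. 1) \<kappa>) (\<lambda>_. 1) t"
      by (rule conv_add_left[OF k0L bdd_upto_imp_L1[OF k1'] bdd_upto_const tT])
    also have "conv (conv (\<lambda>_. 1) \<kappa>) (\<lambda>_. 1) t = conv (\<lambda>_. 1) (conv \<kappa> (\<lambda>_. 1)) t"
      by (rule conv_assoc[OF one \<kappa>L bdd_upto_const tT, symmetric])
    also have "\<dots> = conv (conv \<kappa> (\<lambda>_. 1)) (\<lambda>_. 1) t" by (rule conv_commute)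
    also have "\<dots> = conv \<kappa> (conv (\<lambda>_. 1) (\<lambda>_. 1)) t" by (rule conv_assoc[OF \<kappa>L one bdd_upto_const tT, symmetric])
    also have "\<dots> = conv \<kappa> (\<lambda>x. x) t"
      by (intro conv_cong) (auto simp: conv_def)
    also have "\<dots> = conv (\<lambda>x. x) \<kappa> t" by (rule conv_commute)
    also have "conv k0 (\<lambda>_. 1) t = conv (\<lambda>_. 1) (\<lambda>s. R (\<alpha> 0) * s powr ((1 - \<alpha> 0) - 1)) t"
      by (subst conv_commute, intro conv_cong)
        (use tT in \<open>auto simp: k0_def P_def indicator_def\<close>)
    also have "\<dots> = R (\<alpha> 0) * conv (\<lambda>_. 1) (\<lambda>s. s powr ((1 - \<alpha> 0) - 1)) t" by (rule conv_cmult_right)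
    \<comment> \<open>The constant 1 is rewritten as s powr 0 to match \<open>conv_powr\<close>; the
      two differ at 0, where \<open>0 powr 0 = 0\<close>.\<close>
    also have "conv (\<lambda>_. 1) (\<lambda>s. s powr ((1 - \<alpha> 0) - 1)) t = conv (\<lambda>s. s powr (1 - 1)) (\<lambda>s. s powr ((1 - \<alpha> 0) - 1)) t"
      by (rule conv_AE_cong) auto
    also have "\<dots> = Beta (1 - \<alpha> 0) 1 * t powr (1 - \<alpha> 0)"
      using \<open>\<alpha> 0 < 1\<close> t by (subst conv_powr) (auto simp: Beta_commute)
    finally show ?thesis by (simp add: d_def)
  qed
  then show ?thesis using kL \<kappa>L dpos by blast
qed


section \<open>Test functions and weak derivatives\<close>

lemma partial_deriv_real:
  assumes "(f has_real_derivative D) (at x)"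
  shows "partial_deriv 1 f x = D"
proof -
  have "frechet_derivative f (at x) = (\<lambda>h. h * D)"
    using assms by (intro frechet_derivative_at[symmetric]) (simp add: has_field_derivative_def mult_commute_abs)
  then show ?thesis by (simp add: partial_deriv_def)
qed

text \<open>On the line \<open>Basis\<close> is {1} and the partial derivative is the ordinary one.
  The existential form, with a named derivative, feeds the inductions over sums and
  products.\<close>

lemma Ck_on_real_Suc:
  "Ck_on (Suc k) UNIV (f :: real \<Rightarrow> real) \<longleftrightarrow> (\<exists>f'. (\<forall>x. (f has_real_derivative f' x) (at x)) \<and> Ck_on k UNIV f')"
proof
  assume *: "Ck_on (Suc k) UNIV f"
  have "(f has_real_derivative partial_deriv 1 f x) (at x)" for x
  proof -
    have "f differentiable (at x)" using * by simp
    then obtain D where D: "(f has_real_derivative D) (at x)" by (auto simp: real_differentiable_def)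
    then show ?thesis using partial_deriv_real[OF D] by simp
  qed
  then show "\<exists>f'. (\<forall>x. (f has_real_derivative f' x) (at x)) \<and> Ck_on k UNIV f'"
    using * by (intro exI[of _ "partial_deriv 1 f"]) auto
next
  assume "\<exists>f'. (\<forall>x. (f has_real_derivative f' x) (at x)) \<and> Ck_on k UNIV f'"
  then obtain f' where f': "\<And>x. (f has_real_derivative f' x) (at x)" "Ck_on k UNIV f'" by blast
  have "partial_deriv 1 f = f'" using partial_deriv_real[OF f'(1)] by (rule ext)
  then show "Ck_on (Suc k) UNIV f" using f' by (auto simp: real_differentiable_def)
qed

text \<open>\<open>Ck_on (Suc k)\<close> speaks about the derivatives only, so lowering the order,
  as the product rule demands, takes an induction.\<close>

lemma Ck_on_real_SucD: "Ck_on (Suc k) UNIV (f :: real \<Rightarrow> real) \<Longrightarrow> Ck_on k UNIV f"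
proof (induction k arbitrary: f)
  case 0
  then obtain f' where "\<And>x. (f has_real_derivative f' x) (at x)" unfolding Ck_on_real_Suc by blast
  then show ?case by (auto intro!: continuous_at_imp_continuous_on DERIV_isCont)
next
  case (Suc k)
  then show ?case by (subst Ck_on_real_Suc, subst (asm) (2) Ck_on_real_Suc) blast
qed

lemma Ck_on_real_add: "Ck_on k UNIV f \<Longrightarrow> Ck_on k UNIV g \<Longrightarrow> Ck_on k UNIV (\<lambda>x::real. f x + g x :: real)"
proof (induction k arbitrary: f g)
  case (Suc k)
  then obtain f' g' where *: "\<And>x. (f has_real_derivative f' x) (at x)" "Ck_on k UNIV f'"
    "\<And>x. (g has_real_derivative g' x) (at x)" "Ck_on k UNIV g'" unfolding Ck_on_real_Suc by blast
  show ?case unfolding Ck_on_real_Suc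
    by (rule exI[of _ "\<lambda>x. f' x + g' x"]) (intro conjI allI DERIV_add * Suc.IH)
qed (auto intro: continuous_intros)

lemma Ck_on_real_mult: "Ck_on k UNIV f \<Longrightarrow> Ck_on k UNIV g \<Longrightarrow> Ck_on k UNIV (\<lambda>x::real. f x * g x :: real)"
proof (induction k arbitrary: f g)
  case (Suc k)
  then obtain f' g' where *: "\<And>x. (f has_real_derivative f' x) (at x)" "Ck_on k UNIV f'"
    "\<And>x. (g has_real_derivative g' x) (at x)" "Ck_on k UNIV g'" unfolding Ck_on_real_Suc by blast
  have "Ck_on k UNIV (\<lambda>x. f' x * g x + g' x * f x)"
    by (rule Ck_on_real_add[OF Suc.IH[OF *(2) Ck_on_real_SucD[OF Suc.prems(2)]] Suc.IH[OF *(4) Ck_on_real_SucD[OF Suc.prems(1)]]])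
  then show ?case unfolding Ck_on_real_Suc
    by (intro exI[of _ "\<lambda>x. f' x * g x + g' x * f x"] conjI allI DERIV_mult *)
qed (auto intro: continuous_intros)

lemma Ck_on_real_const: "Ck_on k UNIV (\<lambda>x::real. c :: real)"
proof (induction k arbitrary: c)
  case (Suc k)
  then show ?case unfolding Ck_on_real_Suc by (intro exI[of _ "\<lambda>_. 0"]) auto
qed auto

lemma Ck_on_real_affine: "Ck_on k UNIV f \<Longrightarrow> Ck_on k UNIV (\<lambda>x::real. f (a * x + b) :: real)"
proof (induction k arbitrary: f)
  case 0
  then show ?case by (auto intro!: continuous_intros continuous_on_compose2[of UNIV f])
next
  case (Suc k)
  then obtain f' where *: "\<And>x. (f has_real_derivative f' x) (at x)" "Ck_on k UNIV f'"
    unfolding Ck_on_real_Suc by blast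
  have "((\<lambda>x. f (a * x + b)) has_real_derivative f' (a * x + b) * a) (at x)" for x
    by (rule DERIV_chain2[OF *(1)]) (auto intro!: derivative_eq_intros)
  moreover have "Ck_on k UNIV (\<lambda>x. f' (a * x + b) * a)"
    by (rule Ck_on_real_mult[OF Suc.IH[OF *(2)] Ck_on_real_const])
  ultimately show ?case unfolding Ck_on_real_Suc
    by (intro exI[of _ "\<lambda>x. f' (a * x + b) * a"] conjI allI)
qed

text \<open>The functions x^(-n) exp(-1/x), continued by 0. Their span is closed under
  differentiation, so smoothness of the classical flat function \<open>flat 0\<close> follows by
  induction, without formulas for higher derivatives.\<close>

definition flat :: "nat \<Rightarrow> real \<Rightarrow> real" where
  "flat n x = (if 0 < x then inverse x ^ n / exp (inverse x) else 0)"

lemma flat_deriv: "(flat n has_real_derivative flat (n + 2) x - real n * flat (n + 1) x) (at x)"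
proof -
  consider "x < 0" | "x = 0" | "x > 0" by linarith
  then show ?thesis
  proof cases
    case 1
    have "((\<lambda>x. 0) has_real_derivative flat (n + 2) x - real n * flat (n + 1) x) (at x)"
      using 1 by (simp add: flat_def)
    moreover have "\<forall>\<^sub>F y in nhds x. 0 = flat n y"
      using 1 by (intro eventually_nhds_in_open[of "{..<0}", THEN eventually_mono]) (auto simp: flat_def)
    ultimately show ?thesis by (subst (asm) DERIV_cong_ev[OF refl _ refl]) auto
  next
    case 3
    have "((\<lambda>x. inverse x ^ n / exp (inverse x)) has_real_derivative flat (n + 2) x - real n * flat (n + 1) x) (at x)"
    proof (cases n)
      case 0
      then show ?thesis using 3
        by (auto intro!: derivative_eq_intros simp: flat_def power2_eq_square divide_simps)
    next
      case (Suc m)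
      then show ?thesis using 3
        by (auto intro!: derivative_eq_intros simp: flat_def power2_eq_square divide_simps)
          ((simp add: algebra_simps)?; cases m; simp)
    qed
    moreover have "\<forall>\<^sub>F y in nhds x. inverse y ^ n / exp (inverse y) = flat n y"
      using 3 by (intro eventually_nhds_in_open[of "{0<..}", THEN eventually_mono]) (auto simp: flat_def)
    ultimately show ?thesis by (subst (asm) DERIV_cong_ev[OF refl _ refl]) auto
  next
    case 2
    \<comment> \<open>To the right of 0 the difference quotient is again a member of the family, and
      the exponential beats every power.\<close>
    have "((\<lambda>h. flat n h / h) \<longlongrightarrow> 0) (at_right 0)"
    proof (rule Lim_transform_eventually)
      show "((\<lambda>h. inverse h ^ (n + 1) / exp (inverse h)) \<longlongrightarrow> 0) (at_right (0::real))"
        by (rule filterlim_compose[OF tendsto_power_div_exp_0 filterlim_inverse_at_top_right])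
      show "\<forall>\<^sub>F h in at_right 0. inverse h ^ (n + 1) / exp (inverse h) = flat n h / h"
        using eventually_at_right_less[of 0] by eventually_elim (auto simp: flat_def divide_simps)
    qed
    moreover have "((\<lambda>h. flat n h / h) \<longlongrightarrow> 0) (at_left 0)"
      by (intro tendsto_eventually eventually_at_leftI[of "-1"]) (auto simp: flat_def)
    ultimately have "((\<lambda>h. flat n h / h) \<longlongrightarrow> 0) (at 0)" by (simp add: filterlim_split_at)
    then show ?thesis using 2 by (simp add: DERIV_def flat_def[of _ 0])
  qed
qed

lemma Ck_on_flat: "Ck_on k UNIV (flat n)"
proof (induction k arbitrary: n)
  case 0
  then show ?case using flat_deriv by (auto intro!: continuous_at_imp_continuous_on DERIV_isCont)
next
  case (Suc k)
  have "Ck_on k UNIV (\<lambda>x. flat (n + 2) x + (- real n) * flat (n + 1) x)"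
    by (intro Ck_on_real_add Ck_on_real_mult Ck_on_real_const Suc.IH)
  then show ?case unfolding Ck_on_real_Suc using flat_deriv[of n]
    by (intro exI[of _ "\<lambda>x. flat (n + 2) x - real n * flat (n + 1) x"]) auto
qed

lemma flat0_bounds: "0 \<le> flat 0 x" "flat 0 x \<le> 1"
  by (auto simp: flat_def)

text \<open>A rising and a falling flat function, multiplied. The slope n is a parameter so that the
  bump can tend to 1 inside the interval.\<close>

definition bump :: "nat \<Rightarrow> real \<Rightarrow> real \<Rightarrow> real \<Rightarrow> real" where
  "bump n a b x = flat 0 (real n * x + (- real n * a)) * flat 0 (- real n * x + real n * b)"

lemma bump_bounds: "0 \<le> bump n a b x" "bump n a b x \<le> 1"
  using flat0_bounds by (auto simp: bump_def intro: mult_le_one)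

lemma bump_zero: "x \<notin> {a..b} \<Longrightarrow> bump n a b x = 0"
proof -
  assume "x \<notin> {a..b}"
  then have "real n * x + (- real n * a) \<le> 0 \<or> - real n * x + real n * b \<le> 0"
    by (auto simp: mult_left_mono intro: less_imp_le)
  then show ?thesis by (auto simp: bump_def flat_def)
qed

lemma test_fun_bump:
  assumes "0 < a" "b < T"
  shows "test_fun {0<..<T} (bump n a b)"
  unfolding test_fun_def smooth_on_def
proof (intro conjI allI exI[of _ "{a..b}"])
  show "Ck_on k UNIV (bump n a b)" for k
    unfolding bump_def[abs_def] by (intro Ck_on_real_mult Ck_on_real_affine Ck_on_flat)
qed (use assms bump_zero in auto)

lemma flat0_at_top: "(flat 0 \<longlongrightarrow> 1) at_top"
proof (rule Lim_transform_eventually)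
  have "((\<lambda>x::real. 1 / exp (inverse x)) \<longlongrightarrow> 1 / exp 0) at_top"
    by (intro tendsto_intros tendsto_inverse_0_at_top filterlim_ident) auto
  then show "((\<lambda>x::real. 1 / exp (inverse x)) \<longlongrightarrow> 1) at_top" by simp
  show "\<forall>\<^sub>F x in at_top. 1 / exp (inverse x) = flat 0 x"
    using eventually_gt_at_top[of 0] by eventually_elim (simp add: flat_def)
qed

text \<open>Shrinking by 1 / (n + 1) puts the support compactly inside (a,b). Scaled by the slope n
  it shifts the arguments of \<open>flat 0\<close> by less than 1, so they still tend to infinity at
  interior points.\<close>

lemma bump_tendsto_indicator:
  assumes "a < b"
  shows "(\<lambda>n. bump n (a + 1 / real (Suc n)) (b - 1 / real (Suc n)) x) \<longlonglongrightarrow> indicator {a<..<b} x"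
proof (cases "x \<in> {a<..<b}")
  case True
  have *: "filterlim (\<lambda>n. c * real n + - (real n / real (Suc n))) at_top sequentially" if "c > 0" for c
  proof (rule filterlim_at_top_mono)
    show "filterlim (\<lambda>n. (-1) + c * real n) at_top sequentially"
      by (rule filterlim_tendsto_add_at_top[OF tendsto_const],
          rule filterlim_tendsto_pos_mult_at_top[OF tendsto_const that filterlim_real_sequentially])
    show "\<forall>\<^sub>F n in sequentially. - 1 + c * real n \<le> c * real n + - (real n / real (Suc n))"
    proof (intro always_eventually allI)
      fix n
      have "real n / real (Suc n) \<le> 1" by simp
      then show "- 1 + c * real n \<le> c * real n + - (real n / real (Suc n))" by linarith
    qed
  qed
  have "(\<lambda>n. flat 0 ((x - a) * real n + - (real n / real (Suc n)))) \<longlonglongrightarrow> 1"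
    "(\<lambda>n. flat 0 ((b - x) * real n + - (real n / real (Suc n)))) \<longlonglongrightarrow> 1"
    by (rule filterlim_compose[OF flat0_at_top *], use True in simp)+
  then have "(\<lambda>n. flat 0 ((x - a) * real n + - (real n / real (Suc n))) * flat 0 ((b - x) * real n + - (real n / real (Suc n)))) \<longlonglongrightarrow> 1 * 1"
    by (rule tendsto_mult)
  moreover have "bump n (a + 1 / real (Suc n)) (b - 1 / real (Suc n)) x =
      flat 0 ((x - a) * real n + - (real n / real (Suc n))) * flat 0 ((b - x) * real n + - (real n / real (Suc n)))" for n
    unfolding bump_def by (intro arg_cong2[where f = "(*)"] arg_cong[where f = "flat 0"]) (simp_all add: algebra_simps)
  ultimately show ?thesis using True by simp
next
  case False
  have "bump n (a + 1 / real (Suc n)) (b - 1 / real (Suc n)) x = 0" for n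
  proof (intro bump_zero notI)
    assume "x \<in> {a + 1 / real (Suc n)..b - 1 / real (Suc n)}"
    moreover have "0 < 1 / real (Suc n)" by simp
    ultimately have "a < x" "x < b" by (simp_all only: atLeastAtMost_iff) linarith+
    then show False using False by simp
  qed
  then show ?thesis using False by simp
qed

lemma test_funD:
  assumes "test_fun {0<..<T} (\<psi> :: real \<Rightarrow> real)"
  obtains \<psi>' where "\<And>x. (\<psi> has_real_derivative \<psi>' x) (at x)" "continuous_on UNIV \<psi>'" "deriv \<psi> = \<psi>'" "\<psi> 0 = 0" "\<psi> T = 0"
    "continuous_on UNIV \<psi>"
proof -
  have "Ck_on (Suc 0) UNIV \<psi>" using assms unfolding test_fun_def smooth_on_def by blast
  then obtain \<psi>' where *: "\<And>x. (\<psi> has_real_derivative \<psi>' x) (at x)" "Ck_on 0 UNIV \<psi>'" unfolding Ck_on_real_Suc by blast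
  have "deriv \<psi> = \<psi>'" using DERIV_imp_deriv[OF *(1)] by (rule ext)
  moreover have "continuous_on UNIV \<psi>" using *(1) by (auto intro!: continuous_at_imp_continuous_on DERIV_isCont)
  moreover obtain K where "K \<subseteq> {0<..<T}" "\<forall>x. x \<notin> K \<longrightarrow> \<psi> x = 0" using assms unfolding test_fun_def by blast
  then have "\<psi> 0 = 0" "\<psi> T = 0" by auto
  ultimately show thesis using that[of \<psi>'] * by auto
qed

text \<open>The primitive vanishes to the left of the support, and to the right of it because the
  total integral is 0; so it has compact support again.\<close>

lemma test_fun_antiderivative:
  assumes T: "0 < T" and g: "test_fun {0<..<T} g" and int: "integral {0..T} g = 0"
  obtains \<Psi> where "test_fun {0<..<T} \<Psi>" "deriv \<Psi> = g"
proof -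
  obtain K where K: "compact K" "K \<subseteq> {0<..<T}" "\<And>x. x \<notin> K \<Longrightarrow> g x = 0"
    using g unfolding test_fun_def by blast
  obtain g' where "continuous_on UNIV g" using test_funD[OF g] by metis
  then have gc: "continuous_on S g" for S using continuous_on_subset by blast
  have gi: "g integrable_on {u..v}" for u v using gc by (rule integrable_continuous_interval)
  obtain a b where ab: "0 < a" "a \<le> b" "b < T" "K \<subseteq> {a..b}"
  proof (cases "K = {}")
    case True
    then show thesis using T that[of "T/3" "T/2"] by auto
  next
    case False
    obtain p where p: "p \<in> K" "\<And>x. x \<in> K \<Longrightarrow> p \<le> x" using compact_attains_inf[OF K(1) False] by blast
    obtain q where q: "q \<in> K" "\<And>x. x \<in> K \<Longrightarrow> x \<le> q" using compact_attains_sup[OF K(1) False] by blast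
    show thesis using K(2) p q by (intro that[of p q]) auto
  qed
  have zero: "g x = 0" if "x < a \<or> b < x" for x
  proof (rule K(3))
    show "x \<notin> K" using ab(4) that by auto
  qed
  \<comment> \<open>The base point -1 lies left of the support, so that the fundamental theorem
    gives two-sided derivatives on a neighbourhood of [0,T]; further left \<Psi> is locally
    0.\<close>
  define \<Psi> where "\<Psi> t = integral {-1..t} g" for t
  have \<Psi>0: "\<Psi> t = 0" if "t \<le> a" for t
  proof -
    have "\<Psi> t = integral {-1..t} (\<lambda>_. 0)"
      unfolding \<Psi>_def using that zero by (intro integral_spike[of "{a}"]) auto
    then show ?thesis by simp
  qed
  have \<Psi>T: "\<Psi> t = 0" if "b \<le> t" for t
  proof -
    have e: "integral {u..v} g = 0" if "b \<le> u \<or> v \<le> a" for u v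
    proof -
      have "integral {u..v} g = integral {u..v} (\<lambda>_. 0)"
        using that zero by (intro integral_spike[of "{a, b}"]) force+
      then show ?thesis by simp
    qed
    have "\<Psi> t = integral {-1..b} g + integral {b..t} g"
      unfolding \<Psi>_def using ab that gi by (intro Henstock_Kurzweil_Integration.integral_combine[symmetric]) auto
    also have "integral {b..t} g = integral {b..T} g" using e[of b t] e[of b T] by simp
    also have "integral {-1..b} g = integral {-1..0} g + integral {0..b} g"
      using ab gi by (intro Henstock_Kurzweil_Integration.integral_combine[symmetric]) auto
    also have "integral {-1..0} g = 0" using e[of "-1" 0] ab by simp
    also have "0 + integral {0..b} g + integral {b..T} g = integral {0..T} g"
      using ab gi Henstock_Kurzweil_Integration.integral_combine[of 0 b T g] by simp
    finally show ?thesis using int by simp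
  qed
  have D: "(\<Psi> has_real_derivative g t) (at t)" for t
  proof (cases "t > -1")
    case True
    have "(\<Psi> has_real_derivative g t) (at t within {-1..t+1})"
      unfolding \<Psi>_def using True by (intro integral_has_real_derivative gc) auto
    moreover have "at t within {-1..t+1} = at t"
      using True by (intro at_within_interior) auto
    ultimately show ?thesis by simp
  next
    case False
    have "((\<lambda>_. 0) has_real_derivative g t) (at t)" using zero[of t] False ab by simp
    moreover have "\<forall>\<^sub>F y in nhds t. 0 = \<Psi> y"
      using False ab \<Psi>0 by (intro eventually_nhds_in_open[of "{..<0}", THEN eventually_mono]) auto
    ultimately show ?thesis by (subst (asm) DERIV_cong_ev[OF refl _ refl]) auto
  qed
  have "Ck_on k UNIV \<Psi>" for k
  proof (rule Ck_on_real_SucD)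
    show "Ck_on (Suc k) UNIV \<Psi>"
      unfolding Ck_on_real_Suc using D g by (auto simp: test_fun_def smooth_on_def)
  qed
  moreover have "\<Psi> x = 0" if "x \<notin> {a..b}" for x using \<Psi>0[of x] \<Psi>T[of x] that by auto
  ultimately have "test_fun {0<..<T} \<Psi>"
    unfolding test_fun_def smooth_on_def using ab by (intro conjI allI exI[of _ "{a..b}"]) auto
  moreover have "deriv \<Psi> = g" using DERIV_imp_deriv[OF D] by (rule ext)
  ultimately show thesis by (rule that)
qed

section \<open>Lebesgue integrals over an open interval and Borel representatives\<close>

lemma AE_lebesgue_on_Ioo: "(AE t in lebesgue_on {a<..<b::real}. P t) \<longleftrightarrow> (AE t in lborel. t \<in> {a<..<b} \<longrightarrow> P t)"
  by (subst AE_restrict_space_iff) (auto simp: AE_completion_iff)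

lemma AE_indicator_Icc_Ioo: "AE t in lborel. indicator {a<..<b::real} t = (indicator {a..b} t :: real)"
  using AE_lborel_singleton[of a] AE_lborel_singleton[of b]
  by eventually_elim (auto simp: indicator_def)

lemma borel_measurable_lebesgue_on:
  "g \<in> borel_measurable borel \<Longrightarrow> g \<in> borel_measurable (lebesgue_on S)"
  by (simp add: borel_measurable_if_D measurable_completion measurable_restrict_space1)

lemma lebesgue_on_Ioo_borel:
  fixes g :: "real \<Rightarrow> 'b::{banach, second_countable_topology}"
  assumes [measurable]: "g \<in> borel_measurable borel"
  shows "integrable (lebesgue_on {a<..<b}) g \<longleftrightarrow> integrable lborel (\<lambda>t. indicator {a..b} t *\<^sub>R g t)"
    and "(LINT t|lebesgue_on {a<..<b}. g t) = (LINT t|lborel. indicator {a..b} t *\<^sub>R g t)"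
proof -
  have ae: "AE t in lborel. indicator {a<..<b} t *\<^sub>R g t = indicator {a..b} t *\<^sub>R g t"
    using AE_indicator_Icc_Ioo[of a b] by eventually_elim simp
  have m: "(\<lambda>t. indicator {a<..<b} t *\<^sub>R g t) \<in> lborel \<rightarrow>\<^sub>M borel" by measurable
  show "integrable (lebesgue_on {a<..<b}) g \<longleftrightarrow> integrable lborel (\<lambda>t. indicator {a..b} t *\<^sub>R g t)"
    by (subst integrable_restrict_space, simp, subst integrable_completion[OF m]) (intro integrable_cong_AE ae; measurable)
  show "(LINT t|lebesgue_on {a<..<b}. g t) = (LINT t|lborel. indicator {a..b} t *\<^sub>R g t)"
    by (subst integral_restrict_space, simp, subst integral_completion[OF m]) (intro integral_cong_AE ae; measurable)
qed

text \<open>Convolutions are formed with Borel functions, whereas coefficients of Bochner functions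
  are only Lebesgue measurable on the interval.\<close>

lemma borel_version:
  fixes h :: "real \<Rightarrow> real"
  assumes "h \<in> borel_measurable (lebesgue_on {a<..<b})"
  obtains h' where "h' \<in> borel_measurable borel" "AE t in lebesgue_on {a<..<b}. h t = h' t"
proof -
  have "(\<lambda>x. indicator {a<..<b} x *\<^sub>R h x) \<in> borel_measurable lebesgue"
    using assms by (subst (asm) borel_measurable_restrict_space_iff) auto
  then obtain h' where h': "h' \<in> borel_measurable lborel" "AE x in lborel. indicator {a<..<b} x *\<^sub>R h x = h' x"
    using completion_ex_borel_measurable_real by blast
  have "AE t in lborel. t \<in> {a<..<b} \<longrightarrow> h t = h' t" using h'(2) by eventually_elim auto
  then show thesis using h'(1) by (intro that[of h']) (auto simp: AE_lebesgue_on_Ioo)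
qed

lemma continuous_measurable_lebesgue_on:
  fixes g :: "real \<Rightarrow> 'b::{banach, second_countable_topology}"
  assumes "continuous_on {a..b} g"
  shows "g \<in> borel_measurable (lebesgue_on {a<..<b})"
proof -
  have "continuous_on {a<..<b} g" using assms by (rule continuous_on_subset) auto
  from borel_measurable_continuous_on_indicator[OF _ this]
  have "(\<lambda>x. indicator {a<..<b} x *\<^sub>R g x) \<in> borel_measurable lebesgue" by (auto intro: measurable_completion)
  then show ?thesis by (subst borel_measurable_restrict_space_iff) auto
qed

lemma integrable_bounded_scaleR:
  fixes V :: "'a \<Rightarrow> 'b::{banach, second_countable_topology}"
  assumes "integrable M V" "a \<in> borel_measurable M" "\<And>x. x \<in> space M \<Longrightarrow> \<bar>a x :: real\<bar> \<le> B"
  shows "integrable M (\<lambda>x. a x *\<^sub>R V x)"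
proof (rule Bochner_Integration.integrable_bound)
  show "integrable M (\<lambda>x. B *\<^sub>R V x)" using assms(1) by simp
  show "AE x in M. norm (a x *\<^sub>R V x) \<le> norm (B *\<^sub>R V x)"
    using assms(3) by (intro AE_I2) (auto intro!: mult_right_mono order_trans[OF assms(3) abs_ge_self])
  show "(\<lambda>x. a x *\<^sub>R V x) \<in> borel_measurable M"
    using assms(2) borel_measurable_integrable[OF assms(1)] by measurable
qed

lemma integrable_test_scaleR:
  fixes V :: "real \<Rightarrow> 'b::{banach, second_countable_topology}"
  assumes "integrable (lebesgue_on {0<..<T}) V" "continuous_on UNIV g"
  shows "integrable (lebesgue_on {0<..<T}) (\<lambda>x. g x *\<^sub>R V x)"
proof -
  have "bounded (g ` {0..T})"
    by (intro compact_imp_bounded compact_continuous_image continuous_on_subset[OF assms(2)]) auto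
  then obtain B where "\<forall>x\<in>g ` {0..T}. norm x \<le> B" unfolding bounded_iff by blast
  then show ?thesis
    using assms(2) by (intro integrable_bounded_scaleR[OF assms(1), of _ B] borel_measurable_lebesgue_on borel_measurable_continuous_onI) auto
qed

text \<open>The measures with the positive and the negative part of f as densities are finite on
  half-lines and agree there, hence they coincide, and so do the densities almost
  everywhere.\<close>

lemma AE_zero_of_tail_integrals:
  fixes f :: "real \<Rightarrow> real"
  assumes f: "integrable lborel f" and z: "\<And>x. (LINT t|lborel. indicator {x<..} t * f t) = 0"
  shows "AE t in lborel. f t = 0"
proof -
  note [measurable] = borel_measurable_integrable[OF f]
  define M where "M s = density lborel (\<lambda>t. ennreal (max 0 (s * f t)))" for s
  have i: "integrable lborel (\<lambda>t. indicator {x<..} t * max 0 (s * f t))" for s x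
    by (rule Bochner_Integration.integrable_bound[OF integrable_mult_right[OF f, of s]])
      (auto simp: indicator_def max_def)
  have e: "emeasure (M s) {x<..} = ennreal (LINT t|lborel. indicator {x<..} t * max 0 (s * f t))" for s x
  proof -
    have "emeasure (M s) {x<..} = (\<integral>\<^sup>+t. ennreal (indicator {x<..} t * max 0 (s * f t)) \<partial>lborel)"
      unfolding M_def by (subst emeasure_density) (auto intro!: nn_integral_cong simp: indicator_def)
    also have "\<dots> = ennreal (LINT t|lborel. indicator {x<..} t * max 0 (s * f t))"
      by (intro nn_integral_eq_integral i) auto
    finally show ?thesis .
  qed
  have "M 1 = M (-1)"
  proof (rule measure_eqI_lessThan)
    fix x
    have "(LINT t|lborel. indicator {x<..} t * max 0 (1 * f t)) - (LINT t|lborel. indicator {x<..} t * max 0 ((-1) * f t))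
        = (LINT t|lborel. indicator {x<..} t * f t)"
      by (subst Bochner_Integration.integral_diff[symmetric, OF i i])
        (auto intro!: Bochner_Integration.integral_cong simp: indicator_def)
    then show "emeasure (M 1) {x<..} = emeasure (M (-1)) {x<..}" unfolding e using z[of x] by simp
    show "emeasure (M 1) {x<..} < \<infinity>" unfolding e by simp
  qed (auto simp: M_def)
  then have "AE t in lborel. ennreal (max 0 (1 * f t)) = ennreal (max 0 ((-1) * f t))"
    unfolding M_def by (subst (asm) sigma_finite_measure.density_unique_iff[OF lborel.sigma_finite_measure_axioms]) auto
  then show ?thesis
    by eventually_elim (auto simp: max_def split: if_splits)
qed

text \<open>Bumps converge boundedly to the indicator of an interval (a,T), so all tail integrals of
  w vanish.\<close>

lemma fundamental_lemma_real:
  fixes w :: "real \<Rightarrow> real"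
  assumes T: "0 < T" and w: "integrable (lebesgue_on {0<..<T}) w"
    and z: "\<And>\<psi>. test_fun {0<..<T} \<psi> \<Longrightarrow> (LINT t|lebesgue_on {0<..<T}. \<psi> t * w t) = 0"
  shows "AE t in lebesgue_on {0<..<T}. w t = 0"
proof -
  obtain w' where [measurable]: "w' \<in> borel_measurable borel" and ae: "AE t in lebesgue_on {0<..<T}. w t = w' t"
    using borel_version[OF borel_measurable_integrable[OF w]] by blast
  have w': "integrable (lebesgue_on {0<..<T}) w'"
    using w ae by (subst integrable_cong_AE[of _ _ w]) (auto intro: borel_measurable_lebesgue_on borel_measurable_integrable elim: eventually_mono)
  define f where "f t = indicator {0..T} t * w' t" for t
  have f: "integrable lborel f" using w' unfolding f_def[abs_def] by (subst (asm) lebesgue_on_Ioo_borel) auto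
  have [measurable]: "f \<in> borel_measurable borel" unfolding f_def by measurable
  have test: "(LINT t|lborel. \<psi> t * f t) = 0" if \<psi>: "test_fun {0<..<T} \<psi>" for \<psi>
  proof -
    obtain \<psi>' where "continuous_on UNIV \<psi>" using test_funD[OF \<psi>] by metis
    then have [measurable]: "\<psi> \<in> borel_measurable borel" by (rule borel_measurable_continuous_onI)
    have "(LINT t|lborel. \<psi> t * f t) = (LINT t|lborel. indicator {0..T} t *\<^sub>R (\<psi> t * w' t))"
      by (intro Bochner_Integration.integral_cong) (auto simp: f_def)
    also have "\<dots> = (LINT t|lebesgue_on {0<..<T}. \<psi> t * w' t)"
      by (rule lebesgue_on_Ioo_borel(2)[symmetric]) measurable
    also have "\<dots> = (LINT t|lebesgue_on {0<..<T}. \<psi> t * w t)"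
      using ae borel_measurable_integrable[OF w] borel_measurable_integrable[OF w'] borel_measurable_lebesgue_on[of \<psi>]
      by (intro integral_cong_AE) (auto elim: eventually_mono)
    also have "\<dots> = 0" by (rule z[OF \<psi>])
    finally show ?thesis .
  qed
  have tail: "(LINT t|lborel. indicator {x<..} t * f t) = 0" for x
  proof (cases "x < T")
    case False
    then have "(\<lambda>t. indicator {x<..} t * f t) = (\<lambda>t. 0)" by (auto simp: f_def indicator_def)
    then show ?thesis by simp
  next
    case True
    define a where "a = max 0 x"
    have a: "0 \<le> a" "a < T" using True T by (auto simp: a_def)
    define \<psi> where "\<psi> n = bump n (a + 1 / real (Suc n)) (T - 1 / real (Suc n))" for n
    have \<psi>t: "test_fun {0<..<T} (\<psi> n)" for n
      unfolding \<psi>_def using a by (intro test_fun_bump) (auto intro: add_nonneg_pos)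
    have [measurable]: "\<psi> n \<in> borel_measurable borel" for n
    proof -
      obtain \<psi>' where "continuous_on UNIV (\<psi> n)" using test_funD[OF \<psi>t] by metis
      then show ?thesis by (rule borel_measurable_continuous_onI)
    qed
    have "(\<lambda>n. LINT t|lborel. \<psi> n t * f t) \<longlonglongrightarrow> (LINT t|lborel. indicator {a<..<T} t * f t)"
    proof (rule integral_dominated_convergence[where w = "\<lambda>t. \<bar>f t\<bar>"])
      show "AE t in lborel. (\<lambda>n. \<psi> n t * f t) \<longlonglongrightarrow> indicator {a<..<T} t * f t"
        unfolding \<psi>_def by (intro AE_I2 tendsto_intros bump_tendsto_indicator a)
      show "AE t in lborel. norm (\<psi> n t * f t) \<le> \<bar>f t\<bar>" for n
        unfolding \<psi>_def using bump_bounds by (intro AE_I2) (auto simp: abs_mult intro!: mult_left_le_one_le)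
    qed (use f in auto)
    then have "(LINT t|lborel. indicator {a<..<T} t * f t) = 0"
      by (simp add: test[OF \<psi>t] LIMSEQ_const_iff)
    moreover have "(LINT t|lborel. indicator {a<..<T} t * f t) = (LINT t|lborel. indicator {x<..} t * f t)"
    proof (rule integral_cong_AE)
      show "AE t in lborel. indicator {a<..<T} t * f t = indicator {x<..} t * f t"
        using AE_lborel_singleton[of 0] AE_lborel_singleton[of T]
        by eventually_elim (auto simp: f_def a_def indicator_def)
    qed measurable
    ultimately show ?thesis by simp
  qed
  have "AE t in lborel. f t = 0" by (rule AE_zero_of_tail_integrals[OF f tail])
  then have "AE t in lebesgue_on {0<..<T}. w' t = 0"
    unfolding AE_lebesgue_on_Ioo by eventually_elim (auto simp: f_def)
  with ae show ?thesis by eventually_elim simp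
qed

lemma inner_dense_zero:
  fixes x :: "'b::real_inner"
  assumes D: "\<And>X :: 'b set. open X \<Longrightarrow> X \<noteq> {} \<Longrightarrow> \<exists>d\<in>D. d \<in> X" and z: "\<And>d. d \<in> D \<Longrightarrow> inner x d = 0"
  shows "x = 0"
proof (rule ccontr)
  assume x: "x \<noteq> 0"
  then obtain d where d: "d \<in> D" "d \<in> ball x (norm x)" using D[of "ball x (norm x)"] by auto
  have "norm x * norm x = inner x (x - d)" using z[OF d(1)] by (simp add: inner_diff_right power2_norm_eq_inner[symmetric] power2_eq_square)
  also have "\<dots> \<le> norm x * norm (x - d)" by (rule norm_cauchy_schwarz)
  also have "\<dots> < norm x * norm x" using d(2) x by (intro mult_strict_left_mono) (auto simp: dist_norm)
  finally show False by simp
qed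

text \<open>Testing with a countable dense set merges one null set per vector into a single null
  set.\<close>

lemma AE_zero_of_inner:
  fixes w :: "real \<Rightarrow> 'b::{real_inner, second_countable_topology}"
  assumes "\<And>c. AE t in M. inner (w t) c = 0"
  shows "AE t in M. w t = 0"
proof -
  obtain D :: "'b set" where D: "countable D" "\<And>X :: 'b set. open X \<Longrightarrow> X \<noteq> {} \<Longrightarrow> \<exists>d\<in>D. d \<in> X"
    using countable_dense_exists by metis
  have "AE t in M. \<forall>d\<in>D. inner (w t) d = 0" using assms D(1) by (subst AE_ball_countable) auto
  then show ?thesis by eventually_elim (rule inner_dense_zero[OF D(2)], auto)
qed

lemma fundamental_lemma:
  fixes w :: "real \<Rightarrow> 'b::{real_inner, banach, second_countable_topology}"
  assumes T: "0 < T" and w: "integrable (lebesgue_on {0<..<T}) w"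
    and z: "\<And>\<psi>. test_fun {0<..<T} \<psi> \<Longrightarrow> (LINT t|lebesgue_on {0<..<T}. \<psi> t *\<^sub>R w t) = 0"
  shows "AE t in lebesgue_on {0<..<T}. w t = 0"
proof (rule AE_zero_of_inner, rule fundamental_lemma_real[OF T])
  fix c
  show "integrable (lebesgue_on {0<..<T}) (\<lambda>t. inner (w t) c)" using w by simp
  fix \<psi> assume \<psi>: "test_fun {0<..<T} \<psi>"
  then obtain \<psi>' where "continuous_on UNIV \<psi>" using test_funD[OF \<psi>] by metis
  then have "integrable (lebesgue_on {0<..<T}) (\<lambda>t. \<psi> t *\<^sub>R w t)" by (rule integrable_test_scaleR[OF w])
  then have "(LINT t|lebesgue_on {0<..<T}. inner (\<psi> t *\<^sub>R w t) c) = inner (LINT t|lebesgue_on {0<..<T}. \<psi> t *\<^sub>R w t) c"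
    by (intro integral_inner_left)
  then show "(LINT t|lebesgue_on {0<..<T}. \<psi> t * inner (w t) c) = 0" using z[OF \<psi>] by simp
qed

text \<open>A fixed domain with an indicator, in place of a variable domain, leaves one measure
  space for all t, as dominated convergence in t requires.\<close>

definition prim :: "real \<Rightarrow> (real \<Rightarrow> 'b::{banach, second_countable_topology}) \<Rightarrow> real \<Rightarrow> 'b" where
  "prim T V t = (LINT s|lebesgue_on {0<..<T}. indicator {0..t} s *\<^sub>R V s)"

lemma integrable_prim:
  fixes V :: "real \<Rightarrow> 'b::{banach, second_countable_topology}"
  assumes "integrable (lebesgue_on {0<..<T}) V"
  shows "integrable (lebesgue_on {0<..<T}) (\<lambda>s. indicator {0..t::real} s *\<^sub>R V s)"
  by (intro integrable_bounded_scaleR[OF assms, of _ 1] borel_measurable_lebesgue_on) (auto simp: indicator_def)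

lemma prim_inner:
  fixes V :: "real \<Rightarrow> 'b::{real_inner, banach, second_countable_topology}"
  assumes "integrable (lebesgue_on {0<..<T}) V"
  shows "inner (prim T V t) c = prim T (\<lambda>s. inner (V s) c) t"
  unfolding prim_def using integral_inner_left[of c "lebesgue_on {0<..<T}" "\<lambda>s. indicator {0..t} s *\<^sub>R V s"]
    integrable_prim[OF assms] by simp

lemma finite_measure_lebesgue_on_Ioo: "finite_measure (lebesgue_on {a<..<b::real})"
  by (rule finite_measureI, cases "a \<le> b") (auto simp: emeasure_restrict_space)

lemma integrable_continuous_lebesgue_on:
  fixes g :: "real \<Rightarrow> 'b::{banach, second_countable_topology}"
  assumes "continuous_on {0..T} g"
  shows "integrable (lebesgue_on {0<..<T}) g"
proof -
  interpret finite_measure "lebesgue_on {0<..<T}" by (rule finite_measure_lebesgue_on_Ioo)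
  have "bounded (g ` {0..T})" by (intro compact_imp_bounded compact_continuous_image assms) auto
  then obtain B where "\<forall>x\<in>g ` {0..T}. norm x \<le> B" unfolding bounded_iff by blast
  then show ?thesis by (intro integrable_const_bound[of _ B] continuous_measurable_lebesgue_on assms) auto
qed

lemma AE_lebesgue_on_neq: "AE s in lebesgue_on {0<..<T::real}. s \<noteq> t"
  unfolding AE_lebesgue_on_Ioo using AE_lborel_singleton[of t] by eventually_elim auto

lemma prim_continuous_on:
  fixes V :: "real \<Rightarrow> 'b::{banach, second_countable_topology}"
  assumes V: "integrable (lebesgue_on {0<..<T}) V"
  shows "continuous_on S (prim T V)"
  unfolding continuous_on_sequentially o_def
proof (intro allI ballI impI, elim conjE)
  fix x and t :: real assume x: "x \<longlonglongrightarrow> t"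
  show "(\<lambda>n. prim T V (x n)) \<longlonglongrightarrow> prim T V t"
    unfolding prim_def
  proof (rule integral_dominated_convergence[where w = "\<lambda>s. norm (V s)"])
    show "AE s in lebesgue_on {0<..<T}. (\<lambda>n. indicator {0..x n} s *\<^sub>R V s) \<longlonglongrightarrow> indicator {0..t} s *\<^sub>R V s"
      using AE_lebesgue_on_neq[where T = T and t = t]
    proof eventually_elim
      case (elim s)
      have "\<forall>\<^sub>F n in sequentially. indicator {0..x n} s *\<^sub>R V s = indicator {0..t} s *\<^sub>R V s"
      proof (cases "s < t")
        case True
        from order_tendstoD(1)[OF x this] show ?thesis by eventually_elim (use True in \<open>auto simp: indicator_def\<close>)
      next
        case False
        then have "t < s" using elim by simp
        from order_tendstoD(2)[OF x this] show ?thesis by eventually_elim (use False elim in \<open>auto simp: indicator_def\<close>)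
      qed
      then show ?case by (rule tendsto_eventually)
    qed
  qed (use V integrable_prim[OF V] in \<open>auto simp: indicator_def\<close>)
qed

lemma borel_version_L1:
  fixes h :: "real \<Rightarrow> real"
  assumes h: "integrable (lebesgue_on {0<..<T}) h"
  obtains h' where "L1_upto T h'" "AE t in lebesgue_on {0<..<T}. h t = h' t"
proof -
  obtain h' where h'[measurable]: "h' \<in> borel_measurable borel" and ae: "AE t in lebesgue_on {0<..<T}. h t = h' t"
    using borel_version[OF borel_measurable_integrable[OF h]] by blast
  have "integrable (lebesgue_on {0<..<T}) h'"
    using h ae by (subst integrable_cong_AE[of _ _ h]) (auto intro: borel_measurable_lebesgue_on borel_measurable_integrable elim: eventually_mono)
  then have "L1_upto T h'" by (simp add: lebesgue_on_Ioo_borel(1) L1_upto_def h')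
  then show thesis using ae by (rule that)
qed

lemma integral_lebesgue_on_AE_borel:
  fixes h :: "real \<Rightarrow> real"
  assumes m: "h \<in> borel_measurable (lebesgue_on {0<..<T})" and h': "h' \<in> borel_measurable borel"
    and ae: "AE t in lebesgue_on {0<..<T}. h t = h' t"
  shows "(LINT t|lebesgue_on {0<..<T}. h t) = (LINT t|lborel. indicator {0..T} t * h' t)"
proof -
  have "(LINT t|lebesgue_on {0<..<T}. h t) = (LINT t|lebesgue_on {0<..<T}. h' t)"
    by (intro integral_cong_AE m borel_measurable_lebesgue_on h' ae)
  then show ?thesis by (simp add: lebesgue_on_Ioo_borel(2)[OF h'])
qed

lemma prim_eq_conv:
  assumes h: "integrable (lebesgue_on {0<..<T}) h" and h': "h' \<in> borel_measurable borel"
    and ae: "AE t in lebesgue_on {0<..<T}. h t = h' t" and t: "t \<le> T"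
  shows "prim T h t = conv (\<lambda>_. 1) h' t"
proof -
  have "prim T h t = (LINT s|lborel. indicator {0..T} s * (indicator {0..t} s * h' s))"
    unfolding prim_def
  proof (rule integral_lebesgue_on_AE_borel)
    show "(\<lambda>s. indicator {0..t} s *\<^sub>R h s) \<in> borel_measurable (lebesgue_on {0<..<T})"
      using integrable_prim[OF h] by blast
    show "(\<lambda>s. indicator {0..t} s * h' s) \<in> borel_measurable borel" using h' by measurable
    show "AE s in lebesgue_on {0<..<T}. indicator {0..t} s *\<^sub>R h s = indicator {0..t} s * h' s"
      using ae by eventually_elim simp
  qed
  also have "\<dots> = conv (\<lambda>_. 1) h' t"
    unfolding conv_def using t by (intro Bochner_Integration.integral_cong) (auto simp: indicator_def)
  finally show ?thesis .
qed

text \<open>The left side is the convolution at T of the reflected \<psi>' with c + 1 * h.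
  Associativity moves the 1 onto the reflected \<psi>', whose primitive is - \<psi>(T - s) since
  \<psi>(T) = 0, and the constant drops out by \<psi>(0) = 0. Thus Fubini alone does the integration
  by parts.\<close>

lemma by_parts_real:
  fixes h :: "real \<Rightarrow> real"
  assumes T: "0 < T" and h: "integrable (lebesgue_on {0<..<T}) h" and \<psi>: "test_fun {0<..<T} \<psi>"
  shows "(LINT t|lebesgue_on {0<..<T}. deriv \<psi> t * (c + prim T h t)) = - (LINT t|lebesgue_on {0<..<T}. \<psi> t * h t)"
proof -
  obtain \<psi>' where D: "\<And>x. (\<psi> has_real_derivative \<psi>' x) (at x)" and \<psi>'c: "continuous_on UNIV \<psi>'"
    and d: "deriv \<psi> = \<psi>'" and z: "\<psi> 0 = 0" "\<psi> T = 0" and \<psi>c: "continuous_on UNIV \<psi>"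
    by (rule test_funD[OF \<psi>]) blast
  obtain h' where h': "L1_upto T h'" and ae: "AE t in lebesgue_on {0<..<T}. h t = h' t"
    by (rule borel_version_L1[OF h])
  note hm [measurable] = L1_upto_measurable[OF h']
  have [measurable]: "\<psi> \<in> borel_measurable borel" "\<psi>' \<in> borel_measurable borel"
    using \<psi>c \<psi>'c by (auto intro: borel_measurable_continuous_onI)
  have one: "L1_upto T (\<lambda>_. 1)" by (intro bdd_upto_imp_L1 bdd_upto_const)
  define a where "a x = \<psi>' (T - x)" for x
  have ac: "continuous_on UNIV a"
    unfolding a_def by (intro continuous_on_compose2[OF \<psi>'c] continuous_intros) auto
  have am: "a \<in> borel_measurable borel" unfolding a_def by measurable
  have ab: "bdd_upto T a" by (intro bdd_upto_continuous am continuous_on_subset[OF ac]) auto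
  have prim: "prim T h t = conv (\<lambda>_. 1) h' t" if "t \<le> T" for t
    by (rule prim_eq_conv[OF h hm ae that])
  have int_a: "conv (\<lambda>_. 1) a s = - \<psi> (T - s)" if s: "0 \<le> s" for s
  proof -
    have "(LINT x|lborel. indicator {0..s} x *\<^sub>R a x) = (- \<psi> (T - s)) - (- \<psi> (T - 0))"
    proof (rule integral_FTC_atLeastAtMost[OF s])
      show "((\<lambda>x. - \<psi> (T - x)) has_vector_derivative a x) (at x within {0..s})" for x
        unfolding has_real_derivative_iff_has_vector_derivative[symmetric] a_def
        by (rule DERIV_subset[of _ _ _ UNIV]) (auto intro!: derivative_eq_intros DERIV_chain2[OF D])
    qed (use ac continuous_on_subset in blast)
    then show ?thesis using z by (simp add: conv_def)
  qed
  have hc: "L1_upto T (conv (\<lambda>_. 1) h')" 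
  proof -
    have "conv (\<lambda>_. 1) h' = conv h' (\<lambda>_. 1)" by (rule ext) (rule conv_commute)
    then show ?thesis using bdd_upto_imp_L1[OF bdd_upto_conv[OF h' bdd_upto_const]] by simp
  qed
  have "(LINT t|lebesgue_on {0<..<T}. deriv \<psi> t * (c + prim T h t)) = (LINT t|lborel. indicator {0..T} t * (\<psi>' t * (c + conv (\<lambda>_. 1) h' t)))"
    unfolding d
  proof (rule integral_lebesgue_on_AE_borel)
    show "(\<lambda>t. \<psi>' t * (c + prim T h t)) \<in> borel_measurable (lebesgue_on {0<..<T})"
      by (intro continuous_measurable_lebesgue_on continuous_intros prim_continuous_on[OF h] continuous_on_subset[OF \<psi>'c]) auto
    show "AE t in lebesgue_on {0<..<T}. \<psi>' t * (c + prim T h t) = \<psi>' t * (c + conv (\<lambda>_. 1) h' t)"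
      using prim by (intro AE_I2) auto
  qed measurable
  also have "\<dots> = conv a (\<lambda>t. c * 1 + conv (\<lambda>_. 1) h' t) T"
    unfolding conv_def[of a] a_def by simp
  also have "\<dots> = conv (\<lambda>t. c * 1 + conv (\<lambda>_. 1) h' t) a T" by (rule conv_commute)
  also have "\<dots> = conv (\<lambda>t. c * 1) a T + conv (conv (\<lambda>_. 1) h') a T"
    by (rule conv_add_left[OF L1_upto_cmult[OF one] hc ab order_refl])
  also have "conv (\<lambda>t. c * 1) a T = 0" unfolding conv_cmult_left using int_a[of T] T z by simp
  also have "conv (conv (\<lambda>_. 1) h') a T = conv (conv h' (\<lambda>_. 1)) a T"
    by (rule conv_cong) (auto intro: conv_commute)
  also have "\<dots> = conv h' (conv (\<lambda>_. 1) a) T" by (rule conv_assoc[OF h' one ab order_refl, symmetric])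
  also have "\<dots> = conv h' (\<lambda>s. - \<psi> (T - s)) T" by (intro conv_cong int_a) auto
  also have "\<dots> = conv (\<lambda>s. - \<psi> (T - s)) h' T" by (rule conv_commute)
  also have "\<dots> = (LINT t|lborel. - (indicator {0..T} t * (\<psi> t * h' t)))"
    unfolding conv_def by simp
  also have "\<dots> = - (LINT t|lborel. indicator {0..T} t * (\<psi> t * h' t))" by simp
  also have "(LINT t|lborel. indicator {0..T} t * (\<psi> t * h' t)) = (LINT t|lebesgue_on {0<..<T}. \<psi> t * h t)"
  proof -
    have "(LINT t|lebesgue_on {0<..<T}. \<psi> t * h t) = (LINT t|lborel. indicator {0..T} t * (\<psi> t * h' t))"
    proof (rule integral_lebesgue_on_AE_borel)
      show "(\<lambda>t. \<psi> t * h t) \<in> borel_measurable (lebesgue_on {0<..<T})"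
        by (intro borel_measurable_times borel_measurable_lebesgue_on borel_measurable_integrable[OF h]) measurable
      show "AE t in lebesgue_on {0<..<T}. \<psi> t * h t = \<psi> t * h' t" using ae by eventually_elim simp
    qed measurable
    then show ?thesis by simp
  qed
  finally show ?thesis by simp
qed

lemma eq_of_inner: "(\<And>c. inner x c = inner y c) \<Longrightarrow> x = (y :: 'b::real_inner)"
  using inner_eq_zero_iff[of "x - y"] by (simp add: inner_diff_left)

lemma bochner_weak_deriv_prim:
  fixes V :: "real \<Rightarrow> 'b::{real_inner, banach, second_countable_topology}"
  assumes T: "0 < T" and V: "integrable (lebesgue_on {0<..<T}) V"
  shows "bochner_weak_deriv T (\<lambda>t. c + prim T V t) V"
  unfolding bochner_weak_deriv_def
proof (intro allI impI, rule eq_of_inner)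
  fix \<psi> d assume \<psi>: "test_fun {0<..<T} \<psi>"
  obtain \<psi>' where *: "continuous_on UNIV \<psi>'" "deriv \<psi> = \<psi>'" "continuous_on UNIV \<psi>"
    by (rule test_funD[OF \<psi>]) blast
  have i1: "integrable (lebesgue_on {0<..<T}) (\<lambda>t. c + prim T V t)"
    by (intro integrable_continuous_lebesgue_on continuous_intros prim_continuous_on V)
  have "inner (LINT t|lebesgue_on {0<..<T}. deriv \<psi> t *\<^sub>R (c + prim T V t)) d = (LINT t|lebesgue_on {0<..<T}. deriv \<psi> t * (inner c d + prim T (\<lambda>s. inner (V s) d) t))"
    using integral_inner_left[OF integrable_test_scaleR[OF i1 *(1)], of d]
    by (simp add: *(2) inner_add_left prim_inner[OF V])
  also have "\<dots> = - (LINT t|lebesgue_on {0<..<T}. \<psi> t * inner (V t) d)"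
    using V by (intro by_parts_real[OF T _ \<psi>]) simp
  also have "\<dots> = inner (- (LINT t|lebesgue_on {0<..<T}. \<psi> t *\<^sub>R V t)) d"
    using integral_inner_left[OF integrable_test_scaleR[OF V *(3)], of d] by simp
  finally show "inner (LINT t|lebesgue_on {0<..<T}. deriv \<psi> t *\<^sub>R (c + prim T V t)) d = inner (- (LINT t|lebesgue_on {0<..<T}. \<psi> t *\<^sub>R V t)) d" .
qed

lemma test_fun_combine:
  assumes "test_fun S f" "test_fun S (g :: real \<Rightarrow> real)"
  shows "test_fun S (\<lambda>x. f x + k * g x)"
proof -
  obtain K L where "compact K" "K \<subseteq> S" "\<forall>x. x \<notin> K \<longrightarrow> f x = 0" "compact L" "L \<subseteq> S" "\<forall>x. x \<notin> L \<longrightarrow> g x = 0"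
    using assms unfolding test_fun_def by blast
  then show ?thesis using assms unfolding test_fun_def smooth_on_def
    by (intro conjI allI Ck_on_real_add Ck_on_real_mult Ck_on_real_const exI[of _ "K \<union> L"]) auto
qed

lemma integral_test_eq_HK:
  assumes "continuous_on UNIV g"
  shows "(LINT t|lebesgue_on {0<..<T}. g t) = integral {0..T} (g :: real \<Rightarrow> real)"
proof -
  have "g \<in> borel_measurable borel" using assms by (rule borel_measurable_continuous_onI)
  moreover have "set_integrable lborel {0..T} g"
    unfolding set_integrable_def using continuous_on_subset[OF assms] by (intro borel_integrable_compact) auto
  ultimately show ?thesis
    using set_borel_integral_eq_integral(2)[of "{0..T}" g] by (simp add: lebesgue_on_Ioo_borel(2) set_lebesgue_integral_def)
qed

text \<open>A test function \<open>\<psi>\<close> minus a multiple of a fixed one with nonzero integral is the derivative of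
  a test function; hence \<open>u\<close> minus the primitive of \<open>v\<close> is constant.\<close>

lemma weak_deriv_imp_prim:
  fixes u v :: "real \<Rightarrow> 'b::{real_inner, banach, second_countable_topology}"
  assumes T: "0 < T" and u: "integrable (lebesgue_on {0<..<T}) u" and v: "integrable (lebesgue_on {0<..<T}) v"
    and wd: "bochner_weak_deriv T u v"
  obtains c where "AE t in lebesgue_on {0<..<T}. u t = c + prim T v t"
proof -
  let ?M = "lebesgue_on {0<..<T}"
  interpret finite_measure ?M by (rule finite_measure_lebesgue_on_Ioo)
  \<comment> \<open>If every test function had integral 0, the fundamental lemma would apply to the
    constant 1.\<close>
  have "\<exists>\<psi>. test_fun {0<..<T} \<psi> \<and> (LINT t|?M. \<psi> t * 1) \<noteq> 0"
  proof (rule ccontr)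
    assume "\<not> ?thesis"
    then have "AE t in ?M. (1::real) = 0" by (intro fundamental_lemma_real[OF T]) auto
    then have "AE t in lborel. t \<notin> {0<..<T}" unfolding AE_lebesgue_on_Ioo by simp
    then have "emeasure lborel {0<..<T} = 0" by (subst (asm) AE_iff_measurable[of "{0<..<T}"]) auto
    then show False using T by simp
  qed
  then obtain g where g: "test_fun {0<..<T} g" and g0: "(LINT t|?M. g t) \<noteq> 0" by auto
  define p where "p = prim T v"
  have pc: "continuous_on {0..T} p" unfolding p_def by (rule prim_continuous_on[OF v])
  have pi: "integrable ?M p"
    by (rule integrable_continuous_lebesgue_on[OF pc])
  define w where "w t = u t - p t" for t
  have wi: "integrable ?M w" unfolding w_def using u pi by simp
  have tw: "integrable ?M (\<lambda>t. f t *\<^sub>R w t)" "integrable ?M f" if "continuous_on UNIV f" for f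
    using integrable_test_scaleR[OF wi that] integrable_test_scaleR[of T "\<lambda>_. 1::real", OF _ that] by simp_all
  have Dw: "(LINT t|?M. deriv \<Psi> t *\<^sub>R w t) = 0" if \<Psi>: "test_fun {0<..<T} \<Psi>" for \<Psi>
  proof -
    obtain \<Psi>' where *: "continuous_on UNIV \<Psi>'" "deriv \<Psi> = \<Psi>'" by (rule test_funD[OF \<Psi>]) blast
    have "(LINT t|?M. deriv \<Psi> t *\<^sub>R u t) = - (LINT t|?M. \<Psi> t *\<^sub>R v t)" using wd \<Psi> unfolding bochner_weak_deriv_def by blast
    moreover have "(LINT t|?M. deriv \<Psi> t *\<^sub>R p t) = - (LINT t|?M. \<Psi> t *\<^sub>R v t)"
      using bochner_weak_deriv_prim[OF T v, of 0] \<Psi> unfolding bochner_weak_deriv_def p_def by simp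
    moreover have "(LINT t|?M. deriv \<Psi> t *\<^sub>R w t) = (LINT t|?M. deriv \<Psi> t *\<^sub>R u t) - (LINT t|?M. deriv \<Psi> t *\<^sub>R p t)"
      unfolding w_def *(2) scaleR_diff_right using integrable_test_scaleR[OF u *(1)] integrable_test_scaleR[OF pi *(1)]
      by (rule Bochner_Integration.integral_diff)
    ultimately show ?thesis by simp
  qed
  define c where "c = (1 / (LINT t|?M. g t)) *\<^sub>R (LINT t|?M. g t *\<^sub>R w t)"
  have "AE t in ?M. w t - c = 0"
  proof (rule fundamental_lemma[OF T])
    show "integrable ?M (\<lambda>t. w t - c)" using wi by simp
    fix \<psi> assume \<psi>: "test_fun {0<..<T} \<psi>"
    obtain \<psi>' where c1: "continuous_on UNIV \<psi>" by (rule test_funD[OF \<psi>]) blast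
    obtain g' where c2: "continuous_on UNIV g" by (rule test_funD[OF g]) blast
    note cont = c1 c2
    define k where "k = - (LINT t|?M. \<psi> t) / (LINT t|?M. g t)"
    have ft: "test_fun {0<..<T} (\<lambda>x. \<psi> x + k * g x)" by (rule test_fun_combine[OF \<psi> g])
    have "integral {0..T} (\<lambda>x. \<psi> x + k * g x) = (LINT t|?M. \<psi> t + k * g t)"
      using cont by (intro integral_test_eq_HK[symmetric] continuous_intros)
    also have "\<dots> = (LINT t|?M. \<psi> t) + k * (LINT t|?M. g t)" using tw(2)[OF cont(1)] tw(2)[OF cont(2)] by simp
    also have "\<dots> = 0" using g0 by (simp add: k_def)
    finally obtain \<Psi> where \<Psi>: "test_fun {0<..<T} \<Psi>" "deriv \<Psi> = (\<lambda>x. \<psi> x + k * g x)"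
      by (rule test_fun_antiderivative[OF T ft])
    have "0 = (LINT t|?M. (\<psi> t + k * g t) *\<^sub>R w t)" using Dw[OF \<Psi>(1)] unfolding \<Psi>(2) by simp
    also have "\<dots> = (LINT t|?M. \<psi> t *\<^sub>R w t + k *\<^sub>R (g t *\<^sub>R w t))" by (simp add: scaleR_add_left)
    also have "\<dots> = (LINT t|?M. \<psi> t *\<^sub>R w t) + k *\<^sub>R (LINT t|?M. g t *\<^sub>R w t)"
      unfolding Bochner_Integration.integral_add[OF tw(1)[OF cont(1)] integrable_scaleR_right[OF tw(1)[OF cont(2)]]]
        integral_scaleR_right by (rule refl)
    finally have 1: "(LINT t|?M. \<psi> t *\<^sub>R w t) = - (k *\<^sub>R (LINT t|?M. g t *\<^sub>R w t))" by (simp add: eq_neg_iff_add_eq_0)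
    have "(LINT t|?M. \<psi> t *\<^sub>R (w t - c)) = (LINT t|?M. \<psi> t *\<^sub>R w t) - (LINT t|?M. \<psi> t) *\<^sub>R c"
      unfolding scaleR_diff_right using tw[OF cont(1)] by simp
    then show "(LINT t|?M. \<psi> t *\<^sub>R (w t - c)) = 0"
      unfolding 1 by (simp add: c_def k_def)
  qed
  then have "AE t in ?M. u t = c + prim T v t" by eventually_elim (simp add: w_def p_def algebra_simps)
  then show thesis by (rule that)
qed

lemma bochner_weak_deriv_unique:
  fixes u v w :: "real \<Rightarrow> 'b::{real_inner, banach, second_countable_topology}"
  assumes T: "0 < T" and v: "integrable (lebesgue_on {0<..<T}) v" and w: "integrable (lebesgue_on {0<..<T}) w"
    and "bochner_weak_deriv T u v" "bochner_weak_deriv T u w"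
  shows "AE t in lebesgue_on {0<..<T}. v t = w t"
proof -
  have "AE t in lebesgue_on {0<..<T}. v t - w t = 0"
  proof (rule fundamental_lemma[OF T])
    show "integrable (lebesgue_on {0<..<T}) (\<lambda>t. v t - w t)" using v w by simp
    fix \<psi> assume \<psi>: "test_fun {0<..<T} \<psi>"
    obtain \<psi>' where c: "continuous_on UNIV \<psi>" by (rule test_funD[OF \<psi>]) blast
    have "(LINT t|lebesgue_on {0<..<T}. \<psi> t *\<^sub>R v t) = (LINT t|lebesgue_on {0<..<T}. \<psi> t *\<^sub>R w t)"
      using assms(4,5) \<psi> unfolding bochner_weak_deriv_def by (auto dest!: spec[of _ \<psi>])
    then show "(LINT t|lebesgue_on {0<..<T}. \<psi> t *\<^sub>R (v t - w t)) = 0"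
      unfolding scaleR_diff_right using integrable_test_scaleR[OF v c] integrable_test_scaleR[OF w c] by simp
  qed
  then show ?thesis by eventually_elim simp
qed

section \<open>Bochner spaces and their norms\<close>

lemma bochner_L2_integrable:
  assumes "u \<in> bochner_L2 T X"
  shows "integrable (lebesgue_on {0<..<T}) u"
proof -
  interpret finite_measure "lebesgue_on {0<..<T}" by (rule finite_measure_lebesgue_on_Ioo)
  have *: "integrable (lebesgue_on {0<..<T}) (\<lambda>t. 1 + (norm (u t))\<^sup>2)" using assms by (simp add: bochner_L2_def)
  have "x \<le> 1 + x\<^sup>2" for x :: real
    using sum_squares_bound[of x 1] zero_le_power2[of x] unfolding mult_1_right one_power2 by linarith
  then show ?thesis using assms by (intro Bochner_Integration.integrable_bound[OF *]) (auto simp: bochner_L2_def)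
qed

lemma bochner_L2_norm_AE_cong:
  assumes "u \<in> bochner_L2 T X" "v \<in> bochner_L2 T Y" "AE t in lebesgue_on {0<..<T}. u t = v t"
  shows "bochner_L2_norm T u = bochner_L2_norm T v"
proof -
  have "(LINT t|lebesgue_on {0<..<T}. (norm (u t))\<^sup>2) = (LINT t|lebesgue_on {0<..<T}. (norm (v t))\<^sup>2)"
    using assms by (intro integral_cong_AE) (auto simp: bochner_L2_def elim: eventually_mono)
  then show ?thesis by (simp add: bochner_L2_norm_def)
qed

lemma bochner_L2_subset: "u \<in> bochner_L2 T X \<Longrightarrow> u \<in> bochner_L2 T UNIV"
  by (auto simp: bochner_L2_def)

text \<open>Weak derivatives agree almost everywhere, so the one picked by \<open>SOME\<close> has
  the norm of any given one.\<close>

lemma bochner_H1_norm_eq: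
  fixes u v :: "real \<Rightarrow> 'b::{real_inner, banach, second_countable_topology}"
  assumes T: "0 < T" and v: "v \<in> bochner_L2 T X" and wd: "bochner_weak_deriv T u v"
  shows "bochner_H1_norm T u = sqrt ((bochner_L2_norm T u)\<^sup>2 + (bochner_L2_norm T v)\<^sup>2)"
proof -
  define w where "w = (SOME v. v \<in> bochner_L2 T UNIV \<and> bochner_weak_deriv T u v)"
  have "\<exists>v. v \<in> bochner_L2 T UNIV \<and> bochner_weak_deriv T u v"
    using bochner_L2_subset[OF v] wd by (intro exI[of _ v] conjI)
  from someI_ex[OF this] have "w \<in> bochner_L2 T UNIV \<and> bochner_weak_deriv T u w"
    unfolding w_def .
  then have w: "w \<in> bochner_L2 T UNIV" "bochner_weak_deriv T u w" by auto
  have "AE t in lebesgue_on {0<..<T}. w t = v t"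
    by (rule bochner_weak_deriv_unique[OF T bochner_L2_integrable[OF w(1)] bochner_L2_integrable[OF v] w(2) wd])
  then have "bochner_L2_norm T w = bochner_L2_norm T v" by (rule bochner_L2_norm_AE_cong[OF w(1) v])
  then show ?thesis unfolding bochner_H1_norm_def w_def[symmetric] by simp
qed


section \<open>Absolutely continuous functions with vanishing derivative\<close>

lemma mass_add_le:
  assumes "L1_upto T a" "L1_upto T b"
  shows "mass T (\<lambda>x. a x + b x) \<le> mass T a + mass T b"
proof -
  have i: "integrable lborel (\<lambda>s. indicator {0..T} s * \<bar>c s\<bar>)" if "L1_upto T c" for c
    using L1_upto_abs[OF that] by (simp add: L1_upto_def)
  have "mass T (\<lambda>x. a x + b x) \<le> (LINT s|lborel. indicator {0..T} s * \<bar>a s\<bar> + indicator {0..T} s * \<bar>b s\<bar>)"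
    unfolding mass_def using i[OF L1_upto_add[OF assms]] i[OF assms(1)] i[OF assms(2)]
    by (intro integral_mono) (auto simp: indicator_def abs_triangle_ineq)
  also have "\<dots> = mass T a + mass T b" unfolding mass_def by (rule Bochner_Integration.integral_add[OF i[OF assms(1)] i[OF assms(2)]])
  finally show ?thesis .
qed

lemma L1_upto_continuous: "continuous_on UNIV y \<Longrightarrow> L1_upto T y"
  by (rule bdd_upto_imp_L1, rule bdd_upto_continuous) (auto intro: borel_measurable_continuous_onI continuous_on_subset)

text \<open>Truncation at a height M makes z bounded at small cost. The truncated function is an
  almost everywhere limit of continuous ones; these, truncated at the same height, converge in the
  mean by domination.\<close>

lemma continuous_dense_L1:
  assumes z: "L1_upto T z" and e: "0 < e"
  obtains y where "continuous_on UNIV y" "mass T (\<lambda>t. z t - y t) < e"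
proof -
  note [measurable] = L1_upto_measurable[OF z]
  define tr where "tr M x = max (- real M) (min (real M) x)" for M x
  have trb: "\<bar>tr M x\<bar> \<le> real M" for M x by (auto simp: tr_def)
  have [measurable]: "tr M \<in> borel_measurable borel" for M unfolding tr_def by measurable
  have iz: "integrable lborel (\<lambda>s. indicator {0..T} s * \<bar>z s\<bar>)" using L1_upto_abs[OF z] by (simp add: L1_upto_def)
  have "(\<lambda>M. mass T (\<lambda>t. z t - tr M (z t))) \<longlonglongrightarrow> (LINT s::real|lborel. (0::real))"
    unfolding mass_def
  proof (rule integral_dominated_convergence[where w = "\<lambda>s. indicator {0..T} s * \<bar>z s\<bar>"])
    show "AE s in lborel. (\<lambda>M. indicator {0..T} s * \<bar>z s - tr M (z s)\<bar>) \<longlonglongrightarrow> 0"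
    proof (intro AE_I2 tendsto_eventually)
      fix s
      obtain M0 :: nat where "\<bar>z s\<bar> \<le> real M0" using real_arch_simple by blast
      then show "\<forall>\<^sub>F M in sequentially. indicator {0..T} s * \<bar>z s - tr M (z s)\<bar> = 0"
        by (intro eventually_sequentiallyI[of M0]) (auto simp: tr_def)
    qed
    show "AE s in lborel. norm (indicator {0..T} s * \<bar>z s - tr M (z s)\<bar>) \<le> indicator {0..T} s * \<bar>z s\<bar>" for M
      by (intro AE_I2) (auto simp: indicator_def tr_def)
  qed (use iz in auto)
  then have "\<forall>\<^sub>F M in sequentially. mass T (\<lambda>t. z t - tr M (z t)) < e / 2"
    using e by (intro order_tendstoD(2)) auto
  then obtain M where M: "mass T (\<lambda>t. z t - tr M (z t)) < e / 2" by (auto simp: eventually_sequentially)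
  define zM where "zM t = tr M (z t)" for t
  have zMm [measurable]: "zM \<in> borel_measurable borel" unfolding zM_def by measurable
  have zML: "L1_upto T zM"
    by (intro bdd_upto_imp_L1) (auto simp: bdd_upto_def zM_def intro!: trb)
  have "zM measurable_on UNIV"
    using zMm by (intro lebesgue_measurable_imp_measurable_on measurable_completion) auto
  then obtain N g where N: "negligible N" and gc: "\<And>n. continuous_on UNIV (g n)"
    and lim: "\<And>x. x \<notin> N \<Longrightarrow> (\<lambda>n. g n x) \<longlonglongrightarrow> zM x"
    unfolding measurable_on_def by auto
  define h where "h n t = tr M (g n t)" for n t
  have hc: "continuous_on UNIV (h n)" for n unfolding h_def tr_def by (intro continuous_intros gc)
  have [measurable]: "h n \<in> borel_measurable borel" for n using hc by (rule borel_measurable_continuous_onI)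
  have AEN: "AE x in lborel. x \<notin> N"
    using N unfolding negligible_iff_null_sets by (auto dest!: AE_not_in simp: AE_completion_iff)
  have "(\<lambda>n. mass T (\<lambda>t. zM t - h n t)) \<longlonglongrightarrow> (LINT s::real|lborel. (0::real))"
    unfolding mass_def
  proof (rule integral_dominated_convergence[where w = "\<lambda>s. indicator {0..T} s * (2 * real M)"])
    show "AE s in lborel. (\<lambda>n. indicator {0..T} s * \<bar>zM s - h n s\<bar>) \<longlonglongrightarrow> 0"
      using AEN
    proof eventually_elim
      case (elim s)
      have "(\<lambda>n. tr M (g n s)) \<longlonglongrightarrow> tr M (zM s)" unfolding tr_def by (intro tendsto_intros lim elim)
      moreover have "tr M (zM s) = zM s" by (auto simp: zM_def tr_def)
      ultimately have "(\<lambda>n. indicator {0..T} s * \<bar>zM s - h n s\<bar>) \<longlonglongrightarrow> indicator {0..T} s * \<bar>zM s - zM s\<bar>"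
        unfolding h_def by (intro tendsto_intros) simp
      then show ?case by simp
    qed
    show "AE s in lborel. norm (indicator {0..T} s * \<bar>zM s - h n s\<bar>) \<le> indicator {0..T} s * (2 * real M)" for n
    proof (intro AE_I2)
      fix s
      have "\<bar>zM s - h n s\<bar> \<le> 2 * real M" using trb[of M "z s"] trb[of M "g n s"] unfolding zM_def h_def by linarith
      then show "norm (indicator {0..T} s * \<bar>zM s - h n s\<bar>) \<le> indicator {0..T} s * (2 * real M)"
        by (auto simp: indicator_def)
    qed
    show "integrable lborel (\<lambda>s. indicator {0..T} s * (2 * real M))"
      by (intro integrable_indicator_Icc_mult[of _ _ _ "2 * real M"]) auto
  qed auto
  then have "\<forall>\<^sub>F n in sequentially. mass T (\<lambda>t. zM t - h n t) < e / 2"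
    using e by (intro order_tendstoD(2)) auto
  then obtain n where n: "mass T (\<lambda>t. zM t - h n t) < e / 2" by (auto simp: eventually_sequentially)
  have L1: "L1_upto T (\<lambda>t. z t - zM t)" using L1_upto_add[OF z L1_upto_cmult[OF zML, of "-1"]] by simp
  have L2: "L1_upto T (\<lambda>t. zM t - h n t)" using L1_upto_add[OF zML L1_upto_cmult[OF L1_upto_continuous[OF hc, where T = T], of "-1"]] by simp
  have "mass T (\<lambda>t. z t - h n t) < e"
    using mass_add_le[OF L1 L2] M n by (simp add: zM_def)
  with hc show thesis by (rule that)
qed

lemma conv_one_deriv:
  assumes y: "continuous_on {0..T} y" and t: "0 < t" "t < T"
  shows "(conv (\<lambda>_. 1) y has_real_derivative y t) (at t)"
proof -
  have eq: "conv (\<lambda>_. 1) y s = integral {0..s} y" if "s < T" for s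
  proof -
    have "set_integrable lborel {0..s} y"
      unfolding set_integrable_def using continuous_on_subset[OF y, of "{0..s}"] that by (intro borel_integrable_compact) auto
    then show ?thesis using set_borel_integral_eq_integral(2)[of "{0..s}" y] by (simp add: conv_def set_lebesgue_integral_def)
  qed
  have "((\<lambda>s. integral {0..s} y) has_real_derivative y t) (at t within {0..T})"
    using t by (intro integral_has_real_derivative y) auto
  moreover have "at t within {0..T} = at t" using t by (intro at_within_interior) auto
  ultimately have "((\<lambda>s. integral {0..s} y) has_real_derivative y t) (at t)" by simp
  moreover have "\<forall>\<^sub>F s in nhds t. integral {0..s} y = conv (\<lambda>_. 1) y s"
    using t eq by (intro eventually_nhds_in_open[of "{..<T}", THEN eventually_mono]) auto
  ultimately show ?thesis by (subst (asm) DERIV_cong_ev[OF refl _ refl]) auto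
qed

lemma difference_quotient_tendsto:
  assumes "(F has_real_derivative D) (at t)"
  shows "(\<lambda>n. (F (t + 1 / real (Suc n)) - F t) * real (Suc n)) \<longlonglongrightarrow> D"
proof -
  have "filterlim (\<lambda>n. 1 / real (Suc n)) (at 0) sequentially"
    unfolding filterlim_at using LIMSEQ_inverse_real_of_nat by (auto simp: divide_inverse)
  from filterlim_compose[OF assms[unfolded DERIV_def] this]
  show ?thesis by simp
qed

lemma conv_one_diff:
  assumes a: "L1_upto T a" and t: "0 \<le> t" "0 \<le> h" "t + h \<le> T"
  shows "conv (\<lambda>_. 1) a (t + h) - conv (\<lambda>_. 1) a t = (LINT s|lborel. indicator {t<..t+h} s * a s)"
proof -
  have i: "integrable lborel (\<lambda>s. indicator {0..S} s * a s)" if "S \<le> T" for S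
    using L1_upto_mono[OF a that] by (simp add: L1_upto_def)
  have "conv (\<lambda>_. 1) a (t + h) - conv (\<lambda>_. 1) a t = (LINT s|lborel. indicator {0..t+h} s * a s - indicator {0..t} s * a s)"
    unfolding conv_def using i t by (subst Bochner_Integration.integral_diff) auto
  also have "\<dots> = (LINT s|lborel. indicator {t<..t+h} s * a s)"
    using t by (intro Bochner_Integration.integral_cong) (auto simp: indicator_def)
  finally show ?thesis .
qed

text \<open>Tonelli: a point s lies in the window from t to t + h exactly for t in [s - h, s), a set
  of length h.\<close>

lemma nn_integral_window_average:
  assumes [measurable]: "q \<in> borel_measurable borel" and h: "0 \<le> h"
  shows "(\<integral>\<^sup>+t. (\<integral>\<^sup>+s. indicator {t<..t+h} s * q s \<partial>lborel) \<partial>lborel) = ennreal h * (\<integral>\<^sup>+s. q s \<partial>lborel)"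
proof -
  have m: "(\<lambda>(t, s). (if t < s \<and> s \<le> t + h then 1 else 0) * q s) \<in> borel_measurable (lborel \<Otimes>\<^sub>M lborel)"
    by measurable
  have "(\<integral>\<^sup>+t. (\<integral>\<^sup>+s. indicator {t<..t+h} s * q s \<partial>lborel) \<partial>lborel)
      = (\<integral>\<^sup>+t. (\<integral>\<^sup>+s. (if t < s \<and> s \<le> t + h then 1 else 0) * q s \<partial>lborel) \<partial>lborel)"
    by (intro nn_integral_cong) (auto simp: indicator_def)
  also have "\<dots> = (\<integral>\<^sup>+s. (\<integral>\<^sup>+t. (if t < s \<and> s \<le> t + h then 1 else 0) * q s \<partial>lborel) \<partial>lborel)"
    using lborel_pair.Fubini'[OF m] by simp
  also have "\<dots> = (\<integral>\<^sup>+s. ennreal h * q s \<partial>lborel)"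
  proof (intro nn_integral_cong)
    fix s
    have "(\<integral>\<^sup>+t. (if t < s \<and> s \<le> t + h then 1 else 0) * q s \<partial>lborel) = (\<integral>\<^sup>+t. q s * indicator {s-h..<s} t \<partial>lborel)"
      by (intro nn_integral_cong) (auto simp: indicator_def)
    also have "\<dots> = ennreal h * q s" using h by (simp add: nn_integral_cmult_indicator mult.commute)
    finally show "(\<integral>\<^sup>+t. (if t < s \<and> s \<le> t + h then 1 else 0) * q s \<partial>lborel) = ennreal h * q s" .
  qed
  also have "\<dots> = ennreal h * (\<integral>\<^sup>+s. q s \<partial>lborel)" by (rule nn_integral_cmult) simp
  finally show ?thesis .
qed

text \<open>Fatou's lemma for the difference quotients of \<open>\<integral> (y - z)\<close>, which converge to \<open>y\<close> almost
  everywhere and are averages of \<open>y - z\<close>.\<close>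

lemma mass_le_of_deriv_zero:
  assumes z: "L1_upto T z" and S: "0 < S" "S < T"
    and D: "AE t in lborel. t \<in> {0<..<T} \<longrightarrow> (conv (\<lambda>_. 1) z has_real_derivative 0) (at t)"
    and y: "continuous_on UNIV y"
  shows "mass S y \<le> mass T (\<lambda>t. z t - y t)"
proof -
  note [measurable] = L1_upto_measurable[OF z] borel_measurable_continuous_onI[OF y]
  have yL: "L1_upto T y" by (rule L1_upto_continuous[OF y])
  have wL: "L1_upto T (\<lambda>t. y t - z t)" using L1_upto_add[OF yL L1_upto_cmult[OF z, of "-1"]] by simp
  define q where "q s = indicator {0..T} s * \<bar>y s - z s\<bar>" for s
  have [measurable]: "q \<in> borel_measurable borel" unfolding q_def by measurable
  have qi: "integrable lborel q" using L1_upto_abs[OF wL] by (simp add: L1_upto_def q_def[abs_def])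
  have qnn: "0 \<le> q s" for s by (simp add: q_def)
  have qm: "(LINT s|lborel. q s) = mass T (\<lambda>t. z t - y t)" by (simp add: q_def mass_def abs_minus_commute)
  define Y where "Y = conv (\<lambda>_. 1) y"
  define Z where "Z = conv (\<lambda>_. 1) z"
  have [measurable]: "Y \<in> borel_measurable borel" "Z \<in> borel_measurable borel" unfolding Y_def Z_def by measurable
  define A where "A n t = indicator {0<..<S} t * \<bar>(Y (t + 1 / real (Suc n)) - Y t) * real (Suc n) - (Z (t + 1 / real (Suc n)) - Z t) * real (Suc n)\<bar>" for n t
  have [measurable]: "A n \<in> borel_measurable borel" for n unfolding A_def by measurable
  have lim: "AE t in lborel. ennreal (indicator {0<..<S} t * \<bar>y t\<bar>) = liminf (\<lambda>n. ennreal (A n t))"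
    using D
  proof eventually_elim
    case (elim t)
    have "(\<lambda>n. A n t) \<longlonglongrightarrow> indicator {0<..<S} t * \<bar>y t\<bar>"
    proof (cases "t \<in> {0<..<S}")
      case True
      then have "(\<lambda>n. \<bar>(Y (t + 1 / real (Suc n)) - Y t) * real (Suc n) - (Z (t + 1 / real (Suc n)) - Z t) * real (Suc n)\<bar>) \<longlonglongrightarrow> \<bar>y t - 0\<bar>"
        using elim S continuous_on_subset[OF y, of "{0..T}"] unfolding Y_def Z_def
          by (intro tendsto_intros difference_quotient_tendsto conv_one_deriv[of T]) auto
      then show ?thesis using True by (simp add: A_def)
    qed (simp add: A_def)
    then have "(\<lambda>n. ennreal (A n t)) \<longlonglongrightarrow> ennreal (indicator {0<..<S} t * \<bar>y t\<bar>)" by (rule tendsto_ennrealI)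
    then show ?case by (intro lim_imp_Liminf[symmetric]) auto
  qed
  \<comment> \<open>From \<open>n0\<close> on, windows that start in (0,S) stay inside [0,T], where
    z is integrable.\<close>
  obtain n0 where n0: "\<And>n. n \<ge> n0 \<Longrightarrow> 1 / real (Suc n) < T - S"
  proof -
    have "(\<lambda>n. 1 / real (Suc n)) \<longlonglongrightarrow> 0" using LIMSEQ_inverse_real_of_nat by (simp add: divide_inverse)
    then have "\<forall>\<^sub>F n in sequentially. 1 / real (Suc n) < T - S" using S by (intro order_tendstoD(2)) auto
    then show thesis using that unfolding eventually_sequentially by blast
  qed
  have Ab: "(\<integral>\<^sup>+t. ennreal (A n t) \<partial>lborel) \<le> ennreal (LINT s|lborel. q s)" if n: "n \<ge> n0" for n
  proof -
    define h where "h = 1 / real (Suc n)"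
    have h: "0 < h" "h < T - S" using n0[OF n] by (auto simp: h_def)
    have pt: "ennreal (A n t) \<le> ennreal (real (Suc n)) * (\<integral>\<^sup>+s. indicator {t<..t+h} s * ennreal (q s) \<partial>lborel)" for t
    proof (cases "t \<in> {0<..<S}")
      case True
      then have t: "0 \<le> t" "0 \<le> h" "t + h \<le> T" using h by auto
      have iw: "integrable lborel (\<lambda>s. indicator {t<..t+h} s * q s)" using integrable_mult_indicator[OF _ qi, of "{t<..t+h}"] by simp
      have "(Y (t + h) - Y t) * real (Suc n) - (Z (t + h) - Z t) * real (Suc n) = real (Suc n) * ((Y (t + h) - Z (t + h)) - (Y t - Z t))"
        by (simp add: algebra_simps)
      also have "Y x - Z x = conv (\<lambda>_. 1) (\<lambda>s. y s - z s) x" if "x \<le> T" for x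
      proof -
        have "integrable lborel (\<lambda>s. indicator {0..x} s * y s)" "integrable lborel (\<lambda>s. indicator {0..x} s * z s)"
          using L1_upto_mono[OF yL that] L1_upto_mono[OF z that] by (auto simp: L1_upto_def)
        then show ?thesis unfolding Y_def Z_def conv_def
          by (subst Bochner_Integration.integral_diff[symmetric]) (auto simp: right_diff_distrib)
      qed
      then have "(Y (t + h) - Z (t + h)) - (Y t - Z t) = conv (\<lambda>_. 1) (\<lambda>s. y s - z s) (t + h) - conv (\<lambda>_. 1) (\<lambda>s. y s - z s) t"
        using t by simp
      also have "\<dots> = (LINT s|lborel. indicator {t<..t+h} s * (y s - z s))" by (rule conv_one_diff[OF wL t])
      finally have eq: "(Y (t + h) - Y t) * real (Suc n) - (Z (t + h) - Z t) * real (Suc n) = real (Suc n) * (LINT s|lborel. indicator {t<..t+h} s * (y s - z s))" .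
      have "A n t = \<bar>(Y (t + h) - Y t) * real (Suc n) - (Z (t + h) - Z t) * real (Suc n)\<bar>"
        using True unfolding A_def h_def by (simp del: of_nat_Suc)
      also have "\<dots> = real (Suc n) * \<bar>LINT s|lborel. indicator {t<..t+h} s * (y s - z s)\<bar>"
        unfolding eq abs_mult by simp
      also have "\<dots> \<le> real (Suc n) * (LINT s|lborel. indicator {t<..t+h} s * q s)"
      proof (rule mult_left_mono)
        have "\<bar>LINT s|lborel. indicator {t<..t+h} s * (y s - z s)\<bar> \<le> (LINT s|lborel. \<bar>indicator {t<..t+h} s * (y s - z s)\<bar>)"
          by (rule integral_abs_bound)
        also have "\<dots> = (LINT s|lborel. indicator {t<..t+h} s * q s)"
          using t by (intro Bochner_Integration.integral_cong) (auto simp: indicator_def q_def)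
        finally show "\<bar>LINT s|lborel. indicator {t<..t+h} s * (y s - z s)\<bar> \<le> (LINT s|lborel. indicator {t<..t+h} s * q s)" .
      qed simp
      finally have "ennreal (A n t) \<le> ennreal (real (Suc n)) * ennreal (LINT s|lborel. indicator {t<..t+h} s * q s)"
        by (subst ennreal_mult[symmetric]) (auto intro!: ennreal_leI Bochner_Integration.integral_nonneg mult_nonneg_nonneg qnn)
      also have "ennreal (LINT s|lborel. indicator {t<..t+h} s * q s) = (\<integral>\<^sup>+s. ennreal (indicator {t<..t+h} s * q s) \<partial>lborel)"
        using qnn by (intro nn_integral_eq_integral[symmetric] iw) auto
      also have "\<dots> = (\<integral>\<^sup>+s. indicator {t<..t+h} s * ennreal (q s) \<partial>lborel)"
        by (intro nn_integral_cong) (auto simp: indicator_def)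
      finally show ?thesis .
    qed (simp add: A_def)
    have "(\<integral>\<^sup>+t. ennreal (A n t) \<partial>lborel) \<le> (\<integral>\<^sup>+t. ennreal (real (Suc n)) * (\<integral>\<^sup>+s. indicator {t<..t+h} s * ennreal (q s) \<partial>lborel) \<partial>lborel)"
      by (intro nn_integral_mono pt)
    also have "\<dots> = ennreal (real (Suc n)) * (\<integral>\<^sup>+t. (\<integral>\<^sup>+s. indicator {t<..t+h} s * ennreal (q s) \<partial>lborel) \<partial>lborel)"
    proof (rule nn_integral_cmult)
      have "(\<lambda>t. \<integral>\<^sup>+s. (if t < s \<and> s \<le> t + h then 1 else 0) * ennreal (q s) \<partial>lborel) \<in> borel_measurable lborel" by measurable
      then show "(\<lambda>t. \<integral>\<^sup>+s. indicator {t<..t+h} s * ennreal (q s) \<partial>lborel) \<in> borel_measurable lborel"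
        by (simp add: indicator_def)
    qed
    also have "\<dots> = ennreal (real (Suc n)) * (ennreal h * (\<integral>\<^sup>+s. ennreal (q s) \<partial>lborel))"
      using h by (subst nn_integral_window_average) auto
    also have "\<dots> = ennreal (real (Suc n) * h) * (\<integral>\<^sup>+s. ennreal (q s) \<partial>lborel)"
      using h by (subst ennreal_mult) (auto simp: mult.assoc)
    also have "real (Suc n) * h = 1" by (simp add: h_def)
    also have "(\<integral>\<^sup>+s. ennreal (q s) \<partial>lborel) = ennreal (LINT s|lborel. q s)"
      using qnn by (intro nn_integral_eq_integral qi) auto
    finally show ?thesis by simp
  qed
  have "(\<integral>\<^sup>+t. ennreal (indicator {0<..<S} t * \<bar>y t\<bar>) \<partial>lborel) = (\<integral>\<^sup>+t. liminf (\<lambda>n. ennreal (A n t)) \<partial>lborel)"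
    by (rule nn_integral_cong_AE[OF lim])
  also have "\<dots> \<le> liminf (\<lambda>n. \<integral>\<^sup>+t. ennreal (A n t) \<partial>lborel)" by (rule nn_integral_liminf) measurable
  also have "\<dots> \<le> ennreal (LINT s|lborel. q s)"
    by (intro Liminf_le eventually_sequentiallyI[of n0] Ab) auto
  finally have le: "(\<integral>\<^sup>+t. ennreal (indicator {0<..<S} t * \<bar>y t\<bar>) \<partial>lborel) \<le> ennreal (LINT s|lborel. q s)" .
  have "integrable lborel (\<lambda>t. indicator {0..S} t * \<bar>y t\<bar>)"
    using L1_upto_abs[OF L1_upto_continuous[OF y, of S]] by (simp add: L1_upto_def)
  then have "ennreal (mass S y) = (\<integral>\<^sup>+t. ennreal (indicator {0..S} t * \<bar>y t\<bar>) \<partial>lborel)"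
    unfolding mass_def by (intro nn_integral_eq_integral[symmetric]) auto
  also have "\<dots> = (\<integral>\<^sup>+t. ennreal (indicator {0<..<S} t * \<bar>y t\<bar>) \<partial>lborel)"
    using AE_indicator_Icc_Ioo[of 0 S] by (intro nn_integral_cong_AE) (auto elim: eventually_mono)
  finally have "ennreal (mass S y) \<le> ennreal (mass T (\<lambda>t. z t - y t))" using le qm by simp
  then show ?thesis using mass_nonneg by (simp add: ennreal_le_iff)
qed

text \<open>By \<open>mass_le_of_deriv_zero\<close> a continuous y has mass on [0,S] at most its
  distance to z; hence z has mass at most twice that distance, which is arbitrarily small.\<close>

lemma AE_zero_of_deriv_zero:
  assumes z: "L1_upto T z"
    and D: "AE t in lborel. t \<in> {0<..<T} \<longrightarrow> (conv (\<lambda>_. 1) z has_real_derivative 0) (at t)"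
  shows "AE t in lborel. t \<in> {0<..<T} \<longrightarrow> z t = 0"
proof -
  have mass0: "mass S z = 0" if S: "0 < S" "S < T" for S
  proof -
    have "mass S z \<le> e" if e: "0 < e" for e
    proof -
      have "0 < e / 2" using e by simp
      then obtain y where y: "continuous_on UNIV y" "mass T (\<lambda>t. z t - y t) < e / 2" by (rule continuous_dense_L1[OF z])
      have yL: "L1_upto T y" by (rule L1_upto_continuous[OF y(1)])
      have wL: "L1_upto T (\<lambda>t. z t - y t)" using L1_upto_add[OF z L1_upto_cmult[OF yL, of "-1"]] by simp
      have "mass S z \<le> mass S (\<lambda>t. z t - y t) + mass S y"
        using mass_add_le[OF L1_upto_mono[OF wL, of S] L1_upto_mono[OF yL, of S]] S by simp
      also have "mass S (\<lambda>t. z t - y t) \<le> mass T (\<lambda>t. z t - y t)" using S by (intro mass_mono[OF wL]) auto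
      also have "mass S y \<le> mass T (\<lambda>t. z t - y t)" by (rule mass_le_of_deriv_zero[OF z S D y(1)])
      finally show ?thesis using y(2) by simp
    qed
    then have "mass S z \<le> 0" by (rule field_le_epsilon[of _ 0, simplified])
    then show ?thesis using mass_nonneg[of S z] by simp
  qed
  \<comment> \<open>The estimate requires S < T; these intervals exhaust (0,T).\<close>
  have "AE t in lborel. t \<in> {0<..<T - 1 / real (Suc n)} \<longrightarrow> z t = 0" for n
  proof (cases "0 < T - 1 / real (Suc n)")
    case True
    define S where "S = T - 1 / real (Suc n)"
    have S: "0 < S" "S < T" using True by (auto simp: S_def)
    have i: "integrable lborel (\<lambda>s. indicator {0..S} s * \<bar>z s\<bar>)"
      using L1_upto_abs[OF L1_upto_mono[OF z, of S]] S by (simp add: L1_upto_def)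
    have "AE s in lborel. indicator {0..S} s * \<bar>z s\<bar> = 0"
      using mass0[OF S] unfolding mass_def by (subst (asm) integral_nonneg_eq_0_iff_AE[OF i]) auto
    then show ?thesis unfolding S_def[symmetric] by eventually_elim (auto simp: indicator_def)
  qed auto
  then have "AE t in lborel. \<forall>n. t \<in> {0<..<T - 1 / real (Suc n)} \<longrightarrow> z t = 0" by (subst AE_all_countable) auto
  then show ?thesis
  proof eventually_elim
    case (elim t)
    show ?case
    proof
      assume t: "t \<in> {0<..<T}"
      then obtain n where "inverse (real (Suc n)) < T - t" using reals_Archimedean[of "T - t"] by auto
      then have "t \<in> {0<..<T - 1 / real (Suc n)}" using t by (simp add: inverse_eq_divide)
      then show "z t = 0" using elim by blast
    qed
  qed
qed


section \<open>Modes and orthonormal expansions\<close>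

lemma mass_one: "0 \<le> T \<Longrightarrow> mass T (\<lambda>_. 1) = T"
  by (simp add: mass_def)

lemma conv_at_zero: "conv a b 0 = 0"
proof -
  have "conv a b 0 = (LINT s::real|lborel. 0)"
    unfolding conv_def
  proof (rule integral_cong_AE)
    have "(\<lambda>s::real. indicator {0..0} s * (a (0 - s) * b s)) = (\<lambda>s. indicator {0} s * (a 0 * b 0))"
      by (auto simp: indicator_def fun_eq_iff)
    then show "(\<lambda>s::real. indicator {0..0} s * (a (0 - s) * b s)) \<in> borel_measurable lborel" by simp
    show "AE s in lborel. indicator {0..0::real} s * (a (0 - s) * b s) = 0"
      using AE_lborel_singleton[of 0] by eventually_elim auto
  qed simp
  then show ?thesis by simp
qed

text \<open>Carrying out the outer integration gives x + l (K * x) = c + 1 * f with K = 1 * k, so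
  the difference of two solutions satisfies the homogeneous equation.\<close>

lemma volterra_mode_unique:
  assumes k: "L1_upto T k" and f: "L1_upto T f"
    and g: "g \<in> borel_measurable borel" "continuous_on {0..T} g"
    and h: "h \<in> borel_measurable borel" "continuous_on {0..T} h"
    and eg: "\<And>t. t \<in> {0..T} \<Longrightarrow> g t = c + conv (\<lambda>_. 1) (\<lambda>s. f s + (- l) * conv k g s) t"
    and eh: "\<And>t. t \<in> {0..T} \<Longrightarrow> h t = c + conv (\<lambda>_. 1) (\<lambda>s. f s + (- l) * conv k h s) t"
    and t: "t \<in> {0..T}"
  shows "g t = h t"
proof -
  have one: "L1_upto T (\<lambda>_. 1)" by (intro bdd_upto_imp_L1 bdd_upto_const)
  define K where "K = conv (\<lambda>_. 1) k"
  have K: "L1_upto T K"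
  proof -
    have "K = conv k (\<lambda>_. 1)" unfolding K_def by (rule ext) (rule conv_commute)
    then show ?thesis using bdd_upto_imp_L1[OF bdd_upto_conv[OF k bdd_upto_const]] by simp
  qed
  have expand: "x s = c + conv (\<lambda>_. 1) f s + (- l) * conv K x s"
    if x: "x \<in> borel_measurable borel" "continuous_on {0..T} x"
      and ex: "\<And>t. t \<in> {0..T} \<Longrightarrow> x t = c + conv (\<lambda>_. 1) (\<lambda>s. f s + (- l) * conv k x s) t" and s: "s \<in> {0..T}" for x s
  proof -
    have sT: "s \<le> T" using s by simp
    have bx: "bdd_upto T x" by (rule bdd_upto_continuous[OF x])
    have bk: "bdd_upto T (\<lambda>s. (- l) * conv k x s)" by (intro bdd_upto_cmult bdd_upto_conv k bx)
    have "conv (\<lambda>_. 1) (\<lambda>s. f s + (- l) * conv k x s) s = conv (\<lambda>s. f s + (- l) * conv k x s) (\<lambda>_. 1) s" by (rule conv_commute)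
    also have "\<dots> = conv f (\<lambda>_. 1) s + conv (\<lambda>s. (- l) * conv k x s) (\<lambda>_. 1) s"
      by (rule conv_add_left[OF f bdd_upto_imp_L1[OF bk] bdd_upto_const sT])
    also have "conv f (\<lambda>_. 1) s = conv (\<lambda>_. 1) f s" by (rule conv_commute)
    also have "conv (\<lambda>s. (- l) * conv k x s) (\<lambda>_. 1) s = (- l) * conv (conv k x) (\<lambda>_. 1) s" by (rule conv_cmult_left)
    also have "conv (conv k x) (\<lambda>_. 1) s = conv (\<lambda>_. 1) (conv k x) s" by (rule conv_commute)
    also have "\<dots> = conv K x s" unfolding K_def by (rule conv_assoc[OF one k bx sT])
    finally show ?thesis using ex[OF s] by simp
  qed
  define e where "e = (\<lambda>s. g s + (-1) * h s)"
  have "e t = 0"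
  proof (rule volterra_integrated_unique[OF K _ _ _ t])
    show "e \<in> borel_measurable borel" unfolding e_def using g h by measurable
    show "continuous_on {0..T} e" unfolding e_def by (intro continuous_intros g h)
    fix s assume s: "s \<in> {0..T}"
    then have sT: "s \<le> T" by simp
    have ce: "conv K e s = conv K g s + (-1) * conv K h s"
      unfolding e_def conv_add_right[OF K bdd_upto_continuous[OF g] bdd_upto_cmult[OF bdd_upto_continuous[OF h]] sT] conv_cmult_right
      by (rule refl)
    show "e s + l * conv K e s = 0"
      unfolding ce using expand[OF g eg s] expand[OF h eh s] by (simp add: e_def algebra_simps)
  qed
  then show ?thesis by (simp add: e_def)
qed

text \<open>An almost everywhere derivative determines a function up to a constant only under
  absolute continuity, which is what \<open>z\<close> provides: the primitive of z - R has
  derivative 0 almost everywhere, so z = R almost everywhere.\<close>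

lemma AE_deriv_imp_integral:
  assumes z: "L1_upto T z" and R: "R \<in> borel_measurable borel" "continuous_on {0..T} R"
    and g: "\<And>t. t \<in> {0..T} \<Longrightarrow> g t = c + conv (\<lambda>_. 1) z t"
    and D: "AE t in lebesgue_on {0<..<T}. (g has_real_derivative R t) (at t)"
    and t: "t \<in> {0..T}"
  shows "g t = c + conv (\<lambda>_. 1) R t"
proof -
  have RL: "L1_upto T R" by (intro bdd_upto_imp_L1 bdd_upto_continuous R)
  have wL: "L1_upto T (\<lambda>t. z t - R t)" using L1_upto_add[OF z L1_upto_cmult[OF RL, of "-1"]] by simp
  have split: "conv (\<lambda>_. 1) (\<lambda>t. z t - R t) s = conv (\<lambda>_. 1) z s - conv (\<lambda>_. 1) R s" if "s \<le> T" for s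
  proof -
    have "integrable lborel (\<lambda>x. indicator {0..s} x * z x)" "integrable lborel (\<lambda>x. indicator {0..s} x * R x)"
      using L1_upto_mono[OF z that] L1_upto_mono[OF RL that] by (auto simp: L1_upto_def)
    then show ?thesis unfolding conv_def
      by (subst Bochner_Integration.integral_diff[symmetric]) (auto simp: right_diff_distrib)
  qed
  have "AE t in lborel. t \<in> {0<..<T} \<longrightarrow> z t - R t = 0"
  proof (rule AE_zero_of_deriv_zero[OF wL])
    show "AE t in lborel. t \<in> {0<..<T} \<longrightarrow> (conv (\<lambda>_. 1) (\<lambda>t. z t - R t) has_real_derivative 0) (at t)"
      using D unfolding AE_lebesgue_on_Ioo
    proof eventually_elim
      case (elim t)
      show ?case
      proof
        assume t: "t \<in> {0<..<T}"
        have 1: "(g has_real_derivative R t) (at t)" using elim t by simp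
        have 2: "(conv (\<lambda>_. 1) R has_real_derivative R t) (at t)" using t by (intro conv_one_deriv[OF R(2)]) auto
        have 3: "((\<lambda>t. g t - c - conv (\<lambda>_. 1) R t) has_real_derivative 0) (at t)"
          using DERIV_diff[OF DERIV_diff[OF 1 DERIV_const] 2] by simp
        have "\<forall>\<^sub>F s in nhds t. g s - c - conv (\<lambda>_. 1) R s = conv (\<lambda>_. 1) (\<lambda>t. z t - R t) s"
          using t by (intro eventually_nhds_in_open[of "{0<..<T}", THEN eventually_mono]) (auto simp: g split)
        then show "(conv (\<lambda>_. 1) (\<lambda>t. z t - R t) has_real_derivative 0) (at t)"
          using 3 by (subst (asm) DERIV_cong_ev[OF refl _ refl]) auto
      qed
    qed
  qed
  then have ae: "AE s in lborel. s \<in> {0<..<T} \<longrightarrow> z s = R s" by eventually_elim simp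
  have "conv (\<lambda>_. 1) z t = conv (\<lambda>_. 1) R t"
    unfolding conv_def
  proof (rule integral_cong_AE)
    show "AE s in lborel. indicator {0..t} s * (1 * z s) = indicator {0..t} s * (1 * R s)"
      using ae AE_lborel_singleton[of 0] AE_lborel_singleton[of T]
      by eventually_elim (use t in \<open>auto simp: indicator_def\<close>)
  qed (use L1_upto_measurable[OF z] R(1) in measurable)
  then show ?thesis using g[OF t] by simp
qed

lemma continuous_AE_eq:
  fixes g h :: "real \<Rightarrow> 'b::real_normed_vector"
  assumes T: "0 < T" and g: "continuous_on {0..T} g" and h: "continuous_on {0..T} h"
    and ae: "AE t in lebesgue_on {0<..<T}. g t = h t" and t: "t \<in> {0..T}"
  shows "g t = h t"
proof (rule ccontr)
  assume ne: "g t \<noteq> h t"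
  have "continuous_on {0..T} (\<lambda>s. norm (g s - h s))" by (intro continuous_intros g h)
  moreover have "0 < norm (g t - h t)" using ne by simp
  ultimately obtain d where d: "d > 0" "\<And>s. s \<in> {0..T} \<Longrightarrow> dist s t < d \<Longrightarrow> dist (norm (g s - h s)) (norm (g t - h t)) < norm (g t - h t)"
    using t unfolding continuous_on_iff by blast
  have neq: "g s \<noteq> h s" if "s \<in> {0..T}" "dist s t < d" for s
    using d(2)[OF that] by (auto simp: dist_real_def)
  define a where "a = max 0 (t - d)"
  define b where "b = min T (t + d)"
  have ab: "a < b" using t d(1) T by (auto simp: a_def b_def)
  have "AE s in lborel. s \<notin> {a<..<b}"
    using ae unfolding AE_lebesgue_on_Ioo
    by eventually_elim (use neq in \<open>auto simp: a_def b_def dist_real_def abs_less_iff\<close>)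
  then have "emeasure lborel {a<..<b} = 0" by (subst (asm) AE_iff_measurable[of "{a<..<b}"]) auto
  then show False using ab by simp
qed

section \<open>Orthonormal expansions\<close>

definition partial_proj :: "(nat \<Rightarrow> 'b::real_inner) \<Rightarrow> nat \<Rightarrow> 'b \<Rightarrow> 'b" where
  "partial_proj \<phi> n x = (\<Sum>i<n. inner x (\<phi> i) *\<^sub>R \<phi> i)"

lemma norm_sum_orthonormal:
  fixes \<phi> :: "nat \<Rightarrow> 'b::real_inner"
  assumes "\<And>i j. inner (\<phi> i) (\<phi> j) = (if i = j then 1 else 0)" "finite I"
  shows "(norm (\<Sum>i\<in>I. c i *\<^sub>R \<phi> i))\<^sup>2 = (\<Sum>i\<in>I. (c i)\<^sup>2)"
proof -
  have "(norm (\<Sum>i\<in>I. c i *\<^sub>R \<phi> i))\<^sup>2 = (\<Sum>i\<in>I. \<Sum>j\<in>I. c i * (c j * inner (\<phi> i) (\<phi> j)))"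
    by (simp add: power2_norm_eq_inner inner_sum_left inner_sum_right sum_distrib_left inner_commute mult.left_commute)
  also have "\<dots> = (\<Sum>i\<in>I. \<Sum>j\<in>I. if i = j then c i * c j else 0)"
    by (intro sum.cong) (auto simp: assms(1))
  also have "\<dots> = (\<Sum>i\<in>I. (c i)\<^sup>2)"
    using assms(2) by (intro sum.cong) (auto simp: power2_eq_square)
  finally show ?thesis .
qed

lemma inner_sum_orthonormal:
  fixes \<phi> :: "nat \<Rightarrow> 'b::real_inner"
  assumes "\<And>i j. inner (\<phi> i) (\<phi> j) = (if i = j then 1 else 0)" "finite I"
  shows "inner (\<Sum>i\<in>I. c i *\<^sub>R \<phi> i) (\<phi> k) = (if k \<in> I then c k else 0)"
proof -
  have "inner (\<Sum>i\<in>I. c i *\<^sub>R \<phi> i) (\<phi> k) = (\<Sum>i\<in>I. if i = k then c i else 0)"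
    unfolding inner_sum_left by (intro sum.cong) (auto simp: assms(1))
  then show ?thesis using assms(2) by simp
qed

lemma norm_partial_proj:
  fixes \<phi> :: "nat \<Rightarrow> 'b::real_inner"
  assumes on: "\<And>i j. inner (\<phi> i) (\<phi> j) = (if i = j then 1 else 0)"
  shows "(norm (partial_proj \<phi> n x))\<^sup>2 = (\<Sum>i<n. (inner x (\<phi> i))\<^sup>2)"
    and "(\<Sum>i<n. (inner x (\<phi> i))\<^sup>2) \<le> (norm x)\<^sup>2"
    and "norm (partial_proj \<phi> n x) \<le> norm x"
proof -
  show 1: "(norm (partial_proj \<phi> n x))\<^sup>2 = (\<Sum>i<n. (inner x (\<phi> i))\<^sup>2)"
    unfolding partial_proj_def by (rule norm_sum_orthonormal[OF on]) auto
  have "inner x (partial_proj \<phi> n x) = (\<Sum>i<n. (inner x (\<phi> i))\<^sup>2)"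
    unfolding partial_proj_def by (simp add: inner_sum_right power2_eq_square)
  then have "(norm (x - partial_proj \<phi> n x))\<^sup>2 = (norm x)\<^sup>2 - (\<Sum>i<n. (inner x (\<phi> i))\<^sup>2)"
    using 1 by (simp add: power2_norm_eq_inner inner_diff_left inner_diff_right inner_commute)
  then show 2: "(\<Sum>i<n. (inner x (\<phi> i))\<^sup>2) \<le> (norm x)\<^sup>2"
    using zero_le_power2[of "norm (x - partial_proj \<phi> n x)"] by linarith
  show "norm (partial_proj \<phi> n x) \<le> norm x"
    by (rule power2_le_imp_le) (use 1 2 in auto)
qed

text \<open>Convergence is immediate on the span and passes to the closure because the projections
  have norm at most 1.\<close>

lemma partial_proj_tendsto:
  fixes \<phi> :: "nat \<Rightarrow> 'b::real_inner"
  assumes on: "\<And>i j. inner (\<phi> i) (\<phi> j) = (if i = j then 1 else 0)"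
    and x: "x \<in> closure (span (range \<phi>))"
  shows "(\<lambda>n. partial_proj \<phi> n x) \<longlonglongrightarrow> x"
proof -
  define C where "C = {x. (\<lambda>n. partial_proj \<phi> n x) \<longlonglongrightarrow> x}"
  have add: "partial_proj \<phi> n (x + y) = partial_proj \<phi> n x + partial_proj \<phi> n y" for n x y
    by (simp add: partial_proj_def inner_add_left scaleR_add_left sum.distrib)
  have scale: "partial_proj \<phi> n (c *\<^sub>R x) = c *\<^sub>R partial_proj \<phi> n x" for n c x
    by (simp add: partial_proj_def scaleR_sum_right)
  have "subspace C"
    unfolding subspace_def C_def by (auto simp: add scale partial_proj_def[of _ _ 0] intro!: tendsto_intros)
  moreover have "\<phi> k \<in> C" for k
  proof -
    have "partial_proj \<phi> n (\<phi> k) = \<phi> k" if "n \<ge> Suc k" for n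
    proof -
      have "partial_proj \<phi> n (\<phi> k) = (\<Sum>i<n. if i = k then \<phi> i else 0)"
        unfolding partial_proj_def by (intro sum.cong) (auto simp: on)
      then show ?thesis using that by simp
    qed
    then show ?thesis unfolding C_def
      by (auto intro!: tendsto_eventually eventually_sequentiallyI[of "Suc k"])
  qed
  ultimately have sC: "span (range \<phi>) \<subseteq> C" by (intro span_minimal) auto
  have "x \<in> C"
    unfolding C_def
  proof (intro CollectI LIMSEQ_I)
    fix e :: real assume e: "0 < e"
    then obtain y where y: "y \<in> span (range \<phi>)" "dist y x < e / 3"
      using x closure_approachable[of x] by (metis zero_less_divide_iff zero_less_numeral)
    have "(\<lambda>n. partial_proj \<phi> n y) \<longlonglongrightarrow> y" using y(1) sC by (auto simp: C_def)
    then obtain N where N: "\<And>n. n \<ge> N \<Longrightarrow> norm (partial_proj \<phi> n y - y) < e / 3"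
      using LIMSEQ_D[of _ y "e / 3"] e by auto
    have "norm (partial_proj \<phi> n x - x) < e" if n: "n \<ge> N" for n
    proof -
      have "partial_proj \<phi> n x - x = partial_proj \<phi> n (x - y) + ((partial_proj \<phi> n y - y) + (y - x))"
        using add[of n "x - y" y] by simp
      also have "norm \<dots> \<le> norm (partial_proj \<phi> n (x - y)) + (norm (partial_proj \<phi> n y - y) + norm (y - x))"
        by (intro order_trans[OF norm_triangle_ineq] add_left_mono norm_triangle_ineq)
      also have "norm (partial_proj \<phi> n (x - y)) \<le> norm (x - y)" by (rule norm_partial_proj(3)[OF on])
      finally show ?thesis using N[OF n] y(2) by (simp add: dist_norm norm_minus_commute)
    qed
    then show "\<exists>N. \<forall>n\<ge>N. norm (partial_proj \<phi> n x - x) < e" by blast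
  qed
  then show ?thesis by (simp add: C_def)
qed

lemma parseval:
  fixes \<phi> :: "nat \<Rightarrow> 'b::real_inner"
  assumes on: "\<And>i j. inner (\<phi> i) (\<phi> j) = (if i = j then 1 else 0)"
    and x: "x \<in> closure (span (range \<phi>))"
  shows "(\<lambda>n. \<Sum>i<n. (inner x (\<phi> i))\<^sup>2) \<longlonglongrightarrow> (norm x)\<^sup>2"
  unfolding norm_partial_proj(1)[OF on, symmetric]
  by (intro tendsto_intros partial_proj_tendsto[OF on x])

text \<open>The Riesz-Fischer theorem: by orthonormality the squared norm of a block of the series
  is the same block of the sum of (c i)^2.\<close>

lemma orthonormal_series_converges:
  fixes \<phi> :: "nat \<Rightarrow> 'b::{real_inner, banach}"
  assumes on: "\<And>i j. inner (\<phi> i) (\<phi> j) = (if i = j then 1 else 0)" and c: "summable (\<lambda>i. (c i)\<^sup>2)"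
  shows "\<exists>x. (\<lambda>n. \<Sum>i<n. c i *\<^sub>R \<phi> i) \<longlonglongrightarrow> x \<and> (\<forall>i. inner x (\<phi> i) = c i) \<and> (norm x)\<^sup>2 = (\<Sum>i. (c i)\<^sup>2) \<and>
     x \<in> closure (span (range \<phi>))"
proof -
  have "summable (\<lambda>i. c i *\<^sub>R \<phi> i)"
    unfolding summable_Cauchy
  proof (intro allI impI)
    fix e :: real assume e: "0 < e"
    then have "0 < e\<^sup>2" by simp
    then obtain N where N: "\<And>m n. m \<ge> N \<Longrightarrow> norm (\<Sum>i=m..<n. (c i)\<^sup>2) < e\<^sup>2"
      using c unfolding summable_Cauchy by metis
    have "norm (\<Sum>i=m..<n. c i *\<^sub>R \<phi> i) < e" if "m \<ge> N" for m n
    proof (rule power2_less_imp_less)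
      show "(norm (\<Sum>i=m..<n. c i *\<^sub>R \<phi> i))\<^sup>2 < e\<^sup>2"
        using N[OF that, of n] by (simp add: norm_sum_orthonormal[OF on])
    qed (use e in simp)
    then show "\<exists>N. \<forall>m\<ge>N. \<forall>n. norm (\<Sum>i=m..<n. c i *\<^sub>R \<phi> i) < e" by blast
  qed
  then have lim: "(\<lambda>n. \<Sum>i<n. c i *\<^sub>R \<phi> i) \<longlonglongrightarrow> (\<Sum>i. c i *\<^sub>R \<phi> i)" by (rule summable_LIMSEQ)
  define x where "x = (\<Sum>i. c i *\<^sub>R \<phi> i)"
  have lim: "(\<lambda>n. \<Sum>i<n. c i *\<^sub>R \<phi> i) \<longlonglongrightarrow> x" using lim by (simp add: x_def)
  have "inner x (\<phi> i) = c i" for i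
  proof (rule LIMSEQ_unique)
    show "(\<lambda>n. inner (\<Sum>j<n. c j *\<^sub>R \<phi> j) (\<phi> i)) \<longlonglongrightarrow> inner x (\<phi> i)" by (intro tendsto_intros lim)
    show "(\<lambda>n. inner (\<Sum>j<n. c j *\<^sub>R \<phi> j) (\<phi> i)) \<longlonglongrightarrow> c i"
      by (intro tendsto_eventually eventually_sequentiallyI[of "Suc i"]) (auto simp: inner_sum_orthonormal[OF on])
  qed
  moreover have "(norm x)\<^sup>2 = (\<Sum>i. (c i)\<^sup>2)"
  proof (rule LIMSEQ_unique)
    show "(\<lambda>n. (norm (\<Sum>j<n. c j *\<^sub>R \<phi> j))\<^sup>2) \<longlonglongrightarrow> (norm x)\<^sup>2" by (intro tendsto_intros lim)
    show "(\<lambda>n. (norm (\<Sum>j<n. c j *\<^sub>R \<phi> j))\<^sup>2) \<longlonglongrightarrow> (\<Sum>i. (c i)\<^sup>2)"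
      using summable_LIMSEQ[OF c] by (simp add: norm_sum_orthonormal[OF on])
  qed
  moreover have "x \<in> closure (span (range \<phi>))"
  proof (rule closed_sequentially[OF closed_closure _ lim])
    show "(\<Sum>i<n. c i *\<^sub>R \<phi> i) \<in> closure (span (range \<phi>))" for n
      by (intro subsetD[OF closure_subset] span_sum span_scale span_base) auto
  qed
  ultimately show ?thesis using lim by blast
qed

text \<open>Projections can be taken under the integral. Each projected integral is a finite
  combination of the \<phi> i, and dominated convergence leads into the closure.\<close>

lemma prim_in_closure_span:
  fixes \<phi> :: "nat \<Rightarrow> 'b::{real_inner, banach, second_countable_topology}" and V :: "real \<Rightarrow> 'b::{real_inner, banach, second_countable_topology}"
  assumes on: "\<And>i j. inner (\<phi> i) (\<phi> j) = (if i = j then 1 else 0)"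
    and V: "integrable (lebesgue_on {0<..<T}) V" and VX: "AE t in lebesgue_on {0<..<T}. V t \<in> closure (span (range \<phi>))"
  shows "prim T V t \<in> closure (span (range \<phi>))"
proof -
  let ?M = "lebesgue_on {0<..<T}"
  define W where "W s = indicator {0..t} s *\<^sub>R V s" for s
  have W: "integrable ?M W" unfolding W_def by (rule integrable_prim[OF V])
  have pW: "partial_proj \<phi> n (W s) = indicator {0..t} s *\<^sub>R partial_proj \<phi> n (V s)" for n s
    by (simp add: W_def partial_proj_def scaleR_sum_right)
  have "(\<lambda>n. LINT s|?M. partial_proj \<phi> n (W s)) \<longlonglongrightarrow> (LINT s|?M. W s)"
  proof (rule integral_dominated_convergence[where w = "\<lambda>s. norm (W s)"])
    show "AE s in ?M. (\<lambda>n. partial_proj \<phi> n (W s)) \<longlonglongrightarrow> W s"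
      using VX
    proof eventually_elim
      case (elim s)
      show ?case unfolding pW unfolding W_def by (intro tendsto_intros partial_proj_tendsto[OF on elim])
    qed
    show "(\<lambda>s. partial_proj \<phi> n (W s)) \<in> borel_measurable ?M" for n
      unfolding partial_proj_def using borel_measurable_integrable[OF W] by measurable
    show "AE s in ?M. norm (partial_proj \<phi> n (W s)) \<le> norm (W s)" for n
      by (intro AE_I2 norm_partial_proj(3)[OF on])
  qed (use W in auto)
  moreover have "(LINT s|?M. partial_proj \<phi> n (W s)) \<in> closure (span (range \<phi>))" for n
  proof -
    have "(LINT s|?M. partial_proj \<phi> n (W s)) = (\<Sum>i<n. (LINT s|?M. inner (W s) (\<phi> i)) *\<^sub>R \<phi> i)"
      unfolding partial_proj_def using W
      by (subst Bochner_Integration.integral_sum) auto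
    then show ?thesis by (simp only:) (intro subsetD[OF closure_subset] span_sum span_scale span_base, auto)
  qed
  ultimately show ?thesis unfolding prim_def W_def[symmetric]
    by (rule closed_sequentially[OF closed_closure, rotated])
qed

text \<open>The indicator in \<open>k\<close> cuts off the time 0, which occurs at s = t; this
  agrees with \<open>kernel \<alpha> 0 = 0\<close>, a consequence of
  \<open>0 powr x = 0\<close>.\<close>

lemma kernel_integral_eq_conv:
  fixes \<alpha> :: "real \<Rightarrow> real" and T :: real
  defines "k \<equiv> (\<lambda>t. indicator {0<..T} t * kernel \<alpha> t)"
  assumes k: "k \<in> borel_measurable borel" and g: "g \<in> borel_measurable borel"
    and t: "t \<in> {0..T}" and eq: "\<And>s. s \<in> {0..t} \<Longrightarrow> h s = g s"
  shows "(LINT s|lebesgue_on {0..t}. kernel \<alpha> (t - s) * h s) = conv k g t"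
proof -
  have "(LINT s|lebesgue_on {0..t}. kernel \<alpha> (t - s) * h s) = (LINT s|lebesgue. indicator {0..t} s *\<^sub>R (kernel \<alpha> (t - s) * h s))"
    by (rule integral_restrict_space) simp
  also have "\<dots> = (LINT s|lebesgue. indicator {0..t} s * (k (t - s) * g s))"
  proof (intro Bochner_Integration.integral_cong refl)
    fix s
    show "indicator {0..t} s *\<^sub>R (kernel \<alpha> (t - s) * h s) = indicator {0..t} s * (k (t - s) * g s)"
    proof (cases "s \<in> {0..t}")
      case True
      then have "kernel \<alpha> (t - s) = k (t - s)"
        using t by (cases "s = t") (auto simp: k_def kernel_def)
      then show ?thesis using eq[OF True] by simp
    qed simp
  qed
  also have "\<dots> = conv k g t"
    unfolding conv_def by (rule integral_completion) (use k g in measurable)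
  finally show ?thesis .
qed

lemma bochner_H1_continuous_representative:
  fixes f :: "real \<Rightarrow> 'b::{real_inner, banach, second_countable_topology}"
  assumes T: "0 < T" and f: "f \<in> bochner_H1 T X"
  obtains F where "continuous_on {0..T} F" "AE t in lebesgue_on {0<..<T}. f t = F t"
proof -
  obtain v where v: "v \<in> bochner_L2 T X" "bochner_weak_deriv T f v" and fL: "f \<in> bochner_L2 T X"
    using f unfolding bochner_H1_def by blast
  obtain c where "AE t in lebesgue_on {0<..<T}. f t = c + prim T v t"
    by (rule weak_deriv_imp_prim[OF T bochner_L2_integrable[OF fL] bochner_L2_integrable[OF v(1)] v(2)])
  then show thesis
    by (rule that[rotated]) (intro continuous_intros prim_continuous_on bochner_L2_integrable[OF v(1)])
qed

section \<open>Mode sums and Bochner norms\<close>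

lemma l2sq_eq_lebesgue_on:
  assumes "g \<in> borel_measurable borel" "\<And>t. t \<in> {0..T} \<Longrightarrow> g t = h t"
  shows "l2sq T g = (LINT t|lebesgue_on {0<..<T}. (h t)\<^sup>2)"
proof -
  have m: "(\<lambda>t. (g t)\<^sup>2) \<in> borel_measurable borel" using assms(1) by measurable
  have "(LINT t|lebesgue_on {0<..<T}. (h t)\<^sup>2) = (LINT t|lebesgue_on {0<..<T}. (g t)\<^sup>2)"
    using assms(2) by (intro Bochner_Integration.integral_cong) auto
  also have "\<dots> = l2sq T g" unfolding lebesgue_on_Ioo_borel(2)[OF m] l2sq_def by simp
  finally show ?thesis by simp
qed

lemma bochner_L2_norm_power2: "(bochner_L2_norm T u)\<^sup>2 = (LINT t|lebesgue_on {0<..<T}. (norm (u t))\<^sup>2)"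
  unfolding bochner_L2_norm_def by (intro real_sqrt_pow2 Bochner_Integration.integral_nonneg) auto

lemma sum_l2sq_components:
  fixes \<phi> :: "nat \<Rightarrow> 'b::{real_inner, banach, second_countable_topology}" and F :: "real \<Rightarrow> 'b::{real_inner, banach, second_countable_topology}"
  assumes F: "continuous_on {0..T} F" and g: "\<And>i. g i \<in> borel_measurable borel"
    and eq: "\<And>i t. t \<in> {0..T} \<Longrightarrow> g i t = inner (F t) (\<phi> i)"
  shows "(\<Sum>i<n. l2sq T (g i)) = (LINT t|lebesgue_on {0<..<T}. (\<Sum>i<n. (inner (F t) (\<phi> i))\<^sup>2))"
    and "integrable (lebesgue_on {0<..<T}) (\<lambda>t. \<Sum>i<n. (inner (F t) (\<phi> i))\<^sup>2)"
proof -
  have i: "integrable (lebesgue_on {0<..<T}) (\<lambda>t. (inner (F t) (\<phi> i))\<^sup>2)" for i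
    by (intro integrable_continuous_lebesgue_on continuous_intros F)
  have "l2sq T (g i) = (LINT t|lebesgue_on {0<..<T}. (inner (F t) (\<phi> i))\<^sup>2)" for i
    by (rule l2sq_eq_lebesgue_on[OF g eq])
  then show "(\<Sum>i<n. l2sq T (g i)) = (LINT t|lebesgue_on {0<..<T}. (\<Sum>i<n. (inner (F t) (\<phi> i))\<^sup>2))"
    using i by (simp add: Bochner_Integration.integral_sum)
  show "integrable (lebesgue_on {0<..<T}) (\<lambda>t. \<Sum>i<n. (inner (F t) (\<phi> i))\<^sup>2)" using i by simp
qed

lemma sum_l2sq_le_bochner:
  fixes \<phi> :: "nat \<Rightarrow> 'b::{real_inner, banach, second_countable_topology}" and F :: "real \<Rightarrow> 'b::{real_inner, banach, second_countable_topology}"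
  assumes on: "\<And>i j. inner (\<phi> i) (\<phi> j) = (if i = j then 1 else 0)"
    and F: "continuous_on {0..T} F" and g: "\<And>i. g i \<in> borel_measurable borel"
    and eq: "\<And>i t. t \<in> {0..T} \<Longrightarrow> g i t = inner (F t) (\<phi> i)"
  shows "(\<Sum>i<n. l2sq T (g i)) \<le> (bochner_L2_norm T F)\<^sup>2"
proof -
  have e: "(\<Sum>i<n. l2sq T (g i)) = (LINT t|lebesgue_on {0<..<T}. (\<Sum>i<n. (inner (F t) (\<phi> i))\<^sup>2))"
    by (rule sum_l2sq_components(1)[OF F g]) (rule eq)
  show ?thesis
    unfolding e bochner_L2_norm_power2
    by (rule integral_mono[OF sum_l2sq_components(2)[OF F g]])
      (auto intro!: eq integrable_continuous_lebesgue_on continuous_intros F norm_partial_proj(2)[OF on])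
qed

text \<open>Parseval's identity at each time, integrated: by Bessel's inequality the squared norm
  itself dominates the partial sums.\<close>

lemma bochner_L2_norm_le_components:
  fixes \<phi> :: "nat \<Rightarrow> 'b::{real_inner, banach, second_countable_topology}" and U :: "real \<Rightarrow> 'b::{real_inner, banach, second_countable_topology}"
  assumes on: "\<And>i j. inner (\<phi> i) (\<phi> j) = (if i = j then 1 else 0)"
    and U: "continuous_on {0..T} U" and UX: "\<And>t. t \<in> {0..T} \<Longrightarrow> U t \<in> closure (span (range \<phi>))"
    and g: "\<And>i. g i \<in> borel_measurable borel"
    and eq: "\<And>i t. t \<in> {0..T} \<Longrightarrow> g i t = inner (U t) (\<phi> i)"
    and B: "\<And>n. (\<Sum>i<n. l2sq T (g i)) \<le> B"
  shows "(bochner_L2_norm T U)\<^sup>2 \<le> B"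
proof -
  have e: "(\<Sum>i<n. l2sq T (g i)) = (LINT t|lebesgue_on {0<..<T}. (\<Sum>i<n. (inner (U t) (\<phi> i))\<^sup>2))" for n
    by (rule sum_l2sq_components(1)[OF U g]) (rule eq)
  have "(\<lambda>n. LINT t|lebesgue_on {0<..<T}. (\<Sum>i<n. (inner (U t) (\<phi> i))\<^sup>2)) \<longlonglongrightarrow> (LINT t|lebesgue_on {0<..<T}. (norm (U t))\<^sup>2)"
  proof (rule integral_dominated_convergence[where w = "\<lambda>t. (norm (U t))\<^sup>2"])
    show i: "integrable (lebesgue_on {0<..<T}) (\<lambda>t. (norm (U t))\<^sup>2)"
      by (intro integrable_continuous_lebesgue_on continuous_intros U)
    then show "(\<lambda>t. (norm (U t))\<^sup>2) \<in> borel_measurable (lebesgue_on {0<..<T})" by (rule borel_measurable_integrable)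
    show "(\<lambda>t. \<Sum>i<n. (inner (U t) (\<phi> i))\<^sup>2) \<in> borel_measurable (lebesgue_on {0<..<T})" for n
      using sum_l2sq_components(2)[OF U g eq] by (rule borel_measurable_integrable)
    show "AE t in lebesgue_on {0<..<T}. (\<lambda>n. \<Sum>i<n. (inner (U t) (\<phi> i))\<^sup>2) \<longlonglongrightarrow> (norm (U t))\<^sup>2"
    proof (intro AE_I2)
      fix t assume "t \<in> space (lebesgue_on {0<..<T})"
      then have "t \<in> {0..T}" by auto
      then show "(\<lambda>n. \<Sum>i<n. (inner (U t) (\<phi> i))\<^sup>2) \<longlonglongrightarrow> (norm (U t))\<^sup>2" by (intro parseval[OF on] UX)
    qed
    show "AE t in lebesgue_on {0<..<T}. norm (\<Sum>i<n. (inner (U t) (\<phi> i))\<^sup>2) \<le> (norm (U t))\<^sup>2" for n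
      using norm_partial_proj(2)[OF on] by (intro AE_I2) (simp add: sum_nonneg)
  qed
  then have "(\<lambda>n. \<Sum>i<n. l2sq T (g i)) \<longlonglongrightarrow> (bochner_L2_norm T U)\<^sup>2"
    unfolding e bochner_L2_norm_power2 .
  then show ?thesis by (rule LIMSEQ_le_const2) (use B in auto)
qed

text \<open>Tonelli makes the sum of (v i t)^2 finite for almost every t, and there the
  Riesz-Fischer theorem yields V t.\<close>

lemma bochner_L2_superposition:
  fixes \<phi> :: "nat \<Rightarrow> 'b::{real_inner, banach, second_countable_topology}"
  assumes on: "\<And>i j. inner (\<phi> i) (\<phi> j) = (if i = j then 1 else 0)"
    and v: "\<And>i. bdd_upto T (v i)" and W: "\<And>n. (\<Sum>i<n. l2sq T (v i)) \<le> W"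
  obtains V where "V \<in> bochner_L2 T (closure (span (range \<phi>)))" "(bochner_L2_norm T V)\<^sup>2 \<le> W"
    "\<And>i. AE t in lebesgue_on {0<..<T}. inner (V t) (\<phi> i) = v i t"
proof -
  note [measurable] = bdd_upto_measurable[OF v]
  have W0: "0 \<le> W" using W[of 0] by simp
  have e: "(\<integral>\<^sup>+t. ennreal (indicator {0..T} t * (v i t)\<^sup>2) \<partial>lborel) = ennreal (l2sq T (v i))" for i
    unfolding l2sq_def by (intro nn_integral_eq_integral bdd_upto_integrable bdd_upto_power2 v) auto
  have "(\<integral>\<^sup>+t. (\<Sum>i. ennreal (indicator {0..T} t * (v i t)\<^sup>2)) \<partial>lborel) = (\<Sum>i. ennreal (l2sq T (v i)))"
    by (subst nn_integral_suminf) (auto simp: e)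
  also have "\<dots> \<le> ennreal W"
  proof (rule suminf_le_const)
    show "(\<Sum>i<n. ennreal (l2sq T (v i))) \<le> ennreal W" for n
      using W[of n] l2sq_nonneg by (subst sum_ennreal) (auto intro: ennreal_leI)
  qed (rule summableI)
  finally have fin: "(\<integral>\<^sup>+t. (\<Sum>i. ennreal (indicator {0..T} t * (v i t)\<^sup>2)) \<partial>lborel) \<le> ennreal W" .
  then have "(\<integral>\<^sup>+t. (\<Sum>i. ennreal (indicator {0..T} t * (v i t)\<^sup>2)) \<partial>lborel) \<noteq> \<infinity>"
    by (auto simp: top_unique)
  then have "AE t in lborel. (\<Sum>i. ennreal (indicator {0..T} t * (v i t)\<^sup>2)) \<noteq> \<infinity>"
    by (intro nn_integral_PInf_AE) auto
  then have sm: "AE t in lborel. summable (\<lambda>i. indicator {0..T} t * (v i t)\<^sup>2)"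
    by eventually_elim (intro summable_suminf_not_top, auto)
  \<comment> \<open>Where the series diverges, \<open>lim\<close> is one fixed value, so V is a
    Borel function on the whole line.\<close>
  define V where "V t = lim (\<lambda>n. \<Sum>i<n. v i t *\<^sub>R \<phi> i)" for t
  have [measurable]: "V \<in> borel_measurable borel" unfolding V_def by measurable
  have Vp: "(\<forall>i. inner (V t) (\<phi> i) = v i t) \<and> (norm (V t))\<^sup>2 = (\<Sum>i. (v i t)\<^sup>2) \<and> V t \<in> closure (span (range \<phi>))"
    if sm0: "summable (\<lambda>i. (v i t)\<^sup>2)" for t
  proof -
    obtain x where x: "(\<lambda>n. \<Sum>i<n. v i t *\<^sub>R \<phi> i) \<longlonglongrightarrow> x" "(\<forall>i. inner x (\<phi> i) = v i t) \<and> (norm x)\<^sup>2 = (\<Sum>i. (v i t)\<^sup>2) \<and> x \<in> closure (span (range \<phi>))"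
      using orthonormal_series_converges[OF on sm0] by blast
    have "V t = x" unfolding V_def by (rule limI[OF x(1)])
    then show ?thesis using x(2) by simp
  qed
  have sm': "AE t in lebesgue_on {0<..<T}. summable (\<lambda>i. (v i t)\<^sup>2)"
    unfolding AE_lebesgue_on_Ioo using sm by eventually_elim auto
  have "(\<integral>\<^sup>+t. ennreal (indicator {0..T} t * (norm (V t))\<^sup>2) \<partial>lborel) = (\<integral>\<^sup>+t. (\<Sum>i. ennreal (indicator {0..T} t * (v i t)\<^sup>2)) \<partial>lborel)"
  proof (rule nn_integral_cong_AE, use sm in eventually_elim)
    case (elim t)
    show ?case
    proof (cases "t \<in> {0..T}")
      case True
      then have s: "summable (\<lambda>i. (v i t)\<^sup>2)" using elim by simp
      then have "(\<Sum>i. ennreal ((v i t)\<^sup>2)) = ennreal (\<Sum>i. (v i t)\<^sup>2)" by (intro suminf_ennreal2) auto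
      then show ?thesis using True Vp[OF s] by simp
    qed simp
  qed
  with fin have finV: "(\<integral>\<^sup>+t. ennreal (indicator {0..T} t * (norm (V t))\<^sup>2) \<partial>lborel) \<le> ennreal W" by simp
  have Vm: "(\<lambda>t. (norm (V t))\<^sup>2) \<in> borel_measurable borel" by measurable
  have iV: "integrable lborel (\<lambda>t. indicator {0..T} t * (norm (V t))\<^sup>2)"
    using finV by (intro integrableI_nonneg) (auto simp: le_less_trans[OF _ ennreal_less_top])
  have "V \<in> bochner_L2 T (closure (span (range \<phi>)))"
    unfolding bochner_L2_def
  proof (intro CollectI conjI)
    show "V \<in> borel_measurable (lebesgue_on {0<..<T})" by (rule borel_measurable_lebesgue_on) measurable
    show "AE t in lebesgue_on {0<..<T}. V t \<in> closure (span (range \<phi>))" using sm' by eventually_elim (use Vp in blast)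
    show "integrable (lebesgue_on {0<..<T}) (\<lambda>t. (norm (V t))\<^sup>2)" using iV by (simp add: lebesgue_on_Ioo_borel(1)[OF Vm])
  qed
  moreover have "(bochner_L2_norm T V)\<^sup>2 \<le> W"
  proof -
    have "ennreal (LINT t|lborel. indicator {0..T} t * (norm (V t))\<^sup>2) = (\<integral>\<^sup>+t. ennreal (indicator {0..T} t * (norm (V t))\<^sup>2) \<partial>lborel)"
      by (intro nn_integral_eq_integral[symmetric] iV) auto
    then have "ennreal (LINT t|lborel. indicator {0..T} t * (norm (V t))\<^sup>2) \<le> ennreal W" using finV by simp
    then show ?thesis using W0 by (simp add: bochner_L2_norm_power2 lebesgue_on_Ioo_borel(2)[OF Vm])
  qed
  moreover have "AE t in lebesgue_on {0<..<T}. inner (V t) (\<phi> i) = v i t" for i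
    using sm' by eventually_elim (use Vp in blast)
  ultimately show thesis by (rule that)
qed


section \<open>The theorem\<close>

lemma closure_span_add:
  fixes x y :: "'b::real_normed_vector"
  assumes "x \<in> closure (span S)" "y \<in> closure (span S)"
  shows "x + y \<in> closure (span S)"
proof -
  obtain a b where "\<And>n. a n \<in> span S" "a \<longlonglongrightarrow> x" "\<And>n. b n \<in> span S" "b \<longlonglongrightarrow> y"
    using assms unfolding closure_sequential by blast
  then show ?thesis unfolding closure_sequential
    by (intro exI[of _ "\<lambda>n. a n + b n"]) (auto intro: span_add tendsto_add)
qed

theorem theorem3p1:
  fixes \<Omega> :: "(real ^ 'd) set" and T :: real and \<alpha> :: "real \<Rightarrow> real"
    and lam :: "nat \<Rightarrow> real" and \<phi> :: "nat \<Rightarrow> (real ^ 'd) L2"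
  assumes "1 \<le> CARD('d)" and "CARD('d) \<le> 3"
    and "open \<Omega>" and "connected \<Omega>" and "\<Omega> \<noteq> {}" and "bounded \<Omega>" and "simply_connected \<Omega>"
    and "piecewise_smooth_boundary \<Omega>" and "convex_corners \<Omega>"
    and "dirichlet_eigensystem \<Omega> lam \<phi>"
    and "0 < T"
    and "\<And>t. t \<in> {0..T} \<Longrightarrow> 0 < \<alpha> t \<and> \<alpha> t < 1"
    and "bounded_second_derivative T \<alpha>"
  shows "\<exists>Q>0. \<forall>f \<in> bochner_H1 T (L2_on \<Omega>). \<forall>u0 \<in> spectral_H \<Omega> lam \<phi> 2.
    \<exists>u. is_solution \<Omega> lam \<phi> T \<alpha> f u0 u \<and>
        (\<forall>w. is_solution \<Omega> lam \<phi> T \<alpha> f u0 w \<longrightarrow> (AE t in lebesgue_on {0<..<T}. w t = u t)) \<and>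
        bochner_H1_norm T u \<le> Q * (spectral_H_norm lam \<phi> 2 u0 + bochner_H1_norm T f)"
proof -

  \<comment> \<open>Eigenvalues, kernel and constants\<close>
  let ?M = "lebesgue_on {0<..<T}"
  note T = \<open>0 < T\<close> and \<alpha> = assms(12)
  have lam0: "0 < lam 0" and inc: "incseq lam"
    and on: "\<And>i j. inner (\<phi> i) (\<phi> j) = (if i = j then 1 else 0)"
    and X: "L2_on \<Omega> = closure (span (range \<phi>))"
    using \<open>dirichlet_eigensystem \<Omega> lam \<phi>\<close> unfolding dirichlet_eigensystem_def by auto
  have lam_ge: "lam 0 \<le> lam i" for i using inc by (simp add: incseq_def)
  have lam_pos: "0 < lam i" for i using lam0 lam_ge[of i] by linarith
  obtain \<alpha>' \<alpha>'' C0 where \<alpha>d: "\<forall>t\<in>{0..T}. (\<alpha> has_real_derivative \<alpha>' t) (at t within {0..T}) \<and>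
      (\<alpha>' has_real_derivative \<alpha>'' t) (at t within {0..T}) \<and> \<bar>\<alpha>'' t\<bar> \<le> C0"
    using \<open>bounded_second_derivative T \<alpha>\<close> unfolding bounded_second_derivative_def by blast
  have \<alpha>1: "(\<alpha> has_real_derivative \<alpha>' t) (at t within {0..T})" if "t \<in> {0..T}" for t using \<alpha>d that by blast
  have \<alpha>2: "continuous_on {0..T} \<alpha>'" using \<alpha>d by (intro DERIV_continuous_on[of _ _ \<alpha>'']) blast
  define k where "k = (\<lambda>t. indicator {0<..T} t * kernel \<alpha> t)"
  have dec: "L1_upto T k \<and> (\<exists>\<kappa> d. 0 < d \<and> L1_upto T \<kappa> \<and>
    (\<forall>t\<in>{0..T}. conv k (\<lambda>_. 1) t = d * t powr (1 - \<alpha> 0) + conv (\<lambda>x. x) \<kappa> t))"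
    unfolding k_def by (rule variable_kernel_decomposition[OF T \<alpha> \<alpha>1 \<alpha>2])
  then have kL: "L1_upto T k" by blast
  note km = L1_upto_measurable[OF kL]
  obtain \<kappa> d where \<kappa>: "0 < d" "L1_upto T \<kappa>"
    "\<And>t. t \<in> {0..T} \<Longrightarrow> conv k (\<lambda>_. 1) t = d * t powr (1 - \<alpha> 0) + conv (\<lambda>x. x) \<kappa> t"
    using dec by blast
  define K where "K = conv k (\<lambda>_. 1)"
  have bK: "bdd_upto T K" unfolding K_def by (intro bdd_upto_conv kL bdd_upto_const)
  have \<alpha>0: "0 < \<alpha> 0" "\<alpha> 0 < 1" using \<alpha>[of 0] T by auto
  obtain Q0 where Q0: "0 \<le> Q0" and Qb: "\<And>l v g. 0 \<le> l \<Longrightarrow> bdd_upto T v \<Longrightarrow> bdd_upto T g \<Longrightarrow>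
     (\<forall>t\<in>{0..T}. v t + l * conv K v t = g t) \<Longrightarrow> l2sq T v \<le> Q0 * l2sq T g"
    using volterra_uniform_bound[OF \<alpha>0 \<kappa>(1,2) bdd_upto_imp_L1[OF bK], unfolded K_def, OF \<kappa>(3)]
    unfolding K_def by blast
  define \<kappa>2 where "\<kappa>2 = l2sq T K"
  have \<kappa>2: "0 \<le> \<kappa>2" unfolding \<kappa>2_def by (rule l2sq_nonneg)
  \<comment> \<open>A bound for squares: the first summand is the share of u0 in the norm of U, the
    factor 2 T^2 + 1 collects the share of V in U and V itself, and Q0 (2 + 2 \<kappa>2) dominates
    the bound \<open>W\<close> of V. The 1 secures positivity; the final constant is the root of
    \<open>C\<close>.\<close>
  define C where "C = 2 * T / (lam 0)\<^sup>2 + (2 * T\<^sup>2 + 1) * (Q0 * (2 + 2 * \<kappa>2)) + 1"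
  have Cpos: "0 < C" unfolding C_def using T Q0 \<kappa>2 by (intro add_nonneg_pos add_nonneg_nonneg mult_nonneg_nonneg) auto
  have one: "L1_upto T (\<lambda>_. 1)" by (intro bdd_upto_imp_L1 bdd_upto_const)
  show ?thesis
  proof (intro exI[of _ "sqrt C"] conjI ballI)
    show "0 < sqrt C" using Cpos by simp

    \<comment> \<open>The data in the eigenbasis\<close>
    fix f u0 assume f: "f \<in> bochner_H1 T (L2_on \<Omega>)" and u0: "u0 \<in> spectral_H \<Omega> lam \<phi> 2"
    define p where "p = spectral_H_norm lam \<phi> 2 u0"
    define q where "q = bochner_H1_norm T f"
    define c where "c i = inner u0 (\<phi> i)" for i
    have u0X: "u0 \<in> closure (span (range \<phi>))" using u0 X by (simp add: spectral_H_def)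
    have pow: "lam i powr 2 = (lam i)\<^sup>2" for i using lam_pos[of i] by simp
    have sum2: "summable (\<lambda>i. (lam i)\<^sup>2 * (c i)\<^sup>2)" using u0 unfolding spectral_H_def c_def pow by blast
    have p2: "p\<^sup>2 = (\<Sum>i. (lam i)\<^sup>2 * (c i)\<^sup>2)"
      unfolding p_def spectral_H_norm_def pow c_def[symmetric]
      by (intro real_sqrt_pow2 suminf_nonneg sum2) auto
    have p0: "0 \<le> p" unfolding p_def spectral_H_norm_def pow c_def[symmetric]
      by (intro real_sqrt_ge_zero suminf_nonneg sum2) auto
    have part_p: "(\<Sum>i<n. (lam i)\<^sup>2 * (c i)\<^sup>2) \<le> p\<^sup>2" for n
      unfolding p2 by (intro sum_le_suminf sum2) auto
    have fL: "f \<in> bochner_L2 T (L2_on \<Omega>)" using f unfolding bochner_H1_def by blast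
    obtain F where F: "continuous_on {0..T} F" and fF: "AE t in ?M. f t = F t"
      by (rule bochner_H1_continuous_representative[OF T f])
    have q0: "0 \<le> q" unfolding q_def bochner_H1_norm_def by simp
    have Fq: "(bochner_L2_norm T F)\<^sup>2 \<le> q\<^sup>2"
    proof -
      have "F \<in> bochner_L2 T UNIV"
        unfolding bochner_L2_def using continuous_measurable_lebesgue_on[OF F]
        by (auto intro!: integrable_continuous_lebesgue_on continuous_intros F)
      then have "bochner_L2_norm T F = bochner_L2_norm T f"
        using bochner_L2_norm_AE_cong[OF fL _ fF] by simp
      then show ?thesis unfolding q_def bochner_H1_norm_def by (simp add: real_sqrt_pow2)
    qed
    \<comment> \<open>F is controlled only on [0,T]; the cut-off makes its coefficients Borel
      functions on the line.\<close>
    define fi where "fi i t = indicator {0..T} t * inner (F t) (\<phi> i)" for i t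
    have ind: "(\<lambda>t. indicator {0..T} t * inner (G t) (\<phi> i)) \<in> borel_measurable borel \<and>
        continuous_on {0..T} (\<lambda>t. indicator {0..T} t * inner (G t) (\<phi> i))" if G: "continuous_on {0..T} G" for G i
    proof
      have cG: "continuous_on {0..T} (\<lambda>t. inner (G t) (\<phi> i))" by (intro continuous_intros G)
      show "(\<lambda>t. indicator {0..T} t * inner (G t) (\<phi> i)) \<in> borel_measurable borel"
        using borel_measurable_continuous_on_indicator[OF _ cG] by simp
      show "continuous_on {0..T} (\<lambda>t. indicator {0..T} t * inner (G t) (\<phi> i))"
        using cG by (rule continuous_on_eq) auto
    qed
    have fim: "fi i \<in> borel_measurable borel" and fic: "continuous_on {0..T} (fi i)" for i
      using ind[OF F, of i] by (simp_all add: fi_def[abs_def])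
    have fi_eq: "fi i t = inner (F t) (\<phi> i)" if "t \<in> {0..T}" for i t using that by (simp add: fi_def)
    have bfi: "bdd_upto T (fi i)" for i by (rule bdd_upto_continuous[OF fim fic])

    \<comment> \<open>The scalar problems and their summed bounds\<close>
    define P where "P i u v \<longleftrightarrow> u \<in> borel_measurable borel \<and> v \<in> borel_measurable borel \<and>
       continuous_on {0..T} u \<and> continuous_on {0..T} v \<and>
       (\<forall>t\<in>{0..T}. u t = c i + conv (\<lambda>_. 1) v t \<and> v t + lam i * conv k u t = fi i t \<and>
        v t + lam i * conv K v t = fi i t - lam i * c i * K t)" for i u v
    have "\<forall>i. \<exists>u v. P i u v"
      unfolding P_def K_def using volterra_mode_solution[OF less_imp_le[OF T] kL fim fic] by blast
    from choice[OF this] obtain u where "\<forall>i. \<exists>v. P i (u i) v" by blast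
    from choice[OF this] obtain v where P: "\<forall>i. P i (u i) (v i)" by blast
    have um: "u i \<in> borel_measurable borel" and vm: "v i \<in> borel_measurable borel"
      and uc: "continuous_on {0..T} (u i)" and vc: "continuous_on {0..T} (v i)" for i
      using P unfolding P_def by blast+
    have ueq: "u i t = c i + conv (\<lambda>_. 1) (v i) t" and veq: "v i t + lam i * conv k (u i) t = fi i t"
      and vK: "v i t + lam i * conv K (v i) t = fi i t - lam i * c i * K t" if "t \<in> {0..T}" for i t
      using P that unfolding P_def by blast+
    have bv: "bdd_upto T (v i)" for i by (rule bdd_upto_continuous[OF vm vc])
    \<comment> \<open>The mode bounds \<open>l2v\<close> below, summed with Bessel's inequality for
      the coefficients of F and the spectral norm for those of u0.\<close>
    define W where "W = Q0 * (2 * q\<^sup>2 + 2 * \<kappa>2 * p\<^sup>2)"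
    have W0: "0 \<le> W" unfolding W_def using Q0 \<kappa>2 by simp
    have l2v: "l2sq T (v i) \<le> Q0 * (2 * l2sq T (fi i) + 2 * ((lam i)\<^sup>2 * (c i)\<^sup>2 * \<kappa>2))" for i
    proof -
      \<comment> \<open>The source of the equation for v. Its second part has squared norm (lam i)^2
        (c i)^2 \<kappa>2, which is summable because u0 lies in the spectral space of order
        2.\<close>
      define g where "g = (\<lambda>t. fi i t + (- (lam i * c i)) * K t)"
      have "l2sq T (v i) \<le> Q0 * l2sq T g"
      proof (rule Qb)
        show "0 \<le> lam i" using lam_pos[of i] by simp
        show "bdd_upto T g" unfolding g_def by (intro bdd_upto_add bdd_upto_cmult bfi bK)
        show "\<forall>t\<in>{0..T}. v i t + lam i * conv K (v i) t = g t" using vK by (simp add: g_def)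
      qed (rule bv)
      also have "l2sq T g \<le> 2 * l2sq T (fi i) + 2 * l2sq T (\<lambda>t. (- (lam i * c i)) * K t)"
        unfolding g_def by (intro l2sq_add_le bfi bdd_upto_cmult bK)
      also have "l2sq T (\<lambda>t. (- (lam i * c i)) * K t) = (- (lam i * c i))\<^sup>2 * \<kappa>2"
        unfolding \<kappa>2_def l2sq_eq_conv power_mult_distrib by (rule conv_cmult_right)
      finally show ?thesis using Q0 by (simp add: power_mult_distrib mult_left_mono)
    qed
    have sum_fi: "(\<Sum>i<n. l2sq T (fi i)) \<le> q\<^sup>2" for n
      by (rule order_trans[OF sum_l2sq_le_bochner[OF on F fim] Fq]) (rule fi_eq)
    have sum_v: "(\<Sum>i<n. l2sq T (v i)) \<le> W" for n
    proof -
      have "(\<Sum>i<n. l2sq T (v i)) \<le> (\<Sum>i<n. Q0 * (2 * l2sq T (fi i) + 2 * ((lam i)\<^sup>2 * (c i)\<^sup>2 * \<kappa>2)))"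
        by (intro sum_mono l2v)
      also have "\<dots> = Q0 * (2 * (\<Sum>i<n. l2sq T (fi i)) + 2 * ((\<Sum>i<n. (lam i)\<^sup>2 * (c i)\<^sup>2) * \<kappa>2))"
        by (simp only: sum_distrib_left[symmetric] sum_distrib_right[symmetric] sum.distrib)
      also have "\<dots> \<le> Q0 * (2 * q\<^sup>2 + 2 * (p\<^sup>2 * \<kappa>2))"
        using Q0 \<kappa>2 part_p[of n] sum_fi[of n]
        by (intro mult_left_mono add_mono mult_right_mono) auto
      finally show ?thesis unfolding W_def by (simp only: mult_ac)
    qed

    \<comment> \<open>Assembly of the solution from its modes\<close>
    obtain V where V: "V \<in> bochner_L2 T (closure (span (range \<phi>)))" and VW: "(bochner_L2_norm T V)\<^sup>2 \<le> W"
      and Vi: "\<And>i. AE t in ?M. inner (V t) (\<phi> i) = v i t"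
      by (rule bochner_L2_superposition[OF on bv sum_v]) blast
    have Vint: "integrable ?M V" by (rule bochner_L2_integrable[OF V])
    have VX: "AE t in ?M. V t \<in> closure (span (range \<phi>))" using V by (simp add: bochner_L2_def)
    define U where "U t = u0 + prim T V t" for t
    have Uc: "continuous_on {0..T} U" unfolding U_def by (intro continuous_intros prim_continuous_on[OF Vint])
    have Ui: "inner (U t) (\<phi> i) = u i t" if t: "t \<in> {0..T}" for i t
    proof -
      have "inner (prim T V t) (\<phi> i) = prim T (\<lambda>s. inner (V s) (\<phi> i)) t" by (rule prim_inner[OF Vint])
      also have "\<dots> = conv (\<lambda>_. 1) (v i) t" using Vint t by (intro prim_eq_conv vm Vi) auto
      finally show ?thesis using ueq[OF t, of i] by (simp add: U_def inner_add_left c_def)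
    qed
    have UX: "U t \<in> closure (span (range \<phi>))" for t
      unfolding U_def by (intro closure_span_add u0X prim_in_closure_span[OF on Vint VX])
    have UL: "U \<in> bochner_L2 T (L2_on \<Omega>)"
      unfolding bochner_L2_def X using UX continuous_measurable_lebesgue_on[OF Uc]
      by (auto intro!: integrable_continuous_lebesgue_on continuous_intros Uc)
    have wd: "bochner_weak_deriv T U V" unfolding U_def by (rule bochner_weak_deriv_prim[OF T Vint])
    have UH: "U \<in> bochner_H1 T (L2_on \<Omega>)" unfolding bochner_H1_def using UL V wd X by auto

    \<comment> \<open>The norm estimate\<close>
    have sum_c: "(\<Sum>i<n. (c i)\<^sup>2) \<le> p\<^sup>2 / (lam 0)\<^sup>2" for n
    proof -
      \<comment> \<open>The smallest eigenvalue \<open>lam 0\<close> > 0 lets the spectral norm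
        control the plain norm of u0.\<close>
      have "(lam 0)\<^sup>2 * (\<Sum>i<n. (c i)\<^sup>2) \<le> (\<Sum>i<n. (lam i)\<^sup>2 * (c i)\<^sup>2)"
        unfolding sum_distrib_left using lam0 lam_ge by (intro sum_mono mult_right_mono power_mono) auto
      also have "\<dots> \<le> p\<^sup>2" by (rule part_p)
      finally show ?thesis using lam0 by (simp add: pos_le_divide_eq mult.commute)
    qed
    have l2u: "l2sq T (u i) \<le> 2 * T * (c i)\<^sup>2 + 2 * T\<^sup>2 * l2sq T (v i)" for i
    proof -
      have "l2sq T (u i) = l2sq T (\<lambda>t. c i + conv (\<lambda>_. 1) (v i) t)" using ueq by (intro l2sq_cong) auto
      also have "\<dots> \<le> 2 * l2sq T (\<lambda>_. c i) + 2 * l2sq T (conv (\<lambda>_. 1) (v i))"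
        by (intro l2sq_add_le bdd_upto_const bdd_upto_conv one bv)
      also have "l2sq T (conv (\<lambda>_. 1) (v i)) \<le> (mass T (\<lambda>_. 1))\<^sup>2 * l2sq T (v i)"
        by (rule l2sq_conv_le_mass[OF one bv order_refl])
      also have "l2sq T (\<lambda>_. c i) = T * (c i)\<^sup>2" using T by (simp add: l2sq_def)
      finally show ?thesis using T by (simp add: mass_one)
    qed
    have NU: "(bochner_L2_norm T U)\<^sup>2 \<le> 2 * T * (p\<^sup>2 / (lam 0)\<^sup>2) + 2 * T\<^sup>2 * W"
    proof (rule bochner_L2_norm_le_components[OF on Uc UX um])
      show "u i t = inner (U t) (\<phi> i)" if "t \<in> {0..T}" for i t using Ui[OF that] by simp
      fix n
      have "(\<Sum>i<n. l2sq T (u i)) \<le> (\<Sum>i<n. 2 * T * (c i)\<^sup>2 + 2 * T\<^sup>2 * l2sq T (v i))" by (intro sum_mono l2u)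
      also have "\<dots> = 2 * T * (\<Sum>i<n. (c i)\<^sup>2) + 2 * T\<^sup>2 * (\<Sum>i<n. l2sq T (v i))"
        by (simp add: sum.distrib sum_distrib_left)
      also have "\<dots> \<le> 2 * T * (p\<^sup>2 / (lam 0)\<^sup>2) + 2 * T\<^sup>2 * W"
        using T by (intro add_mono mult_left_mono sum_c sum_v) auto
      finally show "(\<Sum>i<n. l2sq T (u i)) \<le> 2 * T * (p\<^sup>2 / (lam 0)\<^sup>2) + 2 * T\<^sup>2 * W" .
    qed
    have norm_bound: "bochner_H1_norm T U \<le> sqrt C * (p + q)"
    proof -
      have "W \<le> Q0 * ((2 + 2 * \<kappa>2) * (p\<^sup>2 + q\<^sup>2))"
        unfolding W_def using Q0 \<kappa>2 by (intro mult_left_mono) (auto simp: algebra_simps)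
      then have WB: "(2 * T\<^sup>2 + 1) * W \<le> (2 * T\<^sup>2 + 1) * (Q0 * ((2 + 2 * \<kappa>2) * (p\<^sup>2 + q\<^sup>2)))"
        by (intro mult_left_mono) auto
      have "2 * T * (p\<^sup>2 / (lam 0)\<^sup>2) = 2 * T / (lam 0)\<^sup>2 * p\<^sup>2" by simp
      also have "\<dots> \<le> 2 * T / (lam 0)\<^sup>2 * (p\<^sup>2 + q\<^sup>2)" using T by (intro mult_left_mono) auto
      finally have "2 * T * (p\<^sup>2 / (lam 0)\<^sup>2) + (2 * T\<^sup>2 + 1) * W \<le>
          2 * T / (lam 0)\<^sup>2 * (p\<^sup>2 + q\<^sup>2) + (2 * T\<^sup>2 + 1) * (Q0 * ((2 + 2 * \<kappa>2) * (p\<^sup>2 + q\<^sup>2)))"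
        by (rule add_mono[OF _ WB])
      also have "\<dots> = (2 * T / (lam 0)\<^sup>2 + (2 * T\<^sup>2 + 1) * (Q0 * (2 + 2 * \<kappa>2))) * (p\<^sup>2 + q\<^sup>2)"
        by (simp only: distrib_right[of "2 * T / (lam 0)\<^sup>2"] mult.assoc)
      also have "\<dots> \<le> C * (p\<^sup>2 + q\<^sup>2)" unfolding C_def by (intro mult_right_mono) auto
      finally have "2 * T * (p\<^sup>2 / (lam 0)\<^sup>2) + (2 * T\<^sup>2 + 1) * W \<le> C * (p\<^sup>2 + q\<^sup>2)" .
      then have "(bochner_L2_norm T U)\<^sup>2 + (bochner_L2_norm T V)\<^sup>2 \<le> C * (p\<^sup>2 + q\<^sup>2)"
        using NU VW by (simp add: distrib_right)
      also have "\<dots> \<le> C * (p + q)\<^sup>2"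
        using Cpos p0 q0 by (intro mult_left_mono) (auto simp: power2_sum)
      finally have "bochner_H1_norm T U \<le> sqrt (C * (p + q)\<^sup>2)"
        unfolding bochner_H1_norm_eq[OF T V wd] by simp
      then show ?thesis using p0 q0 by (simp add: real_sqrt_mult)
    qed

    \<comment> \<open>Verification of the equation\<close>
    have sol: "is_solution \<Omega> lam \<phi> T \<alpha> f u0 U"
      unfolding is_solution_def
    proof (intro conjI exI[of _ U] allI UH Uc)
      show "AE t in ?M. U t = U t" by simp
      fix i
      show "inner (U 0) (\<phi> i) = inner u0 (\<phi> i)"
        using Ui[of 0 i] ueq[of 0 i] T by (simp add: conv_at_zero c_def)
      show "AE t in ?M. \<exists>D. ((\<lambda>s. inner (U s) (\<phi> i)) has_real_derivative D) (at t) \<and>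
          D + lam i * (LINT s|lebesgue_on {0..t}. kernel \<alpha> (t - s) * inner (U s) (\<phi> i)) = inner (f t) (\<phi> i)"
        using fF AE_space
      proof eventually_elim
        case (elim t)
        then have t: "0 < t" "t < T" by auto
        \<comment> \<open>The mode v is continuous, so the derivative exists at every interior t;
          the exceptional set is that of f = F.\<close>
        have "((\<lambda>s. c i + conv (\<lambda>_. 1) (v i) s) has_real_derivative 0 + v i t) (at t)"
          by (intro DERIV_add DERIV_const conv_one_deriv[OF vc t])
        moreover have "\<forall>\<^sub>F s in nhds t. c i + conv (\<lambda>_. 1) (v i) s = inner (U s) (\<phi> i)"
          using t by (intro eventually_nhds_in_open[of "{0<..<T}", THEN eventually_mono]) (auto simp: Ui ueq)
        ultimately have "((\<lambda>s. inner (U s) (\<phi> i)) has_real_derivative v i t) (at t)"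
          by (subst (asm) DERIV_cong_ev[OF refl _ refl]) auto
        moreover have "(LINT s|lebesgue_on {0..t}. kernel \<alpha> (t - s) * inner (U s) (\<phi> i)) = conv k (u i) t"
          unfolding k_def using t Ui km um by (intro kernel_integral_eq_conv) (auto simp: k_def)
        ultimately show ?case using veq[of t i] fi_eq[of t i] t elim by auto
      qed
    qed

    \<comment> \<open>Uniqueness\<close>
    have uniq: "AE t in ?M. w t = U t" if w: "is_solution \<Omega> lam \<phi> T \<alpha> f u0 w" for w
    proof -
      obtain Wc where wH: "w \<in> bochner_H1 T (L2_on \<Omega>)" and Wc: "continuous_on {0..T} Wc" and wW: "AE t in ?M. Wc t = w t"
        and W0i: "\<And>i. inner (Wc 0) (\<phi> i) = c i"
        and Weq: "\<And>i. AE t in ?M. \<exists>D. ((\<lambda>s. inner (Wc s) (\<phi> i)) has_real_derivative D) (at t) \<and>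
          D + lam i * (LINT s|lebesgue_on {0..t}. kernel \<alpha> (t - s) * inner (Wc s) (\<phi> i)) = inner (f t) (\<phi> i)"
        using w unfolding is_solution_def c_def by blast
      obtain vw where vw: "vw \<in> bochner_L2 T (L2_on \<Omega>)" "bochner_weak_deriv T w vw" and wL: "w \<in> bochner_L2 T (L2_on \<Omega>)"
        using wH unfolding bochner_H1_def by blast
      have vwi: "integrable ?M vw" by (rule bochner_L2_integrable[OF vw(1)])
      obtain c' where c': "AE t in ?M. w t = c' + prim T vw t"
        by (rule weak_deriv_imp_prim[OF T bochner_L2_integrable[OF wL] vwi vw(2)])
      have ae: "AE t in ?M. Wc t = c' + prim T vw t" using wW c' by eventually_elim simp
      \<comment> \<open>Both sides are continuous, so the equality extends to every t, in particular
        to t = 0, where the initial condition is read off.\<close>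
      have Wp: "Wc t = c' + prim T vw t" if "t \<in> {0..T}" for t
        by (rule continuous_AE_eq[OF T Wc _ ae that]) (intro continuous_intros prim_continuous_on[OF vwi])
      have mode: "inner (Wc t) (\<phi> i) = u i t" if t: "t \<in> {0..T}" for i t
      proof -
        define g where "g t = indicator {0..T} t * inner (Wc t) (\<phi> i)" for t
        have gm: "g \<in> borel_measurable borel" and gc: "continuous_on {0..T} g"
          using ind[OF Wc, of i] by (simp_all add: g_def[abs_def])
        have gW: "g t = inner (Wc t) (\<phi> i)" if "t \<in> {0..T}" for t using that by (simp add: g_def)
        have ivw: "integrable ?M (\<lambda>s. inner (vw s) (\<phi> i))" using vwi by simp
        obtain z where z: "L1_upto T z" "AE t in ?M. inner (vw t) (\<phi> i) = z t" by (rule borel_version_L1[OF ivw])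
        have gz0: "inner (Wc t) (\<phi> i) = inner c' (\<phi> i) + conv (\<lambda>_. 1) z t" if t: "t \<in> {0..T}" for t
          using Wp[OF t] prim_inner[OF vwi, of t "\<phi> i"] prim_eq_conv[OF ivw L1_upto_measurable[OF z(1)] z(2), of t] t
          by (simp add: inner_add_left)
        have "inner c' (\<phi> i) = c i" using gz0[of 0] W0i[of i] T by (simp add: conv_at_zero)
        then have gz: "inner (Wc t) (\<phi> i) = c i + conv (\<lambda>_. 1) z t" if "t \<in> {0..T}" for t using gz0[OF that] by simp
        \<comment> \<open>The derivative prescribed by the equation. It is continuous, and
          \<open>AE_deriv_imp_integral\<close> lets it replace the merely integrable
          \<open>z\<close>.\<close>
        define R where "R = (\<lambda>t. fi i t + (- lam i) * conv k g t)"
        have Rm: "R \<in> borel_measurable borel" unfolding R_def using fim km gm by measurable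
        have Rc: "continuous_on {0..T} R" unfolding R_def by (intro continuous_intros fic conv_continuous_on kL gm gc)
        have D: "AE t in ?M. ((\<lambda>s. inner (Wc s) (\<phi> i)) has_real_derivative R t) (at t)"
          using Weq[of i] fF AE_space
        proof eventually_elim
          case (elim t)
          then have t: "0 < t" "t < T" by auto
          obtain D where D: "((\<lambda>s. inner (Wc s) (\<phi> i)) has_real_derivative D) (at t)"
            "D + lam i * (LINT s|lebesgue_on {0..t}. kernel \<alpha> (t - s) * inner (Wc s) (\<phi> i)) = inner (f t) (\<phi> i)"
            using elim by blast
          have "(LINT s|lebesgue_on {0..t}. kernel \<alpha> (t - s) * inner (Wc s) (\<phi> i)) = conv k g t"
            unfolding k_def using t gW km gm by (intro kernel_integral_eq_conv) (auto simp: k_def)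
          then have "D = R t" using D(2) fi_eq[of t i] t elim by (simp add: R_def)
          then show ?case using D(1) by simp
        qed
        have Wg: "inner (Wc t) (\<phi> i) = c i + conv (\<lambda>_. 1) R t" if "t \<in> {0..T}" for t
          by (rule AE_deriv_imp_integral[OF z(1) Rm Rc gz D that])
        have "g t = u i t"
        proof (rule volterra_mode_unique[OF kL bdd_upto_imp_L1[OF bfi] gm gc um uc _ _ t])
          show "g s = c i + conv (\<lambda>_. 1) (\<lambda>s. fi i s + (- lam i) * conv k g s) s" if "s \<in> {0..T}" for s
            using Wg[OF that] gW[OF that] by (simp add: R_def)
          show "u i s = c i + conv (\<lambda>_. 1) (\<lambda>s. fi i s + (- lam i) * conv k (u i) s) s" if s: "s \<in> {0..T}" for s
          proof -
            have "conv (\<lambda>_. 1) (v i) s = conv (\<lambda>_. 1) (\<lambda>s. fi i s + (- lam i) * conv k (u i) s) s"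
            proof (rule conv_cong)
              fix r assume "0 \<le> r" "r \<le> s"
              then have "r \<in> {0..T}" using s by auto
              then show "v i r = fi i r + (- lam i) * conv k (u i) r" using veq[of r i] by simp
            qed simp
            then show ?thesis using ueq[OF s, of i] by simp
          qed
        qed
        then show ?thesis using gW[OF t] by simp
      qed
      have wX: "AE t in ?M. w t \<in> closure (span (range \<phi>))" using wL by (simp add: bochner_L2_def X)
      show ?thesis
        using wW wX AE_space
      proof eventually_elim
        case (elim t)
        then have t: "t \<in> {0..T}" by auto
        \<comment> \<open>Coefficients determine a vector only within the closed span of the \<phi>
          i, which contains w t for almost every t.\<close>
        have "partial_proj \<phi> n (w t) = partial_proj \<phi> n (U t)" for n
          unfolding partial_proj_def using mode[OF t] Ui[OF t] elim by simp
        then show ?case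
          using partial_proj_tendsto[OF on, of "w t"] partial_proj_tendsto[OF on UX, of t] elim
          by (simp add: LIMSEQ_unique)
      qed
    qed
    show "\<exists>u. is_solution \<Omega> lam \<phi> T \<alpha> f u0 u \<and>
        (\<forall>w. is_solution \<Omega> lam \<phi> T \<alpha> f u0 w \<longrightarrow> (AE t in ?M. w t = u t)) \<and>
        bochner_H1_norm T u \<le> sqrt C * (spectral_H_norm lam \<phi> 2 u0 + bochner_H1_norm T f)"
      using sol uniq norm_bound unfolding p_def q_def by blast
  qed
qed

end
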